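(* For $0\le s<t$, the law of $\mathcal{H}_1(s)$ conditioned on $t_\infty=t$ is obtained by size-biasing the law of $H^{(t-s)}$ conditioned to have root age $s$. The size-biasing here means that the law is tilted by the total progeny $|H^{(t-s)}|$. The normalizing factor for this tilt is given by $$\mathbb{E}\left(\left|H^{(t-s)}\right|\,\middle|\,a(\rho)=s\right)=\frac{\tanh\frac{t}{2}}{\tanh\frac{t-s}{2}}.$$
   Context: For $x\ge0$, $H^{(x)}$ is the multitype Galton--Watson tree with types (ages) in $[0,\infty)$ defined as follows. The root age satisfies $\mathbb{P}(a(\rho^{(x)})>y)=\frac{1-\tanh((x+y)/2)}{1-\tanh(x/2)}$, $y\ge0$. Independently for each vertex, the ages of the children of a vertex of age $b$ form a Poisson random measure of intensity $\lambda_b^{(x)}(da)=(b\wedge a)\,\tfrac12\operatorname{sech}^2\left(\tfrac{a+x}{2}\right)da$ on $[0,\infty)$. Given the tree and vertex ages, edges carry independent ages, the age of an edge joining vertices of ages $b$ and $a$ being uniform on $[0,b\wedge a]$. Conditioning on root age $s$ means that the root is given age $s$. $|H^{(x)}|$ is the number of vertices. Write $H=H^{(0)}$. $\mathcal{H}_1(t)$ is the following process of finite rooted trees with vertices and edges labelled by ages. $\mathcal{H}_1(0)$ is a single root vertex of age $0$. All vertex and edge ages increase at rate $1$. At rate equal to its current number of vertices, it jumps: an independent copy of $H$ is attached by adding a new edge of age $0$ from the root of that copy to a uniformly random vertex of the current tree; the root is unchanged. $t_\infty$ denotes the explosion time (limit of the jump times). Conditioning on $t_\infty=t$ is understood as the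 limit as $\epsilon\to0$ of conditioning on $t_\infty\in[t,t+\epsilon)$. *)

theory Defs
  imports "HOL-Probability.Probability"
begin

section \<open>Finite rooted trees with vertex and edge ages\<close>

text \<open>
  \<open>Vertex b C\<close> is a tree whose root has age \<open>b\<close>.  Each pair \<open>(e, T)\<close> in the multiset \<open>C\<close> stands for
  a child of the root: \<open>T\<close> is the subtree of its descendants and \<open>e\<close> is the age of the edge joining
  it to the root.  Because of the multisets, children carry no order.
\<close>

datatype aged_tree = Vertex (root_age: real) (children: "(real \<times> aged_tree) multiset")

primrec num_vertices :: "aged_tree \<Rightarrow> nat" where
  "num_vertices (Vertex b C) = Suc (\<Sum>p\<in>#image_mset (map_prod id num_vertices) C. snd p)"

text \<open>The height of a single vertex is \<open>0\<close>, as \<open>Sup {} = 0\<close> for sets of natural numbers.\<close>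

primrec height :: "aged_tree \<Rightarrow> nat" where
  "height (Vertex b C) = Sup ((\<lambda>p. Suc (snd p)) ` set_mset (image_mset (map_prod id height) C))"

primrec grow :: "real \<Rightarrow> aged_tree \<Rightarrow> aged_tree" where
  "grow d (Vertex b C) = Vertex (b + d) (image_mset (map_prod (\<lambda>e. e + d) (grow d)) C)"

text \<open>
  \<open>attachments S T\<close> collects the trees obtained from \<open>T\<close> by joining one of its vertices to the root
  of \<open>S\<close> by an edge of age \<open>0\<close>.  Every vertex of \<open>T\<close> contributes exactly one entry (vertices that
  are indistinguishable by ages are counted separately), so a uniformly random entry corresponds
  to a uniformly random vertex of \<open>T\<close>.
\<close>

primrec attachments :: "aged_tree \<Rightarrow> aged_tree \<Rightarrow> aged_tree multiset" where
  "attachments S (Vertex b C) =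
     add_mset (Vertex b (add_mset (0, S) C))
       (\<Sum>(e, T, A)\<in>#image_mset (map_prod id (\<lambda>T. (T, attachments S T))) C.
          image_mset (\<lambda>T'. Vertex b (add_mset (e, T') (C - {#(e, T)#}))) A)"

lemma size_attachments: "size (attachments S T) = num_vertices T"
proof (induction T)
  case (Vertex b C)
  have "size (\<Sum>(e, T, A)\<in>#image_mset (map_prod id (\<lambda>T. (T, attachments S T))) D.
               image_mset (\<lambda>T'. Vertex b (add_mset (e, T') (C - {#(e, T)#}))) A) =
        (\<Sum>p\<in>#image_mset (map_prod id num_vertices) D. snd p)" if "set_mset D \<subseteq> set_mset C" for D
    using that
  proof (induction D)
    case empty
    then show ?case by simp
  next
    case (add p D)
    have "size (attachments S (snd p)) = num_vertices (snd p)"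
      using Vertex.IH[of p "snd p"] add.prems by (cases p) auto
    then show ?case
      using add by (simp add: case_prod_unfold)
  qed
  from this[of C] show ?case by simp
qed

section \<open>The measurable space of trees\<close>

text \<open>
  The usual \<open>\<sigma>\<close>-algebra on point configurations, applied recursively: it is the least one that makes
  measurable the age of the root and, for all measurable \<open>B\<close> and \<open>\<A>\<close>, the number of children of the
  root with edge age in \<open>B\<close> and subtree in \<open>\<A>\<close>.
\<close>

inductive_set tree_sets :: "aged_tree set set" where
  root: "B \<in> sets borel \<Longrightarrow> {T. root_age T \<in> B} \<in> tree_sets"
| count: "B \<in> sets borel \<Longrightarrow> \<A> \<in> tree_sets \<Longrightarrow>
    {T. size (filter_mset (\<lambda>p. fst p \<in> B \<and> snd p \<in> \<A>) (children T)) = k} \<in> tree_sets"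
| compl: "\<A> \<in> tree_sets \<Longrightarrow> - \<A> \<in> tree_sets"
| union: "(\<And>i::nat. \<A> i \<in> tree_sets) \<Longrightarrow> (\<Union>i. \<A> i) \<in> tree_sets"

definition tree_space :: "aged_tree measure" where
  "tree_space = sigma UNIV tree_sets"

lemma space_tree_space [simp]: "space tree_space = UNIV"
  by (simp add: tree_space_def space_measure_of_conv)

lemma sets_tree_space: "sets tree_space = tree_sets"
proof -
  have univ: "UNIV \<in> tree_sets"
    using tree_sets.root[of UNIV] by simp
  have "sigma_algebra UNIV tree_sets"
    unfolding sigma_algebra_iff2
    using univ tree_sets.compl[OF univ] tree_sets.compl tree_sets.union
    by (auto simp: Compl_eq_Diff_UNIV image_subset_iff)
  then show ?thesis
    by (simp add: tree_space_def sigma_algebra.sigma_sets_eq)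
qed

section \<open>The multitype Galton--Watson tree\<close>

definition root_age_law :: "real \<Rightarrow> real measure" where
  "root_age_law x = interval_measure
     (\<lambda>y. if y < 0 then 0 else 1 - (1 - tanh ((x + y) / 2)) / (1 - tanh (x / 2)))"

definition sech :: "real \<Rightarrow> real" where
  "sech u = 1 / cosh u"

definition child_intensity :: "real \<Rightarrow> real \<Rightarrow> real measure" where
  "child_intensity x b =
     density lborel (\<lambda>a. ennreal (indicator {0..} a * (min b a * (1 / 2 * sech ((a + x) / 2) ^ 2))))"

text \<open>Unlike \<open>poisson_pmf\<close>, this includes the rate \<open>0\<close>, which occurs below vertices of age \<open>0\<close>.\<close>

definition poisson_law :: "real \<Rightarrow> nat measure" where
  "poisson_law r = density (count_space UNIV) (\<lambda>k. ennreal (exp (- r) * r ^ k / fact k))"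

text \<open>
  \<open>gw_truncated x n b\<close> is the law of generations \<open>0, \<dots>, n\<close> of the Galton--Watson tree with parameter
  \<open>x\<close> whose root is given age \<open>b\<close>.  The intensity \<open>\<lambda>\<close> of the ages of the children of the root has finite
  total mass, so the Poisson random measure of intensity \<open>\<lambda>\<close> consists of a Poisson number of points,
  of mean the total mass, that are independent with law the normalisation \<open>uniform_measure \<lambda> UNIV\<close>
  of \<open>\<lambda>\<close>.  Edge ages and descendants of different children are independent given the ages.
\<close>

primrec gw_truncated :: "real \<Rightarrow> nat \<Rightarrow> real \<Rightarrow> aged_tree measure" where
  "gw_truncated x 0 b = return tree_space (Vertex b {#})"
| "gw_truncated x (Suc n) b = do {
     k \<leftarrow> poisson_law (measure (child_intensity x b) UNIV);
     c \<leftarrow> PiM {..<k} (\<lambda>_. do {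
            a \<leftarrow> uniform_measure (child_intensity x b) UNIV;
            e \<leftarrow> uniform_measure lborel {0..min b a};
            T \<leftarrow> gw_truncated x n a;
            return (borel \<Otimes>\<^sub>M tree_space) (e, T) });
     return tree_space (Vertex b (image_mset c (mset_set {..<k}))) }"

text \<open>
  The law of the whole tree with root age \<open>b\<close>, as a measure on finite trees.  If the part up to
  generation \<open>n\<close> has height less than \<open>n\<close>, then it is the whole tree; hence \<open>gw_law x b \<A>\<close> is the
  probability that the tree is finite and belongs to \<open>\<A>\<close>.  The tree is almost surely finite iff
  \<open>gw_law x b\<close> is a probability measure.
\<close>

definition gw_law :: "real \<Rightarrow> real \<Rightarrow> aged_tree measure" where
  "gw_law x b = measure_of UNIV (sets tree_space)
     (\<lambda>\<A>. SUP n. emeasure (gw_truncated x n b) {T \<in> \<A>. height T < n})"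

definition H_law :: "real \<Rightarrow> aged_tree measure" where
  "H_law x = root_age_law x \<bind> gw_law x"

definition size_biased :: "aged_tree measure \<Rightarrow> aged_tree measure" where
  "size_biased \<mu> =
     density \<mu> (\<lambda>T. of_nat (num_vertices T) / (\<integral>\<^sup>+T'. of_nat (num_vertices T') \<partial>\<mu>))"

section \<open>The growth process\<close>

text \<open>
  The process is described by the sequence of pairs (jump time, tree just after the jump); the
  entry of index \<open>0\<close> is the initial state at time \<open>0\<close>.  Between jumps the number of vertices is
  constant, so the time to the next jump is exponential.
\<close>

abbreviation jump_space :: "(real \<times> aged_tree) measure" where
  "jump_space \<equiv> borel \<Otimes>\<^sub>M tree_space"

definition H1_jump :: "real \<times> aged_tree \<Rightarrow> (real \<times> aged_tree) measure" where
  "H1_jump z = do {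
     d \<leftarrow> density lborel (exponential_density (real (num_vertices (snd z))));
     S \<leftarrow> H_law 0;
     T \<leftarrow> measure_pmf (pmf_of_multiset (attachments S (grow d (snd z))));
     return jump_space (fst z + d, T) }"

text \<open>\<open>H1_process M Z\<close>: on the probability space \<open>M\<close>, \<open>Z\<close> is a Markov chain with transition kernel
  \<open>H1_jump\<close> started from a single vertex of age \<open>0\<close> at time \<open>0\<close>.\<close>

definition H1_process :: "'w measure \<Rightarrow> (nat \<Rightarrow> 'w \<Rightarrow> real \<times> aged_tree) \<Rightarrow> bool" where
  "H1_process M Z \<longleftrightarrow>
     prob_space M \<and>
     (\<forall>n. Z n \<in> M \<rightarrow>\<^sub>M jump_space) \<and>
     (AE \<omega> in M. Z 0 \<omega> = (0, Vertex 0 {#})) \<and>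
     (\<forall>n. distr M (PiM {..Suc n} (\<lambda>_. jump_space)) (\<lambda>\<omega>. \<lambda>i\<in>{..Suc n}. Z i \<omega>) =
          do { h \<leftarrow> distr M (PiM {..n} (\<lambda>_. jump_space)) (\<lambda>\<omega>. \<lambda>i\<in>{..n}. Z i \<omega>);
               z \<leftarrow> H1_jump (h n);
               return (PiM {..Suc n} (\<lambda>_. jump_space)) (h(Suc n := z)) })"

definition jumps_until :: "(nat \<Rightarrow> 'w \<Rightarrow> real \<times> aged_tree) \<Rightarrow> real \<Rightarrow> 'w \<Rightarrow> nat" where
  "jumps_until Z s \<omega> = (LEAST n. s < fst (Z (Suc n) \<omega>))"

text \<open>The state at time \<open>s\<close>; meaningful before the explosion time only.\<close>

definition H1_at :: "(nat \<Rightarrow> 'w \<Rightarrow> real \<times> aged_tree) \<Rightarrow> real \<Rightarrow> 'w \<Rightarrow> aged_tree" where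
  "H1_at Z s \<omega> = (let (\<tau>, T) = Z (jumps_until Z s \<omega>) \<omega> in grow (s - \<tau>) T)"

definition explosion_time :: "(nat \<Rightarrow> 'w \<Rightarrow> real \<times> aged_tree) \<Rightarrow> 'w \<Rightarrow> ereal" where
  "explosion_time Z \<omega> = lim (\<lambda>n. ereal (fst (Z n \<omega>)))"

end

theory Submission
  imports Defs
begin

text \<open>
  For \<open>b \<ge> 0\<close> let \<open>w\<^sub>b\<close> be \<open>sech (b/2)\<^sup>2\<close> times the law of the tree with parameter \<open>0\<close> and root
  age \<open>b\<close> (\<open>tree_weight\<close>). By the Poisson description of the children, \<open>w\<^sub>b\<close> has a density that
  is a product: a factor \<open>exp (- age)\<close> for every vertex and \<open>1/2\<close> for every edge, on the set
  where each edge is younger than its two ends. The theorem combines three consequences of this.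

  Tilting. Passing from parameter \<open>0\<close> to \<open>x\<close> multiplies this density by \<open>sech (x/2)\<^sup>2\<close> for every
  vertex: \<open>sech ((b+x)/2)\<^sup>2\<close> times the law of \<open>H\<^sup>(\<^sup>x\<^sup>)\<close> with root age \<open>b\<close> is
  \<open>sech (x/2)\<^sup>2 ^ |T|\<close> times \<open>w\<^sub>b\<close> (\<open>gw_law_tilt\<close>). For \<open>x > 0\<close> the tree is almost surely finite
  (\<open>gw_law_extinct\<close>), which gives the generating function of the size:
  \<open>w\<^sub>b (z ^ |T|) = sech ((b+x)/2)\<^sup>2\<close> for \<open>z = sech (x/2)\<^sup>2\<close>.

  Growth. Lowering all ages by \<open>c\<close> multiplies the product density by \<open>exp (c |T|)\<close>, and removing
  an edge of age \<open>0\<close> splits a tree into a tree weighted by \<open>w\<close>, one of its vertices, and an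
  independent copy of \<open>H\<close>. So cutting a tree at its youngest edge, of age \<open>c\<close>, undoes the last
  jump of the growth process, which happened \<open>c\<close> time units ago and was followed by no other
  jump, an event of probability \<open>exp (- c |T|)\<close> (\<open>tree_weight_core_bounded\<close>). Iterating, \<open>w\<^sub>s\<close>
  is the law of \<open>H\<^sub>1(s)\<close> on the event that \<open>s\<close> is before the explosion
  (\<open>tree_weight_occupation\<close>). In particular, explosion happens after \<open>r\<close> with probability
  \<open>sech (r/2)\<^sup>2\<close>.

  Survival. From a state with \<open>n\<close> vertices at time \<open>s\<close>, the process survives until \<open>r\<close> with
  probability \<open>sech ((r-s)/2)\<^sup>2 ^ n\<close>. This is the harmonic function \<open>survival\<close> of the jump
  chain. The supermartingale property gives
  \<open>P(H\<^sub>1(s) \<in> A, r < t\<^sub>\<infinity>) \<le> w\<^sub>s (1\<^sub>A sech ((r-s)/2)\<^sup>2 ^ |T|)\<close>, and this is an equality because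
  both sides add up to \<open>sech (r/2)\<^sup>2\<close> over \<open>A\<close> and its complement, by the generating function
  (\<open>joint_eq\<close>).

  The right-hand side is a power series in \<open>z = sech ((r-s)/2)\<^sup>2\<close>. Differentiating at \<open>r = t\<close>
  brings down the factor \<open>|T|\<close>: the density of \<open>t\<^sub>\<infinity>\<close> at \<open>t\<close> on the event \<open>H\<^sub>1(s) \<in> A\<close> is
  \<open>tanh ((t-s)/2) w\<^sub>s (1\<^sub>A |T| sech ((t-s)/2)\<^sup>2 ^ |T|)\<close>, which by the tilting identity is the
  integral of \<open>|T|\<close> over \<open>A\<close> against the law of \<open>H\<^sup>(\<^sup>t\<^sup>-\<^sup>s\<^sup>)\<close> with root age \<open>s\<close>, up to the
  constant \<open>tanh ((t-s)/2) sech (t/2)\<^sup>2\<close>. The full density of \<open>t\<^sub>\<infinity>\<close> is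
  \<open>tanh (t/2) sech (t/2)\<^sup>2\<close>; the quotient is the size-biased law, and \<open>A = UNIV\<close> yields the mean
  size.
\<close>

section \<open>Point configurations as finite multisets\<close>

lemma sum_mset_suminf:
  fixes f :: "nat \<Rightarrow> 'a \<Rightarrow> ennreal"
  shows "(\<Sum>p\<in>#C. \<Sum>i. f i p) = (\<Sum>i. \<Sum>p\<in>#C. f i p)"
proof (induction C)
  case (add p C)
  have "(\<Sum>i. f i p) + (\<Sum>i. \<Sum>p\<in>#C. f i p) = (\<Sum>i. f i p + (\<Sum>p\<in>#C. f i p))"
    by (intro suminf_add) auto
  with add show ?case by simp
qed simp

lemma sum_mset_SUP:
  fixes U :: "nat \<Rightarrow> 'a \<Rightarrow> ennreal"
  assumes "incseq U"
  shows "(\<Sum>p\<in>#C. SUP i. U i p) = (SUP i. \<Sum>p\<in>#C. U i p)"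
proof (induction C)
  case (add p C)
  have "incseq (\<lambda>i. U i p)" "incseq (\<lambda>i. \<Sum>p\<in>#C. U i p)"
    using assms by (auto simp: incseq_def le_fun_def intro!: sum_mset_mono)
  then have "(SUP i. U i p) + (SUP i. \<Sum>p\<in>#C. U i p) = (SUP i. U i p + (\<Sum>p\<in>#C. U i p))"
    by (intro ennreal_SUP_add[symmetric])
  then show ?case using add by (simp add: image_comp)
qed simp

lemma sum_mset_indicator:
  "(\<Sum>p\<in>#C. indicator X p :: ennreal) = of_nat (size (filter_mset (\<lambda>p. p \<in> X) C))"
proof (induction C)
  case (add p C)
  then show ?case by (cases "p \<in> X") simp_all
qed simp

lemma sum_mset_finite:
  fixes f :: "'a \<Rightarrow> ennreal"
  assumes "\<And>p. p \<in># C \<Longrightarrow> f p < \<top>"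
  shows "(\<Sum>p\<in>#C. f p) < \<top>"
  using assms
proof (induction C)
  case (add p C)
  then show ?case by (simp add: less_top[symmetric])
qed simp

text \<open>
  By a monotone class argument, it suffices to count points in the sets of an
  intersection-stable generator; the total count is needed for complements.
\<close>

lemma sum_mset_measurable_generated:
  fixes f :: "'b \<Rightarrow> 'c multiset"
  assumes gen: "sets N = sigma_sets \<Omega> G" "Int_stable G" "G \<subseteq> Pow \<Omega>"
    and f: "\<And>x. x \<in> space B \<Longrightarrow> set_mset (f x) \<subseteq> \<Omega>"
    and size: "(\<lambda>x. of_nat (size (f x)) :: ennreal) \<in> borel_measurable B"
    and G: "\<And>X. X \<in> G \<Longrightarrow> (\<lambda>x. \<Sum>p\<in>#f x. indicator X p :: ennreal) \<in> borel_measurable B"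
    and g: "g \<in> borel_measurable N"
  shows "(\<lambda>x. \<Sum>p\<in>#f x. g p :: ennreal) \<in> borel_measurable B"
proof -
  have sp: "space N = \<Omega>"
    using sets_eq_imp_space_eq[of N "sigma \<Omega> G"] gen by (simp add: space_measure_of_conv sets_measure_of)
  have ind: "(\<lambda>x. \<Sum>p\<in>#f x. indicator X p :: ennreal) \<in> borel_measurable B" if "X \<in> sets N" for X
    using gen(2,3) that[unfolded gen(1)]
  proof (induction rule: sigma_sets_induct_disjoint)
    case (basic A)
    then show ?case by (rule G)
  next
    case empty
    then show ?case by simp
  next
    case (compl A)
    have "(\<Sum>p\<in>#f x. indicator (\<Omega> - A) p :: ennreal) = of_nat (size (f x)) - (\<Sum>p\<in>#f x. indicator A p)"
      if "x \<in> space B" for x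
    proof -
      have "(\<Sum>p\<in>#f x. indicator (\<Omega> - A) p :: ennreal) + (\<Sum>p\<in>#f x. indicator A p) =
            (\<Sum>p\<in>#f x. indicator (\<Omega> - A) p + indicator A p)"
        by (simp add: sum_mset.distrib)
      also have "\<dots> = (\<Sum>p\<in>#f x. 1)"
        using f[OF that] by (intro arg_cong[of _ _ sum_mset] image_mset_cong) (auto simp: indicator_def)
      finally have "(\<Sum>p\<in>#f x. indicator (\<Omega> - A) p :: ennreal) + (\<Sum>p\<in>#f x. indicator A p) = of_nat (size (f x))"
        by simp
      moreover have "(\<Sum>p\<in>#f x. indicator A p :: ennreal) \<noteq> \<top>"
        using sum_mset_finite[of "f x" "indicator A"] by (auto simp: indicator_def less_top)
      ultimately show ?thesis
        by (metis ennreal_add_diff_cancel_right)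
    qed
    then have "(\<lambda>x. \<Sum>p\<in>#f x. indicator (\<Omega> - A) p :: ennreal) \<in> borel_measurable B \<longleftrightarrow>
        (\<lambda>x. of_nat (size (f x)) - (\<Sum>p\<in>#f x. indicator A p) :: ennreal) \<in> borel_measurable B"
      by (rule measurable_cong)
    then show ?case
      using compl(2) size by simp
  next
    case (union A)
    have "(\<Sum>p\<in>#f x. indicator (\<Union>i. A i) p :: ennreal) = (\<Sum>i. \<Sum>p\<in>#f x. indicator (A i) p)" for x
      using union(1) by (simp add: suminf_indicator[symmetric] sum_mset_suminf)
    then show ?case using union by simp
  qed
  show ?thesis
    using g
  proof (induction rule: borel_measurable_induct)
    case (cong u v)
    then have "(\<lambda>x. \<Sum>p\<in>#f x. u p) \<in> borel_measurable B \<longleftrightarrow> (\<lambda>x. \<Sum>p\<in>#f x. v p) \<in> borel_measurable B"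
      using f sp by (intro measurable_cong arg_cong[of _ _ sum_mset] image_mset_cong) auto
    then show ?case using cong by simp
  next
    case (set A)
    then show ?case by (rule ind)
  next
    case (mult u c)
    then show ?case by (simp add: sum_mset_distrib_left[symmetric])
  next
    case (add u v)
    then show ?case by (simp add: sum_mset.distrib)
  next
    case (seq U)
    have "(\<Sum>p\<in>#f x. (SUP i. U i) p) = (SUP i. \<Sum>p\<in>#f x. U i p)" for x
      using sum_mset_SUP[OF \<open>incseq U\<close>] by (simp add: image_comp)
    then show ?case using seq by simp
  qed
qed

text \<open>
  The usual \<open>\<sigma>\<close>-algebra on point configurations: the counts of points in measurable sets are
  measurable.
\<close>

definition multiset_space :: "'a measure \<Rightarrow> 'a multiset measure" where
  "multiset_space N = sigma UNIV {{C. size (filter_mset (\<lambda>p. p \<in> X) C) = k} | X k. X \<in> sets N}"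

lemma space_multiset_space [simp]: "space (multiset_space N) = UNIV"
  by (simp add: multiset_space_def space_measure_of_conv)

lemma measurable_count_multiset_space:
  assumes "X \<in> sets N"
  shows "(\<lambda>C. \<Sum>p\<in>#C. indicator X p :: ennreal) \<in> borel_measurable (multiset_space N)"
proof -
  have "(\<lambda>C. size (filter_mset (\<lambda>p. p \<in> X) C)) \<in> multiset_space N \<rightarrow>\<^sub>M count_space UNIV"
  proof (rule measurable_count_space_eq2_countable[THEN iffD2], safe)
    fix k
    have "{C. size (filter_mset (\<lambda>p. p \<in> X) C) = k} \<in> sets (multiset_space N)"
      unfolding multiset_space_def using assms by (auto simp: sets_measure_of_conv)
    then show "(\<lambda>C. size (filter_mset (\<lambda>p. p \<in> X) C)) -` {k} \<inter> space (multiset_space N) \<in> sets (multiset_space N)"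
      by (simp add: vimage_def)
  qed auto
  then show ?thesis
    unfolding sum_mset_indicator by measurable
qed

lemma measurable_multiset_spaceI:
  assumes "\<And>X. X \<in> sets N \<Longrightarrow> (\<lambda>x. \<Sum>p\<in>#f x. indicator X p :: ennreal) \<in> borel_measurable B"
  shows "f \<in> B \<rightarrow>\<^sub>M multiset_space N"
  unfolding multiset_space_def
proof (rule measurable_measure_of)
  fix Y assume "Y \<in> {{C. size (filter_mset (\<lambda>p. p \<in> X) C) = k} |X k. X \<in> sets N}"
  then obtain X k where X: "X \<in> sets N" "Y = {C. size (filter_mset (\<lambda>p. p \<in> X) C) = k}" by auto
  have "{x \<in> space B. (\<Sum>p\<in>#f x. indicator X p :: ennreal) = of_nat k} \<in> sets B"
    using assms[OF X(1)] by measurable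
  also have "{x \<in> space B. (\<Sum>p\<in>#f x. indicator X p :: ennreal) = of_nat k} = f -` Y \<inter> space B"
    unfolding sum_mset_indicator X(2) by auto
  finally show "f -` Y \<inter> space B \<in> sets B" .
qed auto

text \<open>
  The summand may depend on \<open>x\<close> as well: rectangles generate the product, and on a rectangle the
  sum factors.
\<close>

lemma borel_measurable_sum_mset_joint:
  assumes N: "space N = UNIV" and f: "f \<in> B \<rightarrow>\<^sub>M multiset_space N"
    and g: "(\<lambda>(x, p). g x p :: ennreal) \<in> borel_measurable (B \<Otimes>\<^sub>M N)"
  shows "(\<lambda>x. \<Sum>p\<in>#f x. g x p) \<in> borel_measurable B"
proof -
  have count: "(\<lambda>x. \<Sum>p\<in>#f x. indicator X p :: ennreal) \<in> borel_measurable B" if "X \<in> sets N" for X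
    using f measurable_count_multiset_space[OF that] by (rule measurable_compose)
  have "(\<lambda>x. \<Sum>q\<in>#image_mset (Pair x) (f x). (\<lambda>(x, p). g x p) q) \<in> borel_measurable B"
  proof (rule sum_mset_measurable_generated[OF sets_pair_measure _ pair_measure_closed])
    show "Int_stable {a \<times> b |a b. a \<in> sets B \<and> b \<in> sets N}"
      by (rule Int_stable_pair_measure_generator)
    show "(\<lambda>x. of_nat (size (image_mset (Pair x) (f x))) :: ennreal) \<in> borel_measurable B"
      using count[OF sets.top] N by (simp add: sum_mset_indicator)
    fix X assume "X \<in> {a \<times> b |a b. a \<in> sets B \<and> b \<in> sets N}"
    then obtain a b where X: "X = a \<times> b" and [measurable]: "a \<in> sets B" "b \<in> sets N" by auto
    have "(\<Sum>q\<in>#image_mset (Pair x) (f x). indicator X q :: ennreal) = indicator a x * (\<Sum>p\<in>#f x. indicator b p)" for x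
      by (simp add: X image_mset.compositionality comp_def indicator_times sum_mset_distrib_left)
    then show "(\<lambda>x. \<Sum>q\<in>#image_mset (Pair x) (f x). indicator X q :: ennreal) \<in> borel_measurable B"
      using count[OF \<open>b \<in> sets N\<close>] by simp
  qed (use g N in \<open>auto simp: case_prod_unfold\<close>)
  then show ?thesis
    by (simp add: image_mset.compositionality comp_def)
qed

lemma measurable_add_mset:
  assumes N: "space N = UNIV" and f: "f \<in> B \<rightarrow>\<^sub>M N" and g: "g \<in> B \<rightarrow>\<^sub>M multiset_space N"
  shows "(\<lambda>x. add_mset (f x) (g x)) \<in> B \<rightarrow>\<^sub>M multiset_space N"
proof (rule measurable_multiset_spaceI)
  fix X assume [measurable]: "X \<in> sets N"
  have "(\<lambda>x. \<Sum>p\<in>#g x. indicator X p :: ennreal) \<in> borel_measurable B"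
    using g by (rule measurable_compose[OF _ measurable_count_multiset_space]) simp
  then show "(\<lambda>x. \<Sum>p\<in>#add_mset (f x) (g x). indicator X p :: ennreal) \<in> borel_measurable B"
    using f by simp
qed

lemma measurable_image_mset:
  assumes N: "space N = UNIV" and f: "f \<in> B \<rightarrow>\<^sub>M multiset_space N"
    and h: "(\<lambda>(x, p). h x p) \<in> B \<Otimes>\<^sub>M N \<rightarrow>\<^sub>M N'"
  shows "(\<lambda>x. image_mset (h x) (f x)) \<in> B \<rightarrow>\<^sub>M multiset_space N'"
proof (rule measurable_multiset_spaceI)
  fix X assume [measurable]: "X \<in> sets N'"
  note h[measurable]
  have "(\<lambda>x. \<Sum>p\<in>#f x. indicator X (h x p) :: ennreal) \<in> borel_measurable B"
    by (rule borel_measurable_sum_mset_joint[OF N f]) measurable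
  then show "(\<lambda>x. \<Sum>p\<in>#image_mset (h x) (f x). indicator X p :: ennreal) \<in> borel_measurable B"
    by (simp add: image_mset.compositionality comp_def)
qed

lemma all_mset_iff_sum: "(\<forall>p\<in>#C. p \<in> X) \<longleftrightarrow> (\<Sum>p\<in>#C. indicator (- X) p :: ennreal) = 0"
proof (induction C)
  case (add p C)
  then show ?case by (cases "p \<in> X") simp_all
qed simp

lemma measurable_all_mset:
  assumes N: "space N = UNIV" and f: "f \<in> B \<rightarrow>\<^sub>M multiset_space N"
    and P: "Measurable.pred (B \<Otimes>\<^sub>M N) (\<lambda>(x, p). P x p)"
  shows "Measurable.pred B (\<lambda>x. \<forall>p\<in>#f x. P x p)"
proof -
  have "(\<lambda>x. \<Sum>p\<in>#f x. indicator (- {q. P x q}) p :: ennreal) \<in> borel_measurable B"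
  proof (rule borel_measurable_sum_mset_joint[OF N f])
    have "(\<lambda>(x, p). indicator (- {q. P x q}) p :: ennreal) = (\<lambda>z. if (\<lambda>(x, p). P x p) z then 0 else 1)"
      by (auto simp: fun_eq_iff)
    then show "(\<lambda>(x, p). indicator (- {q. P x q}) p :: ennreal) \<in> borel_measurable (B \<Otimes>\<^sub>M N)"
      using P by simp
  qed
  then have "Measurable.pred B (\<lambda>x. (\<Sum>p\<in>#f x. indicator (- {q. P x q}) p :: ennreal) = 0)"
    by measurable
  then show ?thesis
    unfolding all_mset_iff_sum[symmetric] by simp
qed

text \<open>
  Sums of this shape appear in the Mecke formula. On the set of all \<open>(x, p, C)\<close> with \<open>p \<in># C\<close>
  the removal of \<open>p\<close> is measurable, since there the counts of \<open>C - {#p#}\<close> are differences of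
  counts; so a measurable function of the reduced triple coincides there with a measurable
  function of the triple itself.
\<close>

lemma borel_measurable_sum_mset_remove:
  fixes f :: "'b \<Rightarrow> 'a multiset" and g :: "'b \<Rightarrow> 'a \<Rightarrow> 'a multiset \<Rightarrow> ennreal"
  assumes N: "space N = UNIV" and f: "f \<in> B \<rightarrow>\<^sub>M multiset_space N"
    and g: "(\<lambda>(x, p, C). g x p C :: ennreal) \<in> borel_measurable (B \<Otimes>\<^sub>M N \<Otimes>\<^sub>M multiset_space N)"
  shows "(\<lambda>x. \<Sum>p\<in>#f x. g x p (f x - {#p#})) \<in> borel_measurable B"
proof -
  define W :: "('b \<times> 'a \<times> 'a multiset) measure" where "W = B \<Otimes>\<^sub>M N \<Otimes>\<^sub>M multiset_space N"
  define \<Omega> where "\<Omega> = {(x, p, C) \<in> space W. p \<in># C}"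
  define r :: "'b \<times> 'a \<times> 'a multiset \<Rightarrow> _" where "r = (\<lambda>(x, p, C). (x, p, C - {#p#}))"
  have rm: "r \<in> restrict_space W \<Omega> \<rightarrow>\<^sub>M W"
    unfolding W_def r_def
  proof (subst measurable_pair_iff, safe)
    have 1: "(\<lambda>z. fst z) \<in> restrict_space (B \<Otimes>\<^sub>M N \<Otimes>\<^sub>M multiset_space N) \<Omega> \<rightarrow>\<^sub>M B"
      by (intro measurable_restrict_space1) measurable
    then show "fst \<circ> (\<lambda>(x, p, C). (x, p, C - {#p#})) \<in> restrict_space (B \<Otimes>\<^sub>M N \<Otimes>\<^sub>M multiset_space N) \<Omega> \<rightarrow>\<^sub>M B"
      by (simp add: comp_def case_prod_unfold)
    have 2: "(\<lambda>z. fst (snd z)) \<in> restrict_space (B \<Otimes>\<^sub>M N \<Otimes>\<^sub>M multiset_space N) \<Omega> \<rightarrow>\<^sub>M N"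
      by (intro measurable_restrict_space1) measurable
    have 3: "(\<lambda>z. snd (snd z) - {#fst (snd z)#}) \<in> restrict_space (B \<Otimes>\<^sub>M N \<Otimes>\<^sub>M multiset_space N) \<Omega> \<rightarrow>\<^sub>M multiset_space N"
    proof (rule measurable_multiset_spaceI)
      fix X assume [measurable]: "X \<in> sets N"
      have C[measurable]: "(\<lambda>C. \<Sum>p\<in>#C. indicator X p :: ennreal) \<in> borel_measurable (multiset_space N)"
        by (rule measurable_count_multiset_space) simp
      have "(\<lambda>z. (\<Sum>p\<in>#snd (snd z). indicator X p) - indicator X (fst (snd z)) :: ennreal) \<in> borel_measurable (restrict_space (B \<Otimes>\<^sub>M N \<Otimes>\<^sub>M multiset_space N) \<Omega>)"
        by (intro measurable_restrict_space1 borel_measurable_minus_ennreal measurable_compose[OF _ C] measurable_compose[OF _ borel_measurable_indicator[OF \<open>X \<in> sets N\<close>]]) measurable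
      also have "?this \<longleftrightarrow> (\<lambda>z. \<Sum>p\<in>#snd (snd z) - {#fst (snd z)#}. indicator X p :: ennreal) \<in> borel_measurable (restrict_space (B \<Otimes>\<^sub>M N \<Otimes>\<^sub>M multiset_space N) \<Omega>)"
      proof (rule measurable_cong)
        fix z assume "z \<in> space (restrict_space (B \<Otimes>\<^sub>M N \<Otimes>\<^sub>M multiset_space N) \<Omega>)"
        then have "fst (snd z) \<in># snd (snd z)"
          by (auto simp: space_restrict_space \<Omega>_def)
        then have "snd (snd z) = add_mset (fst (snd z)) (snd (snd z) - {#fst (snd z)#})"
          by simp
        then have "(\<Sum>p\<in>#snd (snd z). indicator X p :: ennreal) =
           indicator X (fst (snd z)) + (\<Sum>p\<in>#snd (snd z) - {#fst (snd z)#}. indicator X p)"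
          by (metis (no_types) image_mset_add_mset sum_mset.add_mset)
        then show "(\<Sum>p\<in>#snd (snd z). indicator X p) - indicator X (fst (snd z)) = (\<Sum>p\<in>#snd (snd z) - {#fst (snd z)#}. indicator X p :: ennreal)"
          by (simp add: indicator_def)
      qed
      finally show "(\<lambda>z. \<Sum>p\<in>#snd (snd z) - {#fst (snd z)#}. indicator X p :: ennreal) \<in> borel_measurable (restrict_space (B \<Otimes>\<^sub>M N \<Otimes>\<^sub>M multiset_space N) \<Omega>)" .
    qed
    show "snd \<circ> (\<lambda>(x, p, C). (x, p, C - {#p#})) \<in> restrict_space (B \<Otimes>\<^sub>M N \<Otimes>\<^sub>M multiset_space N) \<Omega> \<rightarrow>\<^sub>M N \<Otimes>\<^sub>M multiset_space N"
      using measurable_Pair[OF 2 3] by (simp add: comp_def case_prod_unfold)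
  qed
  \<comment> \<open>\<open>\<Omega>\<close> may fail to be measurable, so preimages under \<open>r\<close> are only traces of measurable sets on
    it.\<close>
  have set: "\<exists>Y'\<in>sets W. \<forall>z\<in>\<Omega>. z \<in> Y' \<longleftrightarrow> r z \<in> Y" if "Y \<in> sets W" for Y
  proof -
    have "r -` Y \<inter> space (restrict_space W \<Omega>) \<in> sets (restrict_space W \<Omega>)"
      using rm that by (rule measurable_sets)
    then obtain Y' where "Y' \<in> sets W" "r -` Y \<inter> space (restrict_space W \<Omega>) = \<Omega> \<inter> Y'"
      by (auto simp: sets_restrict_space)
    moreover have "\<Omega> \<subseteq> space W" by (auto simp: \<Omega>_def)
    ultimately show ?thesis
      by (intro bexI[of _ Y']) (auto simp: space_restrict_space)
  qed
  have *: "(\<lambda>x. \<Sum>p\<in>#f x. g' (r (x, p, f x))) \<in> borel_measurable B"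
    if "g' \<in> borel_measurable W" for g' :: "_ \<Rightarrow> ennreal"
    using that
  proof (induction rule: borel_measurable_induct)
    case (cong u v)
    have "r (x, p, f x) \<in> space W" if "x \<in> space B" for x p
      using that N by (auto simp: r_def W_def space_pair_measure)
    with cong have "(\<lambda>x. \<Sum>p\<in>#f x. u (r (x, p, f x))) \<in> borel_measurable B \<longleftrightarrow> (\<lambda>x. \<Sum>p\<in>#f x. v (r (x, p, f x))) \<in> borel_measurable B"
      by (intro measurable_cong arg_cong[of _ _ sum_mset] image_mset_cong) auto
    then show ?case using cong by simp
  next
    case (set Y)
    from \<open>\<And>Y. Y \<in> sets W \<Longrightarrow> _\<close>[OF set] obtain Y' where Y': "Y' \<in> sets W" "\<And>z. z \<in> \<Omega> \<Longrightarrow> z \<in> Y' \<longleftrightarrow> r z \<in> Y" by auto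
    have "(\<lambda>x. \<Sum>p\<in>#f x. indicator Y' (x, p, f x) :: ennreal) \<in> borel_measurable B"
    proof (rule borel_measurable_sum_mset_joint[OF N f])
      show "(\<lambda>(x, p). indicator Y' (x, p, f x) :: ennreal) \<in> borel_measurable (B \<Otimes>\<^sub>M N)"
        using Y'(1) f unfolding W_def by measurable
    qed
    also have "?this \<longleftrightarrow> (\<lambda>x. \<Sum>p\<in>#f x. indicator Y (r (x, p, f x)) :: ennreal) \<in> borel_measurable B"
      using N by (intro measurable_cong arg_cong[of _ _ sum_mset] image_mset_cong)
        (auto simp: indicator_def Y'(2) \<Omega>_def W_def space_pair_measure)
    finally show ?case .
  next
    case (mult u c)
    then show ?case by (simp add: sum_mset_distrib_left[symmetric])
  next
    case (add u v)
    then show ?case by (simp add: sum_mset.distrib)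
  next
    case (seq U)
    have "incseq (\<lambda>i p. U i (r (x, p, f x)))" for x
      using \<open>incseq U\<close> by (auto simp: incseq_def le_fun_def simp del: split_paired_All)
    then have "(\<Sum>p\<in>#f x. (SUP i. U i) (r (x, p, f x))) = (SUP i. \<Sum>p\<in>#f x. U i (r (x, p, f x)))" for x
      using sum_mset_SUP[of "\<lambda>i p. U i (r (x, p, f x))"] by (simp add: image_comp)
    then show ?case using seq by simp
  qed
  from *[of "\<lambda>(x, p, C). g x p C"] g show ?thesis
    by (simp add: W_def r_def)
qed

section \<open>Measurable functions of trees\<close>

abbreviation edge_space :: "(real \<times> aged_tree) measure" where
  "edge_space \<equiv> borel \<Otimes>\<^sub>M tree_space"

lemma space_edge_space: "space edge_space = UNIV"
  by (simp add: space_pair_measure)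

lemma measurable_root_age [measurable]: "root_age \<in> borel_measurable tree_space"
  by (rule measurableI) (auto simp: sets_tree_space vimage_def intro: tree_sets.root)

lemma measurable_count_children:
  assumes "B \<in> sets borel" "\<A> \<in> sets tree_space"
  shows "(\<lambda>T. \<Sum>p\<in>#children T. indicator (B \<times> \<A>) p :: ennreal) \<in> borel_measurable tree_space"
proof -
  have "(\<lambda>T. size (filter_mset (\<lambda>p. p \<in> B \<times> \<A>) (children T))) \<in> tree_space \<rightarrow>\<^sub>M count_space UNIV"
  proof (rule measurable_count_space_eq2_countable[THEN iffD2], safe)
    fix k
    have "{T. size (filter_mset (\<lambda>p. fst p \<in> B \<and> snd p \<in> \<A>) (children T)) = k} \<in> sets tree_space"
      unfolding sets_tree_space using assms by (intro tree_sets.count) (auto simp: sets_tree_space)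
    then show "(\<lambda>T. size (filter_mset (\<lambda>p. p \<in> B \<times> \<A>) (children T))) -` {k} \<inter> space tree_space \<in> sets tree_space"
      by (simp add: vimage_def mem_Times_iff)
  qed auto
  then show ?thesis
    unfolding sum_mset_indicator by measurable
qed

lemma measurable_children [measurable]: "children \<in> tree_space \<rightarrow>\<^sub>M multiset_space edge_space"
proof (rule measurable_multiset_spaceI)
  fix X assume X: "X \<in> sets edge_space"
  show "(\<lambda>T. \<Sum>p\<in>#children T. indicator X p :: ennreal) \<in> borel_measurable tree_space"
  proof (rule sum_mset_measurable_generated[OF sets_pair_measure Int_stable_pair_measure_generator pair_measure_closed])
    have "(\<lambda>T. \<Sum>p\<in>#children T. indicator (UNIV \<times> UNIV) p :: ennreal) \<in> borel_measurable tree_space"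
      by (rule measurable_count_children) (use sets.top[of tree_space] in auto)
    then show "(\<lambda>T. of_nat (size (children T)) :: ennreal) \<in> borel_measurable tree_space"
      by (simp add: sum_mset_indicator)
  qed (use X in \<open>auto intro: measurable_count_children\<close>)
qed

text \<open>
  The \<open>\<sigma>\<close>-algebra of trees makes the root age and the configuration of children measurable; by
  induction on the generation of \<open>tree_sets\<close>, it is the one induced by these two maps.
\<close>

lemma measurable_into_tree_space:
  assumes r: "(\<lambda>x. root_age (f x)) \<in> borel_measurable N"
    and c: "(\<lambda>x. children (f x)) \<in> N \<rightarrow>\<^sub>M multiset_space edge_space"
  shows "f \<in> N \<rightarrow>\<^sub>M tree_space"
proof (rule measurableI)
  fix \<A> assume "\<A> \<in> sets tree_space"
  then have "\<A> \<in> tree_sets" by (simp add: sets_tree_space)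
  then show "f -` \<A> \<inter> space N \<in> sets N"
  proof (induction \<A>)
    case (root B)
    have "(\<lambda>x. root_age (f x)) -` B \<inter> space N \<in> sets N"
      using r root by (rule measurable_sets)
    then show ?case by (simp add: vimage_def)
  next
    case (count B \<A> k)
    have "B \<times> \<A> \<in> sets edge_space"
      using count by (intro pair_measureI) (auto simp: sets_tree_space)
    then have "(\<lambda>x. \<Sum>p\<in>#children (f x). indicator (B \<times> \<A>) p :: ennreal) \<in> borel_measurable N"
      by (rule measurable_compose[OF c measurable_count_multiset_space])
    then have "{x \<in> space N. (\<Sum>p\<in>#children (f x). indicator (B \<times> \<A>) p :: ennreal) = of_nat k} \<in> sets N"
      by measurable
    also have "{x \<in> space N. (\<Sum>p\<in>#children (f x). indicator (B \<times> \<A>) p :: ennreal) = of_nat k} =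
      f -` {T. size (filter_mset (\<lambda>p. fst p \<in> B \<and> snd p \<in> \<A>) (children T)) = k} \<inter> space N"
      by (auto simp: sum_mset_indicator mem_Times_iff)
    finally show ?case .
  next
    case (compl \<A>)
    have "f -` (- \<A>) \<inter> space N = space N - (f -` \<A> \<inter> space N)" by auto
    then show ?case using compl by simp
  next
    case (union \<A>)
    have "f -` (\<Union>i. \<A> i) \<inter> space N = (\<Union>i. f -` \<A> i \<inter> space N)" by auto
    moreover have "(\<Union>i. f -` \<A> i \<inter> space N) \<in> sets N"
      using union by (intro sets.countable_nat_UN) auto
    ultimately show ?case by (simp only:)
  qed
qed simp

lemma measurable_Vertex [measurable (raw)]:
  assumes "f \<in> borel_measurable N" "g \<in> N \<rightarrow>\<^sub>M multiset_space edge_space"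
  shows "(\<lambda>x. Vertex (f x) (g x)) \<in> N \<rightarrow>\<^sub>M tree_space"
  using assms by (intro measurable_into_tree_space) auto

lemma measurable_add_edge [measurable (raw)]:
  assumes "f \<in> N \<rightarrow>\<^sub>M edge_space" "g \<in> N \<rightarrow>\<^sub>M multiset_space edge_space"
  shows "(\<lambda>x. add_mset (f x) (g x)) \<in> N \<rightarrow>\<^sub>M multiset_space edge_space"
  using assms by (rule measurable_add_mset[OF space_edge_space])

lemma measurable_empty_mset [measurable]: "(\<lambda>x. {#}) \<in> N \<rightarrow>\<^sub>M multiset_space N'"
  by (rule measurable_const) simp

lemma height_less_Suc_iff: "height T < Suc n \<longleftrightarrow> (\<forall>p\<in>#children T. height (snd p) < n)"
proof (cases T)
  case (Vertex b C)
  let ?A = "(\<lambda>p. Suc (height (snd p))) ` set_mset C"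
  have h: "height T = Sup ?A"
    by (simp add: Vertex image_image)
  show ?thesis
  proof (cases "C = {#}")
    case False
    then have "Sup ?A = Max ?A" by (simp add: Sup_nat_def)
    with False show ?thesis unfolding h by (simp add: Vertex Max_less_iff)
  qed (simp add: h Vertex Sup_nat_def)
qed

lemma num_vertices_eq: "num_vertices T = Suc (\<Sum>p\<in>#children T. num_vertices (snd p))"
  by (cases T) (simp add: image_mset.compositionality comp_def)

lemma num_vertices_pos [simp]: "0 < num_vertices T"
  by (subst num_vertices_eq) simp

text \<open>
  Structural induction in terms of selectors, which avoids the mapping functions that the nested
  recursion through multisets introduces.
\<close>

lemma tree_height_induct [case_names less]:
  assumes "\<And>T. (\<And>e S. (e, S) \<in># children T \<Longrightarrow> P S) \<Longrightarrow> P T"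
  shows "P T"
proof (induction T)
  case (Vertex b C)
  show ?case
    by (rule assms) (use Vertex in auto)
qed

lemma measurable_height_less [measurable]: "Measurable.pred tree_space (\<lambda>T. height T < n)"
proof (induction n)
  case (Suc n)
  have "Measurable.pred (tree_space \<Otimes>\<^sub>M edge_space) (\<lambda>(T, p). height (snd p) < n)"
    using measurable_compose[OF measurable_compose[OF measurable_snd measurable_snd] Suc] by (simp add: case_prod_unfold)
  from measurable_all_mset[OF space_edge_space measurable_children this]
  show ?case by (simp add: height_less_Suc_iff)
qed simp

text \<open>
  The principle behind all measurability proofs for recursive functions on trees: by induction
  on \<open>n\<close> one finds a measurable function that is correct on trees of height less than \<open>n\<close>.
\<close>

lemma measurable_by_height:
  assumes "\<And>n. \<exists>g \<in> N \<Otimes>\<^sub>M tree_space \<rightarrow>\<^sub>M K. \<forall>x T. height T < n \<longrightarrow> f (x, T) = g (x, T)"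
  shows "f \<in> N \<Otimes>\<^sub>M tree_space \<rightarrow>\<^sub>M K"
proof (rule measurable_piecewise_restrict2[where A = "\<lambda>n. {z \<in> space (N \<Otimes>\<^sub>M tree_space). height (snd z) < n}"])
  show "space (N \<Otimes>\<^sub>M tree_space) = (\<Union>n. {z \<in> space (N \<Otimes>\<^sub>M tree_space). height (snd z) < n})"
    by auto
  show "\<exists>h\<in>N \<Otimes>\<^sub>M tree_space \<rightarrow>\<^sub>M K. \<forall>x\<in>{z \<in> space (N \<Otimes>\<^sub>M tree_space). height (snd z) < n}. f x = h x" for n
    using assms[of n] by fastforce
qed measurable

lemma measurable_tree_by_height:
  assumes "\<And>n. \<exists>g \<in> tree_space \<rightarrow>\<^sub>M K. \<forall>T. height T < n \<longrightarrow> f T = g T"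
  shows "f \<in> tree_space \<rightarrow>\<^sub>M K"
proof (rule measurable_piecewise_restrict2[where A = "\<lambda>n. {T. height T < n}"])
  show "\<exists>h\<in>tree_space \<rightarrow>\<^sub>M K. \<forall>x\<in>{T. height T < n}. f x = h x" for n
    using assms[of n] by fastforce
  show "{T. height T < n} \<in> sets tree_space" for n
    using measurable_height_less[of n] by (simp add: pred_def)
qed auto

lemma of_nat_sum_mset_ennreal: "of_nat (\<Sum>p\<in>#C. f p) = (\<Sum>p\<in>#C. of_nat (f p) :: ennreal)"
  by (induction C) auto

lemma measurable_num_vertices [measurable]: "num_vertices \<in> tree_space \<rightarrow>\<^sub>M count_space UNIV"
proof -
  have "\<exists>g \<in> borel_measurable tree_space. \<forall>T. height T < n \<longrightarrow> (of_nat (num_vertices T) :: ennreal) = g T" for n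
  proof (induction n)
    case 0
    show ?case by (intro bexI[of _ "\<lambda>_. 0"]) auto
  next
    case (Suc n)
    then obtain g :: "aged_tree \<Rightarrow> ennreal" where g[measurable]: "g \<in> borel_measurable tree_space"
      and eq: "\<And>T. height T < n \<Longrightarrow> of_nat (num_vertices T) = g T" by blast
    have "(\<lambda>T. 1 + (\<Sum>p\<in>#children T. g (snd p))) \<in> borel_measurable tree_space"
      by (intro borel_measurable_add borel_measurable_const borel_measurable_sum_mset_joint[OF space_edge_space measurable_children]) measurable
    moreover have "of_nat (num_vertices T) = 1 + (\<Sum>p\<in>#children T. g (snd p))" if "height T < Suc n" for T
    proof -
      have "of_nat (\<Sum>p\<in>#children T. num_vertices (snd p)) = (\<Sum>p\<in>#children T. of_nat (num_vertices (snd p)) :: ennreal)"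
        by (rule of_nat_sum_mset_ennreal)
      also have "\<dots> = (\<Sum>p\<in>#children T. g (snd p))"
        using that by (intro arg_cong[of _ _ sum_mset] image_mset_cong) (auto simp: eq height_less_Suc_iff)
      finally show ?thesis
        unfolding num_vertices_eq[of T] of_nat_Suc by (rule arg_cong)
    qed
    ultimately show ?case
      by (intro bexI[of _ "\<lambda>T. 1 + (\<Sum>p\<in>#children T. g (snd p))"]) auto
  qed
  then have m: "(\<lambda>T. of_nat (num_vertices T) :: ennreal) \<in> borel_measurable tree_space"
    by (rule measurable_tree_by_height)
  show ?thesis
  proof (rule measurable_count_space_eq2_countable[THEN iffD2], safe)
    fix k
    have "{T \<in> space tree_space. (of_nat (num_vertices T) :: ennreal) = of_nat k} \<in> sets tree_space"
      using m by measurable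
    then show "num_vertices -` {k} \<inter> space tree_space \<in> sets tree_space"
      by (simp add: vimage_def)
  qed auto
qed

lemma root_age_grow [simp]: "root_age (grow d T) = root_age T + d"
  by (cases T) simp

lemma children_grow: "children (grow d T) = image_mset (\<lambda>p. (fst p + d, grow d (snd p))) (children T)"
  by (cases T) (simp add: map_prod_def case_prod_unfold)

lemma grow_eq: "grow d T = Vertex (root_age T + d) (image_mset (\<lambda>p. (fst p + d, grow d (snd p))) (children T))"
  by (cases T) (simp add: map_prod_def case_prod_unfold)

lemma num_vertices_grow [simp]: "num_vertices (grow d T) = num_vertices T"
proof (induction T rule: tree_height_induct)
  case (less T)
  have "image_mset (\<lambda>p. num_vertices (snd p)) (children (grow d T)) = image_mset (\<lambda>p. num_vertices (snd p)) (children T)"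
    unfolding children_grow image_mset.compositionality comp_def using less by (intro image_mset_cong) auto
  then show ?case by (subst (1 2) num_vertices_eq) simp
qed

lemma measurable_grow: "(\<lambda>(d, T). grow d T) \<in> borel \<Otimes>\<^sub>M tree_space \<rightarrow>\<^sub>M tree_space"
proof (rule measurable_by_height)
  fix n
  show "\<exists>g\<in>borel \<Otimes>\<^sub>M tree_space \<rightarrow>\<^sub>M tree_space. \<forall>d T. height T < n \<longrightarrow> (\<lambda>(d, T). grow d T) (d, T) = g (d, T)"
  proof (induction n)
    case 0
    show ?case by (intro bexI[of _ snd]) auto
  next
    case (Suc n)
    then obtain g where g[measurable]: "g \<in> borel \<Otimes>\<^sub>M tree_space \<rightarrow>\<^sub>M tree_space"
      and eq: "\<And>d T. height T < n \<Longrightarrow> grow d T = g (d, T)" by auto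
    have "(\<lambda>(d, T). Vertex (root_age T + d) (image_mset (\<lambda>p. (fst p + d, g (d, snd p))) (children T)))
        \<in> borel \<Otimes>\<^sub>M tree_space \<rightarrow>\<^sub>M tree_space"
      unfolding case_prod_unfold
      by (intro measurable_Vertex measurable_image_mset[OF space_edge_space]) (simp_all add: case_prod_unfold)
    moreover have "grow d T = Vertex (root_age T + d) (image_mset (\<lambda>p. (fst p + d, g (d, snd p))) (children T))"
      if "height T < Suc n" for d T
      using that by (subst grow_eq) (auto simp: eq height_less_Suc_iff intro!: image_mset_cong)
    ultimately show ?case by (intro bexI) auto
  qed
qed

lemma measurable_grow' [measurable (raw)]:
  assumes "f \<in> borel_measurable N" "g \<in> N \<rightarrow>\<^sub>M tree_space"
  shows "(\<lambda>x. grow (f x) (g x)) \<in> N \<rightarrow>\<^sub>M tree_space"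
  using measurable_compose[OF measurable_Pair[OF assms] measurable_grow] by simp

lemma attachments_eq:
  "attachments S T = add_mset (Vertex (root_age T) (add_mset (0, S) (children T)))
     (\<Sum>p\<in>#children T. image_mset (\<lambda>T'. Vertex (root_age T) (add_mset (fst p, T') (children T - {#p#}))) (attachments S (snd p)))"
  by (cases T) (simp add: image_mset.compositionality comp_def map_prod_def case_prod_unfold)

lemma sum_mset_sum_mset: "(\<Sum>p\<in>#(\<Sum>q\<in>#C. f q). g p) = (\<Sum>q\<in>#C. \<Sum>p\<in>#f q. g p)"
  by (induction C) auto

lemma measurable_attachments: "(\<lambda>(S, T). attachments S T) \<in> tree_space \<Otimes>\<^sub>M tree_space \<rightarrow>\<^sub>M multiset_space tree_space"
proof (rule measurable_by_height)
  fix n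
  show "\<exists>g\<in>tree_space \<Otimes>\<^sub>M tree_space \<rightarrow>\<^sub>M multiset_space tree_space.
    \<forall>S T. height T < n \<longrightarrow> (\<lambda>(S, T). attachments S T) (S, T) = g (S, T)"
  proof (induction n)
    case 0
    show ?case by (intro bexI[of _ "\<lambda>_. {#}"]) auto
  next
    case (Suc n)
    then obtain g where g[measurable]: "g \<in> tree_space \<Otimes>\<^sub>M tree_space \<rightarrow>\<^sub>M multiset_space tree_space"
      and eq: "\<And>S T. height T < n \<Longrightarrow> attachments S T = g (S, T)" by auto
    let ?h = "\<lambda>z. \<Sum>p\<in>#children (snd z). image_mset (\<lambda>T'. Vertex (root_age (snd z)) (add_mset (fst p, T') (children (snd z) - {#p#}))) (g (fst z, snd p))"
    have "(\<lambda>z. add_mset (Vertex (root_age (snd z)) (add_mset (0, fst z) (children (snd z)))) (?h z))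
        \<in> tree_space \<Otimes>\<^sub>M tree_space \<rightarrow>\<^sub>M multiset_space tree_space"
    proof (intro measurable_add_mset)
      show "?h \<in> tree_space \<Otimes>\<^sub>M tree_space \<rightarrow>\<^sub>M multiset_space tree_space"
      proof (rule measurable_multiset_spaceI)
        fix X assume X[measurable]: "X \<in> sets tree_space"
        have "(\<lambda>z. \<Sum>p\<in>#children (snd z). (\<lambda>z p D. \<Sum>T'\<in>#g (fst z, snd p). indicator X (Vertex (root_age (snd z)) (add_mset (fst p, T') D)) :: ennreal) z p (children (snd z) - {#p#}))
           \<in> borel_measurable (tree_space \<Otimes>\<^sub>M tree_space)"
        proof (rule borel_measurable_sum_mset_remove[OF space_edge_space])
          show "(\<lambda>(z, p, D). \<Sum>T'\<in>#g (fst z, snd p). indicator X (Vertex (root_age (snd z)) (add_mset (fst p, T') D)) :: ennreal)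
            \<in> borel_measurable ((tree_space \<Otimes>\<^sub>M tree_space) \<Otimes>\<^sub>M edge_space \<Otimes>\<^sub>M multiset_space edge_space)"
            unfolding case_prod_unfold
            by (rule borel_measurable_sum_mset_joint[OF space_tree_space]) measurable
        qed measurable
        then show "(\<lambda>z. \<Sum>p\<in>#?h z. indicator X p :: ennreal) \<in> borel_measurable (tree_space \<Otimes>\<^sub>M tree_space)"
          by (simp add: sum_mset_sum_mset image_mset.compositionality comp_def)
      qed
    qed (simp, measurable)
    moreover have "attachments S T = (\<lambda>z. add_mset (Vertex (root_age (snd z)) (add_mset (0, fst z) (children (snd z)))) (?h z)) (S, T)"
      if "height T < Suc n" for S T
      using that by (subst attachments_eq) (auto simp: eq height_less_Suc_iff intro!: arg_cong[of _ _ sum_mset] image_mset_cong)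
    ultimately show ?case by (intro bexI) auto
  qed
qed

lemma borel_measurable_attachments_sum [measurable (raw)]:
  assumes "f \<in> N \<rightarrow>\<^sub>M tree_space" "g \<in> N \<rightarrow>\<^sub>M tree_space"
    and "(\<lambda>(x, T). h x T :: ennreal) \<in> borel_measurable (N \<Otimes>\<^sub>M tree_space)"
  shows "(\<lambda>x. \<Sum>T\<in>#attachments (f x) (g x). h x T) \<in> borel_measurable N"
proof (rule borel_measurable_sum_mset_joint[OF space_tree_space _ assms(3)])
  show "(\<lambda>x. attachments (f x) (g x)) \<in> N \<rightarrow>\<^sub>M multiset_space tree_space"
    using measurable_compose[OF measurable_Pair[OF assms(1,2)] measurable_attachments] by simp
qed

section \<open>Multisets of independent points and Poisson integrals\<close>

lemma multiset_space_cong: "sets N = sets N' \<Longrightarrow> multiset_space N = multiset_space N'"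
  by (simp add: multiset_space_def)

text \<open>
  The unnormalised law of \<open>k\<close> independent points with intensity \<open>N\<close>, as an unordered
  configuration.
\<close>

primrec mset_power :: "'a measure \<Rightarrow> nat \<Rightarrow> 'a multiset measure" where
  "mset_power N 0 = return (multiset_space N) {#}"
| "mset_power N (Suc k) = distr (N \<Otimes>\<^sub>M mset_power N k) (multiset_space N) (\<lambda>(p, C). add_mset p C)"

lemma sets_mset_power [simp, measurable_cong]: "sets (mset_power N k) = sets (multiset_space N)"
  by (cases k) auto

lemma space_mset_power [simp]: "space (mset_power N k) = UNIV"
  by (cases k) auto

lemma measurable_add_mset_pair:
  assumes "space N = UNIV" "sets L = sets (multiset_space N)"
  shows "(\<lambda>(p, C). add_mset p C) \<in> N \<Otimes>\<^sub>M L \<rightarrow>\<^sub>M multiset_space N"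
proof -
  have "(\<lambda>z. add_mset (fst z) (snd z)) \<in> N \<Otimes>\<^sub>M multiset_space N \<rightarrow>\<^sub>M multiset_space N"
    by (intro measurable_add_mset assms(1)) measurable
  then show ?thesis
    using assms by (simp add: case_prod_unfold cong: measurable_cong_sets)
qed

text \<open>
  Full space, so that every multiset of points is an element of \<open>multiset_space N\<close>.
\<close>

locale finite_full_measure = finite_measure N for N :: "'a measure" +
  assumes space_full: "space N = UNIV"
begin

lemma finite_mset_power: "finite_measure (mset_power N k)"
proof (induction k)
  case 0
  show ?case
    by (auto intro!: prob_space.finite_measure prob_space_return)
next
  case (Suc k)
  then interpret L: finite_measure "mset_power N k" .
  have "finite_measure (N \<Otimes>\<^sub>M mset_power N k)"
    by (rule finite_measure_pair_measure) unfold_locales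
  then interpret P: finite_measure "N \<Otimes>\<^sub>M mset_power N k" .
  show ?case
    by (auto intro!: P.finite_measure_distr measurable_add_mset_pair simp: space_full)
qed

lemma sigma_finite_mset_power: "sigma_finite_measure (mset_power N k)"
  using finite_mset_power[of k] by (simp add: finite_measure_def)

lemma measurable_add_point:
  assumes "F \<in> borel_measurable (multiset_space N)"
  shows "(\<lambda>C. F (add_mset p C) :: ennreal) \<in> borel_measurable (multiset_space N)"
  by (rule measurable_compose[OF measurable_add_mset assms]) (auto simp: space_full)

lemma borel_measurable_mset_power_integral:
  assumes "(\<lambda>(x, C). F x C :: ennreal) \<in> borel_measurable (B \<Otimes>\<^sub>M multiset_space N)"
  shows "(\<lambda>x. \<integral>\<^sup>+C. F x C \<partial>mset_power N k) \<in> borel_measurable B"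
proof -
  interpret L: sigma_finite_measure "mset_power N k" by (rule sigma_finite_mset_power)
  show ?thesis
    using assms by (intro L.borel_measurable_nn_integral) (simp cong: measurable_cong_sets)
qed

lemma mset_power_0:
  assumes "F \<in> borel_measurable (multiset_space N)"
  shows "(\<integral>\<^sup>+C. F C \<partial>mset_power N 0) = F {#}"
  using assms by (simp add: nn_integral_return)

lemma mset_power_Suc:
  assumes F: "F \<in> borel_measurable (multiset_space N)"
  shows "(\<integral>\<^sup>+C. F C \<partial>mset_power N (Suc k)) = (\<integral>\<^sup>+p. \<integral>\<^sup>+C. F (add_mset p C) \<partial>mset_power N k \<partial>N)"
proof -
  interpret L: sigma_finite_measure "mset_power N k" by (rule sigma_finite_mset_power)
  have add: "(\<lambda>(p, C). add_mset p C) \<in> N \<Otimes>\<^sub>M mset_power N k \<rightarrow>\<^sub>M multiset_space N"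
    by (rule measurable_add_mset_pair) (auto simp: space_full)
  have "(\<integral>\<^sup>+C. F C \<partial>mset_power N (Suc k)) = (\<integral>\<^sup>+z. F (case z of (p, C) \<Rightarrow> add_mset p C) \<partial>(N \<Otimes>\<^sub>M mset_power N k))"
    using add F by (simp add: nn_integral_distr)
  also have "\<dots> = (\<integral>\<^sup>+p. \<integral>\<^sup>+C. F (add_mset p C) \<partial>mset_power N k \<partial>N)"
    using L.nn_integral_fst[OF measurable_compose[OF add F]] by simp
  finally show ?thesis .
qed

lemma mset_power_mass: "(\<integral>\<^sup>+C. 1 \<partial>mset_power N k) = emeasure N UNIV ^ k"
proof (induction k)
  case (Suc k)
  have "(\<integral>\<^sup>+C. 1 \<partial>mset_power N (Suc k)) = (\<integral>\<^sup>+p. \<integral>\<^sup>+C. 1 \<partial>mset_power N k \<partial>N)"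
    by (rule mset_power_Suc) simp
  also have "\<dots> = emeasure N UNIV ^ Suc k"
    unfolding Suc by (simp add: space_full mult.commute)
  finally show ?case .
next
  case 0
  show ?case using mset_power_0[of "\<lambda>_. 1"] by simp
qed

end

text \<open>
  Change of variables with a density \<open>g\<close>, point by point. The hypothesis on \<open>N\<close> and \<open>N'\<close> is
  required only for functions supported in \<open>S\<close>: when \<open>S\<close> is the set of children with at most \<open>m\<close>
  vertices, this is what an induction on the size of a tree provides for its children.
\<close>

lemma mset_power_transform:
  assumes N: "finite_full_measure N" and N': "finite_full_measure N'"
    and r: "r \<in> N \<rightarrow>\<^sub>M N'" and g: "g \<in> borel_measurable N"
    and G: "G \<in> borel_measurable (multiset_space N)" "G {#} = 1" "\<And>p C. G (add_mset p C) = g p * G C"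
    and eq: "\<And>f. f \<in> borel_measurable N' \<Longrightarrow> (\<And>p. p \<notin> S \<Longrightarrow> f p = 0) \<Longrightarrow>
      (\<integral>\<^sup>+p. f p \<partial>N') = (\<integral>\<^sup>+p. g p * f (r p) \<partial>N)"
    and F: "F \<in> borel_measurable (multiset_space N')" "\<And>C. \<not> set_mset C \<subseteq> S \<Longrightarrow> F C = 0"
  shows "(\<integral>\<^sup>+C. F C \<partial>mset_power N' k) = (\<integral>\<^sup>+C. G C * F (image_mset r C) \<partial>mset_power N k :: ennreal)"
  using F
proof (induction k arbitrary: F)
  case 0
  interpret N: finite_full_measure N by fact
  interpret N': finite_full_measure N' by fact
  have "image_mset r \<in> multiset_space N \<rightarrow>\<^sub>M multiset_space N'"
    by (rule measurable_image_mset) (use r N.space_full in \<open>auto simp: case_prod_unfold\<close>)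
  then have "(\<lambda>C. G C * F (image_mset r C)) \<in> borel_measurable (multiset_space N)"
    using G 0 by simp
  then show ?case
    using 0 G by (simp only: N.mset_power_0 N'.mset_power_0) simp
next
  case (Suc k)
  interpret N: finite_full_measure N by fact
  interpret N': finite_full_measure N' by fact
  note r[measurable] g[measurable] G(1)[measurable] Suc.prems(1)[measurable]
  have im[measurable]: "image_mset r \<in> multiset_space N \<rightarrow>\<^sub>M multiset_space N'"
    by (rule measurable_image_mset) (use N.space_full in \<open>auto simp: case_prod_unfold\<close>)
  have add': "(\<lambda>(p, C). add_mset p C) \<in> N' \<Otimes>\<^sub>M multiset_space N' \<rightarrow>\<^sub>M multiset_space N'"
    by (rule measurable_add_mset_pair) (auto simp: N'.space_full)
  have "(\<lambda>z. (fst z, image_mset r (snd z))) \<in> N' \<Otimes>\<^sub>M multiset_space N \<rightarrow>\<^sub>M N' \<Otimes>\<^sub>M multiset_space N'"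
    by measurable
  from measurable_compose[OF measurable_compose[OF this add'] Suc.prems(1)]
  have m: "(\<lambda>(p, C). F (add_mset p (image_mset r C))) \<in> borel_measurable (N' \<Otimes>\<^sub>M multiset_space N)"
    by (simp add: case_prod_unfold)
  define h where "h p = (\<integral>\<^sup>+C. G C * F (add_mset p (image_mset r C)) \<partial>mset_power N k)" for p
  have h: "h \<in> borel_measurable N'"
    unfolding h_def
    by (rule N.borel_measurable_mset_power_integral) (use m in \<open>simp add: case_prod_unfold\<close>)
  have "(\<integral>\<^sup>+C. F C \<partial>mset_power N' (Suc k)) = (\<integral>\<^sup>+p. \<integral>\<^sup>+C. F (add_mset p C) \<partial>mset_power N' k \<partial>N')"
    by (rule N'.mset_power_Suc) fact
  also have "\<dots> = (\<integral>\<^sup>+p. h p \<partial>N')"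
    unfolding h_def using Suc.prems
    by (intro nn_integral_cong Suc.IH N'.measurable_add_point) auto
  also have "\<dots> = (\<integral>\<^sup>+p. g p * h (r p) \<partial>N)"
    using Suc.prems(2) by (intro eq h) (auto simp: h_def)
  also have "\<dots> = (\<integral>\<^sup>+p. \<integral>\<^sup>+C. G (add_mset p C) * F (image_mset r (add_mset p C)) \<partial>mset_power N k \<partial>N)"
  proof (rule nn_integral_cong)
    fix p assume "p \<in> space N"
    have "(\<lambda>C. G C * F (add_mset (r p) (image_mset r C))) \<in> borel_measurable (multiset_space N)"
      using measurable_Pair2[OF m, of "r p"] N'.space_full by simp
    then show "g p * h (r p) = (\<integral>\<^sup>+C. G (add_mset p C) * F (image_mset r (add_mset p C)) \<partial>mset_power N k)"
      unfolding h_def by (subst nn_integral_cmult[symmetric]) (auto simp: G(3) mult_ac cong: measurable_cong_sets)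
  qed
  also have "\<dots> = (\<integral>\<^sup>+C. G C * F (image_mset r C) \<partial>mset_power N (Suc k))"
    by (rule N.mset_power_Suc[symmetric]) simp
  finally show ?case .
qed

lemma mset_power_SUP:
  fixes L :: "nat \<Rightarrow> 'a measure"
  assumes N: "finite_full_measure N" and L: "\<And>n. finite_full_measure (L n)" "\<And>n. sets (L n) = sets N"
    and inc: "\<And>f. f \<in> borel_measurable N \<Longrightarrow> incseq (\<lambda>n. \<integral>\<^sup>+p. f p \<partial>L n)"
    and sup: "\<And>f. f \<in> borel_measurable N \<Longrightarrow> (\<integral>\<^sup>+p. f p \<partial>N) = (SUP n. \<integral>\<^sup>+p. f p \<partial>L n)"
    and F: "F \<in> borel_measurable (multiset_space N)"
  shows "incseq (\<lambda>n. \<integral>\<^sup>+C. F C \<partial>mset_power (L n) k) \<and>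
    (\<integral>\<^sup>+C. F C \<partial>mset_power N k) = (SUP n. \<integral>\<^sup>+C. F C \<partial>mset_power (L n) k :: ennreal)"
  using F
proof (induction k arbitrary: F)
  case 0
  have m: "multiset_space (L n) = multiset_space N" for n
    by (rule multiset_space_cong) (rule L)
  show ?case
    using 0 by (simp add: m nn_integral_return)
next
  case (Suc k)
  interpret N: finite_full_measure N by fact
  interpret L: finite_full_measure "L n" for n by fact
  have m: "multiset_space (L n) = multiset_space N" for n
    by (rule multiset_space_cong) (rule L)
  have bL: "borel_measurable (L n) = borel_measurable N" for n
    using L(2) by (simp cong: measurable_cong_sets)
  let ?J = "\<lambda>m p. \<integral>\<^sup>+C. F (add_mset p C) \<partial>mset_power (L m) k"
  have add: "(\<lambda>(p, C). F (add_mset p C)) \<in> borel_measurable (N \<Otimes>\<^sub>M multiset_space N)"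
    using measurable_compose[OF measurable_add_mset_pair[OF N.space_full refl] Suc.prems] by (simp add: case_prod_unfold)
  have J: "?J m \<in> borel_measurable N" for m
    by (rule L.borel_measurable_mset_power_integral) (use add m in auto)
  have IH: "incseq (\<lambda>m. ?J m p)" "(\<integral>\<^sup>+C. F (add_mset p C) \<partial>mset_power N k) = (SUP m. ?J m p)" for p
    using Suc.IH[OF N.measurable_add_point[OF Suc.prems, of p]] by auto
  have incJ: "incseq ?J"
    using IH(1) by (auto simp: incseq_def le_fun_def)
  have LS: "(\<integral>\<^sup>+C. F C \<partial>mset_power (L n) (Suc k)) = (\<integral>\<^sup>+p. ?J n p \<partial>L n)" for n
    by (rule L.mset_power_Suc) (simp add: m Suc.prems)
  have mono2: "(\<integral>\<^sup>+p. ?J m p \<partial>L n) \<le> (\<integral>\<^sup>+p. ?J m' p \<partial>L n')" if "n \<le> n'" "m \<le> m'" for n m n' m'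
  proof -
    have "(\<integral>\<^sup>+p. ?J m p \<partial>L n) \<le> (\<integral>\<^sup>+p. ?J m p \<partial>L n')"
      using inc[OF J, of m] that by (auto simp: incseq_def)
    also have "\<dots> \<le> (\<integral>\<^sup>+p. ?J m' p \<partial>L n')"
      using incJ that by (intro nn_integral_mono) (auto simp: incseq_def le_fun_def)
    finally show ?thesis .
  qed
  have "(\<integral>\<^sup>+C. F C \<partial>mset_power N (Suc k)) = (\<integral>\<^sup>+p. (SUP m. ?J m p) \<partial>N)"
    using N.mset_power_Suc[OF Suc.prems] by (simp add: IH(2))
  also have "\<dots> = (SUP n. \<integral>\<^sup>+p. (SUP m. ?J m p) \<partial>L n)"
    by (rule sup) (use J in simp)
  also have "\<dots> = (SUP n. SUP m. \<integral>\<^sup>+p. ?J m p \<partial>L n)"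
    using incJ J by (intro SUP_cong nn_integral_monotone_convergence_SUP) (auto simp: bL)
  also have "\<dots> = (SUP n. \<integral>\<^sup>+p. ?J n p \<partial>L n)"
  proof (rule antisym)
    show "(SUP n. SUP m. \<integral>\<^sup>+p. ?J m p \<partial>L n) \<le> (SUP n. \<integral>\<^sup>+p. ?J n p \<partial>L n)"
    proof (intro SUP_least)
      fix n m
      have "(\<integral>\<^sup>+p. ?J m p \<partial>L n) \<le> (\<integral>\<^sup>+p. ?J (max m n) p \<partial>L (max m n))"
        by (rule mono2) auto
      also have "\<dots> \<le> (SUP n. \<integral>\<^sup>+p. ?J n p \<partial>L n)"
        by (rule SUP_upper) simp
      finally show "(\<integral>\<^sup>+p. ?J m p \<partial>L n) \<le> (SUP n. \<integral>\<^sup>+p. ?J n p \<partial>L n)" .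
    qed
    show "(SUP n. \<integral>\<^sup>+p. ?J n p \<partial>L n) \<le> (SUP n. SUP m. \<integral>\<^sup>+p. ?J m p \<partial>L n)"
    proof (rule SUP_least)
      fix n
      show "(\<integral>\<^sup>+p. ?J n p \<partial>L n) \<le> (SUP n. SUP m. \<integral>\<^sup>+p. ?J m p \<partial>L n)"
        by (rule SUP_upper2[where i = n], simp, rule SUP_upper2[where i = n], simp, rule order_refl)
    qed
  qed
  finally show ?case
    using mono2 by (simp add: LS incseq_def del: mset_power.simps)
qed

context finite_full_measure
begin

text \<open>
  Choosing one of \<open>k + 1\<close> exchangeable points leaves \<open>k\<close> points that are independent of it.
\<close>

lemma mset_power_Mecke:
  assumes f: "(\<lambda>(p, C). f p C :: ennreal) \<in> borel_measurable (N \<Otimes>\<^sub>M multiset_space N)"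
  shows "(\<integral>\<^sup>+C. (\<Sum>p\<in>#C. f p (C - {#p#})) \<partial>mset_power N (Suc k)) =
    of_nat (Suc k) * (\<integral>\<^sup>+p. \<integral>\<^sup>+C. f p C \<partial>mset_power N k \<partial>N)"
  using f
proof (induction k arbitrary: f)
  case (0 f)
  have sm: "(\<lambda>C. \<Sum>p\<in>#C. f p (C - {#p#})) \<in> borel_measurable (multiset_space N)"
    using borel_measurable_sum_mset_remove[OF space_full measurable_ident, of "\<lambda>_. f"] 0
    by (simp add: case_prod_unfold)
  have fp: "f p \<in> borel_measurable (multiset_space N)" for p
    using measurable_Pair2[OF 0, of p] by (simp add: space_full)
  have "(\<integral>\<^sup>+C. (\<Sum>q\<in>#add_mset p C. f q (add_mset p C - {#q#})) \<partial>mset_power N 0) = f p {#}"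
    "(\<integral>\<^sup>+C. f p C \<partial>mset_power N 0) = f p {#}" for p
    using mset_power_0[OF measurable_add_point[OF sm, of p]] mset_power_0[OF fp[of p]] by simp_all
  then show ?case
    unfolding mset_power_Suc[OF sm] by (simp del: mset_power.simps)
next
  case (Suc k)
  have sm: "(\<lambda>C. \<Sum>p\<in>#C. f p (C - {#p#})) \<in> borel_measurable (multiset_space N)"
    if "(\<lambda>(p, C). f p C :: ennreal) \<in> borel_measurable (N \<Otimes>\<^sub>M multiset_space N)" for f
    using borel_measurable_sum_mset_remove[OF space_full measurable_ident, of "\<lambda>_. f"] that
    by (simp add: case_prod_unfold)
  have fp: "f p \<in> borel_measurable (multiset_space N)" for p
    using measurable_Pair2[OF Suc.prems, of p] by (simp add: space_full)
  have fq: "(\<lambda>(p, C). f p (add_mset q C)) \<in> borel_measurable (N \<Otimes>\<^sub>M multiset_space N)" for q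
  proof -
    have "(\<lambda>z. (fst z, add_mset q (snd z))) \<in> N \<Otimes>\<^sub>M multiset_space N \<rightarrow>\<^sub>M N \<Otimes>\<^sub>M multiset_space N"
      by (intro measurable_Pair measurable_add_mset) (auto simp: space_full)
    from measurable_compose[OF this Suc.prems] show ?thesis by (simp add: case_prod_unfold)
  qed
  interpret L: sigma_finite_measure "mset_power N k" by (rule sigma_finite_mset_power)
  interpret NN: pair_sigma_finite N N by unfold_locales
  have pq: "(\<lambda>(q, p). \<integral>\<^sup>+C. f p (add_mset q C) \<partial>mset_power N k) \<in> borel_measurable (N \<Otimes>\<^sub>M N)"
  proof -
    have "(\<lambda>z. (snd (fst z), add_mset (fst (fst z)) (snd z))) \<in> (N \<Otimes>\<^sub>M N) \<Otimes>\<^sub>M multiset_space N \<rightarrow>\<^sub>M N \<Otimes>\<^sub>M multiset_space N"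
      by (intro measurable_Pair measurable_add_mset) (auto simp: space_full)
    from measurable_compose[OF this Suc.prems] show ?thesis
      by (auto simp: case_prod_unfold intro!: borel_measurable_mset_power_integral)
  qed
  have split: "(\<Sum>p\<in>#add_mset q C. f p (add_mset q C - {#p#})) = f q C + (\<Sum>p\<in>#C. f p (add_mset q (C - {#p#})))" for q C
    by (auto intro!: arg_cong[of _ _ sum_mset] image_mset_cong)
  have "(\<integral>\<^sup>+C. (\<Sum>p\<in>#C. f p (C - {#p#})) \<partial>mset_power N (Suc (Suc k))) =
     (\<integral>\<^sup>+q. \<integral>\<^sup>+C. f q C + (\<Sum>p\<in>#C. f p (add_mset q (C - {#p#}))) \<partial>mset_power N (Suc k) \<partial>N)"
    unfolding mset_power_Suc[OF sm[OF Suc.prems], of "Suc k"] split ..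
  also have "\<dots> = (\<integral>\<^sup>+q. (\<integral>\<^sup>+C. f q C \<partial>mset_power N (Suc k)) +
        (\<integral>\<^sup>+C. (\<Sum>p\<in>#C. f p (add_mset q (C - {#p#}))) \<partial>mset_power N (Suc k)) \<partial>N)"
  proof (intro nn_integral_cong nn_integral_add)
    fix q
    show "f q \<in> borel_measurable (mset_power N (Suc k))"
      using fp[of q] by (simp cong: measurable_cong_sets del: mset_power.simps)
    show "(\<lambda>C. \<Sum>p\<in>#C. f p (add_mset q (C - {#p#}))) \<in> borel_measurable (mset_power N (Suc k))"
      using sm[OF fq[of q]] by (simp cong: measurable_cong_sets del: mset_power.simps)
  qed
  also have "\<dots> = (\<integral>\<^sup>+q. (\<integral>\<^sup>+C. f q C \<partial>mset_power N (Suc k)) +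
        of_nat (Suc k) * (\<integral>\<^sup>+p. \<integral>\<^sup>+C. f p (add_mset q C) \<partial>mset_power N k \<partial>N) \<partial>N)"
    using Suc.IH[OF fq] by simp
  also have "\<dots> = (\<integral>\<^sup>+q. \<integral>\<^sup>+C. f q C \<partial>mset_power N (Suc k) \<partial>N) +
        (\<integral>\<^sup>+q. of_nat (Suc k) * (\<integral>\<^sup>+p. \<integral>\<^sup>+C. f p (add_mset q C) \<partial>mset_power N k \<partial>N) \<partial>N)"
  proof (rule nn_integral_add)
    show "(\<lambda>q. \<integral>\<^sup>+C. f q C \<partial>mset_power N (Suc k)) \<in> borel_measurable N"
      by (rule borel_measurable_mset_power_integral[OF Suc.prems])
    show "(\<lambda>q. of_nat (Suc k) * (\<integral>\<^sup>+p. \<integral>\<^sup>+C. f p (add_mset q C) \<partial>mset_power N k \<partial>N)) \<in> borel_measurable N"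
      using borel_measurable_nn_integral[OF pq] by simp
  qed
  also have "(\<integral>\<^sup>+q. of_nat (Suc k) * (\<integral>\<^sup>+p. \<integral>\<^sup>+C. f p (add_mset q C) \<partial>mset_power N k \<partial>N) \<partial>N) =
     of_nat (Suc k) * (\<integral>\<^sup>+q. \<integral>\<^sup>+p. \<integral>\<^sup>+C. f p (add_mset q C) \<partial>mset_power N k \<partial>N \<partial>N)"
    using borel_measurable_nn_integral[OF pq] by (intro nn_integral_cmult) simp
  also have "(\<integral>\<^sup>+q. \<integral>\<^sup>+p. \<integral>\<^sup>+C. f p (add_mset q C) \<partial>mset_power N k \<partial>N \<partial>N) =
      (\<integral>\<^sup>+p. \<integral>\<^sup>+q. \<integral>\<^sup>+C. f p (add_mset q C) \<partial>mset_power N k \<partial>N \<partial>N)"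
    using NN.Fubini'[OF pq] by simp
  also have "\<dots> = (\<integral>\<^sup>+p. \<integral>\<^sup>+C. f p C \<partial>mset_power N (Suc k) \<partial>N)"
    by (intro nn_integral_cong mset_power_Suc[symmetric] fp)
  finally show ?case
    by (simp add: distrib_right)
qed

text \<open>
  If the values of \<open>\<mu>\<close> are almost surely distinct, exactly one of the \<open>k + 1\<close> points attains the
  minimum, and any of them is equally likely to do so. In the inductive step one point \<open>q\<close> is
  split off and the minimum \<open>q'\<close> of the others is compared with it.
\<close>

lemma mset_power_minimum:
  fixes \<mu> :: "'a \<Rightarrow> ereal"
  assumes \<mu>[measurable]: "\<mu> \<in> borel_measurable N"
    and null: "\<And>c. (\<integral>\<^sup>+p. indicator {p. \<mu> p = c} p \<partial>N) = 0"
    and F: "F \<in> borel_measurable (multiset_space N)"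
  shows "(\<integral>\<^sup>+C. indicator {C. \<forall>p\<in>#C. d < \<mu> p} C * F C \<partial>mset_power N (Suc k)) =
    of_nat (Suc k) * (\<integral>\<^sup>+q. indicator {q. d < \<mu> q} q *
      (\<integral>\<^sup>+C. indicator {C. \<forall>p\<in>#C. \<mu> q < \<mu> p} C * F (add_mset q C) \<partial>mset_power N k) \<partial>N)"
  using F
proof (induction k arbitrary: F d)
  case (0 F d)
  note 0[measurable]
  have ind: "indicator {C. \<forall>p\<in>#C. c < \<mu> p} \<in> borel_measurable (multiset_space N)" for c
  proof -
    have "Measurable.pred (multiset_space N) (\<lambda>C. \<forall>p\<in>#C. c < \<mu> p)"
      by (rule measurable_all_mset[OF space_full measurable_ident_sets[OF refl]]) simp
    then show ?thesis by (simp add: pred_def)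
  qed
  have "(\<integral>\<^sup>+C. indicator {C. \<forall>p\<in>#C. d < \<mu> p} (add_mset q C) * F (add_mset q C) \<partial>mset_power N 0) =
      indicator {q. d < \<mu> q} q * F {#q#}" for q
    using mset_power_0[OF measurable_add_point[OF borel_measurable_times_ennreal[OF ind 0]], of d q]
    by (simp add: indicator_def del: mset_power.simps)
  moreover have "(\<integral>\<^sup>+C. indicator {C. \<forall>p\<in>#C. \<mu> q < \<mu> p} C * F (add_mset q C) \<partial>mset_power N 0) = F {#q#}" for q
    using mset_power_0[OF borel_measurable_times_ennreal[OF ind measurable_add_point[OF 0]], of "\<mu> q" q]
    by (simp add: indicator_def del: mset_power.simps)
  ultimately show ?case
    unfolding mset_power_Suc[OF borel_measurable_times_ennreal[OF ind 0]] by (simp del: mset_power.simps)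
next
  case (Suc k F d)
  note Suc.prems[measurable]
  interpret NN: pair_sigma_finite N N by unfold_locales
  have all: "Measurable.pred (B \<Otimes>\<^sub>M multiset_space N) (\<lambda>z. \<forall>p\<in>#snd z. \<mu> (h (fst z)) < \<mu> p)"
    if [measurable]: "h \<in> B \<rightarrow>\<^sub>M N" for B :: "'b measure" and h
    by (rule measurable_all_mset[OF space_full]) measurable
  have ind: "indicator {C. \<forall>p\<in>#C. c < \<mu> p} \<in> borel_measurable (multiset_space N)" for c
  proof -
    have "Measurable.pred (multiset_space N) (\<lambda>C. \<forall>p\<in>#C. c < \<mu> p)"
      by (rule measurable_all_mset[OF space_full measurable_ident_sets[OF refl]]) simp
    then show ?thesis by (simp add: pred_def)
  qed
  define J where "J q q' = (\<integral>\<^sup>+C. indicator {C. \<forall>p\<in>#C. \<mu> q' < \<mu> p} C * F (add_mset q (add_mset q' C)) \<partial>mset_power N k)" for q q'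
  have Jsym: "J q q' = (\<integral>\<^sup>+C. indicator {C. \<forall>p\<in>#C. \<mu> q' < \<mu> p} C * F (add_mset q' (add_mset q C)) \<partial>mset_power N k)" for q q'
    by (simp add: J_def add_mset_commute)
  have J[measurable]: "(\<lambda>(q, q'). J q q') \<in> borel_measurable (N \<Otimes>\<^sub>M N)"
    unfolding J_def case_prod_unfold
  proof (rule borel_measurable_mset_power_integral)
    have [measurable]: "(\<lambda>z. add_mset (fst (fst z)) (add_mset (snd (fst z)) (snd z))) \<in> (N \<Otimes>\<^sub>M N) \<Otimes>\<^sub>M multiset_space N \<rightarrow>\<^sub>M multiset_space N"
      by (intro measurable_add_mset space_full) measurable
    have "Measurable.pred ((N \<Otimes>\<^sub>M N) \<Otimes>\<^sub>M multiset_space N) (\<lambda>z. \<forall>p\<in>#snd z. \<mu> (snd (fst z)) < \<mu> p)"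
      by (rule all) measurable
    then have [measurable]: "{z \<in> space ((N \<Otimes>\<^sub>M N) \<Otimes>\<^sub>M multiset_space N). \<forall>p\<in>#snd z. \<mu> (snd (fst z)) < \<mu> p} \<in> sets ((N \<Otimes>\<^sub>M N) \<Otimes>\<^sub>M multiset_space N)"
      by (simp add: pred_def)
    have "(\<lambda>z. indicator {z \<in> space ((N \<Otimes>\<^sub>M N) \<Otimes>\<^sub>M multiset_space N). \<forall>p\<in>#snd z. \<mu> (snd (fst z)) < \<mu> p} z *
        F (add_mset (fst (fst z)) (add_mset (snd (fst z)) (snd z)))) \<in> borel_measurable ((N \<Otimes>\<^sub>M N) \<Otimes>\<^sub>M multiset_space N)"
      by measurable
    then show "(\<lambda>(x, C). indicator {C. \<forall>p\<in>#C. \<mu> (snd x) < \<mu> p} C * F (add_mset (fst x) (add_mset (snd x) C)))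
        \<in> borel_measurable ((N \<Otimes>\<^sub>M N) \<Otimes>\<^sub>M multiset_space N)"
      by (simp add: case_prod_unfold indicator_def space_pair_measure space_full)
  qed
  let ?X = "\<integral>\<^sup>+q. indicator {q. d < \<mu> q} q *
      (\<integral>\<^sup>+C. indicator {C. \<forall>p\<in>#C. \<mu> q < \<mu> p} C * F (add_mset q C) \<partial>mset_power N (Suc k)) \<partial>N"
  have IH: "(\<integral>\<^sup>+C. indicator {C. \<forall>p\<in>#C. c < \<mu> p} C * F (add_mset q C) \<partial>mset_power N (Suc k)) =
      of_nat (Suc k) * (\<integral>\<^sup>+q'. indicator {q'. c < \<mu> q'} q' * J q q' \<partial>N)" for c q
    unfolding J_def by (rule Suc.IH[OF measurable_add_point[OF Suc.prems]])
  \<comment> \<open>In the case \<open>\<mu> q' < \<mu> q\<close> one of the \<open>k + 1\<close> points other than \<open>q\<close> is the overall minimum,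
    which gives \<open>k + 1\<close> of the \<open>k + 2\<close> copies of \<open>?X\<close>. In the case \<open>\<mu> q < \<mu> q'\<close> the minimum is
    \<open>q\<close>, which gives the last one.\<close>
  have A: "(\<integral>\<^sup>+q'. \<integral>\<^sup>+q. indicator {q'. d < \<mu> q'} q' * (indicator {q. \<mu> q' < \<mu> q} q * J q q') \<partial>N \<partial>N) = ?X"
  proof (rule nn_integral_cong)
    fix q' assume "q' \<in> space N"
    have [measurable]: "q' \<in> space N" by (simp add: space_full)
    have "(\<lambda>q. indicator {q. \<mu> q' < \<mu> q} q * J q q') \<in> borel_measurable N"
      by measurable
    then have "(\<integral>\<^sup>+q. indicator {q'. d < \<mu> q'} q' * (indicator {q. \<mu> q' < \<mu> q} q * J q q') \<partial>N) =
        indicator {q'. d < \<mu> q'} q' * (\<integral>\<^sup>+q. indicator {q. \<mu> q' < \<mu> q} q * J q q' \<partial>N)"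
      by (rule nn_integral_cmult)
    also have "(\<integral>\<^sup>+q. indicator {q. \<mu> q' < \<mu> q} q * J q q' \<partial>N) =
       (\<integral>\<^sup>+q. \<integral>\<^sup>+C. indicator {C. \<forall>p\<in>#C. \<mu> q' < \<mu> p} (add_mset q C) * F (add_mset q' (add_mset q C)) \<partial>mset_power N k \<partial>N)"
      unfolding Jsym by (intro nn_integral_cong) (auto simp: indicator_def)
    also have "\<dots> = (\<integral>\<^sup>+C. indicator {C. \<forall>p\<in>#C. \<mu> q' < \<mu> p} C * F (add_mset q' C) \<partial>mset_power N (Suc k))"
      by (rule mset_power_Suc[symmetric]) (intro borel_measurable_times_ennreal ind measurable_add_point Suc.prems)
    finally show "(\<integral>\<^sup>+q. indicator {q'. d < \<mu> q'} q' * (indicator {q. \<mu> q' < \<mu> q} q * J q q') \<partial>N) =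
      indicator {q. d < \<mu> q} q' * (\<integral>\<^sup>+C. indicator {C. \<forall>p\<in>#C. \<mu> q' < \<mu> p} C * F (add_mset q' C) \<partial>mset_power N (Suc k))" .
  qed
  have B: "of_nat (Suc k) * (\<integral>\<^sup>+q. indicator {q. d < \<mu> q} q * (\<integral>\<^sup>+q'. indicator {q'. \<mu> q < \<mu> q'} q' * J q q' \<partial>N) \<partial>N) = ?X"
    unfolding IH by (subst nn_integral_cmult[symmetric]) (measurable, auto simp: mult_ac)
  have "(\<integral>\<^sup>+C. indicator {C. \<forall>p\<in>#C. d < \<mu> p} C * F C \<partial>mset_power N (Suc (Suc k))) =
     (\<integral>\<^sup>+q. \<integral>\<^sup>+C. indicator {C. \<forall>p\<in>#C. d < \<mu> p} (add_mset q C) * F (add_mset q C) \<partial>mset_power N (Suc k) \<partial>N)"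
    by (rule mset_power_Suc) (intro borel_measurable_times_ennreal ind Suc.prems)
  also have "\<dots> = (\<integral>\<^sup>+q. indicator {q. d < \<mu> q} q * (\<integral>\<^sup>+C. indicator {C. \<forall>p\<in>#C. d < \<mu> p} C * F (add_mset q C) \<partial>mset_power N (Suc k)) \<partial>N)"
    by (intro nn_integral_cong) (auto simp: indicator_def)
  also have "\<dots> = (\<integral>\<^sup>+q. of_nat (Suc k) * (\<integral>\<^sup>+q'. indicator {q. d < \<mu> q} q * indicator {q'. d < \<mu> q'} q' * J q q' \<partial>N) \<partial>N)"
    unfolding IH by (intro nn_integral_cong) (auto simp: indicator_def)
  also have "\<dots> = of_nat (Suc k) * (\<integral>\<^sup>+q. \<integral>\<^sup>+q'. indicator {q. d < \<mu> q} q * indicator {q'. d < \<mu> q'} q' * J q q' \<partial>N \<partial>N)"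
    by (intro nn_integral_cmult) measurable
  also have "(\<integral>\<^sup>+q. \<integral>\<^sup>+q'. indicator {q. d < \<mu> q} q * indicator {q'. d < \<mu> q'} q' * J q q' \<partial>N \<partial>N) =
     (\<integral>\<^sup>+q. (\<integral>\<^sup>+q'. indicator {q'. d < \<mu> q'} q' * (indicator {q. \<mu> q' < \<mu> q} q * J q q') \<partial>N) +
       (\<integral>\<^sup>+q'. indicator {q. d < \<mu> q} q * (indicator {q'. \<mu> q < \<mu> q'} q' * J q q') \<partial>N) \<partial>N)"
  proof (intro nn_integral_cong)
    fix q assume [measurable]: "q \<in> space N"
    have "{p \<in> space N. \<mu> p = \<mu> q} \<in> sets N" by measurable
    then have "{p. \<mu> p = \<mu> q} \<in> sets N" by (simp add: space_full)
    then have "AE q' in N. \<mu> q' \<noteq> \<mu> q"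
      using null[of "\<mu> q"] by (intro AE_I[where N = "{p. \<mu> p = \<mu> q}"]) (auto simp: space_full)
    then have "(\<integral>\<^sup>+q'. indicator {q. d < \<mu> q} q * indicator {q'. d < \<mu> q'} q' * J q q' \<partial>N) =
      (\<integral>\<^sup>+q'. indicator {q'. d < \<mu> q'} q' * (indicator {q. \<mu> q' < \<mu> q} q * J q q') +
         indicator {q. d < \<mu> q} q * (indicator {q'. \<mu> q < \<mu> q'} q' * J q q') \<partial>N)"
      by (intro nn_integral_cong_AE) (auto elim!: eventually_mono simp: indicator_def)
    also have "\<dots> = (\<integral>\<^sup>+q'. indicator {q'. d < \<mu> q'} q' * (indicator {q. \<mu> q' < \<mu> q} q * J q q') \<partial>N) +
       (\<integral>\<^sup>+q'. indicator {q. d < \<mu> q} q * (indicator {q'. \<mu> q < \<mu> q'} q' * J q q') \<partial>N)"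
      by (intro nn_integral_add) measurable
    finally show "(\<integral>\<^sup>+q'. indicator {q. d < \<mu> q} q * indicator {q'. d < \<mu> q'} q' * J q q' \<partial>N) = \<dots>" .
  qed
  also have "\<dots> = (\<integral>\<^sup>+q. \<integral>\<^sup>+q'. indicator {q'. d < \<mu> q'} q' * (indicator {q. \<mu> q' < \<mu> q} q * J q q') \<partial>N \<partial>N) +
     (\<integral>\<^sup>+q. \<integral>\<^sup>+q'. indicator {q. d < \<mu> q} q * (indicator {q'. \<mu> q < \<mu> q'} q' * J q q') \<partial>N \<partial>N)"
    by (intro nn_integral_add) measurable
  also have "(\<integral>\<^sup>+q. \<integral>\<^sup>+q'. indicator {q'. d < \<mu> q'} q' * (indicator {q. \<mu> q' < \<mu> q} q * J q q') \<partial>N \<partial>N) = ?X"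
    unfolding A[symmetric] by (rule NN.Fubini'[symmetric]) measurable
  also have "(\<integral>\<^sup>+q. \<integral>\<^sup>+q'. indicator {q. d < \<mu> q} q * (indicator {q'. \<mu> q < \<mu> q'} q' * J q q') \<partial>N \<partial>N) =
      (\<integral>\<^sup>+q. indicator {q. d < \<mu> q} q * (\<integral>\<^sup>+q'. indicator {q'. \<mu> q < \<mu> q'} q' * J q q' \<partial>N) \<partial>N)"
    using space_full by (intro nn_integral_cong nn_integral_cmult) measurable
  finally show ?case
    using B by (simp add: distrib_left distrib_right)
qed

end

lemma mset_power_mono:
  assumes N: "finite_full_measure N" and N': "finite_full_measure N'" "sets N' = sets N"
    and le: "\<And>f. f \<in> borel_measurable N \<Longrightarrow> (\<integral>\<^sup>+p. f p \<partial>N) \<le> (\<integral>\<^sup>+p. f p \<partial>N')"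
    and F: "F \<in> borel_measurable (multiset_space N)"
  shows "(\<integral>\<^sup>+C. F C \<partial>mset_power N k) \<le> (\<integral>\<^sup>+C. F C \<partial>mset_power N' k :: ennreal)"
  using F
proof (induction k arbitrary: F)
  case (0 F)
  then show ?case
    using multiset_space_cong[OF N'(2)] by (simp add: nn_integral_return)
next
  case (Suc k F)
  interpret N: finite_full_measure N by fact
  interpret N': finite_full_measure N' by fact
  have m: "multiset_space N' = multiset_space N"
    by (rule multiset_space_cong) fact
  have add: "(\<lambda>(p, C). F (add_mset p C)) \<in> borel_measurable (N \<Otimes>\<^sub>M multiset_space N)"
    using measurable_compose[OF measurable_add_mset_pair[OF N.space_full refl] Suc.prems] by (simp add: case_prod_unfold)
  have "(\<integral>\<^sup>+C. F C \<partial>mset_power N (Suc k)) = (\<integral>\<^sup>+p. \<integral>\<^sup>+C. F (add_mset p C) \<partial>mset_power N k \<partial>N)"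
    by (rule N.mset_power_Suc) fact
  also have "\<dots> \<le> (\<integral>\<^sup>+p. \<integral>\<^sup>+C. F (add_mset p C) \<partial>mset_power N k \<partial>N')"
    by (rule le) (rule N.borel_measurable_mset_power_integral[OF add])
  also have "\<dots> \<le> (\<integral>\<^sup>+p. \<integral>\<^sup>+C. F (add_mset p C) \<partial>mset_power N' k \<partial>N')"
    by (intro nn_integral_mono Suc.IH N.measurable_add_point Suc.prems)
  also have "\<dots> = (\<integral>\<^sup>+C. F C \<partial>mset_power N' (Suc k))"
    by (rule N'.mset_power_Suc[symmetric]) (simp add: m Suc.prems)
  finally show ?case .
qed

lemma nn_integral_mset_power_scale:
  assumes N: "finite_full_measure N" and c: "c \<noteq> \<top>"
    and F: "F \<in> borel_measurable (multiset_space N)"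
  shows "(\<integral>\<^sup>+C. F C \<partial>mset_power (scale_measure c N) k) = c ^ k * (\<integral>\<^sup>+C. F C \<partial>mset_power N k)"
  using F
proof (induction k arbitrary: F)
  case (0 F)
  then show ?case
    using multiset_space_cong[of "scale_measure c N" N] by (simp add: nn_integral_return)
next
  case (Suc k F)
  interpret N: finite_full_measure N by fact
  have "emeasure (scale_measure c N) UNIV \<noteq> \<top>"
    using c N.emeasure_finite[of UNIV] by (simp add: ennreal_mult_eq_top_iff)
  then interpret N': finite_full_measure "scale_measure c N"
    by (intro finite_full_measure.intro finite_measureI finite_full_measure_axioms.intro)
       (simp_all add: space_scale_measure N.space_full)
  have m: "multiset_space (scale_measure c N) = multiset_space N"
    by (rule multiset_space_cong) simp
  have add: "(\<lambda>(p, C). F (add_mset p C)) \<in> borel_measurable (N \<Otimes>\<^sub>M multiset_space N)"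
    using measurable_compose[OF measurable_add_mset_pair[OF N.space_full refl] Suc.prems] by (simp add: case_prod_unfold)
  have I: "(\<lambda>p. \<integral>\<^sup>+C. F (add_mset p C) \<partial>mset_power N k) \<in> borel_measurable N"
    by (rule N.borel_measurable_mset_power_integral[OF add])
  have "(\<integral>\<^sup>+C. F C \<partial>mset_power (scale_measure c N) (Suc k)) =
      (\<integral>\<^sup>+p. \<integral>\<^sup>+C. F (add_mset p C) \<partial>mset_power (scale_measure c N) k \<partial>scale_measure c N)"
    by (rule N'.mset_power_Suc) (simp add: m Suc.prems)
  also have "\<dots> = (\<integral>\<^sup>+p. c ^ k * (\<integral>\<^sup>+C. F (add_mset p C) \<partial>mset_power N k) \<partial>scale_measure c N)"
    by (intro nn_integral_cong Suc.IH N.measurable_add_point Suc.prems)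
  also have "\<dots> = c * (\<integral>\<^sup>+p. c ^ k * (\<integral>\<^sup>+C. F (add_mset p C) \<partial>mset_power N k) \<partial>N)"
    using I by (intro nn_integral_scale_measure) auto
  also have "\<dots> = c ^ Suc k * (\<integral>\<^sup>+p. \<integral>\<^sup>+C. F (add_mset p C) \<partial>mset_power N k \<partial>N)"
    by (simp add: nn_integral_cmult[OF I] mult_ac)
  also have "(\<integral>\<^sup>+p. \<integral>\<^sup>+C. F (add_mset p C) \<partial>mset_power N k \<partial>N) = (\<integral>\<^sup>+C. F C \<partial>mset_power N (Suc k))"
    by (rule N.mset_power_Suc[symmetric]) fact
  finally show ?case .
qed

lemma subprob_mset_power:
  assumes "subprob_space N" "space N = UNIV"
  shows "subprob_space (mset_power N k)"
proof
  interpret subprob_space N by fact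
  interpret finite_full_measure N by unfold_locales fact
  have "emeasure (mset_power N k) (space (mset_power N k)) = emeasure N UNIV ^ k"
    using mset_power_mass[of k] by simp
  also have "\<dots> \<le> 1"
    using emeasure_space_le_1 by (simp add: assms(2) power_le_one_iff power_le_one)
  finally show "emeasure (mset_power N k) (space (mset_power N k)) \<le> 1" .
qed simp

lemma measurable_mset_power [measurable (raw)]:
  assumes N: "N \<in> B \<rightarrow>\<^sub>M subprob_algebra S" and S: "space S = UNIV"
  shows "(\<lambda>x. mset_power (N x) k) \<in> B \<rightarrow>\<^sub>M subprob_algebra (multiset_space S)"
proof (induction k)
  case 0
  have "(\<lambda>x. return (multiset_space S) {#}) \<in> B \<rightarrow>\<^sub>M subprob_algebra (multiset_space S)"
    by measurable
  then show ?case
  proof (rule measurable_cong[THEN iffD2, rotated])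
    fix x assume "x \<in> space B"
    then show "mset_power (N x) 0 = return (multiset_space S) {#}"
      using multiset_space_cong[OF sets_kernel[OF N]] by simp
  qed
next
  case (Suc k)
  have "(\<lambda>(x, z). add_mset (fst z) (snd z)) \<in> B \<Otimes>\<^sub>M (S \<Otimes>\<^sub>M multiset_space S) \<rightarrow>\<^sub>M multiset_space S"
    unfolding case_prod_unfold by (intro measurable_add_mset S) measurable
  then have "(\<lambda>x. distr (N x \<Otimes>\<^sub>M mset_power (N x) k) (multiset_space S) (\<lambda>z. add_mset (fst z) (snd z))) \<in> B \<rightarrow>\<^sub>M subprob_algebra (multiset_space S)"
    using measurable_pair_measure[OF N Suc] by (rule measurable_distr2)
  then show ?case
  proof (rule measurable_cong[THEN iffD2, rotated])
    fix x assume "x \<in> space B"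
    then show "mset_power (N x) (Suc k) = distr (N x \<Otimes>\<^sub>M mset_power (N x) k) (multiset_space S) (\<lambda>z. add_mset (fst z) (snd z))"
      using multiset_space_cong[OF sets_kernel[OF N]] by (simp add: case_prod_unfold)
  qed
qed

context finite_full_measure
begin

lemma measurable_points_PiM:
  "(\<lambda>c. image_mset c (mset_set {..<k})) \<in> PiM {..<k} (\<lambda>_. N) \<rightarrow>\<^sub>M multiset_space N"
proof (rule measurable_multiset_spaceI)
  fix X assume [measurable]: "X \<in> sets N"
  have "(\<lambda>c. \<Sum>i<k. indicator X (c i) :: ennreal) \<in> borel_measurable (PiM {..<k} (\<lambda>_. N))"
    by measurable
  then show "(\<lambda>c. \<Sum>p\<in>#image_mset c (mset_set {..<k}). indicator X p :: ennreal) \<in> borel_measurable (PiM {..<k} (\<lambda>_. N))"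
    by (simp add: image_mset.compositionality comp_def sum_unfold_sum_mset)
qed

lemma nn_integral_points_PiM:
  assumes F: "F \<in> borel_measurable (multiset_space N)"
  shows "(\<integral>\<^sup>+c. F (image_mset c (mset_set {..<k})) \<partial>PiM {..<k} (\<lambda>_. N)) = (\<integral>\<^sup>+C. F C \<partial>mset_power N k)"
  using F
proof (induction k arbitrary: F)
  interpret product_sigma_finite "\<lambda>_::nat. N"
    by unfold_locales
  {
    case (0 F)
    then show ?case
      using mset_power_0[OF 0] by (simp add: PiM_empty nn_integral_count_space_finite del: mset_power.simps)
  next
    case (Suc k F)
    have ins: "{..<Suc k} = insert k {..<k}" by auto
    have upd: "image_mset (c(k := y)) (mset_set (insert k {..<k})) = add_mset y (image_mset c (mset_set {..<k}))" for c :: "nat \<Rightarrow> 'a" and y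
    proof -
      have "image_mset (c(k := y)) (mset_set {..<k}) = image_mset c (mset_set {..<k})"
        by (rule image_mset_cong) auto
      then show ?thesis by simp
    qed
    have "(\<integral>\<^sup>+c. F (image_mset c (mset_set {..<Suc k})) \<partial>PiM {..<Suc k} (\<lambda>_. N)) =
        (\<integral>\<^sup>+y. \<integral>\<^sup>+c. F (image_mset (c(k := y)) (mset_set (insert k {..<k}))) \<partial>PiM {..<k} (\<lambda>_. N) \<partial>N)"
      unfolding ins
      by (rule product_nn_integral_insert_rev) (use measurable_compose[OF measurable_points_PiM Suc.prems, of "Suc k"] in \<open>auto simp: ins\<close>)
    also have "\<dots> = (\<integral>\<^sup>+y. \<integral>\<^sup>+C. F (add_mset y C) \<partial>mset_power N k \<partial>N)"
      unfolding upd by (intro nn_integral_cong Suc.IH measurable_add_point Suc.prems)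
    also have "\<dots> = (\<integral>\<^sup>+C. F C \<partial>mset_power N (Suc k))"
      by (rule mset_power_Suc[symmetric]) fact
    finally show ?case .
  }
qed

end

lemma suminf_split_head_ennreal: "(\<Sum>k. f k :: ennreal) = f 0 + (\<Sum>k. f (Suc k))"
  using suminf_offset[of f 1] by (simp add: add.commute summableI)

text \<open>
  The expectation of \<open>F\<close> over a Poisson configuration of intensity \<open>N\<close>, multiplied by
  \<open>exp (N(UNIV))\<close>. Without the normalisation the formulas below have no exponential factors.
\<close>

definition poisson_int :: "'a measure \<Rightarrow> ('a multiset \<Rightarrow> ennreal) \<Rightarrow> ennreal" where
  "poisson_int N F = (\<Sum>k. ennreal (1 / fact k) * (\<integral>\<^sup>+C. F C \<partial>mset_power N k))"

lemma poisson_int_transform: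
  assumes N: "finite_full_measure N" and N': "finite_full_measure N'"
    and r: "r \<in> N \<rightarrow>\<^sub>M N'" and g: "g \<in> borel_measurable N"
    and G: "G \<in> borel_measurable (multiset_space N)" "G {#} = 1" "\<And>p C. G (add_mset p C) = g p * G C"
    and eq: "\<And>f. f \<in> borel_measurable N' \<Longrightarrow> (\<And>p. p \<notin> S \<Longrightarrow> f p = 0) \<Longrightarrow>
      (\<integral>\<^sup>+p. f p \<partial>N') = (\<integral>\<^sup>+p. g p * f (r p) \<partial>N)"
    and F: "F \<in> borel_measurable (multiset_space N')" "\<And>C. \<not> set_mset C \<subseteq> S \<Longrightarrow> F C = 0"
  shows "poisson_int N' F = poisson_int N (\<lambda>C. G C * F (image_mset r C))"
proof -
  have "(\<integral>\<^sup>+C. F C \<partial>mset_power N' k) = (\<integral>\<^sup>+C. G C * F (image_mset r C) \<partial>mset_power N k)" for k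
    by (rule mset_power_transform[where S = S, OF N N' r g G(1,2)]) (simp_all add: G(3) eq F del: mset_power.simps)
  then show ?thesis
    by (simp only: poisson_int_def)
qed

lemma poisson_int_SUP:
  fixes L :: "nat \<Rightarrow> 'a measure"
  assumes N: "finite_full_measure N" and L: "\<And>n. finite_full_measure (L n)" "\<And>n. sets (L n) = sets N"
    and inc: "\<And>f. f \<in> borel_measurable N \<Longrightarrow> incseq (\<lambda>n. \<integral>\<^sup>+p. f p \<partial>L n)"
    and sup: "\<And>f. f \<in> borel_measurable N \<Longrightarrow> (\<integral>\<^sup>+p. f p \<partial>N) = (SUP n. \<integral>\<^sup>+p. f p \<partial>L n)"
    and F: "F \<in> borel_measurable (multiset_space N)"
  shows "poisson_int N F = (SUP n. poisson_int (L n) F)"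
proof -
  have *: "incseq (\<lambda>n. \<integral>\<^sup>+C. F C \<partial>mset_power (L n) k) \<and>
      (\<integral>\<^sup>+C. F C \<partial>mset_power N k) = (SUP n. \<integral>\<^sup>+C. F C \<partial>mset_power (L n) k)" for k
    by (rule mset_power_SUP[OF N L]) (simp_all add: inc sup F)
  have "poisson_int N F = (\<Sum>k. SUP n. ennreal (1 / fact k) * (\<integral>\<^sup>+C. F C \<partial>mset_power (L n) k))"
    unfolding poisson_int_def conjunct2[OF *] by (simp only: SUP_mult_left_ennreal)
  also have "\<dots> = (SUP n. poisson_int (L n) F)"
    unfolding poisson_int_def
  proof (rule ennreal_suminf_SUP_eq)
    show "incseq (\<lambda>n. ennreal (1 / fact k) * (\<integral>\<^sup>+C. F C \<partial>mset_power (L n) k))" for k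
      using *[of k] by (auto simp: incseq_def intro!: mult_left_mono)
  qed
  finally show ?thesis .
qed

lemma poisson_int_mono:
  assumes N: "finite_full_measure N" and N': "finite_full_measure N'" "sets N' = sets N"
    and le: "\<And>f. f \<in> borel_measurable N \<Longrightarrow> (\<integral>\<^sup>+p. f p \<partial>N) \<le> (\<integral>\<^sup>+p. f p \<partial>N')"
    and F: "F \<in> borel_measurable (multiset_space N)"
  shows "poisson_int N F \<le> poisson_int N' F"
  unfolding poisson_int_def
  by (intro suminf_le mult_left_mono mset_power_mono assms summableI) auto

context finite_full_measure
begin

lemma poisson_int_Mecke:
  assumes f: "(\<lambda>(p, C). f p C :: ennreal) \<in> borel_measurable (N \<Otimes>\<^sub>M multiset_space N)"
  shows "poisson_int N (\<lambda>C. \<Sum>p\<in>#C. f p (C - {#p#})) = (\<integral>\<^sup>+p. poisson_int N (f p) \<partial>N)"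
proof -
  have sm: "(\<lambda>C. \<Sum>p\<in>#C. f p (C - {#p#})) \<in> borel_measurable (multiset_space N)"
    using borel_measurable_sum_mset_remove[OF space_full measurable_ident, of "\<lambda>_. f"] f
    by (simp add: case_prod_unfold)
  have fp: "(\<lambda>p. \<integral>\<^sup>+C. f p C \<partial>mset_power N k) \<in> borel_measurable N" for k
    by (rule borel_measurable_mset_power_integral) fact
  have "poisson_int N (\<lambda>C. \<Sum>p\<in>#C. f p (C - {#p#})) =
     (\<Sum>k. ennreal (1 / fact (Suc k)) * (\<integral>\<^sup>+C. (\<Sum>p\<in>#C. f p (C - {#p#})) \<partial>mset_power N (Suc k)))"
    unfolding poisson_int_def
    by (subst suminf_split_head_ennreal) (simp only: mset_power_0[OF sm], simp)
  also have "\<dots> = (\<Sum>k. \<integral>\<^sup>+p. ennreal (1 / fact k) * (\<integral>\<^sup>+C. f p C \<partial>mset_power N k) \<partial>N)"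
  proof (rule suminf_cong)
    fix k
    have "ennreal (1 / fact (Suc k)) * of_nat (Suc k) = ennreal (1 / fact k)"
      by (simp add: ennreal_of_nat_eq_real_of_nat ennreal_mult[symmetric] del: of_nat_Suc)
    then show "ennreal (1 / fact (Suc k)) * (\<integral>\<^sup>+C. (\<Sum>p\<in>#C. f p (C - {#p#})) \<partial>mset_power N (Suc k)) =
      (\<integral>\<^sup>+p. ennreal (1 / fact k) * (\<integral>\<^sup>+C. f p C \<partial>mset_power N k) \<partial>N)"
      unfolding mset_power_Mecke[OF f] nn_integral_cmult[OF fp] mult.assoc[symmetric] by simp
  qed
  also have "\<dots> = (\<integral>\<^sup>+p. poisson_int N (f p) \<partial>N)"
    unfolding poisson_int_def using fp by (intro nn_integral_suminf[symmetric]) auto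
  finally show ?thesis .
qed

text \<open>
  Decomposition of a Poisson configuration according to its point of minimal \<open>\<mu>\<close>, if any.
\<close>

lemma poisson_int_minimum:
  fixes \<mu> :: "'a \<Rightarrow> ereal"
  assumes \<mu>[measurable]: "\<mu> \<in> borel_measurable N" and \<mu>_inf: "\<And>p. \<mu> p \<noteq> -\<infinity>"
    and null: "\<And>c. (\<integral>\<^sup>+p. indicator {p. \<mu> p = c} p \<partial>N) = 0"
    and F: "F \<in> borel_measurable (multiset_space N)"
  shows "poisson_int N F = F {#} + (\<integral>\<^sup>+q. poisson_int N (\<lambda>C. indicator {C. \<forall>p\<in>#C. \<mu> q < \<mu> p} C * F (add_mset q C)) \<partial>N)"
proof -
  let ?J = "\<lambda>k q. \<integral>\<^sup>+C. indicator {C. \<forall>p\<in>#C. \<mu> q < \<mu> p} C * F (add_mset q C) \<partial>mset_power N k"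
  have J: "?J k \<in> borel_measurable N" for k
  proof (rule borel_measurable_mset_power_integral)
    have [measurable]: "(\<lambda>z. F (add_mset (fst z) (snd z))) \<in> borel_measurable (N \<Otimes>\<^sub>M multiset_space N)"
      using measurable_compose[OF measurable_add_mset_pair[OF space_full refl] F] by (simp add: case_prod_unfold)
    have "Measurable.pred (N \<Otimes>\<^sub>M multiset_space N) (\<lambda>z. \<forall>p\<in>#snd z. \<mu> (fst z) < \<mu> p)"
      by (rule measurable_all_mset[OF space_full]) measurable
    then have [measurable]: "{z \<in> space (N \<Otimes>\<^sub>M multiset_space N). \<forall>p\<in>#snd z. \<mu> (fst z) < \<mu> p} \<in> sets (N \<Otimes>\<^sub>M multiset_space N)"
      by (simp add: pred_def)
    have "(\<lambda>z. indicator {z \<in> space (N \<Otimes>\<^sub>M multiset_space N). \<forall>p\<in>#snd z. \<mu> (fst z) < \<mu> p} z *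
        F (add_mset (fst z) (snd z))) \<in> borel_measurable (N \<Otimes>\<^sub>M multiset_space N)"
      by measurable
    then show "(\<lambda>(q, C). indicator {C. \<forall>p\<in>#C. \<mu> q < \<mu> p} C * F (add_mset q C)) \<in> borel_measurable (N \<Otimes>\<^sub>M multiset_space N)"
      by (simp add: case_prod_unfold indicator_def space_pair_measure space_full)
  qed
  have min: "(\<integral>\<^sup>+C. F C \<partial>mset_power N (Suc k)) = of_nat (Suc k) * (\<integral>\<^sup>+q. ?J k q \<partial>N)" for k
  proof -
    have "-\<infinity> < \<mu> p" for p
      using \<mu>_inf[of p] by (cases "\<mu> p") auto
    then show ?thesis
      using mset_power_minimum[OF \<mu> null F, where d = "-\<infinity>" and k = k] by (simp del: mset_power.simps)
  qed
  have "poisson_int N F = F {#} + (\<Sum>k. ennreal (1 / fact (Suc k)) * (\<integral>\<^sup>+C. F C \<partial>mset_power N (Suc k)))"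
    unfolding poisson_int_def
    by (subst suminf_split_head_ennreal) (simp only: mset_power_0[OF F], simp del: mset_power.simps)
  also have "(\<Sum>k. ennreal (1 / fact (Suc k)) * (\<integral>\<^sup>+C. F C \<partial>mset_power N (Suc k))) =
     (\<Sum>k. \<integral>\<^sup>+q. ennreal (1 / fact k) * ?J k q \<partial>N)"
  proof (rule suminf_cong)
    fix k
    have "ennreal (1 / fact (Suc k)) * of_nat (Suc k) = ennreal (1 / fact k)"
      by (simp add: ennreal_of_nat_eq_real_of_nat ennreal_mult[symmetric] del: of_nat_Suc)
    then show "ennreal (1 / fact (Suc k)) * (\<integral>\<^sup>+C. F C \<partial>mset_power N (Suc k)) = (\<integral>\<^sup>+q. ennreal (1 / fact k) * ?J k q \<partial>N)"
      unfolding min nn_integral_cmult[OF J] mult.assoc[symmetric] by simp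
  qed
  also have "\<dots> = (\<integral>\<^sup>+q. poisson_int N (\<lambda>C. indicator {C. \<forall>p\<in>#C. \<mu> q < \<mu> p} C * F (add_mset q C)) \<partial>N)"
    unfolding poisson_int_def using J by (intro nn_integral_suminf[symmetric]) auto
  finally show ?thesis .
qed

lemma poisson_int_1: "poisson_int N (\<lambda>_. 1) = ennreal (exp (measure N UNIV))"
proof -
  have "(\<lambda>k. measure N UNIV ^ k /\<^sub>R fact k) sums exp (measure N UNIV)"
    by (rule exp_converges)
  then have "(\<Sum>k. ennreal (measure N UNIV ^ k /\<^sub>R fact k)) = ennreal (exp (measure N UNIV))"
    by (intro suminf_ennreal_eq) auto
  moreover have "ennreal (1 / fact k) * emeasure N UNIV ^ k = ennreal (measure N UNIV ^ k /\<^sub>R fact k)" for k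
    by (simp add: emeasure_eq_measure ennreal_power ennreal_mult[symmetric] divide_inverse)
  ultimately show ?thesis
    unfolding poisson_int_def mset_power_mass by simp
qed

lemma poisson_int_cmult:
  assumes "F \<in> borel_measurable (multiset_space N)"
  shows "poisson_int N (\<lambda>C. c * F C) = c * poisson_int N F"
  unfolding poisson_int_def using assms by (simp add: nn_integral_cmult mult_ac cong: measurable_cong_sets)

lemma poisson_int_add:
  assumes "F \<in> borel_measurable (multiset_space N)" "G \<in> borel_measurable (multiset_space N)"
  shows "poisson_int N (\<lambda>C. F C + G C) = poisson_int N F + poisson_int N G"
  unfolding poisson_int_def using assms
  by (simp add: nn_integral_add distrib_left cong: measurable_cong_sets) (simp add: suminf_add)

lemma borel_measurable_poisson_int:
  assumes "(\<lambda>(x, C). F x C :: ennreal) \<in> borel_measurable (B \<Otimes>\<^sub>M multiset_space N)"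
  shows "(\<lambda>x. poisson_int N (F x)) \<in> borel_measurable B"
  unfolding poisson_int_def
  using borel_measurable_mset_power_integral[OF assms] by measurable

lemma poisson_int_nn_integral:
  assumes "sigma_finite_measure B"
    and "(\<lambda>(x, C). F x C :: ennreal) \<in> borel_measurable (B \<Otimes>\<^sub>M multiset_space N)"
  shows "poisson_int N (\<lambda>C. \<integral>\<^sup>+x. F x C \<partial>B) = (\<integral>\<^sup>+x. poisson_int N (F x) \<partial>B)"
proof -
  have "(\<integral>\<^sup>+C. \<integral>\<^sup>+x. F x C \<partial>B \<partial>mset_power N k) = (\<integral>\<^sup>+x. \<integral>\<^sup>+C. F x C \<partial>mset_power N k \<partial>B)" for k
  proof -
    interpret B: sigma_finite_measure B by fact
    interpret L: sigma_finite_measure "mset_power N k" by (rule sigma_finite_mset_power)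
    interpret P: pair_sigma_finite B "mset_power N k" by unfold_locales
    have "(\<lambda>(x, C). F x C) \<in> borel_measurable (B \<Otimes>\<^sub>M mset_power N k)"
      using assms(2) by (simp cong: measurable_cong_sets)
    from P.Fubini'[OF this] show ?thesis by simp
  qed
  then show ?thesis
    unfolding poisson_int_def using borel_measurable_mset_power_integral[OF assms(2)]
    by (subst nn_integral_suminf) (auto simp: nn_integral_cmult)
qed

end

section \<open>Offspring of a vertex\<close>

definition child_density :: "real \<Rightarrow> real \<Rightarrow> real" where
  "child_density x a = 1 / 2 * sech ((a + x) / 2) ^ 2"

lemma sech_squared: "sech u ^ 2 = 1 - tanh u ^ 2"
proof -
  have "cosh u ^ 2 \<noteq> 0" by simp
  then show ?thesis
    using hyperbolic_pythagoras[of u] by (simp add: sech_def tanh_def power_divide divide_simps)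
qed

lemma sech_pos [simp]: "0 < sech u"
  by (simp add: sech_def)

lemma measurable_sech [measurable]: "sech \<in> borel_measurable borel"
  unfolding sech_def by (intro borel_measurable_continuous_onI continuous_intros) auto

lemma measurable_child_density [measurable]: "child_density x \<in> borel_measurable borel"
  unfolding child_density_def by measurable

lemma child_density_nonneg [simp]: "0 \<le> child_density x a"
  by (simp add: child_density_def)

lemma child_density_eq: "child_density x a = (1 - tanh ((a + x) / 2) ^ 2) / 2"
  by (simp add: child_density_def sech_squared)

lemma nn_integral_child_density:
  "(\<integral>\<^sup>+a. ennreal (child_density x a) * indicator {e..} a \<partial>lborel) = ennreal (1 - tanh ((e + x) / 2))"
proof (rule nn_integral_FTC_atLeast)
  show "((\<lambda>a. tanh ((a + x) / 2)) has_real_derivative child_density x a) (at a)" if "e \<le> a" for a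
    unfolding child_density_eq by (auto intro!: derivative_eq_intros simp: field_simps)
  show "((\<lambda>a. tanh ((a + x) / 2)) \<longlongrightarrow> 1) at_top"
  proof (rule filterlim_compose[OF tanh_real_at_top])
    show "filterlim (\<lambda>a. (a + x) / 2) at_top at_top"
      unfolding filterlim_at_top
    proof
      fix Z :: real
      show "\<forall>\<^sub>F a in at_top. Z \<le> (a + x) / 2"
        by (rule eventually_at_top_linorderI[of "2 * Z - x"]) (simp add: field_simps)
    qed
  qed
qed auto

lemma sets_child_intensity [simp, measurable_cong]: "sets (child_intensity x b) = sets borel"
  by (simp add: child_intensity_def)

lemma space_child_intensity [simp]: "space (child_intensity x b) = UNIV"
  by (simp add: child_intensity_def)

lemma nn_integral_child_intensity:
  assumes [measurable]: "f \<in> borel_measurable borel"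
  shows "(\<integral>\<^sup>+a. f a \<partial>child_intensity x b) = (\<integral>\<^sup>+a. ennreal (indicator {0..} a * (min b a * child_density x a)) * f a \<partial>lborel)"
  unfolding child_intensity_def child_density_def[symmetric] by (rule nn_integral_density) measurable

definition child_mass :: "real \<Rightarrow> real \<Rightarrow> ennreal" where
  "child_mass x b = emeasure (child_intensity x b) UNIV"

lemma child_mass_eq: "child_mass x b = (\<integral>\<^sup>+a. ennreal (indicator {0..} a * (min b a * child_density x a)) \<partial>lborel)"
  using nn_integral_child_intensity[of "\<lambda>_. 1" x b] by (simp add: child_mass_def)

lemma child_mass_finite: "child_mass x b < \<top>"
proof -
  have "child_mass x b \<le> (\<integral>\<^sup>+a. ennreal \<bar>b\<bar> * (ennreal (child_density x a) * indicator {0..} a) \<partial>lborel)"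
    unfolding child_mass_eq
    by (intro nn_integral_mono) (auto simp: indicator_def ennreal_mult[symmetric] intro!: ennreal_leI mult_right_mono)
  also have "\<dots> = ennreal \<bar>b\<bar> * ennreal (1 - tanh ((0 + x) / 2))"
    by (subst nn_integral_cmult) (auto simp: nn_integral_child_density)
  also have "\<dots> < \<top>" by (simp add: ennreal_mult_less_top)
  finally show ?thesis .
qed

lemma child_mass_measure: "child_mass x b = ennreal (measure (child_intensity x b) UNIV)"
  using child_mass_finite[of x b] by (simp add: child_mass_def emeasure_eq_ennreal_measure less_top)

lemma measurable_child_mass [measurable]: "child_mass x \<in> borel_measurable borel"
  unfolding child_mass_eq by measurable

lemma measurable_child_measure [measurable]: "(\<lambda>b. measure (child_intensity x b) UNIV) \<in> borel_measurable borel"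
proof -
  have "(\<lambda>b. measure (child_intensity x b) UNIV) = (\<lambda>b. enn2real (child_mass x b))"
    by (simp add: child_mass_measure)
  then show ?thesis by simp
qed

lemma measurable_child_age [measurable]:
  "(\<lambda>b. uniform_measure (child_intensity x b) UNIV) \<in> borel \<rightarrow>\<^sub>M subprob_algebra borel"
proof (rule measurable_subprob_algebra)
  fix b
  have "emeasure (uniform_measure (child_intensity x b) UNIV) UNIV = child_mass x b / child_mass x b"
    by (simp add: child_mass_def)
  also have "\<dots> \<le> 1"
    using child_mass_finite[of x b] by (cases "child_mass x b = 0") (simp_all add: less_top[symmetric])
  finally show "subprob_space (uniform_measure (child_intensity x b) UNIV)"
    by (intro subprob_spaceI) auto
next
  fix A :: "real set" assume [measurable]: "A \<in> sets borel"
  have "emeasure (uniform_measure (child_intensity x b) UNIV) A =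
     (\<integral>\<^sup>+a. ennreal (indicator {0..} a * (min b a * child_density x a)) * indicator A a \<partial>lborel) / child_mass x b" for b
    using nn_integral_child_intensity[of "indicator A" x b] by (simp add: child_mass_def)
  then show "(\<lambda>b. emeasure (uniform_measure (child_intensity x b) UNIV) A) \<in> borel_measurable borel"
    by simp
qed simp

lemma measurable_edge_age [measurable]:
  "(\<lambda>z. uniform_measure lborel {0..min (fst z) (snd z)}) \<in> borel \<Otimes>\<^sub>M borel \<rightarrow>\<^sub>M subprob_algebra (borel :: real measure)"
proof (rule measurable_subprob_algebra)
  fix z :: "real \<times> real"
  have "emeasure (uniform_measure lborel {0..min (fst z) (snd z)}) UNIV =
      emeasure lborel {0..min (fst z) (snd z)} / emeasure lborel {0..min (fst z) (snd z)}"
    by simp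
  also have "\<dots> \<le> 1"
    by (cases "emeasure lborel {0..min (fst z) (snd z)} = 0") (simp_all add: emeasure_lborel_Icc_eq ennreal_divide_self)
  finally show "subprob_space (uniform_measure lborel {0..min (fst z) (snd z)})"
    by (intro subprob_spaceI) auto
next
  fix A :: "real set" assume [measurable]: "A \<in> sets borel"
  have eq: "emeasure (uniform_measure lborel {0..min (fst z) (snd z)}) A =
     (\<integral>\<^sup>+e. indicator {e. 0 \<le> e \<and> e \<le> fst z \<and> e \<le> snd z} e * indicator A e \<partial>lborel) / emeasure lborel {0..min (fst z) (snd z)}" for z
  proof -
    have "emeasure lborel ({0..min (fst z) (snd z)} \<inter> A) = (\<integral>\<^sup>+e. indicator ({0..min (fst z) (snd z)} \<inter> A) e \<partial>lborel)"
      by simp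
    also have "\<dots> = (\<integral>\<^sup>+e. indicator {e. 0 \<le> e \<and> e \<le> fst z \<and> e \<le> snd z} e * indicator A e \<partial>lborel)"
      by (intro nn_integral_cong) (auto simp: indicator_def)
    finally show ?thesis by simp
  qed
  have m: "(\<lambda>z. (\<integral>\<^sup>+e. indicator {e. 0 \<le> e \<and> e \<le> fst z \<and> e \<le> snd z} e * indicator A e \<partial>lborel) / emeasure lborel {0..min (fst z) (snd z)})
      \<in> borel_measurable (borel \<Otimes>\<^sub>M borel)"
  proof -
    have [measurable]: "(\<lambda>(z, e). indicator {e. 0 \<le> e \<and> e \<le> fst z \<and> e \<le> snd z} e * indicator A e :: ennreal) \<in> borel_measurable ((borel \<Otimes>\<^sub>M borel) \<Otimes>\<^sub>M lborel)"
      unfolding indicator_def by measurable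
    show ?thesis
      unfolding emeasure_lborel_Icc_eq by measurable
  qed
  show "(\<lambda>z. emeasure (uniform_measure lborel {0..min (fst z) (snd z)}) A) \<in> borel_measurable (borel \<Otimes>\<^sub>M borel)"
    unfolding eq by (rule m)
qed simp

definition offspring_law :: "real \<Rightarrow> (real \<Rightarrow> aged_tree measure) \<Rightarrow> real \<Rightarrow> (real \<times> aged_tree) measure" where
  "offspring_law x K b = do {
     a \<leftarrow> uniform_measure (child_intensity x b) UNIV;
     e \<leftarrow> uniform_measure lborel {0..min b a};
     T \<leftarrow> K a;
     return edge_space (e, T) }"

context
  fixes K :: "real \<Rightarrow> aged_tree measure"
  assumes K [measurable]: "K \<in> borel \<rightarrow>\<^sub>M subprob_algebra tree_space"
begin

lemma measurable_offspring_law [measurable]: "offspring_law x K \<in> borel \<rightarrow>\<^sub>M subprob_algebra edge_space"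
  unfolding offspring_law_def by measurable

lemma sets_offspring_law: "sets (offspring_law x K b) = sets edge_space"
  by (rule sets_kernel[OF measurable_offspring_law]) simp

lemma space_offspring_law: "space (offspring_law x K b) = UNIV"
  using sets_eq_imp_space_eq[OF sets_offspring_law, of x b] by (simp only: space_edge_space)

lemma nn_integral_offspring_law:
  assumes [measurable]: "f \<in> borel_measurable edge_space"
  shows "(\<integral>\<^sup>+p. f p \<partial>offspring_law x K b) =
    (\<integral>\<^sup>+a. \<integral>\<^sup>+e. \<integral>\<^sup>+T. f (e, T) \<partial>K a \<partial>uniform_measure lborel {0..min b a} \<partial>uniform_measure (child_intensity x b) UNIV)"
proof -
  have [simp]: "sets (K a) = sets tree_space" for a
    by (rule sets_kernel[OF K]) simp
  have [measurable]: "(\<lambda>a. uniform_measure lborel {0..min b a}) \<in> borel \<rightarrow>\<^sub>M subprob_algebra (borel :: real measure)"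
    using measurable_compose[OF measurable_Pair[OF measurable_const measurable_ident_sets[OF refl]] measurable_edge_age] by simp
  have c: "sets (uniform_measure (child_intensity x b) UNIV) = sets borel" "sets (uniform_measure lborel {0..min b a}) = sets (borel :: real measure)" for a
    by simp_all
  note [measurable_cong] = c
  have 1: "(\<lambda>T. return edge_space (e, T)) \<in> tree_space \<rightarrow>\<^sub>M subprob_algebra edge_space" for e :: real
    by measurable
  then have kk1: "(\<lambda>T. return edge_space (e, T)) \<in> K a \<rightarrow>\<^sub>M subprob_algebra edge_space" for a e
    by (simp cong: measurable_cong_sets)
  have 2: "(\<lambda>e. K a \<bind> (\<lambda>T. return edge_space (e, T))) \<in> borel \<rightarrow>\<^sub>M subprob_algebra edge_space" for a
    by (rule measurable_bind[where N = tree_space]) measurable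
  then have kk2: "(\<lambda>e. K a \<bind> (\<lambda>T. return edge_space (e, T))) \<in> uniform_measure lborel {0..min b a} \<rightarrow>\<^sub>M subprob_algebra edge_space" for a
    by (simp cong: measurable_cong_sets)
  have "(\<lambda>a. uniform_measure lborel {0..min b a} \<bind> (\<lambda>e. K a \<bind> (\<lambda>T. return edge_space (e, T)))) \<in> borel \<rightarrow>\<^sub>M subprob_algebra edge_space"
  proof (rule measurable_bind[where N = borel])
    show "(\<lambda>z. K (fst z) \<bind> (\<lambda>T. return edge_space (snd z, T))) \<in> borel \<Otimes>\<^sub>M (borel :: real measure) \<rightarrow>\<^sub>M subprob_algebra edge_space"
      by (rule measurable_bind[where N = tree_space]) measurable
  qed measurable
  then have kk3: "(\<lambda>a. uniform_measure lborel {0..min b a} \<bind> (\<lambda>e. K a \<bind> (\<lambda>T. return edge_space (e, T)))) \<in>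
      uniform_measure (child_intensity x b) UNIV \<rightarrow>\<^sub>M subprob_algebra edge_space"
    by (simp cong: measurable_cong_sets)
  show ?thesis
    unfolding offspring_law_def
    unfolding nn_integral_bind[OF assms kk3] nn_integral_bind[OF assms kk2] nn_integral_bind[OF assms kk1]
    by (simp add: nn_integral_return space_pair_measure)
qed

end

definition offspring_intensity :: "real \<Rightarrow> (real \<Rightarrow> aged_tree measure) \<Rightarrow> real \<Rightarrow> (real \<times> aged_tree) measure" where
  "offspring_intensity x K b = scale_measure (child_mass x b) (offspring_law x K b)"

lemma ennreal_mult_divide_cancel: "0 < c \<Longrightarrow> 0 \<le> d \<Longrightarrow> ennreal (c * d) * (Y / ennreal c) = ennreal d * Y"
proof -
  assume *: "0 < c" "0 \<le> d"
  then have "ennreal c * inverse (ennreal c) = 1"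
    by (simp add: inverse_ennreal ennreal_mult[symmetric])
  moreover have "ennreal (c * d) * (Y / ennreal c) = ennreal c * inverse (ennreal c) * (ennreal d * Y)"
    using * by (simp add: ennreal_mult divide_ennreal_def mult_ac)
  ultimately show ?thesis by simp
qed

context
  fixes K :: "real \<Rightarrow> aged_tree measure"
  assumes K [measurable]: "K \<in> borel \<rightarrow>\<^sub>M subprob_algebra tree_space"
begin

lemma measurable_edge_integral:
  assumes f: "(\<lambda>(z, T). f z T :: ennreal) \<in> borel_measurable ((borel \<Otimes>\<^sub>M borel) \<Otimes>\<^sub>M tree_space)"
  shows "(\<lambda>(a, e). \<integral>\<^sup>+T. f (a, e) T \<partial>K a) \<in> borel_measurable (borel \<Otimes>\<^sub>M (borel :: real measure))"
proof -
  have "(\<lambda>z. \<integral>\<^sup>+T. f z T \<partial>K (fst z)) \<in> borel_measurable (borel \<Otimes>\<^sub>M (borel :: real measure))"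
    by (rule nn_integral_measurable_subprob_algebra2[OF f]) measurable
  then show ?thesis by (simp add: case_prod_unfold)
qed

text \<open>
  The factor \<open>min b a\<close> of the intensity of ages cancels against the uniform density of the edge
  age on \<open>[0, min b a]\<close>. This makes the density of a tree a product over vertices and edges.
\<close>

lemma nn_integral_offspring_intensity:
  assumes f[measurable]: "f \<in> borel_measurable edge_space"
  shows "(\<integral>\<^sup>+p. f p \<partial>offspring_intensity x K b) =
    (\<integral>\<^sup>+a. ennreal (child_density x a) * indicator {0..} a *
       (\<integral>\<^sup>+e. indicator {0..min b a} e * (\<integral>\<^sup>+T. f (e, T) \<partial>K a) \<partial>lborel) \<partial>lborel)"
proof -
  define h where "h a e = (\<integral>\<^sup>+T. f (e, T) \<partial>K a)" for a e
  define Y where "Y a = (\<integral>\<^sup>+e. indicator {0..min b a} e * h a e \<partial>lborel)" for a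
  define g where "g a = Y a / emeasure lborel {0..min b a}" for a
  have h[measurable]: "(\<lambda>(a, e). h a e) \<in> borel_measurable (borel \<Otimes>\<^sub>M borel)"
    unfolding h_def using measurable_edge_integral[of "\<lambda>z T. f (snd z, T)"] by simp
  have [measurable]: "Y \<in> borel_measurable borel"
  proof -
    have [measurable]: "(\<lambda>(a, e). indicator {0..min b a} e * h a e) \<in> borel_measurable (borel \<Otimes>\<^sub>M lborel)"
    proof -
      have "(\<lambda>(a, e). indicator {e. 0 \<le> e \<and> e \<le> b \<and> e \<le> a} e * h a e) \<in> borel_measurable (borel \<Otimes>\<^sub>M lborel)"
        unfolding indicator_def by measurable
      then show ?thesis
        by (simp add: indicator_def case_prod_unfold)
    qed
    show ?thesis unfolding Y_def by measurable
  qed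
  have g[measurable]: "g \<in> borel_measurable borel"
    unfolding g_def emeasure_lborel_Icc_eq by measurable
  have fm: "f \<in> borel_measurable (offspring_law x K b)"
    unfolding measurable_cong_sets[OF sets_offspring_law[OF K] refl] by (rule f)
  have ha: "h a \<in> borel_measurable borel" for a
    using measurable_Pair2[OF h, of a] by simp
  have "(\<integral>\<^sup>+p. f p \<partial>offspring_intensity x K b) = child_mass x b * (\<integral>\<^sup>+p. f p \<partial>offspring_law x K b)"
    unfolding offspring_intensity_def by (rule nn_integral_scale_measure[OF fm])
  also have "(\<integral>\<^sup>+p. f p \<partial>offspring_law x K b) = (\<integral>\<^sup>+a. g a \<partial>uniform_measure (child_intensity x b) UNIV)"
    unfolding nn_integral_offspring_law[OF K f] h_def[symmetric] g_def Y_def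
    by (intro nn_integral_cong, subst nn_integral_uniform_measure) (simp_all add: ha mult.commute)
  also have "\<dots> = (\<integral>\<^sup>+a. g a \<partial>child_intensity x b) / child_mass x b"
    by (subst nn_integral_uniform_measure) (simp_all add: child_mass_def)
  also have "child_mass x b * \<dots> = (\<integral>\<^sup>+a. g a \<partial>child_intensity x b)"
  proof (cases "child_mass x b = 0")
    case True
    then have "AE a in child_intensity x b. False"
      by (intro AE_I[where N = UNIV]) (auto simp: child_mass_def)
    then have "(\<integral>\<^sup>+a. g a \<partial>child_intensity x b) = (\<integral>\<^sup>+a. 0 \<partial>child_intensity x b)"
      by (intro nn_integral_cong_AE) auto
    with True show ?thesis by simp
  next
    case False
    then have "0 < measure (child_intensity x b) UNIV"
      by (simp add: child_mass_measure zero_less_measure_iff)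
    from ennreal_mult_divide_cancel[OF this, of 1] show ?thesis
      by (simp add: child_mass_measure)
  qed
  also have "\<dots> = (\<integral>\<^sup>+a. ennreal (indicator {0..} a * (min b a * child_density x a)) * g a \<partial>lborel)"
    by (rule nn_integral_child_intensity) measurable
  also have "\<dots> = (\<integral>\<^sup>+a. ennreal (child_density x a) * indicator {0..} a * Y a \<partial>lborel)"
  proof (rule nn_integral_cong)
    fix a :: real
    show "ennreal (indicator {0..} a * (min b a * child_density x a)) * g a = ennreal (child_density x a) * indicator {0..} a * Y a"
    proof (cases "0 < min b a")
      case True
      then show ?thesis
        using ennreal_mult_divide_cancel[OF True, of "child_density x a" "Y a"] by (simp add: g_def)
    next
      case False
      have "Y a = (\<integral>\<^sup>+e. 0 \<partial>(lborel :: real measure))"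
        unfolding Y_def
      proof (rule nn_integral_cong_AE)
        show "AE e in lborel. indicator {0..min b a} e * h a e = 0"
          using AE_lborel_singleton[of 0]
        proof eventually_elim
          case (elim e)
          with False have "e \<notin> {0..min b a}" by (simp del: min_less_iff_conj min.bounded_iff)
          then show ?case by simp
        qed
      qed
      then show ?thesis by (simp add: g_def)
    qed
  qed
  finally show ?thesis by (simp add: Y_def h_def)
qed

lemma sets_offspring_intensity: "sets (offspring_intensity x K b) = sets edge_space"
  unfolding offspring_intensity_def by (simp only: sets_scale_measure sets_offspring_law[OF K])

lemma finite_offspring_law: "finite_full_measure (offspring_law x K b)" "subprob_space (offspring_law x K b)"
proof -
  interpret subprob_space "offspring_law x K b"
    by (rule subprob_space_kernel[OF measurable_offspring_law[OF K]]) simp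
  show "finite_full_measure (offspring_law x K b)"
    by unfold_locales (rule space_offspring_law[OF K])
  show "subprob_space (offspring_law x K b)" by unfold_locales
qed

lemma finite_offspring_intensity: "finite_full_measure (offspring_intensity x K b)"
proof -
  interpret finite_full_measure "offspring_law x K b" by (rule finite_offspring_law)
  show ?thesis
    unfolding offspring_intensity_def
    using child_mass_finite[of x b] emeasure_finite[of UNIV]
    by (intro finite_full_measure.intro finite_measureI finite_full_measure_axioms.intro)
       (simp_all add: space_scale_measure space_full ennreal_mult_eq_top_iff less_top)
qed

lemma offspring_intensity_mass_le: "measure (offspring_intensity x K b) UNIV \<le> measure (child_intensity x b) UNIV"
proof -
  interpret subprob_space "offspring_law x K b" by (rule finite_offspring_law)
  have "emeasure (offspring_intensity x K b) UNIV \<le> child_mass x b"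
    unfolding offspring_intensity_def by (simp add: mult_left_le subprob_emeasure_le_1)
  then show ?thesis
    using child_mass_finite[of x b] by (simp add: measure_def child_mass_def enn2real_mono)
qed

text \<open>
  One generation of the branching construction, for an arbitrary kernel \<open>K\<close> in place of the law
  of the subtrees: a Poisson number of independent children is a Poisson configuration.
\<close>

lemma gw_step:
  fixes x :: real
  defines "\<nu> \<equiv> offspring_law x K"
  defines "L \<equiv> \<lambda>b. do {
     k \<leftarrow> poisson_law (measure (child_intensity x b) UNIV);
     c \<leftarrow> PiM {..<k} (\<lambda>_. \<nu> b);
     return tree_space (Vertex b (image_mset c (mset_set {..<k}))) }"
  shows measurable_gw_step: "L \<in> borel \<rightarrow>\<^sub>M subprob_algebra tree_space"
    and nn_integral_gw_step: "\<And>f. f \<in> borel_measurable tree_space \<Longrightarrow> (\<integral>\<^sup>+T. f T \<partial>L b) =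
      ennreal (exp (- measure (child_intensity x b) UNIV)) * poisson_int (offspring_intensity x K b) (\<lambda>C. f (Vertex b C))"
proof -
  define m where "m b = measure (child_intensity x b) UNIV" for b
  define D where "D b k = PiM {..<k} (\<lambda>_. \<nu> b) \<bind> (\<lambda>c. return tree_space (Vertex b (image_mset c (mset_set {..<k}))))" for b and k :: nat
  have fin: "finite_full_measure (\<nu> b)" "subprob_space (\<nu> b)" for b
    unfolding \<nu>_def by (rule finite_offspring_law)+
  have ms: "multiset_space (\<nu> b) = multiset_space edge_space" for b
    unfolding \<nu>_def by (rule multiset_space_cong[OF sets_offspring_law[OF K]])
  have V[measurable]: "Vertex b \<in> multiset_space edge_space \<rightarrow>\<^sub>M tree_space" for b
    by (rule measurable_Vertex[OF measurable_const measurable_ident_sets[OF refl]]) simp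
  have h: "(\<lambda>c. Vertex b (image_mset c (mset_set {..<k}))) \<in> PiM {..<k} (\<lambda>_. \<nu> b) \<rightarrow>\<^sub>M tree_space" for b and k :: nat
    by (rule measurable_compose[OF finite_full_measure.measurable_points_PiM[OF fin(1)]]) (simp add: ms)
  have ne: "space (PiM {..<k} (\<lambda>_. \<nu> b)) \<noteq> {}" for b and k :: nat
    by (simp add: space_PiM PiE_eq_empty_iff finite_full_measure.space_full[OF fin(1)])
  have D_eq: "D b k = distr (PiM {..<k} (\<lambda>_. \<nu> b)) tree_space (\<lambda>c. Vertex b (image_mset c (mset_set {..<k})))" for b k
    unfolding D_def using bind_return_distr'[OF ne h] by simp
  have D_int: "(\<integral>\<^sup>+T. f T \<partial>D b k) = (\<integral>\<^sup>+C. f (Vertex b C) \<partial>mset_power (\<nu> b) k)"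
    if [measurable]: "f \<in> borel_measurable tree_space" for f b k
  proof -
    have "(\<lambda>C. f (Vertex b C)) \<in> borel_measurable (multiset_space (\<nu> b))"
      unfolding ms by measurable
    from finite_full_measure.nn_integral_points_PiM[OF fin(1) this] show ?thesis
      unfolding D_eq by (simp add: nn_integral_distr[OF h])
  qed
  have D_sub: "D b k \<in> space (subprob_algebra tree_space)" for b k
  proof -
    interpret subprob_space "mset_power (\<nu> b) k"
      by (rule subprob_mset_power[OF fin(2) finite_full_measure.space_full[OF fin(1)]])
    have "emeasure (D b k) UNIV = emeasure (mset_power (\<nu> b) k) UNIV"
      using D_int[of "\<lambda>_. 1" b k] by (simp add: D_eq)
    also have "\<dots> \<le> 1" by (rule subprob_emeasure_le_1)
    finally show ?thesis
      by (auto simp: space_subprob_algebra D_eq intro!: subprob_spaceI)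
  qed
  have L_eq: "L b = poisson_law (m b) \<bind> D b" for b
    unfolding L_def D_def m_def ..
  have P: "sets (poisson_law r) = UNIV" "space (poisson_law r) = UNIV" for r
    by (auto simp: poisson_law_def)
  have D_meas: "D b \<in> poisson_law r \<rightarrow>\<^sub>M subprob_algebra tree_space" for b r
    using D_sub by (auto simp: measurable_def P)
  have int: "(\<integral>\<^sup>+T. f T \<partial>L b) = (\<Sum>k. ennreal (exp (- m b) * m b ^ k / fact k) * (\<integral>\<^sup>+C. f (Vertex b C) \<partial>mset_power (\<nu> b) k))"
    if f: "f \<in> borel_measurable tree_space" for f b
    unfolding L_eq nn_integral_bind[OF f D_meas] D_int[OF f]
    by (simp add: poisson_law_def nn_integral_density nn_integral_count_space_nat)
  show int': "(\<integral>\<^sup>+T. f T \<partial>L b) = ennreal (exp (- measure (child_intensity x b) UNIV)) * poisson_int (offspring_intensity x K b) (\<lambda>C. f (Vertex b C))"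
    if f: "f \<in> borel_measurable tree_space" for f b
  proof -
    have "ennreal (exp (- m b) * m b ^ k / fact k) * (\<integral>\<^sup>+C. f (Vertex b C) \<partial>mset_power (\<nu> b) k) =
        ennreal (exp (- m b)) * (ennreal (1 / fact k) * (\<integral>\<^sup>+C. f (Vertex b C) \<partial>mset_power (offspring_intensity x K b) k))" for k
    proof -
      have "(\<integral>\<^sup>+C. f (Vertex b C) \<partial>mset_power (offspring_intensity x K b) k) = child_mass x b ^ k * (\<integral>\<^sup>+C. f (Vertex b C) \<partial>mset_power (\<nu> b) k)"
        unfolding offspring_intensity_def \<nu>_def[symmetric]
        using fin(1) child_mass_finite[of x b] measurable_compose[OF V f]
        by (intro nn_integral_mset_power_scale) (auto simp: ms less_top)
      also have "child_mass x b ^ k = ennreal (m b ^ k)"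
        by (simp add: child_mass_measure m_def ennreal_power)
      finally show ?thesis
        by (simp add: mult.assoc[symmetric] ennreal_mult[symmetric] m_def)
    qed
    then show ?thesis
      unfolding int[OF f] poisson_int_def m_def[symmetric] by simp
  qed
  show "L \<in> borel \<rightarrow>\<^sub>M subprob_algebra tree_space"
  proof (rule measurable_subprob_algebra)
    fix b
    have setsL: "sets (L b) = sets tree_space"
      unfolding L_eq by (rule sets_bind) (auto simp: D_eq P)
    then show "sets (L b) = sets tree_space" .
    interpret L: finite_full_measure "offspring_intensity x K b" by (rule finite_offspring_intensity)
    have "emeasure (L b) UNIV = (\<integral>\<^sup>+T. 1 \<partial>L b)"
      using sets_eq_imp_space_eq[OF setsL] by simp
    also have "\<dots> = ennreal (exp (- m b) * exp (measure (offspring_intensity x K b) UNIV))"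
      by (subst int') (simp_all add: L.poisson_int_1 m_def ennreal_mult)
    also have "\<dots> \<le> 1"
      using offspring_intensity_mass_le[of x b] by (simp add: m_def mult_exp_exp)
    finally show "subprob_space (L b)"
      using sets_eq_imp_space_eq[OF setsL] by (intro subprob_spaceI) auto
  next
    fix A assume A[measurable]: "A \<in> sets tree_space"
    have "emeasure (L b) A = (\<integral>\<^sup>+T. indicator A T \<partial>L b)" for b
      using A by (subst nn_integral_indicator) (auto simp: L_eq sets_bind[of _ _ tree_space] D_eq P)
    then have "emeasure (L b) A = (\<Sum>k. ennreal (exp (- m b) * m b ^ k / fact k) * (\<integral>\<^sup>+C. indicator A (Vertex b C) \<partial>mset_power (\<nu> b) k))" for b
      by (simp add: int)
    moreover have "(\<lambda>b. \<Sum>k. ennreal (exp (- m b) * m b ^ k / fact k) * (\<integral>\<^sup>+C. indicator A (Vertex b C) \<partial>mset_power (\<nu> b) k)) \<in> borel_measurable borel"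
    proof -
      have [measurable]: "m \<in> borel_measurable borel"
        unfolding m_def by measurable
      have mp: "(\<lambda>b. mset_power (\<nu> b) k) \<in> borel \<rightarrow>\<^sub>M subprob_algebra (multiset_space edge_space)" for k
        unfolding \<nu>_def by (rule measurable_mset_power) (auto simp: space_edge_space intro: measurable_offspring_law[OF K])
      have [measurable]: "(\<lambda>b. \<integral>\<^sup>+C. indicator A (Vertex b C) \<partial>mset_power (\<nu> b) k) \<in> borel_measurable borel" for k
        by (rule nn_integral_measurable_subprob_algebra2[OF _ mp]) measurable
      show ?thesis by measurable
    qed
    ultimately show "(\<lambda>b. emeasure (L b) A) \<in> borel_measurable borel"
      by simp
  qed
qed

end

lemma gw_truncated_Suc_eq:
  "gw_truncated x (Suc n) = (\<lambda>b. do {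
     k \<leftarrow> poisson_law (measure (child_intensity x b) UNIV);
     c \<leftarrow> PiM {..<k} (\<lambda>_. offspring_law x (gw_truncated x n) b);
     return tree_space (Vertex b (image_mset c (mset_set {..<k}))) })"
  by (simp add: offspring_law_def fun_eq_iff)

lemma measurable_gw_truncated [measurable]: "gw_truncated x n \<in> borel \<rightarrow>\<^sub>M subprob_algebra tree_space"
proof (induction n)
  case 0
  have "(\<lambda>b. Vertex b {#}) \<in> borel \<rightarrow>\<^sub>M tree_space" by measurable
  from measurable_compose[OF this return_measurable] show ?case
    by (simp add: fun_eq_iff[of "gw_truncated x 0"] ext[of "gw_truncated x 0"])
next
  case (Suc n)
  show ?case
    unfolding gw_truncated_Suc_eq by (rule measurable_gw_step[OF Suc])
qed

lemma sets_gw_truncated: "sets (gw_truncated x n b) = sets tree_space"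
  by (rule sets_kernel[OF measurable_gw_truncated]) simp

lemma nn_integral_gw_truncated_Suc:
  assumes "f \<in> borel_measurable tree_space"
  shows "(\<integral>\<^sup>+T. f T \<partial>gw_truncated x (Suc n) b) = ennreal (exp (- measure (child_intensity x b) UNIV)) *
     poisson_int (offspring_intensity x (gw_truncated x n) b) (\<lambda>C. f (Vertex b C))"
  unfolding gw_truncated_Suc_eq by (rule nn_integral_gw_step[OF measurable_gw_truncated assms])

section \<open>The branching recursion for the law of the tree\<close>

text \<open>
  The part of the mass of \<open>gw_truncated\<close> that sits on trees already complete before generation
  \<open>n\<close>. These measures increase to \<open>gw_law\<close>.
\<close>

definition gw_killed :: "real \<Rightarrow> nat \<Rightarrow> real \<Rightarrow> aged_tree measure" where
  "gw_killed x n b = density (gw_truncated x n b) (indicator {T. height T < n})"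

lemma height_less_set [measurable]: "{T. height T < n} \<in> sets tree_space"
  using measurable_height_less[of n] by (simp add: pred_def)

lemma sets_gw_killed: "sets (gw_killed x n b) = sets tree_space"
  by (simp add: gw_killed_def sets_gw_truncated)

lemma nn_integral_gw_killed:
  assumes "f \<in> borel_measurable tree_space"
  shows "(\<integral>\<^sup>+T. f T \<partial>gw_killed x n b) = (\<integral>\<^sup>+T. indicator {T. height T < n} T * f T \<partial>gw_truncated x n b)"
  unfolding gw_killed_def using assms
  by (intro nn_integral_density) (auto simp: measurable_cong_sets[OF sets_gw_truncated refl])

lemma emeasure_gw_killed:
  assumes "A \<in> sets tree_space"
  shows "emeasure (gw_killed x n b) A = emeasure (gw_truncated x n b) {T \<in> A. height T < n}"
proof -
  have "{T \<in> A. height T < n} = A \<inter> {T. height T < n}" by auto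
  then have m: "{T \<in> A. height T < n} \<in> sets (gw_truncated x n b)"
    using assms by (simp add: sets_gw_truncated)
  have "emeasure (gw_killed x n b) A = (\<integral>\<^sup>+T. indicator A T \<partial>gw_killed x n b)"
    using assms by (simp add: sets_gw_killed)
  also have "\<dots> = (\<integral>\<^sup>+T. indicator {T. height T < n} T * indicator A T \<partial>gw_truncated x n b)"
    using assms by (intro nn_integral_gw_killed) simp
  also have "\<dots> = (\<integral>\<^sup>+T. indicator {T \<in> A. height T < n} T \<partial>gw_truncated x n b)"
    by (intro nn_integral_cong) (auto simp: indicator_def)
  also have "\<dots> = emeasure (gw_truncated x n b) {T \<in> A. height T < n}"
    using m by simp
  finally show ?thesis .
qed

lemma measurable_gw_killed [measurable]: "gw_killed x n \<in> borel \<rightarrow>\<^sub>M subprob_algebra tree_space"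
proof (rule measurable_subprob_algebra)
  fix b
  interpret subprob_space "gw_truncated x n b"
    by (rule subprob_space_kernel[OF measurable_gw_truncated]) simp
  have sp: "space (gw_killed x n b) = UNIV"
    using sets_eq_imp_space_eq[OF sets_gw_killed[of x n b]] by simp
  have "emeasure (gw_killed x n b) UNIV \<le> 1"
    using sets.top[of tree_space] by (subst emeasure_gw_killed) (auto intro: subprob_emeasure_le_1)
  then show "subprob_space (gw_killed x n b)"
    by (intro subprob_spaceI) (simp_all add: sp)
next
  fix A assume A: "A \<in> sets tree_space"
  have "{T \<in> A. height T < n} = A \<inter> {T. height T < n}" by auto
  then have "{T \<in> A. height T < n} \<in> sets tree_space" using A by simp
  then show "(\<lambda>b. emeasure (gw_killed x n b) A) \<in> borel_measurable borel"
    unfolding emeasure_gw_killed[OF A] by measurable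
qed (rule sets_gw_killed)

lemma measurable_Vertex_const [measurable]: "Vertex b \<in> multiset_space edge_space \<rightarrow>\<^sub>M tree_space"
  by (rule measurable_Vertex[OF measurable_const measurable_ident_sets[OF refl]]) simp

lemma nn_integral_gw_killed_Suc:
  assumes f: "f \<in> borel_measurable tree_space"
  shows "(\<integral>\<^sup>+T. f T \<partial>gw_killed x (Suc n) b) = ennreal (exp (- measure (child_intensity x b) UNIV)) *
     poisson_int (offspring_intensity x (gw_killed x n) b) (\<lambda>C. f (Vertex b C))"
proof -
  let ?N = "offspring_intensity x (gw_truncated x n) b" and ?N' = "offspring_intensity x (gw_killed x n) b"
  have sN: "sets ?N = sets edge_space" and sN': "sets ?N' = sets edge_space"
    by (rule sets_offspring_intensity, measurable)+
  have ms: "multiset_space ?N = multiset_space edge_space" "multiset_space ?N' = multiset_space edge_space"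
    by (rule multiset_space_cong, rule sN) (rule multiset_space_cong, rule sN')
  have [measurable]: "{p. height (snd p) < n} \<in> sets edge_space"
    using measurable_compose[OF measurable_snd measurable_height_less[of n], of borel] by (simp add: pred_def space_pair_measure)
  have all: "{C. \<forall>p\<in>#C. height (snd p) < n} \<in> sets (multiset_space edge_space)"
  proof -
    have "Measurable.pred (multiset_space edge_space) (\<lambda>C. \<forall>p\<in>#C. height (snd p) < n)"
      by (rule measurable_all_mset[OF space_edge_space measurable_ident_sets[OF refl]]) measurable
    then show ?thesis by (simp add: pred_def)
  qed
  have "poisson_int ?N' (\<lambda>C. f (Vertex b C)) =
      poisson_int ?N (\<lambda>C. indicator {C. \<forall>p\<in>#C. height (snd p) < n} C * f (Vertex b (image_mset (\<lambda>p. p) C)))"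
  proof (rule poisson_int_transform[where g = "indicator {p. height (snd p) < n}" and S = UNIV])
    show "finite_full_measure ?N" "finite_full_measure ?N'"
      by (rule finite_offspring_intensity, measurable)+
    show "(\<lambda>p. p) \<in> ?N \<rightarrow>\<^sub>M ?N'"
      by (rule measurable_ident_sets) (simp add: sN sN')
    show "indicator {p. height (snd p) < n} \<in> borel_measurable ?N"
      unfolding measurable_cong_sets[OF sN refl] by measurable
    show "indicator {C. \<forall>p\<in>#C. height (snd p) < n} \<in> borel_measurable (multiset_space ?N)"
      unfolding ms using all by measurable
    show "(\<lambda>C. f (Vertex b C)) \<in> borel_measurable (multiset_space ?N')"
      unfolding ms using f by measurable
    fix g :: "real \<times> aged_tree \<Rightarrow> ennreal"
    assume "g \<in> borel_measurable ?N'"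
    then have g: "g \<in> borel_measurable edge_space"
      unfolding measurable_cong_sets[OF sN' refl] .
    have g1: "(\<lambda>T. g (e, T)) \<in> borel_measurable tree_space" for e
      using g by measurable
    have gi: "(\<lambda>p. indicator {p. height (snd p) < n} p * g p) \<in> borel_measurable edge_space"
      using g by measurable
    show "(\<integral>\<^sup>+p. g p \<partial>?N') = (\<integral>\<^sup>+p. indicator {p. height (snd p) < n} p * g p \<partial>?N)"
      unfolding nn_integral_offspring_intensity[OF measurable_gw_killed g] nn_integral_offspring_intensity[OF measurable_gw_truncated gi] nn_integral_gw_killed[OF g1]
      by (simp add: indicator_def)
  qed (auto simp: indicator_def)
  also have "\<dots> = poisson_int ?N (\<lambda>C. indicator {T. height T < Suc n} (Vertex b C) * f (Vertex b C))"
    by (simp add: indicator_def height_less_Suc_iff)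
  finally show ?thesis
    using f by (simp add: nn_integral_gw_killed nn_integral_gw_truncated_Suc del: gw_truncated.simps)
qed

lemma gw_killed_mono:
  assumes "f \<in> borel_measurable tree_space"
  shows "(\<integral>\<^sup>+T. f T \<partial>gw_killed x n b) \<le> (\<integral>\<^sup>+T. f T \<partial>gw_killed x (Suc n) b)"
  using assms
proof (induction n arbitrary: b f)
  case 0
  then show ?case by (simp add: nn_integral_gw_killed del: gw_truncated.simps)
next
  case (Suc n b f)
  note f[measurable] = Suc.prems
  show ?case
    unfolding nn_integral_gw_killed_Suc[OF Suc.prems]
  proof (intro mult_left_mono poisson_int_mono)
    show "finite_full_measure (offspring_intensity x (gw_killed x n) b)" "finite_full_measure (offspring_intensity x (gw_killed x (Suc n)) b)"
      by (rule finite_offspring_intensity, measurable)+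
    show "sets (offspring_intensity x (gw_killed x (Suc n)) b) = sets (offspring_intensity x (gw_killed x n) b)"
      by (simp only: sets_offspring_intensity[OF measurable_gw_killed])
    show "(\<lambda>C. f (Vertex b C)) \<in> borel_measurable (multiset_space (offspring_intensity x (gw_killed x n) b))"
      unfolding multiset_space_cong[OF sets_offspring_intensity[OF measurable_gw_killed]] by measurable
    fix g :: "real \<times> aged_tree \<Rightarrow> ennreal"
    assume "g \<in> borel_measurable (offspring_intensity x (gw_killed x n) b)"
    then have g: "g \<in> borel_measurable edge_space"
      unfolding measurable_cong_sets[OF sets_offspring_intensity[OF measurable_gw_killed] refl] .
    then have "(\<lambda>T. g (e, T)) \<in> borel_measurable tree_space" for e
      by measurable
    then show "(\<integral>\<^sup>+p. g p \<partial>offspring_intensity x (gw_killed x n) b) \<le> (\<integral>\<^sup>+p. g p \<partial>offspring_intensity x (gw_killed x (Suc n)) b)"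
      unfolding nn_integral_offspring_intensity[OF measurable_gw_killed g]
      by (intro nn_integral_mono mult_left_mono Suc.IH) auto
  qed simp
qed

lemma incseq_gw_killed:
  "f \<in> borel_measurable tree_space \<Longrightarrow> incseq (\<lambda>n. \<integral>\<^sup>+T. f T \<partial>gw_killed x n b)"
  by (intro incseq_SucI gw_killed_mono)

lemma sets_gw_law: "sets (gw_law x b) = sets tree_space"
  using sets.sigma_sets_eq[of tree_space] by (simp add: gw_law_def sets_measure_of)

lemma space_gw_law [simp]: "space (gw_law x b) = UNIV"
  by (simp add: gw_law_def space_measure_of_conv)

lemma emeasure_gw_law:
  assumes A: "A \<in> sets tree_space"
  shows "emeasure (gw_law x b) A = (SUP n. emeasure (gw_killed x n b) A)"
proof -
  let ?\<mu> = "\<lambda>A. SUP n. emeasure (gw_truncated x n b) {T \<in> A. height T < n}"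
  have eq: "?\<mu> A = (SUP n. emeasure (gw_killed x n b) A)" if "A \<in> sets tree_space" for A
    by (simp add: emeasure_gw_killed[OF that])
  have ind: "emeasure (gw_killed x n b) A = (\<integral>\<^sup>+T. indicator A T \<partial>gw_killed x n b)" if "A \<in> sets tree_space" for n A
    using that by (simp add: sets_gw_killed)
  have inc: "incseq (\<lambda>n. emeasure (gw_killed x n b) A)" if "A \<in> sets tree_space" for A
    unfolding ind[OF that] using that by (intro incseq_gw_killed) simp
  have "emeasure (gw_law x b) A = ?\<mu> A"
  proof (rule emeasure_measure_of[OF gw_law_def[of x b]])
    show "positive (sets (gw_law x b)) ?\<mu>"
      by (simp add: positive_def)
    show "countably_additive (sets (gw_law x b)) ?\<mu>"
      unfolding countably_additive_def sets_gw_law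
    proof (intro allI impI)
      fix F :: "nat \<Rightarrow> aged_tree set"
      assume F: "range F \<subseteq> sets tree_space" "disjoint_family F" "(\<Union>i. F i) \<in> sets tree_space"
      have "(\<Sum>i. ?\<mu> (F i)) = (\<Sum>i. SUP n. emeasure (gw_killed x n b) (F i))"
        using F(1) by (intro suminf_cong eq) auto
      also have "\<dots> = (SUP n. \<Sum>i. emeasure (gw_killed x n b) (F i))"
        using F(1) by (intro ennreal_suminf_SUP_eq inc) auto
      also have "\<dots> = (SUP n. emeasure (gw_killed x n b) (\<Union>i. F i))"
        using F by (intro SUP_cong suminf_emeasure) (auto simp: sets_gw_killed)
      also have "\<dots> = ?\<mu> (\<Union>i. F i)"
        by (rule eq[symmetric]) fact
      finally show "(\<Sum>i. ?\<mu> (F i)) = ?\<mu> (\<Union>i. F i)" .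
    qed
    show "sets tree_space \<subseteq> Pow UNIV" by simp
    show "A \<in> sets (gw_law x b)" using A by (simp add: sets_gw_law)
  qed
  then show ?thesis using eq[OF A] by simp
qed

lemma nn_integral_gw_law_SUP:
  assumes "f \<in> borel_measurable tree_space"
  shows "(\<integral>\<^sup>+T. f T \<partial>gw_law x b) = (SUP n. \<integral>\<^sup>+T. f T \<partial>gw_killed x n b)"
proof -
  have m: "u \<in> borel_measurable (gw_law x b)" "u \<in> borel_measurable (gw_killed x n b)"
    if "u \<in> borel_measurable tree_space" for u :: "aged_tree \<Rightarrow> ennreal" and n
    using that by (simp_all add: measurable_cong_sets[OF sets_gw_law refl] measurable_cong_sets[OF sets_gw_killed refl])
  show ?thesis
    using assms
  proof (induction rule: borel_measurable_induct)
    case (cong f g)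
    have "f = g" using cong(3) by auto
    then show ?case using cong by simp
  next
    case (set A)
    then show ?case by (simp add: sets_gw_law sets_gw_killed emeasure_gw_law)
  next
    case (mult u c)
    then show ?case by (simp add: nn_integral_cmult m SUP_mult_left_ennreal)
  next
    case (add u v)
    then show ?case
      by (simp add: nn_integral_add m ennreal_SUP_add incseq_gw_killed)
  next
    case (seq U)
    have "(\<integral>\<^sup>+T. (SUP i. U i) T \<partial>gw_law x b) = (SUP i. \<integral>\<^sup>+T. U i T \<partial>gw_law x b)"
      unfolding SUP_apply by (intro nn_integral_monotone_convergence_SUP m seq)
    also have "\<dots> = (SUP i. SUP n. \<integral>\<^sup>+T. U i T \<partial>gw_killed x n b)"
      by (simp only: seq.IH)
    also have "\<dots> = (SUP n. SUP i. \<integral>\<^sup>+T. U i T \<partial>gw_killed x n b)"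
      by (rule SUP_commute)
    also have "\<dots> = (SUP n. \<integral>\<^sup>+T. (SUP i. U i) T \<partial>gw_killed x n b)"
      unfolding SUP_apply by (intro SUP_cong nn_integral_monotone_convergence_SUP[symmetric] m seq refl)
    finally show ?case .
  qed
qed

lemma measurable_gw_law [measurable]: "gw_law x \<in> borel \<rightarrow>\<^sub>M subprob_algebra tree_space"
proof (rule measurable_subprob_algebra)
  fix b
  have "emeasure (gw_killed x n b) UNIV \<le> 1" for n
    by (rule subprob_space.subprob_emeasure_le_1[OF subprob_space_kernel[OF measurable_gw_killed]]) simp
  then have "emeasure (gw_law x b) UNIV \<le> 1"
    using sets.top[of tree_space] by (subst emeasure_gw_law) (auto intro: SUP_least)
  then show "subprob_space (gw_law x b)"
    by (intro subprob_spaceI) simp_all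
next
  fix A assume "A \<in> sets tree_space"
  then show "(\<lambda>b. emeasure (gw_law x b) A) \<in> borel_measurable borel"
    unfolding emeasure_gw_law[OF \<open>A \<in> sets tree_space\<close>] by measurable
qed (rule sets_gw_law)

text \<open>
  The branching recursion passes to the limit by monotone convergence. It holds although
  \<open>gw_law\<close> may have mass less than one, since a tree is finite iff all its branches are.
\<close>

lemma gw_law_fixed_point:
  assumes f[measurable]: "f \<in> borel_measurable tree_space"
  shows "(\<integral>\<^sup>+T. f T \<partial>gw_law x b) = ennreal (exp (- measure (child_intensity x b) UNIV)) *
     poisson_int (offspring_intensity x (gw_law x) b) (\<lambda>C. f (Vertex b C))"
proof -
  let ?N = "\<lambda>n. offspring_intensity x (gw_killed x n) b" and ?L = "offspring_intensity x (gw_law x) b"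
  have sN: "sets (?N n) = sets edge_space" and sL: "sets ?L = sets edge_space" for n
    by (rule sets_offspring_intensity, measurable)+
  have inc: "incseq (\<lambda>n. \<integral>\<^sup>+T. f T \<partial>gw_killed x n b)"
    by (rule incseq_gw_killed) fact
  have main: "poisson_int ?L (\<lambda>C. f (Vertex b C)) = (SUP n. poisson_int (?N n) (\<lambda>C. f (Vertex b C)))"
  proof (rule poisson_int_SUP)
    show "finite_full_measure ?L" "finite_full_measure (?N n)" for n
      by (rule finite_offspring_intensity, measurable)+
    show "sets (?N n) = sets ?L" for n by (simp add: sN sL)
    show "(\<lambda>C. f (Vertex b C)) \<in> borel_measurable (multiset_space ?L)"
      unfolding multiset_space_cong[OF sL] by measurable
    fix g :: "real \<times> aged_tree \<Rightarrow> ennreal" assume "g \<in> borel_measurable ?L"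
    then have g[measurable]: "g \<in> borel_measurable edge_space"
      unfolding measurable_cong_sets[OF sL refl] .
    have g1: "(\<lambda>T. g (e, T)) \<in> borel_measurable tree_space" for e by measurable
    define I where "I n a = ennreal (child_density x a) * indicator {0..} a * (\<integral>\<^sup>+e. indicator {0..min b a} e * (\<integral>\<^sup>+T. g (e, T) \<partial>gw_killed x n a) \<partial>lborel)" for n a
    have J_inc: "incseq (\<lambda>n e. indicator {0..min b a} e * (\<integral>\<^sup>+T. g (e, T) \<partial>gw_killed x n a))" for a
      using incseq_gw_killed[OF g1] by (auto simp: incseq_def le_fun_def intro!: mult_left_mono)
    have I_inc: "incseq I"
      unfolding incseq_def le_fun_def I_def
      by (intro allI impI mult_left_mono nn_integral_mono incseqD[OF incseq_gw_killed[OF g1]]) auto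
    have h[measurable]: "(\<lambda>z. \<integral>\<^sup>+T. g (snd z, T) \<partial>gw_killed x n (fst z)) \<in> borel_measurable (borel \<Otimes>\<^sub>M borel)" for n
      by (rule nn_integral_measurable_subprob_algebra2) measurable
    have h1[measurable]: "(\<lambda>e. \<integral>\<^sup>+T. g (e, T) \<partial>gw_killed x n a) \<in> borel_measurable borel" for n a
      by (rule nn_integral_measurable_subprob_algebra2) measurable
    have I_meas[measurable]: "I n \<in> borel_measurable borel" for n
    proof -
      have "(\<lambda>(a, e). indicator {e. 0 \<le> e \<and> e \<le> b \<and> e \<le> a} e * (\<integral>\<^sup>+T. g (e, T) \<partial>gw_killed x n a)) \<in> borel_measurable (borel \<Otimes>\<^sub>M lborel)"
      proof -
        have "(\<lambda>(a, e). indicator {e. 0 \<le> e \<and> e \<le> b \<and> e \<le> a} e :: ennreal) \<in> borel_measurable (borel \<Otimes>\<^sub>M lborel)"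
          unfolding indicator_def by measurable
        then show ?thesis
          using h[of n] by (simp add: case_prod_unfold)
      qed
      then have [measurable]: "(\<lambda>(a, e). indicator {0..min b a} e * (\<integral>\<^sup>+T. g (e, T) \<partial>gw_killed x n a)) \<in> borel_measurable (borel \<Otimes>\<^sub>M lborel)"
        by (simp add: indicator_def case_prod_unfold)
      show ?thesis unfolding I_def by measurable
    qed
    have IN: "(\<integral>\<^sup>+p. g p \<partial>?N n) = (\<integral>\<^sup>+a. I n a \<partial>lborel)" for n
      unfolding I_def by (rule nn_integral_offspring_intensity[OF measurable_gw_killed g])
    show "incseq (\<lambda>n. \<integral>\<^sup>+p. g p \<partial>?N n)"
      unfolding IN using I_inc by (auto simp: incseq_def le_fun_def intro!: nn_integral_mono)
    have "(\<integral>\<^sup>+p. g p \<partial>?L) = (\<integral>\<^sup>+a. (SUP n. I n a) \<partial>lborel)"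
      unfolding nn_integral_offspring_intensity[OF measurable_gw_law g]
    proof (rule nn_integral_cong)
      fix a :: real
      have "(\<integral>\<^sup>+e. indicator {0..min b a} e * (\<integral>\<^sup>+T. g (e, T) \<partial>gw_law x a) \<partial>lborel) =
          (\<integral>\<^sup>+e. (SUP n. indicator {0..min b a} e * (\<integral>\<^sup>+T. g (e, T) \<partial>gw_killed x n a)) \<partial>lborel)"
        by (simp add: nn_integral_gw_law_SUP[OF g1] SUP_mult_left_ennreal)
      also have "\<dots> = (SUP n. \<integral>\<^sup>+e. indicator {0..min b a} e * (\<integral>\<^sup>+T. g (e, T) \<partial>gw_killed x n a) \<partial>lborel)"
        by (rule nn_integral_monotone_convergence_SUP[OF J_inc]) measurable
      finally show "ennreal (child_density x a) * indicator {0..} a * (\<integral>\<^sup>+e. indicator {0..min b a} e * (\<integral>\<^sup>+T. g (e, T) \<partial>gw_law x a) \<partial>lborel) = (SUP n. I n a)"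
        by (simp add: I_def SUP_mult_left_ennreal)
    qed
    also have "\<dots> = (SUP n. \<integral>\<^sup>+a. I n a \<partial>lborel)"
      by (rule nn_integral_monotone_convergence_SUP[OF I_inc]) measurable
    finally show "(\<integral>\<^sup>+p. g p \<partial>?L) = (SUP n. \<integral>\<^sup>+p. g p \<partial>?N n)"
      by (simp add: IN)
  qed
  have "(\<integral>\<^sup>+T. f T \<partial>gw_law x b) = (SUP n. \<integral>\<^sup>+T. f T \<partial>gw_killed x n b)"
    by (rule nn_integral_gw_law_SUP) fact
  also have "\<dots> = (SUP n. \<integral>\<^sup>+T. f T \<partial>gw_killed x (Suc n) b)"
  proof (rule antisym)
    show "(SUP n. \<integral>\<^sup>+T. f T \<partial>gw_killed x n b) \<le> (SUP n. \<integral>\<^sup>+T. f T \<partial>gw_killed x (Suc n) b)"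
      by (intro SUP_mono) (use gw_killed_mono[OF f] in blast)
    show "(SUP n. \<integral>\<^sup>+T. f T \<partial>gw_killed x (Suc n) b) \<le> (SUP n. \<integral>\<^sup>+T. f T \<partial>gw_killed x n b)"
      by (intro SUP_mono) blast
  qed
  also have "\<dots> = ennreal (exp (- measure (child_intensity x b) UNIV)) * poisson_int ?L (\<lambda>C. f (Vertex b C))"
    by (simp only: nn_integral_gw_killed_Suc[OF f] main SUP_mult_left_ennreal)
  finally show ?thesis .
qed

section \<open>The law at parameter zero and its tilts\<close>

text \<open>
  The region \<open>0 \<le> e \<le> min b a\<close> is \<open>0 \<le> e \<le> b\<close>, \<open>e \<le> a\<close>.
\<close>

lemma child_swap:
  fixes h :: "real \<Rightarrow> real \<Rightarrow> ennreal"
  assumes h[measurable]: "(\<lambda>(a, e). h a e :: ennreal) \<in> borel_measurable (borel \<Otimes>\<^sub>M borel)"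
    and k[measurable]: "k \<in> borel_measurable borel"
  shows "(\<integral>\<^sup>+a. k a * indicator {0..} a * (\<integral>\<^sup>+e. indicator {0..min b a} e * h a e \<partial>lborel) \<partial>lborel) =
    (\<integral>\<^sup>+e. indicator {0..b} e * (\<integral>\<^sup>+a. k a * indicator {e..} a * h a e \<partial>lborel) \<partial>lborel)"
proof -
  have h1[measurable]: "h a \<in> borel_measurable borel" for a
    using measurable_Pair2[OF h, of a] by simp
  have h2[measurable]: "(\<lambda>a. h a e) \<in> borel_measurable borel" for e
    using measurable_Pair1[OF h, of e] by simp
  have ind[measurable]: "(\<lambda>(a, e). indicator {e::real. 0 \<le> e \<and> e \<le> b \<and> e \<le> a} e :: ennreal) \<in> borel_measurable (borel \<Otimes>\<^sub>M borel)"
    unfolding indicator_def by measurable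
  let ?g = "\<lambda>a e. k a * (indicator {e. 0 \<le> e \<and> e \<le> b \<and> e \<le> a} e * h a e)"
  have "(\<integral>\<^sup>+a. k a * indicator {0..} a * (\<integral>\<^sup>+e. indicator {0..min b a} e * h a e \<partial>lborel) \<partial>lborel) =
      (\<integral>\<^sup>+a. \<integral>\<^sup>+e. ?g a e \<partial>lborel \<partial>lborel)"
  proof (rule nn_integral_cong)
    fix a
    have "k a * indicator {0..} a * (\<integral>\<^sup>+e. indicator {0..min b a} e * h a e \<partial>lborel) =
       (\<integral>\<^sup>+e. k a * indicator {0..} a * (indicator {0..min b a} e * h a e) \<partial>lborel)"
      by (rule nn_integral_cmult[symmetric]) measurable
    also have "\<dots> = (\<integral>\<^sup>+e. ?g a e \<partial>lborel)"
      by (intro nn_integral_cong) (auto simp: indicator_def)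
    finally show "k a * indicator {0..} a * (\<integral>\<^sup>+e. indicator {0..min b a} e * h a e \<partial>lborel) = (\<integral>\<^sup>+e. ?g a e \<partial>lborel)" .
  qed
  also have "\<dots> = (\<integral>\<^sup>+e. \<integral>\<^sup>+a. ?g a e \<partial>lborel \<partial>lborel)"
    by (rule lborel_pair.Fubini'[symmetric]) measurable
  also have "\<dots> = (\<integral>\<^sup>+e. indicator {0..b} e * (\<integral>\<^sup>+a. k a * indicator {e..} a * h a e \<partial>lborel) \<partial>lborel)"
  proof (rule nn_integral_cong)
    fix e
    have "indicator {0..b} e * (\<integral>\<^sup>+a. k a * indicator {e..} a * h a e \<partial>lborel) =
      (\<integral>\<^sup>+a. indicator {0..b} e * (k a * indicator {e..} a * h a e) \<partial>lborel)"
      by (rule nn_integral_cmult[symmetric]) measurable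
    also have "\<dots> = (\<integral>\<^sup>+a. ?g a e \<partial>lborel)"
      by (intro nn_integral_cong) (auto simp: indicator_def)
    finally show "(\<integral>\<^sup>+a. ?g a e \<partial>lborel) = indicator {0..b} e * (\<integral>\<^sup>+a. k a * indicator {e..} a * h a e \<partial>lborel)" by simp
  qed
  finally show ?thesis .
qed

lemma child_mass_swap:
  "child_mass x b = (\<integral>\<^sup>+a. ennreal (child_density x a) * indicator {0..} a * (\<integral>\<^sup>+e. indicator {0..min b a} e \<partial>lborel) \<partial>lborel)"
proof -
  have "(\<integral>\<^sup>+e. indicator {0..min b a} e \<partial>lborel) = emeasure lborel {0..min b a}" for a
    by simp
  then show ?thesis
    unfolding child_mass_eq
    by (intro nn_integral_cong) (auto simp: emeasure_lborel_Icc_eq indicator_def ennreal_mult mult.commute ennreal_eq_0_iff mult_nonpos_nonneg)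
qed

text \<open>
  The intensity integrated over \<open>a \<ge> e\<close> is \<open>1 - tanh ((e + x)/2)\<close>, whose primitive is
  \<open>e - 2 ln (cosh ((e + x)/2))\<close>.
\<close>

lemma child_measure:
  assumes "0 \<le> b"
  shows "measure (child_intensity x b) UNIV = b - 2 * ln (cosh ((b + x) / 2)) + 2 * ln (cosh (x / 2))"
proof -
  have "child_mass x b = (\<integral>\<^sup>+e. indicator {0..b} e * (\<integral>\<^sup>+a. ennreal (child_density x a) * indicator {e..} a \<partial>lborel) \<partial>lborel)"
    unfolding child_mass_swap using child_swap[of "\<lambda>_ _. 1" "\<lambda>a. ennreal (child_density x a)" b] by simp
  also have "\<dots> = (\<integral>\<^sup>+e. ennreal (1 - tanh ((e + x) / 2)) * indicator {0..b} e \<partial>lborel)"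
    unfolding nn_integral_child_density by (simp add: mult.commute)
  also have "\<dots> = ennreal ((b - 2 * ln (cosh ((b + x) / 2))) - (0 - 2 * ln (cosh ((0 + x) / 2))))"
  proof (rule nn_integral_FTC_Icc)
    show "((\<lambda>e. e - 2 * ln (cosh ((e + x) / 2))) has_real_derivative 1 - tanh ((e + x) / 2)) (at e)" for e
      by (auto intro!: derivative_eq_intros simp: tanh_def)
    show "0 \<le> 1 - tanh ((e + x) / 2)" for e
      using tanh_real_lt_1[of "(e + x) / 2"] by simp
    show "(\<lambda>e. 1 - tanh ((e + x) / 2)) \<in> borel_measurable borel"
      by (intro borel_measurable_continuous_onI continuous_intros) auto
  qed (use assms in auto)
  finally have "child_mass x b = ennreal (b - 2 * ln (cosh ((b + x) / 2)) + 2 * ln (cosh (x / 2)))"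
    by simp
  moreover have "0 \<le> b - 2 * ln (cosh ((b + x) / 2)) + 2 * ln (cosh (x / 2))"
  proof -
    have "(0 - 2 * ln (cosh ((0 + x) / 2))) \<le> (b - 2 * ln (cosh ((b + x) / 2)))"
    proof (rule DERIV_nonneg_imp_nondecreasing[OF assms])
      fix e
      have "((\<lambda>e. e - 2 * ln (cosh ((e + x) / 2))) has_real_derivative 1 - tanh ((e + x) / 2)) (at e)"
        by (auto intro!: derivative_eq_intros simp: tanh_def)
      then show "\<exists>y. ((\<lambda>e. e - 2 * ln (cosh ((e + x) / 2))) has_real_derivative y) (at e) \<and> 0 \<le> y"
        using tanh_real_lt_1[of "(e + x) / 2"] by (intro exI[of _ "1 - tanh ((e + x) / 2)"]) auto
    qed
    then show ?thesis by simp
  qed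
  ultimately show ?thesis
    by (simp add: child_mass_measure)
qed

lemma sech_exp_child_measure:
  assumes "0 \<le> b"
  shows "sech ((b + x) / 2) ^ 2 * exp (- measure (child_intensity x b) UNIV) = exp (- b) * sech (x / 2) ^ 2"
proof -
  have sq: "exp (2 * ln (cosh u)) = cosh u ^ 2" for u :: real
    by (simp add: exp_double)
  have "- measure (child_intensity x b) UNIV = - b + 2 * ln (cosh ((b + x) / 2)) - 2 * ln (cosh (x / 2))"
    unfolding child_measure[OF assms] by simp
  then have "exp (- measure (child_intensity x b) UNIV) = exp (- b) * (cosh ((b + x) / 2) ^ 2 / cosh (x / 2) ^ 2)"
    by (simp only: exp_add exp_diff sq times_divide_eq_right)
  then show ?thesis
    by (simp add: sech_def power_divide)
qed

text \<open>
  With the factor \<open>sech (b/2)\<^sup>2\<close> the recursion for the law takes the exponential form of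
  \<open>tree_weight_fixed_point\<close>: the same factor occurs in the intensity of the ages of children,
  where the weight of the subtree absorbs it, and the total intensity contributes \<open>exp (- b)\<close>.
\<close>

definition tree_weight :: "real \<Rightarrow> (aged_tree \<Rightarrow> ennreal) \<Rightarrow> ennreal" where
  "tree_weight b f = ennreal (sech (b / 2) ^ 2) * (\<integral>\<^sup>+T. f T \<partial>gw_law 0 b)"

abbreviation offspring :: "real \<Rightarrow> (real \<times> aged_tree) measure" where
  "offspring b \<equiv> offspring_intensity 0 (gw_law 0) b"

lemma sets_offspring: "sets (offspring b) = sets edge_space"
  by (rule sets_offspring_intensity) measurable

lemma finite_offspring: "finite_full_measure (offspring b)"
  by (rule finite_offspring_intensity) measurable

lemma multiset_space_offspring: "multiset_space (offspring b) = multiset_space edge_space"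
  by (rule multiset_space_cong[OF sets_offspring])

lemma measurable_offspring: "borel_measurable (offspring b) = borel_measurable edge_space"
  by (rule measurable_cong_sets[OF sets_offspring refl])

lemma tree_weight_fixed_point:
  assumes "0 \<le> b" "f \<in> borel_measurable tree_space"
  shows "tree_weight b f = ennreal (exp (- b)) * poisson_int (offspring b) (\<lambda>C. f (Vertex b C))"
  unfolding tree_weight_def gw_law_fixed_point[OF assms(2)] mult.assoc[symmetric]
  using sech_exp_child_measure[OF assms(1), of 0] by (simp add: ennreal_mult[symmetric] sech_def)

lemma child_density_half: "ennreal (child_density x a) = ennreal (1 / 2) * ennreal (sech ((a + x) / 2) ^ 2)"
  by (subst ennreal_mult[symmetric]) (simp_all add: child_density_def)

lemma nn_integral_offspring:
  assumes f: "f \<in> borel_measurable edge_space"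
  shows "(\<integral>\<^sup>+p. f p \<partial>offspring b) =
    (\<integral>\<^sup>+a. indicator {0..} a * (\<integral>\<^sup>+e. indicator {0..min b a} e * (ennreal (1 / 2) * tree_weight a (\<lambda>T. f (e, T))) \<partial>lborel) \<partial>lborel)"
proof -
  note f[measurable]
  have m[measurable]: "(\<lambda>e. \<integral>\<^sup>+T. f (e, T) \<partial>gw_law 0 a) \<in> borel_measurable borel" for a
    by (rule nn_integral_measurable_subprob_algebra2) measurable
  show ?thesis
    unfolding nn_integral_offspring_intensity[OF measurable_gw_law f]
  proof (rule nn_integral_cong)
    fix a :: real
    have half: "ennreal (1 / 2) * ennreal (sech (a / 2) ^ 2) = ennreal (child_density 0 a)"
      by (simp only: child_density_half[of 0 a] add_0_right)
    have "indicator {0..min b a} e * (ennreal (1 / 2) * tree_weight a (\<lambda>T. f (e, T))) =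
       ennreal (child_density 0 a) * (indicator {0..min b a} e * (\<integral>\<^sup>+T. f (e, T) \<partial>gw_law 0 a))" for e
      unfolding tree_weight_def mult.assoc[symmetric] half[symmetric] by (simp only: mult_ac)
    then have "(\<integral>\<^sup>+e. indicator {0..min b a} e * (ennreal (1 / 2) * tree_weight a (\<lambda>T. f (e, T))) \<partial>lborel) =
      ennreal (child_density 0 a) * (\<integral>\<^sup>+e. indicator {0..min b a} e * (\<integral>\<^sup>+T. f (e, T) \<partial>gw_law 0 a) \<partial>lborel)"
      by (simp add: nn_integral_cmult)
    then show "ennreal (child_density 0 a) * indicator {0..} a * (\<integral>\<^sup>+e. indicator {0..min b a} e * (\<integral>\<^sup>+T. f (e, T) \<partial>gw_law 0 a) \<partial>lborel) =
      indicator {0..} a * (\<integral>\<^sup>+e. indicator {0..min b a} e * (ennreal (1 / 2) * tree_weight a (\<lambda>T. f (e, T))) \<partial>lborel)"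
      by (simp add: mult_ac)
  qed
qed

lemma tree_weight_cong: "(\<And>T. f T = g T) \<Longrightarrow> tree_weight b f = tree_weight b g"
  by (simp add: tree_weight_def)

lemma tree_weight_cmult:
  "f \<in> borel_measurable tree_space \<Longrightarrow> tree_weight b (\<lambda>T. c * f T) = c * tree_weight b f"
  unfolding tree_weight_def by (subst nn_integral_cmult) (auto simp: measurable_cong_sets[OF sets_gw_law refl] mult_ac)

lemma tree_weight_add:
  "f \<in> borel_measurable tree_space \<Longrightarrow> g \<in> borel_measurable tree_space \<Longrightarrow>
   tree_weight b (\<lambda>T. f T + g T) = tree_weight b f + tree_weight b g"
  unfolding tree_weight_def by (subst nn_integral_add) (auto simp: measurable_cong_sets[OF sets_gw_law refl] distrib_left)

lemma tree_weight_SUP: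
  "(\<And>n. f n \<in> borel_measurable tree_space) \<Longrightarrow> incseq f \<Longrightarrow> tree_weight b (\<lambda>T. SUP n. f n T) = (SUP n. tree_weight b (f n))"
  unfolding tree_weight_def
  by (subst nn_integral_monotone_convergence_SUP) (auto simp: measurable_cong_sets[OF sets_gw_law refl] SUP_mult_left_ennreal)

lemma tree_weight_mono: "(\<And>T. f T \<le> g T) \<Longrightarrow> tree_weight b f \<le> tree_weight b g"
  unfolding tree_weight_def by (intro mult_left_mono nn_integral_mono) auto

lemma borel_measurable_tree_weight [measurable (raw)]:
  assumes g[measurable]: "g \<in> borel_measurable N" and f[measurable]: "(\<lambda>(x, T). f x T :: ennreal) \<in> borel_measurable (N \<Otimes>\<^sub>M tree_space)"
  shows "(\<lambda>x. tree_weight (g x) (f x)) \<in> borel_measurable N"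
  unfolding tree_weight_def
proof (rule borel_measurable_times_ennreal)
  show "(\<lambda>x. \<integral>\<^sup>+T. f x T \<partial>gw_law 0 (g x)) \<in> borel_measurable N"
    by (rule nn_integral_measurable_subprob_algebra2[OF f]) measurable
qed measurable

lemma SUP_size_truncation:
  fixes f :: "aged_tree \<Rightarrow> ennreal"
  shows "(SUP m. f T * indicator {T. num_vertices T \<le> m} T) = f T"
proof (rule antisym)
  show "(SUP m. f T * indicator {T. num_vertices T \<le> m} T) \<le> f T"
    by (intro SUP_least) (simp add: indicator_def)
  show "f T \<le> (SUP m. f T * indicator {T. num_vertices T \<le> m} T)"
    by (rule SUP_upper2[of "num_vertices T"]) auto
qed

lemma incseq_size_truncation:
  fixes f :: "aged_tree \<Rightarrow> ennreal"
  shows "incseq (\<lambda>m T. f T * indicator {T. num_vertices T \<le> m} T)"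
  by (auto simp: incseq_def le_fun_def indicator_def)

lemma num_vertices_le_set [measurable]: "{T. num_vertices T \<le> m} \<in> sets tree_space"
proof -
  have "{T \<in> space tree_space. num_vertices T \<le> m} \<in> sets tree_space" by measurable
  then show ?thesis by simp
qed

lemma measurable_size_truncation [measurable]:
  "f \<in> borel_measurable tree_space \<Longrightarrow> (\<lambda>T. f T * indicator {T. num_vertices T \<le> m} T :: ennreal) \<in> borel_measurable tree_space"
  by (intro borel_measurable_times_ennreal borel_measurable_indicator num_vertices_le_set)

lemma num_vertices_child_less: "p \<in># C \<Longrightarrow> num_vertices (snd p) < num_vertices (Vertex b C)"
proof -
  assume "p \<in># C"
  then obtain D where "C = add_mset p D" by (meson mset_add)
  then show ?thesis by (simp add: num_vertices_eq[of "Vertex b C"])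
qed

text \<open>
  By \<open>sech_exp_child_measure\<close>, the recursions for both sides have the same factor \<open>exp (- b)\<close>,
  up to one factor \<open>sech (x/2)\<^sup>2\<close> for the root, and by induction on the size the intensities of
  children differ by the density \<open>sech (x/2)\<^sup>2 ^ |T|\<close>.
\<close>

lemma gw_law_tilt_bounded:
  assumes "\<And>T. m < num_vertices T \<Longrightarrow> f T = 0" "f \<in> borel_measurable tree_space" "0 \<le> b"
  shows "ennreal (sech ((b + x) / 2) ^ 2) * (\<integral>\<^sup>+T. f T \<partial>gw_law x b) =
     tree_weight b (\<lambda>T. ennreal ((sech (x / 2) ^ 2) ^ num_vertices T) * f T)"
  using assms
proof (induction m arbitrary: f b)
  case 0
  then have "f = (\<lambda>_. 0)" by auto
  then show ?case by (simp add: tree_weight_def)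
next
  case (Suc m f b)
  note f[measurable] = Suc.prems(2)
  define z where "z = sech (x / 2) ^ 2"
  have z: "0 < z" unfolding z_def by (rule zero_less_power) simp
  let ?N = "offspring b" and ?N' = "offspring_intensity x (gw_law x) b"
  let ?g = "\<lambda>p. ennreal (z ^ num_vertices (snd p))"
  have sN': "sets ?N' = sets edge_space"
    by (rule sets_offspring_intensity) measurable
  have msN': "multiset_space ?N' = multiset_space edge_space"
    by (rule multiset_space_cong[OF sN'])
  have [measurable]: "?g \<in> borel_measurable edge_space" by measurable
  let ?G = "\<lambda>C. ennreal (z ^ (num_vertices (Vertex 0 C) - 1))"
  have V0: "num_vertices (Vertex b C) = Suc (num_vertices (Vertex 0 C) - 1)" for b C
    by (simp add: num_vertices_eq[of "Vertex _ C"])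
  have "poisson_int ?N' (\<lambda>C. f (Vertex b C)) = poisson_int ?N (\<lambda>C. ?G C * f (Vertex b (image_mset (\<lambda>p. p) C)))"
  proof (rule poisson_int_transform[where g = ?g and S = "{p. num_vertices (snd p) \<le> m}"])
    show "finite_full_measure ?N" by (rule finite_offspring)
    show "finite_full_measure ?N'" by (rule finite_offspring_intensity) measurable
    show "(\<lambda>p. p) \<in> ?N \<rightarrow>\<^sub>M ?N'" by (rule measurable_ident_sets) (simp add: sN' sets_offspring)
    show "?g \<in> borel_measurable ?N" unfolding measurable_offspring by measurable
    show "?G \<in> borel_measurable (multiset_space ?N)" unfolding multiset_space_offspring by measurable
    show "?G {#} = 1" by simp
    show "?G (add_mset p C) = ?g p * ?G C" for p C
      using z by (simp add: num_vertices_eq[of "Vertex _ _"] power_add ennreal_mult[symmetric])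
    show "(\<lambda>C. f (Vertex b C)) \<in> borel_measurable (multiset_space ?N')"
      unfolding msN' by measurable
    show "f (Vertex b C) = 0" if "\<not> set_mset C \<subseteq> {p. num_vertices (snd p) \<le> m}" for C
    proof -
      from that obtain p where "p \<in># C" "m < num_vertices (snd p)"
        by (auto simp: subset_iff not_le)
      then show ?thesis
        using num_vertices_child_less[of p C b] by (intro Suc.prems(1)) linarith
    qed
    fix h :: "real \<times> aged_tree \<Rightarrow> ennreal"
    assume "h \<in> borel_measurable ?N'" and h0: "\<And>p. p \<notin> {p. num_vertices (snd p) \<le> m} \<Longrightarrow> h p = 0"
    then have h[measurable]: "h \<in> borel_measurable edge_space"
      unfolding measurable_cong_sets[OF sN' refl] by simp
    have hm[measurable]: "(\<lambda>e. \<integral>\<^sup>+T. h (e, T) \<partial>gw_law x a) \<in> borel_measurable borel" for a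
      by (rule nn_integral_measurable_subprob_algebra2) measurable
    have gh: "(\<lambda>p. ?g p * h p) \<in> borel_measurable edge_space" by measurable
    show "(\<integral>\<^sup>+p. h p \<partial>?N') = (\<integral>\<^sup>+p. ?g p * h p \<partial>?N)"
      unfolding nn_integral_offspring[OF gh] nn_integral_offspring_intensity[OF measurable_gw_law h]
    proof (rule nn_integral_cong)
      fix a :: real
      show "ennreal (child_density x a) * indicator {0..} a * (\<integral>\<^sup>+e. indicator {0..min b a} e * (\<integral>\<^sup>+T. h (e, T) \<partial>gw_law x a) \<partial>lborel) =
         indicator {0..} a * (\<integral>\<^sup>+e. indicator {0..min b a} e * (ennreal (1 / 2) * tree_weight a (\<lambda>T. ?g (e, T) * h (e, T))) \<partial>lborel)"
      proof (cases "0 \<le> a")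
        case True
        have "ennreal (1 / 2) * tree_weight a (\<lambda>T. ?g (e, T) * h (e, T)) = ennreal (child_density x a) * (\<integral>\<^sup>+T. h (e, T) \<partial>gw_law x a)" for e
        proof -
          have "ennreal (sech ((a + x) / 2) ^ 2) * (\<integral>\<^sup>+T. h (e, T) \<partial>gw_law x a) = tree_weight a (\<lambda>T. ?g (e, T) * h (e, T))"
            using Suc.IH[of "\<lambda>T. h (e, T)" a] True h0 by (simp add: z_def)
          then show ?thesis
            by (simp only: child_density_half mult.assoc)
        qed
        then have "(\<integral>\<^sup>+e. indicator {0..min b a} e * (ennreal (1 / 2) * tree_weight a (\<lambda>T. ?g (e, T) * h (e, T))) \<partial>lborel) =
          (\<integral>\<^sup>+e. ennreal (child_density x a) * (indicator {0..min b a} e * (\<integral>\<^sup>+T. h (e, T) \<partial>gw_law x a)) \<partial>lborel)"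
          by (simp add: mult_ac)
        also have "\<dots> = ennreal (child_density x a) * (\<integral>\<^sup>+e. indicator {0..min b a} e * (\<integral>\<^sup>+T. h (e, T) \<partial>gw_law x a) \<partial>lborel)"
          by (rule nn_integral_cmult) measurable
        finally show ?thesis by (simp add: mult_ac)
      qed simp
    qed
  qed
  then have "ennreal (sech ((b + x) / 2) ^ 2) * (\<integral>\<^sup>+T. f T \<partial>gw_law x b) =
     ennreal (sech ((b + x) / 2) ^ 2 * exp (- measure (child_intensity x b) UNIV)) * poisson_int ?N (\<lambda>C. ?G C * f (Vertex b C))"
    unfolding gw_law_fixed_point[OF f] by (simp add: ennreal_mult mult.assoc)
  also have "\<dots> = ennreal (exp (- b)) * (ennreal z * poisson_int ?N (\<lambda>C. ?G C * f (Vertex b C)))"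
    unfolding sech_exp_child_measure[OF Suc.prems(3)] z_def by (simp add: ennreal_mult mult.assoc)
  also have "ennreal z * poisson_int ?N (\<lambda>C. ?G C * f (Vertex b C)) = poisson_int ?N (\<lambda>C. ennreal z * (?G C * f (Vertex b C)))"
    by (rule finite_full_measure.poisson_int_cmult[OF finite_offspring, symmetric])
       (unfold multiset_space_offspring, measurable)
  also have "(\<lambda>C. ennreal z * (?G C * f (Vertex b C))) = (\<lambda>C. ennreal (z ^ num_vertices (Vertex b C)) * f (Vertex b C))"
    using z by (intro ext) (subst V0, simp add: ennreal_mult mult.assoc)
  also have "ennreal (exp (- b)) * poisson_int ?N (\<lambda>C. ennreal (z ^ num_vertices (Vertex b C)) * f (Vertex b C)) =
     tree_weight b (\<lambda>T. ennreal (z ^ num_vertices T) * f T)"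
    by (rule tree_weight_fixed_point[symmetric]) (use Suc.prems in measurable)
  finally show ?case by (simp only: z_def)
qed

lemma gw_law_tilt:
  assumes f[measurable]: "f \<in> borel_measurable tree_space" and b: "0 \<le> b"
  shows "ennreal (sech ((b + x) / 2) ^ 2) * (\<integral>\<^sup>+T. f T \<partial>gw_law x b) =
     tree_weight b (\<lambda>T. ennreal ((sech (x / 2) ^ 2) ^ num_vertices T) * f T)"
proof -
  let ?f = "\<lambda>m T. f T * indicator {T. num_vertices T \<le> m} T"
  have "(\<integral>\<^sup>+T. f T \<partial>gw_law x b) = (\<integral>\<^sup>+T. (SUP m. ?f m T) \<partial>gw_law x b)"
    by (simp only: SUP_size_truncation)
  also have "\<dots> = (SUP m. \<integral>\<^sup>+T. ?f m T \<partial>gw_law x b)"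
    by (rule nn_integral_monotone_convergence_SUP[OF incseq_size_truncation])
       (unfold measurable_cong_sets[OF sets_gw_law refl], measurable)
  finally have "ennreal (sech ((b + x) / 2) ^ 2) * (\<integral>\<^sup>+T. f T \<partial>gw_law x b) =
     (SUP m. ennreal (sech ((b + x) / 2) ^ 2) * (\<integral>\<^sup>+T. ?f m T \<partial>gw_law x b))"
    by (simp only: SUP_mult_left_ennreal)
  also have "\<dots> = (SUP m. tree_weight b (\<lambda>T. ennreal ((sech (x / 2) ^ 2) ^ num_vertices T) * ?f m T))"
  proof (rule SUP_cong[OF refl])
    fix m
    show "ennreal (sech ((b + x) / 2) ^ 2) * (\<integral>\<^sup>+T. ?f m T \<partial>gw_law x b) =
        tree_weight b (\<lambda>T. ennreal ((sech (x / 2) ^ 2) ^ num_vertices T) * ?f m T)"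
      by (rule gw_law_tilt_bounded[of m]) (use b in auto)
  qed
  also have "\<dots> = tree_weight b (\<lambda>T. SUP m. ennreal ((sech (x / 2) ^ 2) ^ num_vertices T) * ?f m T)"
    by (rule tree_weight_SUP[symmetric]) (measurable, auto simp: incseq_def le_fun_def indicator_def)
  also have "\<dots> = tree_weight b (\<lambda>T. ennreal ((sech (x / 2) ^ 2) ^ num_vertices T) * f T)"
    by (rule tree_weight_cong) (subst SUP_mult_left_ennreal[symmetric], subst SUP_size_truncation, rule refl)
  finally show ?thesis .
qed

section \<open>Extinction and the generating function of the size\<close>

text \<open>
  Let \<open>p b\<close> be the probability of survival and \<open>K\<close> the mean operator of one generation. As
  \<open>1 - exp (- u) \<le> u\<close>, \<open>p \<le> K p\<close>. The function \<open>\<mu> b = tanh ((b + x)/2) / tanh (x/2)\<close> satisfies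
  \<open>K \<mu> = \<mu> - 1\<close> (it is the mean total progeny) and is bounded by \<open>1 / tanh (x/2)\<close>, so that
  \<open>K \<mu> \<le> (1 - tanh (x/2)) \<mu>\<close>. Iterating \<open>p \<le> K p\<close> from \<open>p \<le> \<mu>\<close> gives \<open>p = 0\<close>.
\<close>

lemma gw_law_extinct:
  assumes x: "0 < x" and b: "0 \<le> b"
  shows "emeasure (gw_law x b) UNIV = 1"
proof -
  define y where "y a = measure (gw_law x a) UNIV" for a
  define p where "p a = 1 - y a" for a
  have sub: "subprob_space (gw_law x a)" for a
    by (rule subprob_space_kernel[OF measurable_gw_law]) simp
  have y_emeasure: "emeasure (gw_law x a) UNIV = ennreal (y a)" for a
  proof -
    interpret subprob_space "gw_law x a" by (rule sub)
    show ?thesis by (simp add: y_def emeasure_eq_measure)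
  qed
  have y01: "0 \<le> y a" "y a \<le> 1" for a
    using subprob_space.subprob_measure_le_1[OF sub] by (auto simp: y_def)
  have p01: "0 \<le> p a" "p a \<le> 1" for a
    using y01[of a] by (auto simp: p_def)
  have y_meas[measurable]: "y \<in> borel_measurable borel"
    unfolding y_def using sets.top[of tree_space]
    by (intro measurable_compose[OF measurable_gw_law measurable_measure_subprob_algebra]) simp
  then have [measurable]: "p \<in> borel_measurable borel"
    unfolding p_def by measurable
  define K where "K u b = (\<integral>\<^sup>+a. ennreal (child_density x a) * indicator {0..} a * (\<integral>\<^sup>+e. indicator {0..min b a} e * u a \<partial>lborel) \<partial>lborel)" for u :: "real \<Rightarrow> ennreal" and b
  have K_eq: "K u b = (\<integral>\<^sup>+e. indicator {0..b} e * (\<integral>\<^sup>+a. ennreal (child_density x a) * indicator {e..} a * u a \<partial>lborel) \<partial>lborel)"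
    if "u \<in> borel_measurable borel" for u b
    unfolding K_def using child_swap[of "\<lambda>a e. u a" "\<lambda>a. ennreal (child_density x a)" b] that by measurable
  have K_mass: "K (\<lambda>_. 1) b = child_mass x b" for b
    unfolding K_def child_mass_swap by simp
  have K_add: "K (\<lambda>a. u a + v a) b = K u b + K v b"
    if [measurable]: "u \<in> borel_measurable borel" "v \<in> borel_measurable borel" for u v b
  proof -
    have m: "(\<lambda>e. \<integral>\<^sup>+a. ennreal (child_density x a) * indicator {e..} a * w a \<partial>lborel) \<in> borel_measurable borel"
      if [measurable]: "w \<in> borel_measurable borel" for w
    proof -
      have [measurable]: "(\<lambda>(e, a). indicator {a. e \<le> a} a :: ennreal) \<in> borel_measurable (borel \<Otimes>\<^sub>M (borel :: real measure))"
        unfolding indicator_def by measurable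
      have "(\<lambda>e. \<integral>\<^sup>+a. ennreal (child_density x a) * indicator {a. e \<le> a} a * w a \<partial>lborel) \<in> borel_measurable borel"
        by measurable
      then show ?thesis by (simp add: atLeast_def)
    qed
    have "(\<integral>\<^sup>+a. ennreal (child_density x a) * indicator {e..} a * (u a + v a) \<partial>lborel) =
        (\<integral>\<^sup>+a. ennreal (child_density x a) * indicator {e..} a * u a \<partial>lborel) +
        (\<integral>\<^sup>+a. ennreal (child_density x a) * indicator {e..} a * v a \<partial>lborel)" for e
      by (subst nn_integral_add[symmetric]) (auto simp: distrib_left)
    then show ?thesis
      using m[of u] m[of v] by (subst (1 2 3) K_eq) (auto simp: distrib_left nn_integral_add)
  qed
  have le_K: "ennreal (p b) \<le> K (\<lambda>a. ennreal (p a)) b" for b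
  proof -
    let ?L = "offspring_intensity x (gw_law x) b"
    interpret L: finite_full_measure ?L by (rule finite_offspring_intensity) measurable
    define m where "m = measure (child_intensity x b) UNIV"
    define l where "l = measure ?L UNIV"
    have "ennreal (y b) = (\<integral>\<^sup>+T. 1 \<partial>gw_law x b)"
      by (simp add: y_emeasure)
    also have "\<dots> = ennreal (exp (- m)) * poisson_int ?L (\<lambda>C. 1)"
      unfolding m_def by (rule gw_law_fixed_point) simp
    also have "\<dots> = ennreal (exp (l - m))"
      by (simp add: L.poisson_int_1 l_def ennreal_mult[symmetric] mult_exp_exp)
    finally have yb: "y b = exp (l - m)"
      using y01 by simp
    have "ennreal l = (\<integral>\<^sup>+p. 1 \<partial>?L)"
      by (simp add: l_def L.emeasure_eq_measure L.space_full)
    also have "\<dots> = K (\<lambda>a. ennreal (y a)) b"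
      unfolding K_def by (subst nn_integral_offspring_intensity[OF measurable_gw_law]) (simp_all add: y_emeasure)
    finally have "ennreal l + K (\<lambda>a. ennreal (p a)) b = K (\<lambda>a. ennreal (y a) + ennreal (p a)) b"
      by (simp add: K_add)
    also have "(\<lambda>a. ennreal (y a) + ennreal (p a)) = (\<lambda>_. 1)"
      using y01 p01 by (auto simp: ennreal_plus[symmetric] p_def simp del: ennreal_plus)
    finally have sum: "ennreal l + K (\<lambda>a. ennreal (p a)) b = ennreal m"
      by (simp add: K_mass child_mass_measure m_def)
    have "K (\<lambda>a. ennreal (p a)) b \<noteq> \<top>"
    proof
      assume "K (\<lambda>a. ennreal (p a)) b = \<top>"
      with sum show False by simp
    qed
    then obtain r where r: "0 \<le> r" "K (\<lambda>a. ennreal (p a)) b = ennreal r"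
      by (cases "K (\<lambda>a. ennreal (p a)) b") auto
    then have "l + r = m"
      using sum by (simp add: l_def m_def ennreal_plus[symmetric] del: ennreal_plus)
    then have "p b \<le> r"
      unfolding p_def yb using exp_ge_add_one_self[of "l - m"] by linarith
    then show ?thesis by (simp add: r ennreal_leI)
  qed
  define t where "t = tanh (x / 2)"
  have t: "0 < t" "t < 1"
    using x tanh_real_lt_1[of "x / 2"] by (auto simp: t_def)
  define \<mu> where "\<mu> a = tanh ((a + x) / 2) / t" for a
  have \<mu>_ge: "1 \<le> \<mu> a" if "0 \<le> a" for a
    using that t by (simp add: \<mu>_def t_def)
  have \<mu>_meas[measurable]: "\<mu> \<in> borel_measurable borel"
    unfolding \<mu>_def by (intro borel_measurable_continuous_onI continuous_intros) (use t in auto)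
  have inner: "(\<integral>\<^sup>+a. ennreal (child_density x a) * indicator {e..} a * ennreal (\<mu> a) \<partial>lborel) = ennreal ((1 - tanh ((e + x) / 2) ^ 2) / (2 * t))"
    if "0 \<le> e" for e
  proof -
    have "(\<integral>\<^sup>+a. ennreal (child_density x a) * indicator {e..} a * ennreal (\<mu> a) \<partial>lborel) =
       (\<integral>\<^sup>+a. ennreal (child_density x a * \<mu> a) * indicator {e..} a \<partial>lborel)"
      by (intro nn_integral_cong) (auto simp: indicator_def ennreal_mult')
    also have "\<dots> = ennreal (1 / (2 * t) - tanh ((e + x) / 2) ^ 2 / (2 * t))"
    proof (rule nn_integral_FTC_atLeast)
      show "((\<lambda>a. tanh ((a + x) / 2) ^ 2 / (2 * t)) has_real_derivative child_density x a * \<mu> a) (at a)" for a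
        unfolding child_density_eq \<mu>_def using t by (auto intro!: derivative_eq_intros simp: field_simps)
      show "0 \<le> child_density x a * \<mu> a" if "e \<le> a" for a
        using \<mu>_ge[of a] that \<open>0 \<le> e\<close> by (intro mult_nonneg_nonneg) auto
      have "((\<lambda>a. tanh ((a + x) / 2)) \<longlongrightarrow> 1) at_top"
      proof (rule filterlim_compose[OF tanh_real_at_top])
        show "filterlim (\<lambda>a. (a + x) / 2) at_top at_top"
          unfolding filterlim_at_top
        proof
          fix Z :: real
          show "\<forall>\<^sub>F a in at_top. Z \<le> (a + x) / 2"
            by (rule eventually_at_top_linorderI[of "2 * Z - x"]) (simp add: field_simps)
        qed
      qed
      then have "((\<lambda>a. tanh ((a + x) / 2) ^ 2 / (2 * t)) \<longlongrightarrow> 1 ^ 2 / (2 * t)) at_top"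
        using t by (intro tendsto_intros) auto
      then show "((\<lambda>a. tanh ((a + x) / 2) ^ 2 / (2 * t)) \<longlongrightarrow> 1 / (2 * t)) at_top" by simp
    qed measurable
    finally show ?thesis by (simp add: diff_divide_distrib)
  qed
  have K\<mu>: "K (\<lambda>a. ennreal (\<mu> a)) b = ennreal (\<mu> b - 1)" if "0 \<le> b" for b
  proof -
    have "K (\<lambda>a. ennreal (\<mu> a)) b = (\<integral>\<^sup>+e. ennreal ((1 - tanh ((e + x) / 2) ^ 2) / (2 * t)) * indicator {0..b} e \<partial>lborel)"
    proof (subst K_eq, measurable, rule nn_integral_cong)
      fix e :: real
      show "indicator {0..b} e * (\<integral>\<^sup>+a. ennreal (child_density x a) * indicator {e..} a * ennreal (\<mu> a) \<partial>lborel) =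
          ennreal ((1 - tanh ((e + x) / 2) ^ 2) / (2 * t)) * indicator {0..b} e"
        using inner[of e] by (cases "0 \<le> e") (simp_all only: mult.commute[of "indicator {0..b} e"], simp)
    qed
    also have "\<dots> = ennreal (\<mu> b - \<mu> 0)"
    proof (rule nn_integral_FTC_Icc)
      show "(\<mu> has_real_derivative (1 - tanh ((e + x) / 2) ^ 2) / (2 * t)) (at e)" for e
        unfolding \<mu>_def using t by (auto intro!: derivative_eq_intros simp: field_simps)
      show "0 \<le> (1 - tanh ((e + x) / 2) ^ 2) / (2 * t)" for e
        using t child_density_nonneg[of x e] by (simp add: child_density_eq)
      show "(\<lambda>e. (1 - tanh ((e + x) / 2) ^ 2) / (2 * t)) \<in> borel_measurable borel"
        using t by (intro borel_measurable_continuous_onI continuous_intros) auto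
    qed fact
    finally show ?thesis using t by (simp add: \<mu>_def t_def)
  qed
  have bound: "p b \<le> (1 - t) ^ n * \<mu> b" if "0 \<le> b" for n b
    using that
  proof (induction n arbitrary: b)
    case 0
    then show ?case using p01[of b] \<mu>_ge[of b] by simp
  next
    case (Suc n b)
    have "ennreal (p b) \<le> K (\<lambda>a. ennreal (p a)) b" by (rule le_K)
    also have "\<dots> \<le> (\<integral>\<^sup>+a. ennreal ((1 - t) ^ n) * (ennreal (child_density x a) * indicator {0..} a * (\<integral>\<^sup>+e. indicator {0..min b a} e * ennreal (\<mu> a) \<partial>lborel)) \<partial>lborel)"
      unfolding K_def
    proof (rule nn_integral_mono)
      fix a :: real
      show "ennreal (child_density x a) * indicator {0..} a * (\<integral>\<^sup>+e. indicator {0..min b a} e * ennreal (p a) \<partial>lborel) \<le>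
        ennreal ((1 - t) ^ n) * (ennreal (child_density x a) * indicator {0..} a * (\<integral>\<^sup>+e. indicator {0..min b a} e * ennreal (\<mu> a) \<partial>lborel))"
      proof (cases "0 \<le> a")
        case True
        have "ennreal (p a) \<le> ennreal ((1 - t) ^ n) * ennreal (\<mu> a)"
          using Suc.IH[OF True] t \<mu>_ge[OF True] by (simp add: ennreal_mult[symmetric] ennreal_leI)
        then have "(\<integral>\<^sup>+e. indicator {0..min b a} e * ennreal (p a) \<partial>lborel) \<le>
          (\<integral>\<^sup>+e. ennreal ((1 - t) ^ n) * (indicator {0..min b a} e * ennreal (\<mu> a)) \<partial>lborel)"
          by (intro nn_integral_mono) (auto simp: indicator_def)
        also have "\<dots> = ennreal ((1 - t) ^ n) * (\<integral>\<^sup>+e. indicator {0..min b a} e * ennreal (\<mu> a) \<partial>lborel)"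
          by (rule nn_integral_cmult) simp
        finally show ?thesis
          unfolding mult.left_commute[of "ennreal ((1 - t) ^ n)"] by (rule mult_left_mono) simp
      qed simp
    qed
    also have "\<dots> = ennreal ((1 - t) ^ n) * K (\<lambda>a. ennreal (\<mu> a)) b"
      unfolding K_def
    proof (rule nn_integral_cmult)
      have "(\<integral>\<^sup>+e. indicator {0..min b a} e * ennreal (\<mu> a) \<partial>lborel) = emeasure lborel {0..min b a} * ennreal (\<mu> a)" for a
        by (simp add: nn_integral_multc)
      then show "(\<lambda>a. ennreal (child_density x a) * indicator {0..} a * (\<integral>\<^sup>+e. indicator {0..min b a} e * ennreal (\<mu> a) \<partial>lborel)) \<in> borel_measurable lborel"
        by (simp add: emeasure_lborel_Icc_eq)
    qed
    also have "\<dots> = ennreal ((1 - t) ^ n * (\<mu> b - 1))"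
      using t \<mu>_ge[OF Suc.prems] by (simp add: K\<mu>[OF Suc.prems] ennreal_mult)
    finally have "p b \<le> (1 - t) ^ n * (\<mu> b - 1)"
      using t \<mu>_ge[OF Suc.prems] by (simp add: ennreal_le_iff)
    also have "\<dots> \<le> (1 - t) ^ n * ((1 - t) * \<mu> b)"
    proof (intro mult_left_mono)
      have "t * \<mu> b \<le> 1" using t tanh_real_lt_1[of "(b + x) / 2"] by (simp add: \<mu>_def)
      then show "\<mu> b - 1 \<le> (1 - t) * \<mu> b" by (simp add: algebra_simps)
    qed (use t in auto)
    finally show ?case by (simp add: mult_ac)
  qed
  have "(\<lambda>n. (1 - t) ^ n * \<mu> b) \<longlonglongrightarrow> 0 * \<mu> b"
    using t by (intro tendsto_mult LIMSEQ_power_zero tendsto_const) auto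
  then have "p b \<le> 0 * \<mu> b"
    by (rule LIMSEQ_le_const) (use bound[OF b] in auto)
  then show ?thesis
    using y01[of b] by (simp add: y_emeasure p_def)
qed

lemma prob_space_gw_law: "0 < x \<Longrightarrow> 0 \<le> b \<Longrightarrow> prob_space (gw_law x b)"
  using gw_law_extinct[of x b] by (intro prob_spaceI) simp

lemma tree_weight_power:
  assumes "0 < x" "0 \<le> b"
  shows "tree_weight b (\<lambda>T. ennreal ((sech (x / 2) ^ 2) ^ num_vertices T)) = ennreal (sech ((b + x) / 2) ^ 2)"
  using gw_law_tilt[of "\<lambda>_. 1" b x] gw_law_extinct[OF assms] assms by simp

lemma sech_le_1: "sech u ^ 2 \<le> 1"
  by (simp add: sech_squared)

lemma continuous_sech: "continuous_on A sech"
  unfolding sech_def by (intro continuous_intros) auto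

text \<open>
  The limit \<open>x \<rightarrow> 0\<close> of \<open>tree_weight_power\<close>, which shows that the critical tree is finite too.
\<close>

lemma tree_weight_1:
  assumes b: "0 \<le> b"
  shows "tree_weight b (\<lambda>_. 1) = ennreal (sech (b / 2) ^ 2)"
proof (rule antisym)
  interpret subprob_space "gw_law 0 b" by (rule subprob_space_kernel[OF measurable_gw_law]) simp
  show "tree_weight b (\<lambda>_. 1) \<le> ennreal (sech (b / 2) ^ 2)"
    using subprob_emeasure_le_1[of UNIV] by (simp add: tree_weight_def mult_left_le)
  have "ennreal (sech ((b + x) / 2) ^ 2) \<le> tree_weight b (\<lambda>_. 1)" if "0 < x" for x
    unfolding tree_weight_power[OF that b, symmetric]
    by (rule tree_weight_mono) (auto intro!: power_le_one sech_le_1)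
  then have "\<forall>\<^sub>F x in at_right 0. ennreal (sech ((b + x) / 2) ^ 2) \<le> tree_weight b (\<lambda>_. 1)"
    by (auto simp: eventually_at_filter)
  moreover have "((\<lambda>x. ennreal (sech ((b + x) / 2) ^ 2)) \<longlongrightarrow> ennreal (sech ((b + 0) / 2) ^ 2)) (at_right 0)"
  proof -
    have "continuous_on UNIV (\<lambda>x. sech ((b + x) / 2))"
      by (rule continuous_on_compose2[OF continuous_sech[of UNIV]]) (auto intro!: continuous_intros)
    then have "isCont (\<lambda>x. sech ((b + x) / 2)) 0"
      by (simp add: continuous_on_eq_continuous_at)
    then have "((\<lambda>x. sech ((b + x) / 2)) \<longlongrightarrow> sech ((b + 0) / 2)) (at_right 0)"
      by (auto simp: isCont_def intro: filterlim_mono[OF _ order_refl at_le])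
    then show ?thesis by (intro tendsto_intros)
  qed
  ultimately show "ennreal (sech (b / 2) ^ 2) \<le> tree_weight b (\<lambda>_. 1)"
    by (intro tendsto_upperbound[of "\<lambda>x. ennreal (sech ((b + x) / 2) ^ 2)" _ "at_right 0"]) auto
qed

text \<open>
  Its distribution function is \<open>tanh (y/2)\<close> on \<open>[0, \<infinity>)\<close>.
\<close>

lemma root_age_law_0: "root_age_law 0 = density lborel (\<lambda>a. ennreal (child_density 0 a) * indicator {0..} a)"
proof -
  define F where "F y = tanh (max 0 y / 2)" for y :: real
  have "root_age_law 0 = interval_measure F"
    unfolding root_age_law_def F_def by (rule arg_cong[where f = interval_measure]) (auto simp: fun_eq_iff max_def)
  moreover have "interval_measure F = density lborel (\<lambda>a. ennreal (child_density 0 a) * indicator {0..} a)" (is "_ = ?D")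
  proof (rule cdf_unique)
    have mono: "F x \<le> F y" if "x \<le> y" for x y
      using that by (auto simp: F_def max_def)
    have "continuous_on UNIV F"
      unfolding F_def by (intro continuous_intros) auto
    then have cont: "continuous (at_right a) F" for a
      by (simp add: continuous_on_eq_continuous_at continuous_at_imp_continuous_at_within)
    have bot: "(F \<longlongrightarrow> 0) at_bot"
      by (rule tendsto_eventually) (auto simp: F_def eventually_at_bot_linorder max_def intro!: exI[of _ 0])
    have top: "(F \<longlongrightarrow> 1) at_top"
      unfolding F_def
    proof (rule filterlim_compose[OF tanh_real_at_top])
      show "filterlim (\<lambda>y::real. max 0 y / 2) at_top at_top"
        unfolding filterlim_at_top
      proof
        fix Z :: real
        show "\<forall>\<^sub>F y in at_top. Z \<le> max 0 y / 2"
          by (rule eventually_at_top_linorderI[of "2 * Z"]) (simp add: max_def)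
      qed
    qed
    show "real_distribution (interval_measure F)"
      by (rule real_distribution_interval_measure[OF mono cont bot top])
    have em: "emeasure ?D UNIV = 1"
      using nn_integral_child_density[of 0 0] by (simp add: emeasure_density)
    interpret D: prob_space ?D by (rule prob_spaceI) (simp add: em)
    show "real_distribution ?D"
      by unfold_locales auto
    have "measure ?D {..y} = F y" for y
    proof (cases "0 \<le> y")
      case True
      have "emeasure ?D {..y} = (\<integral>\<^sup>+a. ennreal (child_density 0 a) * indicator {0..y} a \<partial>lborel)"
        by (subst emeasure_density) (auto intro!: nn_integral_cong simp: indicator_def)
      also have "\<dots> = ennreal (tanh (y / 2) - tanh (0 / 2))"
      proof (rule nn_integral_FTC_Icc)
        show "((\<lambda>a. tanh (a / 2)) has_real_derivative child_density 0 a) (at a)" for a :: real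
          unfolding child_density_eq by (auto intro!: derivative_eq_intros simp: field_simps)
      qed (use True in auto)
      finally show ?thesis using True by (simp add: measure_def F_def max_def)
    next
      case False
      have "emeasure ?D {..y} = (\<integral>\<^sup>+a. ennreal (child_density 0 a) * indicator {0..} a * indicator {..y} a \<partial>lborel)"
        by (rule emeasure_density) auto
      also have "\<dots> = (\<integral>\<^sup>+a. 0 \<partial>(lborel :: real measure))"
        using False by (intro nn_integral_cong) (auto simp: indicator_def)
      finally have "emeasure ?D {..y} = 0" by simp
      then show ?thesis using False by (simp add: measure_def F_def max_def)
    qed
    then have "cdf ?D = F" by (simp add: cdf_def fun_eq_iff)
    moreover have "cdf (interval_measure F) = F"
      by (rule cdf_interval_measure) (auto intro: mono cont bot)
    ultimately show "cdf (interval_measure F) = cdf ?D" by simp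
  qed
  ultimately show ?thesis by simp
qed

lemma sets_H_law: "sets (H_law 0) = sets tree_space"
  unfolding H_law_def by (rule sets_bind[OF sets_gw_law]) (simp add: root_age_law_0)

lemma nn_integral_H_law:
  assumes f[measurable]: "f \<in> borel_measurable tree_space"
  shows "(\<integral>\<^sup>+T. f T \<partial>H_law 0) = (\<integral>\<^sup>+a. indicator {0..} a * (ennreal (1 / 2) * tree_weight a f) \<partial>lborel)"
proof -
  have "gw_law 0 \<in> root_age_law 0 \<rightarrow>\<^sub>M subprob_algebra tree_space"
    unfolding root_age_law_0 by measurable
  then have "(\<integral>\<^sup>+T. f T \<partial>H_law 0) = (\<integral>\<^sup>+a. (\<integral>\<^sup>+T. f T \<partial>gw_law 0 a) \<partial>root_age_law 0)"
    unfolding H_law_def by (rule nn_integral_bind[OF f])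
  also have "\<dots> = (\<integral>\<^sup>+a. ennreal (child_density 0 a) * indicator {0..} a * (\<integral>\<^sup>+T. f T \<partial>gw_law 0 a) \<partial>lborel)"
    unfolding root_age_law_0
    using measurable_compose[OF measurable_gw_law nn_integral_measurable_subprob_algebra[OF f]]
    by (intro nn_integral_density) simp_all
  also have "\<dots> = (\<integral>\<^sup>+a. indicator {0..} a * (ennreal (1 / 2) * tree_weight a f) \<partial>lborel)"
    unfolding tree_weight_def child_density_half add_0_right by (intro nn_integral_cong) (simp only: mult_ac)
  finally show ?thesis .
qed

lemma subprob_H_law: "subprob_space (H_law 0)"
proof -
  have "emeasure (root_age_law 0) UNIV = 1"
    unfolding root_age_law_0 using nn_integral_child_density[of 0 0] by (simp add: emeasure_density)
  then interpret prob_space "root_age_law 0"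
    by (intro prob_spaceI) (simp add: root_age_law_0)
  have "gw_law 0 \<in> root_age_law 0 \<rightarrow>\<^sub>M subprob_algebra tree_space"
    unfolding root_age_law_0 by measurable
  then show ?thesis
    unfolding H_law_def by (intro subprob_space_bind prob_space_imp_subprob_space prob_space_axioms)
qed

section \<open>Lowering all ages\<close>

text \<open>
  Infinite for a single vertex, as the infimum of the empty set of extended reals.
\<close>

primrec min_edge :: "aged_tree \<Rightarrow> ereal" where
  "min_edge (Vertex b C) = (INF p\<in>set_mset (image_mset (map_prod id min_edge) C). min (ereal (fst p)) (snd p))"

definition edge_min :: "real \<times> aged_tree \<Rightarrow> ereal" where
  "edge_min p = min (ereal (fst p)) (min_edge (snd p))"

lemma min_edge_eq: "min_edge T = (INF p\<in>set_mset (children T). edge_min p)"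
  by (cases T) (simp add: image_image edge_min_def)

lemma min_edge_single [simp]: "min_edge (Vertex b {#}) = \<infinity>"
  by (simp add: top_ereal_def)

lemma le_min_edge_iff: "c \<le> min_edge T \<longleftrightarrow> (\<forall>p\<in>#children T. c \<le> edge_min p)"
  unfolding min_edge_eq by (simp add: le_INF_iff)

lemma le_edge_min_iff: "c \<le> edge_min p \<longleftrightarrow> c \<le> ereal (fst p) \<and> c \<le> min_edge (snd p)"
  by (simp add: edge_min_def)

lemma min_edge_not_MInf: "min_edge T \<noteq> -\<infinity>"
proof -
  have "\<exists>r. ereal r \<le> min_edge T"
  proof (induction T rule: tree_height_induct)
    case (less T)
    have "\<exists>r. ereal r \<le> edge_min p" if p: "p \<in># children T" for p
    proof -
      obtain r where "ereal r \<le> min_edge (snd p)" using less[of "fst p" "snd p"] p by auto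
      then have "ereal (min r (fst p)) \<le> edge_min p"
        unfolding le_edge_min_iff by (auto simp: min_def intro: order_trans[of _ "ereal r"])
      then show ?thesis by blast
    qed
    then obtain r where r: "\<And>p. p \<in># children T \<Longrightarrow> ereal (r p) \<le> edge_min p" by metis
    have "ereal (Min (insert 0 (r ` set_mset (children T)))) \<le> edge_min p" if "p \<in># children T" for p
    proof -
      have "Min (insert 0 (r ` set_mset (children T))) \<le> r p"
        using that by (intro Min_le) auto
      then have "ereal (Min (insert 0 (r ` set_mset (children T)))) \<le> ereal (r p)" by simp
      also note r[OF that]
      finally show ?thesis .
    qed
    then show ?case unfolding le_min_edge_iff by blast
  qed
  then show ?thesis by auto
qed

lemma edge_min_not_MInf: "edge_min p \<noteq> -\<infinity>"
  using min_edge_not_MInf[of "snd p"] by (auto simp: edge_min_def min_def)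

lemma edge_min_not_PInf: "edge_min p \<noteq> \<infinity>"
  by (auto simp: edge_min_def min_def)

lemma min_edge_attained:
  assumes "min_edge T = c" "c \<noteq> \<infinity>"
  shows "\<exists>p\<in>#children T. edge_min p = c"
proof -
  have "children T \<noteq> {#}"
    using assms by (auto simp: min_edge_eq top_ereal_def)
  then have "min_edge T = Min (edge_min ` set_mset (children T))"
    unfolding min_edge_eq by (intro Min_Inf[symmetric]) auto
  moreover have "Min (edge_min ` set_mset (children T)) \<in> edge_min ` set_mset (children T)"
    using \<open>children T \<noteq> {#}\<close> by (intro Min_in) auto
  ultimately show ?thesis using assms by auto
qed

lemma measurable_min_edge [measurable]: "min_edge \<in> borel_measurable tree_space"
proof (rule borel_measurableI_ge)
  fix c
  have "(\<lambda>T. c \<le> min_edge T) \<in> tree_space \<rightarrow>\<^sub>M count_space UNIV"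
  proof (rule measurable_tree_by_height)
    fix n
    show "\<exists>g\<in>tree_space \<rightarrow>\<^sub>M count_space UNIV. \<forall>T. height T < n \<longrightarrow> (c \<le> min_edge T) = g T"
    proof (induction n)
      case 0
      show ?case by (intro bexI[of _ "\<lambda>_. True"]) auto
    next
      case (Suc n)
      then obtain g where g[measurable]: "Measurable.pred tree_space g"
        and eq: "\<And>T. height T < n \<Longrightarrow> (c \<le> min_edge T) = g T" by blast
      have "Measurable.pred tree_space (\<lambda>T. \<forall>p\<in>#children T. c \<le> ereal (fst p) \<and> g (snd p))"
        by (rule measurable_all_mset[OF space_edge_space measurable_children]) measurable
      moreover have "(c \<le> min_edge T) = (\<forall>p\<in>#children T. c \<le> ereal (fst p) \<and> g (snd p))" if "height T < Suc n" for T
        using that eq unfolding le_min_edge_iff[of c T] le_edge_min_iff height_less_Suc_iff by auto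
      ultimately show ?case
        by (intro bexI[of _ "\<lambda>T. \<forall>p\<in>#children T. c \<le> ereal (fst p) \<and> g (snd p)"] allI impI)
    qed
  qed
  then show "{T \<in> space tree_space. c \<le> min_edge T} \<in> sets tree_space"
    by measurable
qed

lemma measurable_edge_min [measurable]: "edge_min \<in> borel_measurable edge_space"
  unfolding edge_min_def by measurable

lemma le_min_edge_grow: "y + ereal d \<le> min_edge (grow d T) \<longleftrightarrow> y \<le> min_edge T"
proof (induction T rule: tree_height_induct)
  case (less T)
  have e: "y + ereal d \<le> ereal (u + d) \<longleftrightarrow> y \<le> ereal u" for u
    by (cases y) auto
  have "y + ereal d \<le> edge_min (fst p + d, grow d (snd p)) \<longleftrightarrow> y \<le> edge_min p" if "p \<in># children T" for p
    using less[of "fst p" "snd p"] that by (simp only: le_edge_min_iff fst_conv snd_conv e prod.collapse)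
  then show ?case
    unfolding le_min_edge_iff children_grow by auto
qed

lemma min_edge_grow_0:
  assumes "min_edge T = 0"
  shows "min_edge (grow d T) = ereal d"
proof (rule antisym)
  show "ereal d \<le> min_edge (grow d T)"
    using le_min_edge_grow[of 0 d T] assms by simp
  have "min_edge (grow d T) - ereal d + ereal d \<le> min_edge (grow d T)"
    by (cases "min_edge (grow d T)") auto
  then have "min_edge (grow d T) - ereal d \<le> 0"
    unfolding le_min_edge_grow assms .
  then show "min_edge (grow d T) \<le> ereal d"
    by (cases "min_edge (grow d T)") auto
qed

lemma grow_0 [simp]: "grow 0 T = T"
proof (induction T rule: tree_height_induct)
  case (less T)
  have "image_mset (\<lambda>p. (fst p + 0, grow 0 (snd p))) (children T) = image_mset (\<lambda>p. p) (children T)"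
    using less by (intro image_mset_cong) auto
  then show ?case by (subst grow_eq) simp
qed

lemma min_edge_attachments:
  assumes "T' \<in># attachments S T" "0 \<le> min_edge S" "0 \<le> min_edge T"
  shows "min_edge T' = 0"
  using assms
proof (induction T arbitrary: T' rule: tree_height_induct)
  case (less T T')
  have T: "0 \<le> edge_min p" if "p \<in># children T" for p
    using less.prems(3) that by (simp add: le_min_edge_iff)
  have key: "min_edge (Vertex b (add_mset q D)) = 0"
    if "edge_min q = 0" "\<And>p. p \<in># D \<Longrightarrow> 0 \<le> edge_min p" for b q D
  proof (rule antisym)
    show "0 \<le> min_edge (Vertex b (add_mset q D))"
      unfolding le_min_edge_iff using that by auto
    have "min_edge (Vertex b (add_mset q D)) \<le> edge_min q"
      unfolding min_edge_eq by (rule INF_lower) simp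
    then show "min_edge (Vertex b (add_mset q D)) \<le> 0" using that by simp
  qed
  from less.prems(1) consider "T' = Vertex (root_age T) (add_mset (0, S) (children T))"
    | p T'' where "p \<in># children T" "T'' \<in># attachments S (snd p)"
        "T' = Vertex (root_age T) (add_mset (fst p, T'') (children T - {#p#}))"
    by (subst (asm) attachments_eq) auto
  then show ?case
  proof cases
    case 1
    show ?thesis unfolding 1
      using T less.prems(2) by (intro key) (auto simp: edge_min_def min_def zero_ereal_def)
  next
    case 2
    have "min_edge T'' = 0"
      using less.IH[of "fst p" "snd p" T''] 2 less.prems(2) T[OF 2(1)] by (simp add: le_edge_min_iff)
    moreover have "0 \<le> ereal (fst p)"
      using T[OF 2(1)] unfolding le_edge_min_iff by (rule conjunct1)
    ultimately have "edge_min (fst p, T'') = 0"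
      by (simp only: edge_min_def fst_conv snd_conv min_absorb2)
    then show ?thesis unfolding 2(3)
      using T by (intro key) (auto dest: in_diffD)
  qed
qed

lemma nn_integral_shift:
  fixes f :: "real \<Rightarrow> ennreal"
  assumes "f \<in> borel_measurable borel"
  shows "(\<integral>\<^sup>+a. f a \<partial>lborel) = (\<integral>\<^sup>+a. f (a + d) \<partial>lborel)"
  using nn_integral_real_affine[OF assms, of 1 d] by (simp add: add.commute)

abbreviation decay :: "real \<Rightarrow> aged_tree \<Rightarrow> ennreal" where
  "decay d T \<equiv> ennreal (exp (- d * real (num_vertices T)))"

text \<open>
  The shift of \<open>a\<close> and \<open>e\<close> by \<open>d\<close> maps \<open>0 \<le> e \<le> min (b - d) a\<close> onto \<open>d \<le> e \<le> min b a\<close>; the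
  weight of the subtree is treated by the hypothesis.
\<close>

lemma nn_integral_offspring_scale:
  assumes d: "0 \<le> d" "d \<le> b"
    and IH: "\<And>f b. (\<And>T. T \<notin> S \<Longrightarrow> f T = 0) \<Longrightarrow> f \<in> borel_measurable tree_space \<Longrightarrow> d \<le> b \<Longrightarrow>
      tree_weight b (\<lambda>T. indicator {T. ereal d \<le> min_edge T} T * f T) = tree_weight (b - d) (\<lambda>T. decay d T * f (grow d T))"
    and h[measurable]: "h \<in> borel_measurable edge_space" and supp: "\<And>p. snd p \<notin> S \<Longrightarrow> h p = 0"
  shows "(\<integral>\<^sup>+p. indicator {p. ereal d \<le> edge_min p} p * h p \<partial>offspring b) =
    (\<integral>\<^sup>+p. decay d (snd p) * h (fst p + d, grow d (snd p)) \<partial>offspring (b - d))"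
proof -
  have hI: "(\<lambda>p. indicator {p. ereal d \<le> edge_min p} p * h p) \<in> borel_measurable edge_space"
    unfolding indicator_def by measurable
  have hg: "(\<lambda>p. decay d (snd p) * h (fst p + d, grow d (snd p))) \<in> borel_measurable edge_space"
    by measurable
  define \<Phi> where "\<Phi> a e = ennreal (1 / 2) * tree_weight a (\<lambda>T. indicator {p. ereal d \<le> edge_min p} (e, T) * h (e, T))" for a e
  have \<Phi>[measurable]: "(\<lambda>z. \<Phi> (fst z) (snd z)) \<in> borel_measurable (borel \<Otimes>\<^sub>M borel)"
  proof -
    have "(\<lambda>(z, T). indicator {p. ereal d \<le> edge_min p} (snd z, T) * h (snd z, T)) \<in> borel_measurable ((borel \<Otimes>\<^sub>M borel) \<Otimes>\<^sub>M tree_space)"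
      unfolding indicator_def by measurable
    then show ?thesis unfolding \<Phi>_def by measurable
  qed
  have [measurable]: "\<Phi> a \<in> borel_measurable borel" for a
    using measurable_Pair2[OF \<Phi>, of a] by simp
  have meas: "(\<lambda>a. indicator {0..} a * (\<integral>\<^sup>+e. indicator {0..min b a} e * \<Phi> a e \<partial>lborel)) \<in> borel_measurable borel"
  proof -
    have "(\<lambda>(a, e). indicator {e. 0 \<le> e \<and> e \<le> b \<and> e \<le> a} e * \<Phi> a e) \<in> borel_measurable (borel \<Otimes>\<^sub>M lborel)"
      unfolding indicator_def by measurable
    then have [measurable]: "(\<lambda>(a, e). indicator {0..min b a} e * \<Phi> a e) \<in> borel_measurable (borel \<Otimes>\<^sub>M lborel)"
      by (simp add: indicator_def case_prod_unfold)
    show ?thesis by measurable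
  qed
  have "(\<integral>\<^sup>+p. indicator {p. ereal d \<le> edge_min p} p * h p \<partial>offspring b) =
     (\<integral>\<^sup>+a. indicator {0..} a * (\<integral>\<^sup>+e. indicator {0..min b a} e * \<Phi> a e \<partial>lborel) \<partial>lborel)"
    unfolding nn_integral_offspring[OF hI] \<Phi>_def ..
  also have "\<dots> = (\<integral>\<^sup>+a. indicator {0..} (a + d) * (\<integral>\<^sup>+e. indicator {0..min b (a + d)} (e + d) * \<Phi> (a + d) (e + d) \<partial>lborel) \<partial>lborel)"
    by (subst nn_integral_shift[OF meas, of d]) (intro nn_integral_cong arg_cong2[of _ _ _ _ "(*)"] nn_integral_shift refl, measurable)
  also have "\<dots> = (\<integral>\<^sup>+a. indicator {0..} a * (\<integral>\<^sup>+e. indicator {0..min (b - d) a} e *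
      (ennreal (1 / 2) * tree_weight a (\<lambda>T. decay d T * h (e + d, grow d T))) \<partial>lborel) \<partial>lborel)"
  proof (rule nn_integral_cong)
    fix a :: real
    have "indicator {0..} (a + d) * (indicator {0..min b (a + d)} (e + d) * \<Phi> (a + d) (e + d)) =
        indicator {0..} a * (indicator {0..min (b - d) a} e * (ennreal (1 / 2) * tree_weight a (\<lambda>T. decay d T * h (e + d, grow d T))))" for e
    proof (cases "0 \<le> e \<and> e \<le> a \<and> e \<le> b - d")
      case True
      have "indicator {p. ereal d \<le> edge_min p} (e + d, T) = (indicator {T. ereal d \<le> min_edge T} T :: ennreal)" for T
        using True by (simp add: indicator_def le_edge_min_iff)
      then have "\<Phi> (a + d) (e + d) = ennreal (1 / 2) * tree_weight (a + d - d) (\<lambda>T. decay d T * h (e + d, grow d T))"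
        unfolding \<Phi>_def using True d supp by (subst IH[symmetric]) auto
      then show ?thesis using True d by (simp add: indicator_def)
    next
      case False
      have "\<Phi> (a + d) (e + d) = 0" if "e < 0"
      proof -
        have "indicator {p. ereal d \<le> edge_min p} (e + d, T) = (0 :: ennreal)" for T
          using that by (simp add: indicator_def le_edge_min_iff)
        then show ?thesis by (simp add: \<Phi>_def tree_weight_def)
      qed
      with False show ?thesis using d by (auto simp: indicator_def)
    qed
    then have eq: "(\<integral>\<^sup>+e. indicator {0..} (a + d) * (indicator {0..min b (a + d)} (e + d) * \<Phi> (a + d) (e + d)) \<partial>lborel) =
       (\<integral>\<^sup>+e. indicator {0..} a * (indicator {0..min (b - d) a} e * (ennreal (1 / 2) * tree_weight a (\<lambda>T. decay d T * h (e + d, grow d T)))) \<partial>lborel)"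
      by (simp only:)
    have L: "(\<integral>\<^sup>+e. indicator {0..} (a + d) * (indicator {0..min b (a + d)} (e + d) * \<Phi> (a + d) (e + d)) \<partial>lborel) =
       indicator {0..} (a + d) * (\<integral>\<^sup>+e. indicator {0..min b (a + d)} (e + d) * \<Phi> (a + d) (e + d) \<partial>lborel)"
      by (rule nn_integral_cmult) measurable
    have R: "(\<integral>\<^sup>+e. indicator {0..} a * (indicator {0..min (b - d) a} e * (ennreal (1 / 2) * tree_weight a (\<lambda>T. decay d T * h (e + d, grow d T)))) \<partial>lborel) =
       indicator {0..} a * (\<integral>\<^sup>+e. indicator {0..min (b - d) a} e * (ennreal (1 / 2) * tree_weight a (\<lambda>T. decay d T * h (e + d, grow d T))) \<partial>lborel)"
      by (rule nn_integral_cmult) measurable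
    show "indicator {0..} (a + d) * (\<integral>\<^sup>+e. indicator {0..min b (a + d)} (e + d) * \<Phi> (a + d) (e + d) \<partial>lborel) =
      indicator {0..} a * (\<integral>\<^sup>+e. indicator {0..min (b - d) a} e * (ennreal (1 / 2) * tree_weight a (\<lambda>T. decay d T * h (e + d, grow d T))) \<partial>lborel)"
      unfolding L[symmetric] R[symmetric] by (rule eq)
  qed
  also have "\<dots> = (\<integral>\<^sup>+p. decay d (snd p) * h (fst p + d, grow d (snd p)) \<partial>offspring (b - d))"
    unfolding nn_integral_offspring[OF hg] by (simp only: fst_conv snd_conv)
  finally show ?thesis .
qed

lemma num_vertices_add_child: "num_vertices (Vertex b (add_mset p C)) = num_vertices (snd p) + num_vertices (Vertex b C)"
  by (simp add: num_vertices_eq[of "Vertex b C"] num_vertices_eq[of "Vertex b (add_mset p C)"])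

lemma num_vertices_single: "num_vertices (Vertex b {#}) = 1"
  by (simp add: num_vertices_eq[of "Vertex b {#}"])

lemma decay_add: "ennreal (exp (- d * real (m + n))) = ennreal (exp (- d * real m)) * ennreal (exp (- d * real n))"
  by (simp only: of_nat_add distrib_left exp_add ennreal_mult exp_ge_zero)

lemma decay_Vertex: "decay d (Vertex b (add_mset p C)) = decay d (snd p) * decay d (Vertex b C)"
  unfolding num_vertices_add_child by (rule decay_add)

lemma decay_single: "decay d (Vertex b {#}) = ennreal (exp (- d))"
  by (simp only: num_vertices_single of_nat_1 mult_1_right)

lemma ennreal_exp_cancel: "ennreal (exp d) * (ennreal (exp (- d)) * y) = y"
  unfolding mult.assoc[symmetric] by (simp add: ennreal_mult[symmetric] mult_exp_exp)

definition shift_points :: "real \<Rightarrow> (real \<times> aged_tree) multiset \<Rightarrow> (real \<times> aged_tree) multiset" where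
  "shift_points d = image_mset (\<lambda>p. (fst p + d, grow d (snd p)))"

lemma measurable_shift_points [measurable]: "shift_points d \<in> multiset_space edge_space \<rightarrow>\<^sub>M multiset_space edge_space"
  unfolding shift_points_def
  by (rule measurable_image_mset[OF space_edge_space measurable_ident_sets[OF refl]]) measurable

lemma grow_Vertex: "grow d (Vertex b C) = Vertex (b + d) (shift_points d C)"
  by (simp add: shift_points_def map_prod_def case_prod_unfold)

text \<open>
  The factors \<open>exp (- d)\<close> of all vertices except the root: a multiplicative functional of the
  configuration of children.
\<close>

definition decay_points :: "real \<Rightarrow> (real \<times> aged_tree) multiset \<Rightarrow> ennreal" where
  "decay_points d C = ennreal (exp d) * decay d (Vertex 0 C)"

lemma decay_points_simps: "decay_points d {#} = 1" "decay_points d (add_mset p C) = decay d (snd p) * decay_points d C"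
proof -
  show "decay_points d {#} = 1"
    using ennreal_exp_cancel[of d 1] by (simp only: decay_points_def decay_single mult_1_right)
  show "decay_points d (add_mset p C) = decay d (snd p) * decay_points d C"
    unfolding decay_points_def decay_Vertex by (rule mult.left_commute)
qed

lemma decay_eq_points: "decay d (Vertex b C) = ennreal (exp (- d)) * decay_points d C"
proof -
  have "num_vertices (Vertex 0 C) = num_vertices (Vertex b C)"
    by (simp add: num_vertices_eq[of "Vertex b C"] num_vertices_eq[of "Vertex 0 C"])
  then show ?thesis
    unfolding decay_points_def using ennreal_exp_cancel[of "- d" "decay d (Vertex b C)"] by (simp only: minus_minus)
qed

lemma measurable_decay_points [measurable]: "decay_points d \<in> borel_measurable (multiset_space edge_space)"
  unfolding decay_points_def by measurable

lemma poisson_int_offspring_scale: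
  assumes d: "0 \<le> d" "d \<le> b"
    and P: "\<And>h. h \<in> borel_measurable edge_space \<Longrightarrow> (\<And>p. snd p \<notin> S \<Longrightarrow> h p = 0) \<Longrightarrow>
      (\<integral>\<^sup>+p. indicator {p. P p} p * h p \<partial>offspring b) =
      (\<integral>\<^sup>+p. decay d (snd p) * h (fst p + d, grow d (snd p)) \<partial>offspring (b - d))"
    and P_meas[measurable]: "Measurable.pred edge_space P"
    and F[measurable]: "F \<in> borel_measurable (multiset_space edge_space)"
    and supp: "\<And>C. \<not> snd ` set_mset C \<subseteq> S \<Longrightarrow> F C = 0"
  shows "poisson_int (offspring b) (\<lambda>C. indicator {C. \<forall>p\<in>#C. P p} C * F C) =
    poisson_int (offspring (b - d)) (\<lambda>C. decay_points d C * F (shift_points d C))"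
proof -
  let ?N' = "density (offspring b) (indicator {p. P p})"
  interpret N: finite_full_measure "offspring b" by (rule finite_offspring)
  have Pset: "{p. P p} \<in> sets edge_space"
    using P_meas by (simp add: pred_def space_pair_measure)
  then have Pm: "indicator {p. P p} \<in> borel_measurable (offspring b)"
    unfolding measurable_offspring by simp
  have sN': "sets ?N' = sets edge_space" by (simp add: sets_offspring)
  have N'int: "(\<integral>\<^sup>+p. h p \<partial>?N') = (\<integral>\<^sup>+p. indicator {p. P p} p * h p \<partial>offspring b)" if "h \<in> borel_measurable edge_space" for h
    by (rule nn_integral_density) (use that Pm in \<open>auto simp: measurable_offspring\<close>)
  have "emeasure ?N' UNIV = (\<integral>\<^sup>+p. indicator {p. P p} p * 1 \<partial>offspring b)"
    using N'int[of "\<lambda>_. 1"] N.space_full by simp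
  also have "\<dots> \<le> (\<integral>\<^sup>+p. 1 \<partial>offspring b)"
    by (intro nn_integral_mono) (simp add: indicator_def)
  also have "\<dots> < \<top>"
    by (simp add: N.space_full N.emeasure_finite less_top[symmetric])
  finally have N': "finite_full_measure ?N'"
    using N.space_full by (intro finite_full_measure.intro finite_measureI finite_full_measure_axioms.intro) simp_all
  have ms: "multiset_space ?N' = multiset_space edge_space"
    by (rule multiset_space_cong[OF sN'])
  have all: "{C. \<forall>p\<in>#C. P p} \<in> sets (multiset_space edge_space)"
  proof -
    have "Measurable.pred (multiset_space edge_space) (\<lambda>C. \<forall>p\<in>#C. P p)"
      by (rule measurable_all_mset[OF space_edge_space measurable_ident_sets[OF refl]]) measurable
    then show ?thesis by (simp add: pred_def)
  qed
  have "poisson_int ?N' F = poisson_int (offspring b) (\<lambda>C. indicator {C. \<forall>p\<in>#C. P p} C * F (image_mset (\<lambda>p. p) C))"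
  proof (rule poisson_int_transform[where g = "indicator {p. P p}" and S = UNIV, OF N.finite_full_measure_axioms N'])
    show "(\<lambda>p. p) \<in> offspring b \<rightarrow>\<^sub>M ?N'" by (rule measurable_ident_sets) (simp add: sN' sets_offspring)
    show "indicator {C. \<forall>p\<in>#C. P p} \<in> borel_measurable (multiset_space (offspring b))"
      unfolding multiset_space_offspring using all by simp
    show "F \<in> borel_measurable (multiset_space ?N')" unfolding ms by (rule F)
    show "(\<integral>\<^sup>+p. f p \<partial>?N') = (\<integral>\<^sup>+p. indicator {p. P p} p * f p \<partial>offspring b)" if "f \<in> borel_measurable ?N'" for f
      by (rule N'int) (use that in \<open>simp add: measurable_cong_sets[OF sN' refl]\<close>)
  qed (use Pm in \<open>auto simp: indicator_def\<close>)
  moreover have "poisson_int ?N' F = poisson_int (offspring (b - d)) (\<lambda>C. decay_points d C * F (image_mset (\<lambda>p. (fst p + d, grow d (snd p))) C))"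
  proof (rule poisson_int_transform[where g = "\<lambda>p. decay d (snd p)" and S = "{p. snd p \<in> S}", OF finite_offspring N'])
    show "(\<lambda>p. (fst p + d, grow d (snd p))) \<in> offspring (b - d) \<rightarrow>\<^sub>M ?N'"
      unfolding measurable_cong_sets[OF sets_offspring sN'] by measurable
    show "(\<lambda>p. decay d (snd p)) \<in> borel_measurable (offspring (b - d))"
      unfolding measurable_offspring by measurable
    show "decay_points d \<in> borel_measurable (multiset_space (offspring (b - d)))"
      unfolding multiset_space_offspring by measurable
    show "F \<in> borel_measurable (multiset_space ?N')" unfolding ms by (rule F)
    show "F C = 0" if "\<not> set_mset C \<subseteq> {p. snd p \<in> S}" for C
      using that by (intro supp) auto
    fix f :: "real \<times> aged_tree \<Rightarrow> ennreal"
    assume "f \<in> borel_measurable ?N'" and f0: "\<And>p. p \<notin> {p. snd p \<in> S} \<Longrightarrow> f p = 0"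
    then have f: "f \<in> borel_measurable edge_space" by (simp add: measurable_cong_sets[OF sN' refl])
    show "(\<integral>\<^sup>+p. f p \<partial>?N') = (\<integral>\<^sup>+p. decay d (snd p) * f (fst p + d, grow d (snd p)) \<partial>offspring (b - d))"
      unfolding N'int[OF f] by (rule P[OF f]) (use f0 in auto)
  qed (auto simp: decay_points_simps)
  ultimately show ?thesis by (simp add: shift_points_def)
qed

text \<open>
  The weight of a tree has the factor \<open>exp (- age)\<close> for each vertex, and the constraint that
  edges are younger than their ends is invariant under a common shift. So lowering all ages by
  \<open>d\<close> costs \<open>exp (- d)\<close> per vertex.
\<close>

lemma tree_weight_scale_bounded:
  assumes d: "0 \<le> d" and "d \<le> b" "\<And>T. m < num_vertices T \<Longrightarrow> f T = 0" "f \<in> borel_measurable tree_space"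
  shows "tree_weight b (\<lambda>T. indicator {T. ereal d \<le> min_edge T} T * f T) = tree_weight (b - d) (\<lambda>T. decay d T * f (grow d T))"
  using assms(2-)
proof (induction m arbitrary: f b)
  case 0
  then have "f = (\<lambda>_. 0)" by auto
  then show ?case by (simp add: tree_weight_def)
next
  case (Suc m f b)
  note f[measurable] = Suc.prems(3)
  let ?S = "{T. num_vertices T \<le> m}" and ?P = "\<lambda>p. ereal d \<le> edge_min p"
  have scale: "(\<integral>\<^sup>+p. indicator {p. ?P p} p * h p \<partial>offspring b) =
      (\<integral>\<^sup>+p. decay d (snd p) * h (fst p + d, grow d (snd p)) \<partial>offspring (b - d))"
    if "h \<in> borel_measurable edge_space" "\<And>p. snd p \<notin> ?S \<Longrightarrow> h p = 0" for h
  proof (rule nn_integral_offspring_scale[OF d Suc.prems(1) _ that])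
    fix g :: "aged_tree \<Rightarrow> ennreal" and a
    assume "\<And>T. T \<notin> ?S \<Longrightarrow> g T = 0" "g \<in> borel_measurable tree_space" "d \<le> a"
    then show "tree_weight a (\<lambda>T. indicator {T. ereal d \<le> min_edge T} T * g T) = tree_weight (a - d) (\<lambda>T. decay d T * g (grow d T))"
      by (intro Suc.IH) auto
  qed
  have fI: "(\<lambda>T. indicator {T. ereal d \<le> min_edge T} T * f T) \<in> borel_measurable tree_space"
    unfolding indicator_def by measurable
  have "tree_weight b (\<lambda>T. indicator {T. ereal d \<le> min_edge T} T * f T) =
     ennreal (exp (- b)) * poisson_int (offspring b) (\<lambda>C. indicator {C. \<forall>p\<in>#C. ?P p} C * f (Vertex b C))"
    by (subst tree_weight_fixed_point[OF _ fI]) (use d Suc.prems in \<open>auto simp: indicator_def le_min_edge_iff\<close>)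
  also have "poisson_int (offspring b) (\<lambda>C. indicator {C. \<forall>p\<in>#C. ?P p} C * f (Vertex b C)) =
     poisson_int (offspring (b - d)) (\<lambda>C. decay_points d C * f (Vertex b (shift_points d C)))"
  proof (rule poisson_int_offspring_scale[OF d Suc.prems(1) scale])
    show "f (Vertex b C) = 0" if "\<not> snd ` set_mset C \<subseteq> ?S" for C
    proof -
      from that obtain p where "p \<in># C" "m < num_vertices (snd p)"
        by (auto simp: subset_iff not_le)
      then show ?thesis
        using num_vertices_child_less[of p C b] by (intro Suc.prems(2)) linarith
    qed
    show "Measurable.pred edge_space (\<lambda>p. ereal d \<le> edge_min p)" by measurable
    show "(\<lambda>C. f (Vertex b C)) \<in> borel_measurable (multiset_space edge_space)" by measurable
  qed
  also have "ennreal (exp (- b)) * \<dots> = ennreal (exp (- (b - d))) * (ennreal (exp (- d)) * poisson_int (offspring (b - d)) (\<lambda>C. decay_points d C * f (Vertex b (shift_points d C))))"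
    unfolding mult.assoc[symmetric] by (simp add: ennreal_mult[symmetric] mult_exp_exp)
  also have "ennreal (exp (- d)) * poisson_int (offspring (b - d)) (\<lambda>C. decay_points d C * f (Vertex b (shift_points d C))) =
     poisson_int (offspring (b - d)) (\<lambda>C. ennreal (exp (- d)) * (decay_points d C * f (Vertex b (shift_points d C))))"
    by (rule finite_full_measure.poisson_int_cmult[OF finite_offspring, symmetric]) (unfold multiset_space_offspring, measurable)
  also have "(\<lambda>C. ennreal (exp (- d)) * (decay_points d C * f (Vertex b (shift_points d C)))) =
     (\<lambda>C. decay d (Vertex (b - d) C) * f (grow d (Vertex (b - d) C)))"
    unfolding decay_eq_points grow_Vertex diff_add_cancel by (simp only: mult.assoc)
  also have "ennreal (exp (- (b - d))) * poisson_int (offspring (b - d)) \<dots> = tree_weight (b - d) (\<lambda>T. decay d T * f (grow d T))"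
    by (rule tree_weight_fixed_point[symmetric]) (use Suc.prems in \<open>simp, measurable\<close>)
  finally show ?case .
qed

lemma tree_weight_scale:
  assumes d: "0 \<le> d" "d \<le> b" and f[measurable]: "f \<in> borel_measurable tree_space"
  shows "tree_weight b (\<lambda>T. indicator {T. ereal d \<le> min_edge T} T * f T) = tree_weight (b - d) (\<lambda>T. decay d T * f (grow d T))"
proof -
  let ?f = "\<lambda>m T. f T * indicator {T. num_vertices T \<le> m} T"
  have [measurable]: "(\<lambda>T. indicator {T. ereal d \<le> min_edge T} T :: ennreal) \<in> borel_measurable tree_space"
    unfolding indicator_def by measurable
  have fm[measurable]: "?f m \<in> borel_measurable tree_space" for m by measurable
  have fg[measurable]: "(\<lambda>T. ?f m (grow d T)) \<in> borel_measurable tree_space" for m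
    by (rule measurable_compose[OF _ fm]) measurable
  have "tree_weight b (\<lambda>T. indicator {T. ereal d \<le> min_edge T} T * f T) = tree_weight b (\<lambda>T. SUP m. indicator {T. ereal d \<le> min_edge T} T * ?f m T)"
    by (rule tree_weight_cong) (subst SUP_mult_left_ennreal[symmetric], subst SUP_size_truncation, rule refl)
  also have "\<dots> = (SUP m. tree_weight b (\<lambda>T. indicator {T. ereal d \<le> min_edge T} T * ?f m T))"
    by (rule tree_weight_SUP) (measurable, auto simp: incseq_def le_fun_def indicator_def)
  also have "\<dots> = (SUP m. tree_weight (b - d) (\<lambda>T. decay d T * ?f m (grow d T)))"
  proof (rule SUP_cong[OF refl])
    fix m
    show "tree_weight b (\<lambda>T. indicator {T. ereal d \<le> min_edge T} T * ?f m T) = tree_weight (b - d) (\<lambda>T. decay d T * ?f m (grow d T))"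
      by (rule tree_weight_scale_bounded[of d b m]) (use d in auto)
  qed
  also have "\<dots> = tree_weight (b - d) (\<lambda>T. SUP m. decay d T * ?f m (grow d T))"
    by (rule tree_weight_SUP[symmetric]) (measurable, auto simp: incseq_def le_fun_def indicator_def)
  also have "\<dots> = tree_weight (b - d) (\<lambda>T. decay d T * f (grow d T))"
    by (rule tree_weight_cong) (subst SUP_mult_left_ennreal[symmetric], subst SUP_size_truncation, rule refl)
  finally show ?thesis .
qed

lemma poisson_int_mono_fun: "(\<And>C. F C \<le> G C) \<Longrightarrow> poisson_int N F \<le> poisson_int N G"
  unfolding poisson_int_def by (intro suminf_le mult_left_mono nn_integral_mono summableI) auto

lemma (in finite_full_measure) poisson_int_sum_mset:
  assumes "\<And>x. x \<in># A \<Longrightarrow> F x \<in> borel_measurable (multiset_space N)"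
  shows "poisson_int N (\<lambda>C. \<Sum>x\<in>#A. F x C) = (\<Sum>x\<in>#A. poisson_int N (F x))"
    and "(\<lambda>C. \<Sum>x\<in>#A. F x C) \<in> borel_measurable (multiset_space N)"
  using assms
proof (induction A)
  case empty
  { case 1 show ?case by (simp add: poisson_int_def) }
  { case 2 show ?case by simp }
next
  case (add x A)
  have x: "F x \<in> borel_measurable (multiset_space N)" and A: "\<And>y. y \<in># A \<Longrightarrow> F y \<in> borel_measurable (multiset_space N)"
    if "\<And>y. y \<in># add_mset x A \<Longrightarrow> F y \<in> borel_measurable (multiset_space N)"
    using that by auto
  { case 1 show ?case using add.IH[OF A[OF 1]] poisson_int_add[OF x[OF 1]] by simp }
  { case 2 show ?case using add.IH(2)[OF A[OF 2]] x[OF 2] by simp }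
qed

lemma nn_integral_sum_mset:
  assumes "\<And>x. x \<in># A \<Longrightarrow> f x \<in> borel_measurable M"
  shows "(\<integral>\<^sup>+y. (\<Sum>x\<in>#A. f x y) \<partial>M) = (\<Sum>x\<in>#A. \<integral>\<^sup>+y. f x y \<partial>M)"
    and "(\<lambda>y. \<Sum>x\<in>#A. f x y :: ennreal) \<in> borel_measurable M"
  using assms
proof (induction A)
  case empty
  { case 1 show ?case by simp }
  { case 2 show ?case by simp }
next
  case (add x A)
  have x: "f x \<in> borel_measurable M" and A: "\<And>y. y \<in># A \<Longrightarrow> f y \<in> borel_measurable M"
    if "\<And>y. y \<in># add_mset x A \<Longrightarrow> f y \<in> borel_measurable M"
    using that by auto
  { case 1 show ?case using add.IH[OF A[OF 1]] nn_integral_add[OF x[OF 1]] by simp }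
  { case 2 show ?case using add.IH(2)[OF A[OF 2]] x[OF 2] by simp }
qed

section \<open>Attaching a tree\<close>

text \<open>
  The integral of \<open>k\<close> over the trees that a jump may produce from \<open>T\<close>, with total mass the
  number of vertices of \<open>T\<close>, the jump rate.
\<close>

definition attach :: "(aged_tree \<Rightarrow> ennreal) \<Rightarrow> aged_tree \<Rightarrow> ennreal" where
  "attach k T = (\<integral>\<^sup>+S. (\<Sum>T'\<in>#attachments S T. k T') \<partial>H_law 0)"

definition attach_weight :: "real \<Rightarrow> (aged_tree \<Rightarrow> ennreal) \<Rightarrow> ennreal" where
  "attach_weight b k = tree_weight b (attach k)"

lemma sigma_finite_H_law: "sigma_finite_measure (H_law 0)"
  by (rule subprob_space_imp_sigma_finite[OF subprob_H_law])

lemma borel_measurable_H_integral: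
  assumes "(\<lambda>(x, S). f x S :: ennreal) \<in> borel_measurable (N \<Otimes>\<^sub>M tree_space)"
  shows "(\<lambda>x. \<integral>\<^sup>+S. f x S \<partial>H_law 0) \<in> borel_measurable N"
  by (rule sigma_finite_measure.borel_measurable_nn_integral[OF sigma_finite_H_law])
     (use assms in \<open>simp add: measurable_cong_sets[OF sets_pair_measure_cong[OF refl sets_H_law] refl]\<close>)

lemma borel_measurable_attach [measurable (raw)]:
  assumes f[measurable]: "f \<in> N \<rightarrow>\<^sub>M tree_space" and k: "(\<lambda>(x, T). k x T :: ennreal) \<in> borel_measurable (N \<Otimes>\<^sub>M tree_space)"
  shows "(\<lambda>x. attach (k x) (f x)) \<in> borel_measurable N"
  unfolding attach_def
proof (rule borel_measurable_H_integral)
  have "(\<lambda>z. \<Sum>T'\<in>#attachments (snd z) (f (fst z)). k (fst z) T') \<in> borel_measurable (N \<Otimes>\<^sub>M tree_space)"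
  proof (rule borel_measurable_attachments_sum)
    show "(\<lambda>(z, T). k (fst z) T) \<in> borel_measurable ((N \<Otimes>\<^sub>M tree_space) \<Otimes>\<^sub>M tree_space)"
    proof -
      have "(\<lambda>z. (fst (fst z), snd z)) \<in> (N \<Otimes>\<^sub>M tree_space) \<Otimes>\<^sub>M tree_space \<rightarrow>\<^sub>M N \<Otimes>\<^sub>M tree_space"
        by measurable
      from measurable_compose[OF this k] show ?thesis by (simp add: case_prod_unfold)
    qed
  qed measurable
  then show "(\<lambda>(x, S). \<Sum>T'\<in>#attachments S (f x). k x T') \<in> borel_measurable (N \<Otimes>\<^sub>M tree_space)"
    by (simp add: case_prod_unfold)
qed

lemma borel_measurable_attach_const:
  assumes "k \<in> borel_measurable tree_space"
  shows "attach k \<in> borel_measurable tree_space"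
proof -
  have "(\<lambda>(x, T). k T) \<in> borel_measurable (tree_space \<Otimes>\<^sub>M tree_space)"
    using measurable_compose[OF measurable_snd assms] by (simp add: case_prod_unfold)
  from borel_measurable_attach[OF measurable_ident_sets[OF refl] this] show ?thesis by simp
qed

lemma borel_measurable_attach_weight [measurable (raw)]:
  assumes g[measurable]: "g \<in> borel_measurable N" and k: "(\<lambda>(x, T). k x T :: ennreal) \<in> borel_measurable (N \<Otimes>\<^sub>M tree_space)"
  shows "(\<lambda>x. attach_weight (g x) (k x)) \<in> borel_measurable N"
  unfolding attach_weight_def
proof (rule borel_measurable_tree_weight[OF g])
  have "(\<lambda>z. attach (k (fst z)) (snd z)) \<in> borel_measurable (N \<Otimes>\<^sub>M tree_space)"
  proof (rule borel_measurable_attach)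
    show "(\<lambda>(z, T). k (fst z) T) \<in> borel_measurable ((N \<Otimes>\<^sub>M tree_space) \<Otimes>\<^sub>M tree_space)"
    proof -
      have "(\<lambda>z. (fst (fst z), snd z)) \<in> (N \<Otimes>\<^sub>M tree_space) \<Otimes>\<^sub>M tree_space \<rightarrow>\<^sub>M N \<Otimes>\<^sub>M tree_space"
        by measurable
      from measurable_compose[OF this k] show ?thesis by (simp add: case_prod_unfold)
    qed
  qed measurable
  then show "(\<lambda>(x, T). attach (k x) T) \<in> borel_measurable (N \<Otimes>\<^sub>M tree_space)"
    by (simp add: case_prod_unfold)
qed

lemma measurable_attachments_sum0:
  assumes "k \<in> borel_measurable tree_space"
  shows "(\<lambda>S. \<Sum>T'\<in>#attachments S T. k T' :: ennreal) \<in> borel_measurable tree_space"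
proof -
  have "(\<lambda>(x, T). k T) \<in> borel_measurable (tree_space \<Otimes>\<^sub>M tree_space)"
    using measurable_compose[OF measurable_snd assms] by (simp add: case_prod_unfold)
  from borel_measurable_attachments_sum[OF measurable_ident_sets[OF refl] measurable_const this] show ?thesis by simp
qed

lemma measurable_attachments_sum1:
  assumes "k \<in> borel_measurable tree_space"
  shows "(\<lambda>S. \<Sum>T'\<in>#attachments S T. k T' :: ennreal) \<in> borel_measurable (H_law 0)"
proof -
  have "(\<lambda>S. \<Sum>T'\<in>#attachments S T. k T') \<in> borel_measurable tree_space"
    by (rule measurable_attachments_sum0) fact
  then show ?thesis by (simp add: measurable_cong_sets[OF sets_H_law refl])
qed

lemma attach_cmult:
  assumes "k \<in> borel_measurable tree_space"
  shows "attach (\<lambda>T. c * k T) T = c * attach k T"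
  unfolding attach_def sum_mset_distrib_left[symmetric]
  by (rule nn_integral_cmult[OF measurable_attachments_sum1[OF assms]])

lemma attach_weight_cmult:
  assumes "k \<in> borel_measurable tree_space"
  shows "attach_weight b (\<lambda>T. c * k T) = c * attach_weight b k"
  unfolding attach_weight_def attach_cmult[OF assms]
  by (rule tree_weight_cmult[OF borel_measurable_attach_const[OF assms]])

lemma tree_weight_nonneg_edges:
  assumes "0 \<le> b" "f \<in> borel_measurable tree_space"
  shows "tree_weight b (\<lambda>T. indicator {T. 0 \<le> min_edge T} T * f T) = tree_weight b f"
  using tree_weight_scale[of 0 b f] assms by (simp add: zero_ereal_def)

lemma measurable_nonneg_edges [measurable]: "(\<lambda>T. indicator {T. 0 \<le> min_edge T} T :: ennreal) \<in> borel_measurable tree_space"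
  unfolding indicator_def by measurable

text \<open>
  After an attachment the youngest edge is the new one, of age \<open>0\<close>, as no edge in the support of
  the weight has a negative age.
\<close>

lemma attach_weight_cong:
  assumes b: "0 \<le> b" and k: "k \<in> borel_measurable tree_space" "k' \<in> borel_measurable tree_space"
    and eq: "\<And>T. min_edge T = 0 \<Longrightarrow> k T = k' T"
  shows "attach_weight b k = attach_weight b k'"
proof -
  have H: "(\<integral>\<^sup>+S. f S \<partial>H_law 0) = (\<integral>\<^sup>+S. indicator {T. 0 \<le> min_edge T} S * f S \<partial>H_law 0)"
    if f[measurable]: "f \<in> borel_measurable tree_space" for f
  proof -
    have fI: "(\<lambda>S. indicator {T. 0 \<le> min_edge T} S * f S) \<in> borel_measurable tree_space" by measurable
    show ?thesis
      unfolding nn_integral_H_law[OF f] nn_integral_H_law[OF fI]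
    proof (rule nn_integral_cong)
      fix a :: real
      show "indicator {0..} a * (ennreal (1 / 2) * tree_weight a f) = indicator {0..} a * (ennreal (1 / 2) * tree_weight a (\<lambda>S. indicator {T. 0 \<le> min_edge T} S * f S))"
        using tree_weight_nonneg_edges[OF _ f, of a] by (cases "0 \<le> a") simp_all
    qed
  qed
  have sm: "(\<lambda>S. \<Sum>T'\<in>#attachments S T. k T') \<in> borel_measurable tree_space"
    if "k \<in> borel_measurable tree_space" for k :: "aged_tree \<Rightarrow> ennreal" and T
    by (rule measurable_attachments_sum0) fact
  have att: "attach k T = attach k' T" if "0 \<le> min_edge T" for T
    unfolding attach_def H[OF sm[OF k(1)]] H[OF sm[OF k(2)]]
  proof (rule nn_integral_cong)
    fix S
    show "indicator {T. 0 \<le> min_edge T} S * (\<Sum>T'\<in>#attachments S T. k T') = indicator {T. 0 \<le> min_edge T} S * (\<Sum>T'\<in>#attachments S T. k' T')"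
    proof (cases "0 \<le> min_edge S")
      case True
      then have "(\<Sum>T'\<in>#attachments S T. k T') = (\<Sum>T'\<in>#attachments S T. k' T')"
        using that by (intro arg_cong[of _ _ sum_mset] image_mset_cong eq min_edge_attachments)
      then show ?thesis by simp
    qed simp
  qed
  have "attach_weight b k = tree_weight b (\<lambda>T. indicator {T. 0 \<le> min_edge T} T * attach k T)"
    unfolding attach_weight_def by (rule tree_weight_nonneg_edges[OF b borel_measurable_attach_const[OF k(1)], symmetric])
  also have "\<dots> = tree_weight b (\<lambda>T. indicator {T. 0 \<le> min_edge T} T * attach k' T)"
    by (rule tree_weight_cong) (use att in \<open>auto simp: indicator_def\<close>)
  also have "\<dots> = attach_weight b k'"
    unfolding attach_weight_def by (rule tree_weight_nonneg_edges[OF b borel_measurable_attach_const[OF k(2)]])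
  finally show ?thesis .
qed

lemma offspring_min_null_aux:
  assumes u[measurable]: "u \<in> borel_measurable tree_space"
    and null: "\<And>a. 0 \<le> a \<Longrightarrow> tree_weight a (\<lambda>T. indicator {T. min_edge T = c} T * u T) = 0"
  shows "(\<integral>\<^sup>+p. indicator {p. edge_min p = c} p * u (snd p) \<partial>offspring b) = 0"
proof -
  have m: "(\<lambda>p. indicator {p. edge_min p = c} p * u (snd p)) \<in> borel_measurable edge_space"
    unfolding indicator_def by measurable
  have z: "(\<integral>\<^sup>+e. indicator {0..min b a} e * (ennreal (1 / 2) * tree_weight a (\<lambda>T. indicator {p. edge_min p = c} (e, T) * u (snd (e, T)))) \<partial>lborel) = (\<integral>\<^sup>+e. 0 \<partial>(lborel :: real measure))"
    if a: "0 \<le> a" for a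
  proof (rule nn_integral_cong_AE)
    show "AE e in lborel. indicator {0..min b a} e * (ennreal (1 / 2) * tree_weight a (\<lambda>T. indicator {p. edge_min p = c} (e, T) * u (snd (e, T)))) = 0"
      using AE_lborel_singleton[of "real_of_ereal c"]
    proof eventually_elim
      case (elim e)
      have "tree_weight a (\<lambda>T. indicator {p. edge_min p = c} (e, T) * u (snd (e, T))) \<le> tree_weight a (\<lambda>T. indicator {T. min_edge T = c} T * u T)"
        using elim by (intro tree_weight_mono) (auto simp: indicator_def edge_min_def min_def split: if_splits)
      then have "tree_weight a (\<lambda>T. indicator {p. edge_min p = c} (e, T) * u (snd (e, T))) = 0"
        using null[OF a] by simp
      then show ?case by simp
    qed
  qed
  have "indicator {0..} a * (\<integral>\<^sup>+e. indicator {0..min b a} e * (ennreal (1 / 2) * tree_weight a (\<lambda>T. indicator {p. edge_min p = c} (e, T) * u (snd (e, T)))) \<partial>lborel) = 0" for a :: real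
    using z[of a] by (cases "0 \<le> a") simp_all
  then show ?thesis
    unfolding nn_integral_offspring[OF m] by (simp only: nn_integral_const mult_zero_left)
qed

text \<open>
  Almost surely no edge has age exactly \<open>c\<close>, because edge ages are uniform.
\<close>

lemma tree_weight_min_edge_null_bounded:
  assumes c: "c \<noteq> \<infinity>" and "0 \<le> b"
  shows "tree_weight b (\<lambda>T. indicator {T. min_edge T = c} T * indicator {T. num_vertices T \<le> m} T) = 0"
  using assms(2)
proof (induction m arbitrary: b)
  case 0
  have "indicator {T. min_edge T = c} T * indicator {T. num_vertices T \<le> 0} T = (0 :: ennreal)" for T
    using num_vertices_pos[of T] by (simp add: indicator_def)
  then show ?case by (simp only: tree_weight_def nn_integral_const mult_zero_left mult_zero_right)
next
  case (Suc m b)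
  interpret N: finite_full_measure "offspring b" by (rule finite_offspring)
  let ?g = "\<lambda>p. indicator {p. edge_min p = c} p * indicator {T. num_vertices T \<le> m} (snd p) :: ennreal"
  have g: "?g \<in> borel_measurable edge_space"
    unfolding indicator_def by measurable
  have g0: "(\<integral>\<^sup>+p. ?g p \<partial>offspring b) = 0"
    by (rule offspring_min_null_aux[OF borel_measurable_indicator[OF num_vertices_le_set] Suc.IH])
  have m: "(\<lambda>T. indicator {T. min_edge T = c} T * indicator {T. num_vertices T \<le> Suc m} T :: ennreal) \<in> borel_measurable tree_space"
    unfolding indicator_def by measurable
  have fp: "tree_weight b (\<lambda>T. indicator {T. min_edge T = c} T * indicator {T. num_vertices T \<le> Suc m} T) =
     ennreal (exp (- b)) * poisson_int (offspring b) (\<lambda>C. indicator {T. min_edge T = c} (Vertex b C) * indicator {T. num_vertices T \<le> Suc m} (Vertex b C))"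
    by (rule tree_weight_fixed_point[OF Suc.prems m])
  have "poisson_int (offspring b) (\<lambda>C. indicator {T. min_edge T = c} (Vertex b C) * indicator {T. num_vertices T \<le> Suc m} (Vertex b C)) \<le>
     poisson_int (offspring b) (\<lambda>C. \<Sum>p\<in>#C. (\<lambda>p D. ?g p) p (C - {#p#}))"
  proof (rule poisson_int_mono_fun)
    fix C
    show "indicator {T. min_edge T = c} (Vertex b C) * indicator {T. num_vertices T \<le> Suc m} (Vertex b C) \<le> (\<Sum>p\<in>#C. (\<lambda>p D. ?g p) p (C - {#p#}))"
    proof (cases "min_edge (Vertex b C) = c \<and> num_vertices (Vertex b C) \<le> Suc m")
      case True
      then obtain p where p: "p \<in># C" "edge_min p = c"
        using min_edge_attained[of "Vertex b C" c] c by auto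
      have "num_vertices (snd p) \<le> m"
        using num_vertices_child_less[OF p(1), of b] True by linarith
      then have "?g p = 1" using p by simp
      moreover obtain D where "C = add_mset p D" using p(1) by (meson mset_add)
      ultimately have "1 \<le> (\<Sum>p\<in>#C. ?g p)" by simp
      then show ?thesis using True by (simp only: indicator_simps mem_Collect_eq mult_1_left)
    next
      case False
      then have "indicator {T. min_edge T = c} (Vertex b C) * indicator {T. num_vertices T \<le> Suc m} (Vertex b C) = (0::ennreal)"
        unfolding indicator_def by (auto simp del: min_edge.simps num_vertices.simps)
      then show ?thesis by (simp only: zero_le)
    qed
  qed
  also have "poisson_int (offspring b) (\<lambda>C. \<Sum>p\<in>#C. (\<lambda>p D. ?g p) p (C - {#p#})) = (\<integral>\<^sup>+p. poisson_int (offspring b) (\<lambda>C. ?g p * 1) \<partial>offspring b)"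
    unfolding mult_1_right
    by (rule N.poisson_int_Mecke) (use measurable_compose[OF measurable_fst g] in \<open>simp add: case_prod_unfold measurable_cong_sets[OF sets_pair_measure_cong[OF sets_offspring refl] refl]\<close>)
  also have "\<dots> = (\<integral>\<^sup>+p. ?g p * poisson_int (offspring b) (\<lambda>C. 1) \<partial>offspring b)"
    by (intro nn_integral_cong N.poisson_int_cmult) simp
  also have "\<dots> = (\<integral>\<^sup>+p. ?g p \<partial>offspring b) * poisson_int (offspring b) (\<lambda>C. 1)"
    by (rule nn_integral_multc) (use g in \<open>simp add: measurable_offspring\<close>)
  also have "\<dots> = 0" by (simp only: g0 mult_zero_left)
  finally have "poisson_int (offspring b) (\<lambda>C. indicator {T. min_edge T = c} (Vertex b C) * indicator {T. num_vertices T \<le> Suc m} (Vertex b C)) \<le> 0" .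
  then show ?case unfolding fp by (simp only: le_zero_eq mult_zero_right)
qed

lemma tree_weight_min_edge_null:
  assumes c: "c \<noteq> \<infinity>" and b: "0 \<le> b"
  shows "tree_weight b (\<lambda>T. indicator {T. min_edge T = c} T * 1) = 0"
proof -
  have [measurable]: "(\<lambda>T. indicator {T. min_edge T = c} T :: ennreal) \<in> borel_measurable tree_space"
    unfolding indicator_def by measurable
  have "tree_weight b (\<lambda>T. indicator {T. min_edge T = c} T) =
    tree_weight b (\<lambda>T. SUP m. indicator {T. min_edge T = c} T * indicator {T. num_vertices T \<le> m} T)"
    by (simp only: SUP_size_truncation)
  also have "\<dots> = (SUP m. tree_weight b (\<lambda>T. indicator {T. min_edge T = c} T * indicator {T. num_vertices T \<le> m} T))"
    by (rule tree_weight_SUP[OF _ incseq_size_truncation]) measurable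
  also have "\<dots> = 0"
    by (simp add: tree_weight_min_edge_null_bounded[OF c b])
  finally show ?thesis by simp
qed

lemma offspring_edge_min_null: "(\<integral>\<^sup>+p. indicator {p. edge_min p = c} p \<partial>offspring b) = 0"
proof (cases "c = \<infinity>")
  case True
  then show ?thesis using edge_min_not_PInf by (simp add: indicator_def)
next
  case False
  then show ?thesis
    using offspring_min_null_aux[of "\<lambda>_. 1" c b] tree_weight_min_edge_null[OF False] by simp
qed

lemma attach_Vertex:
  assumes k[measurable]: "k \<in> borel_measurable tree_space"
  shows "attach k (Vertex b C) = (\<integral>\<^sup>+S. k (Vertex b (add_mset (0, S) C)) \<partial>H_law 0) +
    (\<Sum>p\<in>#C. attach (\<lambda>T. k (Vertex b (add_mset (fst p, T) (C - {#p#})))) (snd p))"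
proof -
  have V: "(\<lambda>T. k (Vertex b (add_mset (e, T) D))) \<in> borel_measurable tree_space" for e D
  proof -
    have "(\<lambda>T. Vertex b (add_mset (e, T) D)) \<in> tree_space \<rightarrow>\<^sub>M tree_space"
      by (intro measurable_Vertex measurable_add_edge measurable_Pair measurable_const) simp_all
    from measurable_compose[OF this k] show ?thesis .
  qed
  have "(\<Sum>T'\<in>#attachments S (Vertex b C). k T') = k (Vertex b (add_mset (0, S) C)) +
      (\<Sum>p\<in>#C. \<Sum>T\<in>#attachments S (snd p). k (Vertex b (add_mset (fst p, T) (C - {#p#}))))" for S
    by (subst attachments_eq) (simp add: sum_mset_sum_mset image_mset.compositionality comp_def)
  then have "attach k (Vertex b C) = (\<integral>\<^sup>+S. k (Vertex b (add_mset (0, S) C)) +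
      (\<Sum>p\<in>#C. \<Sum>T\<in>#attachments S (snd p). k (Vertex b (add_mset (fst p, T) (C - {#p#})))) \<partial>H_law 0)"
    by (simp only: attach_def)
  also have "\<dots> = (\<integral>\<^sup>+S. k (Vertex b (add_mset (0, S) C)) \<partial>H_law 0) +
      (\<integral>\<^sup>+S. (\<Sum>p\<in>#C. \<Sum>T\<in>#attachments S (snd p). k (Vertex b (add_mset (fst p, T) (C - {#p#})))) \<partial>H_law 0)"
    by (intro nn_integral_add nn_integral_sum_mset measurable_attachments_sum1 V)
       (use V in \<open>simp add: measurable_cong_sets[OF sets_H_law refl]\<close>)
  also have "(\<integral>\<^sup>+S. (\<Sum>p\<in>#C. \<Sum>T\<in>#attachments S (snd p). k (Vertex b (add_mset (fst p, T) (C - {#p#})))) \<partial>H_law 0) =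
     (\<Sum>p\<in>#C. attach (\<lambda>T. k (Vertex b (add_mset (fst p, T) (C - {#p#})))) (snd p))"
    unfolding attach_def by (intro nn_integral_sum_mset measurable_attachments_sum1 V)
  finally show ?thesis .
qed

lemma measurable_poisson_add_point:
  assumes k[measurable]: "k \<in> borel_measurable tree_space"
  shows "(\<lambda>q. poisson_int (offspring b) (\<lambda>C. k (Vertex b (add_mset q C)))) \<in> borel_measurable edge_space"
proof (rule finite_full_measure.borel_measurable_poisson_int[OF finite_offspring])
  have "(\<lambda>z. k (Vertex b (add_mset (fst z) (snd z)))) \<in> borel_measurable (edge_space \<Otimes>\<^sub>M multiset_space edge_space)"
    by measurable
  then show "(\<lambda>(q, C). k (Vertex b (add_mset q C))) \<in> borel_measurable (edge_space \<Otimes>\<^sub>M multiset_space (offspring b))"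
    by (simp add: case_prod_unfold multiset_space_offspring)
qed

text \<open>
  A tree with a marked edge of age \<open>0\<close>: the edge leads either from the root to a copy of \<open>H\<close>, or
  lies in the branch of a child. By the Mecke formula the other children are unaffected by this
  branch, and \<open>R q\<close> collects them around a given branch \<open>q\<close>.
\<close>

lemma attach_weight_fixed_point:
  assumes b: "0 \<le> b" and k[measurable]: "k \<in> borel_measurable tree_space"
  defines "R \<equiv> \<lambda>q. poisson_int (offspring b) (\<lambda>C. k (Vertex b (add_mset q C)))"
  shows "attach_weight b k = ennreal (exp (- b)) * ((\<integral>\<^sup>+S. R (0, S) \<partial>H_law 0) +
    (\<integral>\<^sup>+a. indicator {0..} a * (\<integral>\<^sup>+e. indicator {0..min b a} e * (ennreal (1 / 2) * attach_weight a (\<lambda>T. R (e, T))) \<partial>lborel) \<partial>lborel))"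
proof -
  interpret N: finite_full_measure "offspring b" by (rule finite_offspring)
  have R[measurable]: "R \<in> borel_measurable edge_space"
    unfolding R_def by (rule measurable_poisson_add_point[OF k])
  let ?f1 = "\<lambda>C. \<integral>\<^sup>+S. k (Vertex b (add_mset (0, S) C)) \<partial>H_law 0"
  let ?f2 = "\<lambda>p D. attach (\<lambda>T. k (Vertex b (add_mset (fst p, T) D))) (snd p)"
  have f1: "?f1 \<in> borel_measurable (multiset_space edge_space)"
    by (rule borel_measurable_H_integral) measurable
  have k3: "(\<lambda>(z, T). k (Vertex b (add_mset (fst (fst z), T) (snd z)))) \<in> borel_measurable ((edge_space \<Otimes>\<^sub>M multiset_space edge_space) \<Otimes>\<^sub>M tree_space)"
    by measurable
  have f2: "(\<lambda>z. ?f2 (fst z) (snd z)) \<in> borel_measurable (edge_space \<Otimes>\<^sub>M multiset_space edge_space)"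
    by (rule borel_measurable_attach[OF _ k3]) measurable
  have sN: "sets (offspring b \<Otimes>\<^sub>M multiset_space (offspring b)) = sets (edge_space \<Otimes>\<^sub>M multiset_space edge_space)"
    by (rule sets_pair_measure_cong) (simp_all add: sets_offspring multiset_space_offspring)
  have f2': "(\<lambda>(p, C). ?f2 p C) \<in> borel_measurable (offspring b \<Otimes>\<^sub>M multiset_space (offspring b))"
    unfolding measurable_cong_sets[OF sN refl] using f2 by (simp add: case_prod_unfold)
  have f2s: "(\<lambda>C. \<Sum>p\<in>#C. ?f2 p (C - {#p#})) \<in> borel_measurable (multiset_space edge_space)"
  proof -
    have "(\<lambda>(C, z). ?f2 (fst z) (snd z)) \<in> borel_measurable (multiset_space edge_space \<Otimes>\<^sub>M edge_space \<Otimes>\<^sub>M multiset_space edge_space)"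
      using measurable_compose[OF measurable_snd f2] by (simp add: case_prod_unfold)
    then show ?thesis
      using borel_measurable_sum_mset_remove[OF space_edge_space measurable_ident_sets[OF refl], where g = "\<lambda>_. ?f2"]
      by (simp add: case_prod_unfold)
  qed
  have P1: "poisson_int (offspring b) ?f1 = (\<integral>\<^sup>+S. R (0, S) \<partial>H_law 0)"
    unfolding R_def
  proof (rule N.poisson_int_nn_integral[OF sigma_finite_H_law])
    have s: "sets (H_law 0 \<Otimes>\<^sub>M multiset_space (offspring b)) = sets (tree_space \<Otimes>\<^sub>M multiset_space edge_space)"
      by (rule sets_pair_measure_cong) (simp_all add: sets_H_law multiset_space_offspring)
    show "(\<lambda>(S, C). k (Vertex b (add_mset (0, S) C))) \<in> borel_measurable (H_law 0 \<Otimes>\<^sub>M multiset_space (offspring b))"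
      unfolding measurable_cong_sets[OF s refl] by measurable
  qed
  have P2: "poisson_int (offspring b) (?f2 p) = attach (\<lambda>T. R (fst p, T)) (snd p)" for p
  proof -
    let ?h = "\<lambda>S C. \<Sum>T\<in>#attachments S (snd p). k (Vertex b (add_mset (fst p, T) C))"
    have s: "sets (H_law 0 \<Otimes>\<^sub>M multiset_space (offspring b)) = sets (tree_space \<Otimes>\<^sub>M multiset_space edge_space)"
      by (rule sets_pair_measure_cong) (simp_all add: sets_H_law multiset_space_offspring)
    have "(\<lambda>z. ?h (fst z) (snd z)) \<in> borel_measurable (tree_space \<Otimes>\<^sub>M multiset_space edge_space)"
    proof (rule borel_measurable_attachments_sum)
      show "(\<lambda>(z, T). k (Vertex b (add_mset (fst p, T) (snd z)))) \<in> borel_measurable ((tree_space \<Otimes>\<^sub>M multiset_space edge_space) \<Otimes>\<^sub>M tree_space)"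
        by measurable
    qed measurable
    then have h: "(\<lambda>(S, C). ?h S C) \<in> borel_measurable (H_law 0 \<Otimes>\<^sub>M multiset_space (offspring b))"
      unfolding measurable_cong_sets[OF s refl] by (simp add: case_prod_unfold)
    have "poisson_int (offspring b) (?f2 p) = (\<integral>\<^sup>+S. poisson_int (offspring b) (?h S) \<partial>H_law 0)"
      unfolding attach_def by (rule N.poisson_int_nn_integral[OF sigma_finite_H_law h])
    also have "\<dots> = (\<integral>\<^sup>+S. (\<Sum>T\<in>#attachments S (snd p). R (fst p, T)) \<partial>H_law 0)"
      unfolding R_def by (intro nn_integral_cong N.poisson_int_sum_mset) (unfold multiset_space_offspring, measurable)
    finally show ?thesis by (simp only: attach_def)
  qed
  have aR: "(\<lambda>p. attach (\<lambda>T. R (fst p, T)) (snd p)) \<in> borel_measurable edge_space"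
    by (rule borel_measurable_attach) measurable
  have "attach_weight b k = ennreal (exp (- b)) * poisson_int (offspring b) (\<lambda>C. attach k (Vertex b C))"
    unfolding attach_weight_def by (rule tree_weight_fixed_point[OF b borel_measurable_attach_const[OF k]])
  also have "poisson_int (offspring b) (\<lambda>C. attach k (Vertex b C)) = poisson_int (offspring b) (\<lambda>C. ?f1 C + (\<Sum>p\<in>#C. ?f2 p (C - {#p#})))"
    unfolding attach_Vertex[OF k] ..
  also have "\<dots> = poisson_int (offspring b) ?f1 + poisson_int (offspring b) (\<lambda>C. \<Sum>p\<in>#C. ?f2 p (C - {#p#}))"
    by (rule N.poisson_int_add) (unfold multiset_space_offspring, rule f1, rule f2s)
  also have "poisson_int (offspring b) (\<lambda>C. \<Sum>p\<in>#C. ?f2 p (C - {#p#})) = (\<integral>\<^sup>+p. attach (\<lambda>T. R (fst p, T)) (snd p) \<partial>offspring b)"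
    unfolding N.poisson_int_Mecke[OF f2'] P2 ..
  also have "\<dots> = (\<integral>\<^sup>+a. indicator {0..} a * (\<integral>\<^sup>+e. indicator {0..min b a} e * (ennreal (1 / 2) * attach_weight a (\<lambda>T. R (e, T))) \<partial>lborel) \<partial>lborel)"
    unfolding nn_integral_offspring[OF aR] attach_weight_def fst_conv snd_conv ..
  finally show ?thesis by (simp only: P1)
qed

section \<open>Decomposition of a tree at its youngest edge\<close>

text \<open>
  Decomposition of a single branch \<open>(e, T)\<close> at the age \<open>c\<close> of its youngest edge. If that is the
  edge to the root, lowering ages by \<open>c\<close> leaves a subtree whose root has an age of density
  \<open>1/2 w\<close>, which is a copy of \<open>H\<close>. Otherwise the youngest edge is in \<open>T\<close>, and \<open>T\<close> is decomposed
  by the hypothesis. Its first summand, the tree without edges, belongs to the former case.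
\<close>

lemma nn_integral_offspring_by_min:
  fixes h :: "real \<times> (real \<times> aged_tree) \<Rightarrow> ennreal"
  assumes h[measurable]: "h \<in> borel_measurable (borel \<Otimes>\<^sub>M edge_space)"
    and supp: "\<And>c p. snd p \<notin> S \<Longrightarrow> h (c, p) = 0"
    and IH: "\<And>a f. 0 \<le> a \<Longrightarrow> f \<in> borel_measurable tree_space \<Longrightarrow> (\<And>T. T \<notin> S \<Longrightarrow> f T = 0) \<Longrightarrow>
      tree_weight a f = ennreal (exp (- a)) * f (Vertex a {#}) +
        (\<integral>\<^sup>+c. indicator {0..a} c * attach_weight (a - c) (\<lambda>T. decay c T * f (grow c T)) \<partial>lborel)"
  shows "(\<integral>\<^sup>+p. h (real_of_ereal (edge_min p), p) \<partial>offspring b) =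
    (\<integral>\<^sup>+c. indicator {0..b} c * ((\<integral>\<^sup>+S. decay c S * h (c, c, grow c S) \<partial>H_law 0) +
      (\<integral>\<^sup>+a. indicator {0..} a * (\<integral>\<^sup>+e. indicator {0..min (b - c) a} e *
        (ennreal (1 / 2) * attach_weight a (\<lambda>T. decay c T * h (c, e + c, grow c T))) \<partial>lborel) \<partial>lborel)) \<partial>lborel)"
proof -
  let ?half = "ennreal (1 / 2)"
  have g: "(\<lambda>p. h (real_of_ereal (edge_min p), p)) \<in> borel_measurable edge_space"
    by measurable
  define X where "X = (\<lambda>(a, c, e). attach_weight (a - c) (\<lambda>T. decay c T * h (c, e, grow c T)))"
  have X[measurable]: "X \<in> borel_measurable (borel \<Otimes>\<^sub>M (borel \<Otimes>\<^sub>M borel))"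
    unfolding X_def case_prod_unfold by measurable
  define A where "A = (\<lambda>(a, e). ?half * tree_weight (a - e) (\<lambda>T. decay e T * h (e, e, grow e T)))"
  have A[measurable]: "A \<in> borel_measurable (borel \<Otimes>\<^sub>M borel)"
    unfolding A_def case_prod_unfold by measurable
  define G where "G = (\<lambda>(a, c, e). if 0 \<le> c \<and> c < e \<and> e \<le> b \<and> e \<le> a then ?half * X (a, c, e) else 0)"
  have G[measurable]: "G \<in> borel_measurable (borel \<Otimes>\<^sub>M (borel \<Otimes>\<^sub>M borel))"
    unfolding G_def case_prod_unfold by measurable
  have X_eq: "X (a, c, e) = attach_weight (a - c) (\<lambda>T. decay c T * h (c, e, grow c T))" for a c e
    by (simp only: X_def prod.case)
  have A_eq: "A (a, e) = ?half * tree_weight (a - e) (\<lambda>T. decay e T * h (e, e, grow e T))" for a e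
    by (simp only: A_def prod.case)
  have G_eq: "G (a, c, e) = (if 0 \<le> c \<and> c < e \<and> e \<le> b \<and> e \<le> a then ?half * X (a, c, e) else 0)" for a c e
    by (simp only: G_def prod.case)
  define B where "B a e = ?half * (\<integral>\<^sup>+c. indicator {0..a} c * (indicator {..<e} c * X (a, c, e)) \<partial>lborel)" for a e
  have B_G: "indicator {0..b} e * (indicator {e..} a * B a e) = (\<integral>\<^sup>+c. G (a, c, e) \<partial>lborel)" for a e
  proof (cases "0 \<le> e \<and> e \<le> b \<and> e \<le> a")
    case True
    have "B a e = (\<integral>\<^sup>+c. ?half * (indicator {0..a} c * (indicator {..<e} c * X (a, c, e))) \<partial>lborel)"
      unfolding B_def by (rule nn_integral_cmult[symmetric]) measurable
    also have "\<dots> = (\<integral>\<^sup>+c. G (a, c, e) \<partial>lborel)"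
      using True by (intro nn_integral_cong) (auto simp: G_eq indicator_def)
    finally show ?thesis using True by simp
  next
    case False
    then have "G (a, c, e) = 0" for c by (auto simp: G_eq)
    then show ?thesis using False by (auto simp: indicator_def)
  qed
  \<comment> \<open>For given \<open>a\<close> and \<open>e\<close>, either \<open>e\<close> is minimal (\<open>A\<close>) or the minimum \<open>c < e\<close> is in the subtree
    (\<open>B\<close>).\<close>
  have split: "?half * tree_weight a (\<lambda>T. h (real_of_ereal (edge_min (e, T)), (e, T))) = A (a, e) + B a e"
    if a: "0 \<le> a" and e: "0 \<le> e" "e \<le> a" for a e
  proof -
    define f where "f T = indicator {T. min_edge T < ereal e} T * h (real_of_ereal (min_edge T), (e, T))" for T
    have f: "f \<in> borel_measurable tree_space"
      unfolding f_def indicator_def by measurable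
    have he: "(\<lambda>T. h (e, (e, T))) \<in> borel_measurable tree_space" by measurable
    have hi: "(\<lambda>T. indicator {T. ereal e \<le> min_edge T} T * h (e, (e, T))) \<in> borel_measurable tree_space"
      unfolding indicator_def by measurable
    have "h (real_of_ereal (edge_min (e, T)), (e, T)) = indicator {T. ereal e \<le> min_edge T} T * h (e, (e, T)) + f T" for T
    proof (cases "ereal e \<le> min_edge T")
      case True
      then have "edge_min (e, T) = ereal e"
        unfolding edge_min_def fst_conv snd_conv by (rule min_absorb1)
      then show ?thesis using True by (simp add: f_def not_less)
    next
      case False
      then have "edge_min (e, T) = min_edge T"
        unfolding edge_min_def fst_conv snd_conv by (intro min_absorb2) simp
      then show ?thesis using False by (simp add: f_def not_le)
    qed
    then have "tree_weight a (\<lambda>T. h (real_of_ereal (edge_min (e, T)), (e, T))) =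
        tree_weight a (\<lambda>T. indicator {T. ereal e \<le> min_edge T} T * h (e, (e, T))) + tree_weight a f"
      by (simp only: tree_weight_add[OF hi f])
    moreover have "?half * tree_weight a (\<lambda>T. indicator {T. ereal e \<le> min_edge T} T * h (e, (e, T))) = A (a, e)"
      unfolding A_eq tree_weight_scale[OF e he] ..
    moreover have "?half * tree_weight a f = B a e"
    proof -
      have "f T = 0" if "T \<notin> S" for T
        using supp[of "(e, T)"] that by (simp add: f_def)
      then have "tree_weight a f = ennreal (exp (- a)) * f (Vertex a {#}) +
        (\<integral>\<^sup>+c. indicator {0..a} c * attach_weight (a - c) (\<lambda>T. decay c T * f (grow c T)) \<partial>lborel)"
        by (rule IH[OF a f])
      also have "f (Vertex a {#}) = 0"
        unfolding f_def min_edge_single by simp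
      also have "(\<integral>\<^sup>+c. indicator {0..a} c * attach_weight (a - c) (\<lambda>T. decay c T * f (grow c T)) \<partial>lborel) =
        (\<integral>\<^sup>+c. indicator {0..a} c * (indicator {..<e} c * X (a, c, e)) \<partial>lborel)"
      proof (rule nn_integral_cong)
        fix c :: real
        show "indicator {0..a} c * attach_weight (a - c) (\<lambda>T. decay c T * f (grow c T)) = indicator {0..a} c * (indicator {..<e} c * X (a, c, e))"
        proof (cases "0 \<le> c \<and> c \<le> a")
          case True
          have "attach_weight (a - c) (\<lambda>T. decay c T * f (grow c T)) = attach_weight (a - c) (\<lambda>T. indicator {..<e} c * (decay c T * h (c, e, grow c T)))"
          proof (rule attach_weight_cong)
            show "(\<lambda>T. decay c T * f (grow c T)) \<in> borel_measurable tree_space"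
              using f by measurable
            show "(\<lambda>T. indicator {..<e} c * (decay c T * h (c, e, grow c T))) \<in> borel_measurable tree_space"
              by measurable
            show "decay c T * f (grow c T) = indicator {..<e} c * (decay c T * h (c, e, grow c T))" if "min_edge T = 0" for T
              unfolding f_def indicator_def mem_Collect_eq min_edge_grow_0[OF that] by (simp add: mult.left_commute)
          qed (use True in simp)
          also have "\<dots> = indicator {..<e} c * X (a, c, e)"
            unfolding X_eq by (rule attach_weight_cmult) measurable
          finally show ?thesis by (simp only:)
        next
          case False
          then have "indicator {0..a} c = (0 :: ennreal)" by (simp add: indicator_def)
          then show ?thesis by (simp only: mult_zero_left)
        qed
      qed
      finally show ?thesis unfolding B_def by (simp only: mult_zero_right add_0_left)
    qed
    ultimately show ?thesis by (simp only: distrib_left)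
  qed
  define W where "W a e = A (a, e) + (\<integral>\<^sup>+c. G (a, c, e) \<partial>lborel)" for a e
  have W: "(\<lambda>(a, e). W a e) \<in> borel_measurable (borel \<Otimes>\<^sub>M borel)"
    unfolding W_def case_prod_unfold by measurable
  have "(\<integral>\<^sup>+p. h (real_of_ereal (edge_min p), p) \<partial>offspring b) =
     (\<integral>\<^sup>+a. 1 * indicator {0..} a * (\<integral>\<^sup>+e. indicator {0..min b a} e * W a e \<partial>lborel) \<partial>lborel)"
    unfolding nn_integral_offspring[OF g]
  proof (rule nn_integral_cong)
    fix a :: real
    have eq: "indicator {0..min b a} e * (?half * tree_weight a (\<lambda>T. h (real_of_ereal (edge_min (e, T)), e, T))) = indicator {0..min b a} e * W a e"
      if "0 \<le> a" for e
    proof (cases "0 \<le> e \<and> e \<le> b \<and> e \<le> a")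
      case True
      have "W a e = A (a, e) + B a e"
        unfolding W_def B_G[symmetric] using True by simp
      then show ?thesis using split[of a e] True that by (simp only:)
    next
      case False
      then have "indicator {0..min b a} e = (0 :: ennreal)" by (auto simp: indicator_def)
      then show ?thesis by (simp only: mult_zero_left)
    qed
    show "indicator {0..} a * (\<integral>\<^sup>+e. indicator {0..min b a} e * (?half * tree_weight a (\<lambda>T. h (real_of_ereal (edge_min (e, T)), e, T))) \<partial>lborel) =
       1 * indicator {0..} a * (\<integral>\<^sup>+e. indicator {0..min b a} e * W a e \<partial>lborel)"
    proof (cases "0 \<le> a")
      case True
      then show ?thesis by (simp only: eq[OF True] mult_1_left)
    next
      case False
      then have "indicator {0..} a = (0 :: ennreal)" by (simp add: indicator_def)
      then show ?thesis by (simp only: mult_zero_left mult_zero_right)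
    qed
  qed
  also have "\<dots> = (\<integral>\<^sup>+e. indicator {0..b} e * (\<integral>\<^sup>+a. 1 * indicator {e..} a * W a e \<partial>lborel) \<partial>lborel)"
    by (rule child_swap[OF W]) simp
  also have "\<dots> = (\<integral>\<^sup>+e. indicator {0..b} e * (\<integral>\<^sup>+S. decay e S * h (e, e, grow e S) \<partial>H_law 0) + (\<integral>\<^sup>+a. \<integral>\<^sup>+c. G (a, c, e) \<partial>lborel \<partial>lborel) \<partial>lborel)"
  proof (rule nn_integral_cong)
    fix e :: real
    have G0: "indicator {0..b} e * (\<integral>\<^sup>+a. indicator {e..} a * (\<integral>\<^sup>+c. G (a, c, e) \<partial>lborel) \<partial>lborel) = (\<integral>\<^sup>+a. \<integral>\<^sup>+c. G (a, c, e) \<partial>lborel \<partial>lborel)"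
    proof -
      have "indicator {0..b} e * (\<integral>\<^sup>+a. indicator {e..} a * (\<integral>\<^sup>+c. G (a, c, e) \<partial>lborel) \<partial>lborel) =
         (\<integral>\<^sup>+a. indicator {0..b} e * (indicator {e..} a * (\<integral>\<^sup>+c. G (a, c, e) \<partial>lborel)) \<partial>lborel)"
        by (rule nn_integral_cmult[symmetric]) measurable
      also have "\<dots> = (\<integral>\<^sup>+a. \<integral>\<^sup>+c. G (a, c, e) \<partial>lborel \<partial>lborel)"
      proof (rule nn_integral_cong)
        fix a
        have "(\<integral>\<^sup>+c. G (a, c, e) \<partial>lborel) = 0" if "\<not> (e \<in> {0..b} \<and> a \<in> {e..})"
        proof -
          have "G (a, c, e) = 0" for c using that by (auto simp: G_eq)
          then show ?thesis by simp
        qed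
        then show "indicator {0..b} e * (indicator {e..} a * (\<integral>\<^sup>+c. G (a, c, e) \<partial>lborel)) = (\<integral>\<^sup>+c. G (a, c, e) \<partial>lborel)"
          by (cases "e \<in> {0..b} \<and> a \<in> {e..}") (auto simp: indicator_def)
      qed
      finally show ?thesis .
    qed
    have "(\<integral>\<^sup>+a. indicator {e..} a * A (a, e) \<partial>lborel) = (\<integral>\<^sup>+a. indicator {e..} (a + e) * A (a + e, e) \<partial>lborel)"
      by (rule nn_integral_shift) measurable
    also have "\<dots> = (\<integral>\<^sup>+S. decay e S * h (e, e, grow e S) \<partial>H_law 0)"
      by (subst nn_integral_H_law) (measurable, auto intro!: nn_integral_cong simp: A_eq indicator_def)
    finally have PA: "(\<integral>\<^sup>+a. indicator {e..} a * A (a, e) \<partial>lborel) = (\<integral>\<^sup>+S. decay e S * h (e, e, grow e S) \<partial>H_law 0)" .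
    have "(\<integral>\<^sup>+a. 1 * indicator {e..} a * W a e \<partial>lborel) = (\<integral>\<^sup>+a. indicator {e..} a * A (a, e) + indicator {e..} a * (\<integral>\<^sup>+c. G (a, c, e) \<partial>lborel) \<partial>lborel)"
      by (simp only: W_def mult_1_left distrib_left)
    also have "\<dots> = (\<integral>\<^sup>+a. indicator {e..} a * A (a, e) \<partial>lborel) + (\<integral>\<^sup>+a. indicator {e..} a * (\<integral>\<^sup>+c. G (a, c, e) \<partial>lborel) \<partial>lborel)"
      by (rule nn_integral_add) measurable
    finally show "indicator {0..b} e * (\<integral>\<^sup>+a. 1 * indicator {e..} a * W a e \<partial>lborel) =
      indicator {0..b} e * (\<integral>\<^sup>+S. decay e S * h (e, e, grow e S) \<partial>H_law 0) + (\<integral>\<^sup>+a. \<integral>\<^sup>+c. G (a, c, e) \<partial>lborel \<partial>lborel)"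
      by (simp only: distrib_left PA G0)
  qed
  also have "\<dots> = (\<integral>\<^sup>+e. indicator {0..b} e * (\<integral>\<^sup>+S. decay e S * h (e, e, grow e S) \<partial>H_law 0) \<partial>lborel) + (\<integral>\<^sup>+e. \<integral>\<^sup>+a. \<integral>\<^sup>+c. G (a, c, e) \<partial>lborel \<partial>lborel \<partial>lborel)"
  proof (rule nn_integral_add)
    have [measurable]: "(\<lambda>e. \<integral>\<^sup>+S. decay e S * h (e, e, grow e S) \<partial>H_law 0) \<in> borel_measurable borel"
      by (rule borel_measurable_H_integral) measurable
    show "(\<lambda>e. indicator {0..b} e * (\<integral>\<^sup>+S. decay e S * h (e, e, grow e S) \<partial>H_law 0)) \<in> borel_measurable lborel"
      by measurable
    show "(\<lambda>e. \<integral>\<^sup>+a. \<integral>\<^sup>+c. G (a, c, e) \<partial>lborel \<partial>lborel) \<in> borel_measurable lborel"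
      by measurable
  qed
  \<comment> \<open>It remains to integrate over \<open>c\<close> last, and to shift \<open>a\<close> and \<open>e\<close> by \<open>c\<close>.\<close>
  also have "(\<integral>\<^sup>+e. \<integral>\<^sup>+a. \<integral>\<^sup>+c. G (a, c, e) \<partial>lborel \<partial>lborel \<partial>lborel) = (\<integral>\<^sup>+e. \<integral>\<^sup>+c. \<integral>\<^sup>+a. G (a, c, e) \<partial>lborel \<partial>lborel \<partial>lborel)"
  proof (rule nn_integral_cong)
    fix e :: real
    have "(\<lambda>(a, c). G (a, c, e)) \<in> borel_measurable (lborel \<Otimes>\<^sub>M lborel)"
      by measurable
    from lborel_pair.Fubini'[OF this]
    show "(\<integral>\<^sup>+a. \<integral>\<^sup>+c. G (a, c, e) \<partial>lborel \<partial>lborel) = (\<integral>\<^sup>+c. \<integral>\<^sup>+a. G (a, c, e) \<partial>lborel \<partial>lborel)" by simp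
  qed
  also have "\<dots> = (\<integral>\<^sup>+c. \<integral>\<^sup>+e. \<integral>\<^sup>+a. G (a, c, e) \<partial>lborel \<partial>lborel \<partial>lborel)"
  proof -
    have "(\<lambda>(e, c). \<integral>\<^sup>+a. G (a, c, e) \<partial>lborel) \<in> borel_measurable (lborel \<Otimes>\<^sub>M lborel)"
      by measurable
    from lborel_pair.Fubini'[OF this] show ?thesis by simp
  qed
  also have "\<dots> = (\<integral>\<^sup>+c. \<integral>\<^sup>+a. \<integral>\<^sup>+e. G (a, c, e) \<partial>lborel \<partial>lborel \<partial>lborel)"
  proof (rule nn_integral_cong)
    fix c :: real
    have "(\<lambda>(e, a). G (a, c, e)) \<in> borel_measurable (lborel \<Otimes>\<^sub>M lborel)"
      by measurable
    from lborel_pair.Fubini'[OF this]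
    show "(\<integral>\<^sup>+e. \<integral>\<^sup>+a. G (a, c, e) \<partial>lborel \<partial>lborel) = (\<integral>\<^sup>+a. \<integral>\<^sup>+e. G (a, c, e) \<partial>lborel \<partial>lborel)" by simp
  qed
  also have "\<dots> = (\<integral>\<^sup>+c. indicator {0..b} c * (\<integral>\<^sup>+a. indicator {0..} a * (\<integral>\<^sup>+e. indicator {0..min (b - c) a} e *
        (?half * attach_weight a (\<lambda>T. decay c T * h (c, e + c, grow c T))) \<partial>lborel) \<partial>lborel) \<partial>lborel)"
  proof (rule nn_integral_cong)
    fix c :: real
    let ?Y = "\<lambda>a e. ?half * attach_weight a (\<lambda>T. decay c T * h (c, e + c, grow c T))"
    show "(\<integral>\<^sup>+a. \<integral>\<^sup>+e. G (a, c, e) \<partial>lborel \<partial>lborel) = indicator {0..b} c * (\<integral>\<^sup>+a. indicator {0..} a * (\<integral>\<^sup>+e. indicator {0..min (b - c) a} e * ?Y a e \<partial>lborel) \<partial>lborel)"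
    proof (cases "0 \<le> c \<and> c \<le> b")
      case True
      have "(\<lambda>a. \<integral>\<^sup>+e. G (a, c, e) \<partial>lborel) \<in> borel_measurable borel"
        by measurable
      then have "(\<integral>\<^sup>+a. \<integral>\<^sup>+e. G (a, c, e) \<partial>lborel \<partial>lborel) = (\<integral>\<^sup>+a. \<integral>\<^sup>+e. G (a + c, c, e) \<partial>lborel \<partial>lborel)"
        by (rule nn_integral_shift)
      also have "\<dots> = (\<integral>\<^sup>+a. indicator {0..} a * (\<integral>\<^sup>+e. indicator {0..min (b - c) a} e * ?Y a e \<partial>lborel) \<partial>lborel)"
      proof (rule nn_integral_cong)
        fix a :: real
        have "(\<integral>\<^sup>+e. G (a + c, c, e) \<partial>lborel) = (\<integral>\<^sup>+e. G (a + c, c, e + c) \<partial>lborel)"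
          by (rule nn_integral_shift) measurable
        also have "\<dots> = (\<integral>\<^sup>+e. indicator {0..} a * (indicator {0..min (b - c) a} e * ?Y a e) \<partial>lborel)"
        proof (rule nn_integral_cong_AE)
          show "AE e in lborel. G (a + c, c, e + c) = indicator {0..} a * (indicator {0..min (b - c) a} e * ?Y a e)"
            using AE_lborel_singleton[of 0]
          proof eventually_elim
            case (elim e)
            then show ?case
              using True by (auto simp: G_eq X_eq indicator_def)
          qed
        qed
        also have "\<dots> = indicator {0..} a * (\<integral>\<^sup>+e. indicator {0..min (b - c) a} e * ?Y a e \<partial>lborel)"
          by (rule nn_integral_cmult) measurable
        finally show "(\<integral>\<^sup>+e. G (a + c, c, e) \<partial>lborel) = indicator {0..} a * (\<integral>\<^sup>+e. indicator {0..min (b - c) a} e * ?Y a e \<partial>lborel)" .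
      qed
      finally show ?thesis using True by simp
    next
      case False
      then have "G (a, c, e) = 0" for a e by (auto simp: G_eq)
      moreover have "indicator {0..b} c = (0 :: ennreal)" using False by (simp add: indicator_def)
      ultimately show ?thesis by (simp only: nn_integral_const mult_zero_left)
    qed
  qed
  also have "(\<integral>\<^sup>+e. indicator {0..b} e * (\<integral>\<^sup>+S. decay e S * h (e, e, grow e S) \<partial>H_law 0) \<partial>lborel) + \<dots> =
    (\<integral>\<^sup>+c. indicator {0..b} c * (\<integral>\<^sup>+S. decay c S * h (c, c, grow c S) \<partial>H_law 0) +
      indicator {0..b} c * (\<integral>\<^sup>+a. indicator {0..} a * (\<integral>\<^sup>+e. indicator {0..min (b - c) a} e *
        (?half * attach_weight a (\<lambda>T. decay c T * h (c, e + c, grow c T))) \<partial>lborel) \<partial>lborel) \<partial>lborel)"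
  proof (rule nn_integral_add[symmetric])
    have [measurable]: "(\<lambda>e. \<integral>\<^sup>+S. decay e S * h (e, e, grow e S) \<partial>H_law 0) \<in> borel_measurable borel"
      by (rule borel_measurable_H_integral) measurable
    show "(\<lambda>e. indicator {0..b} e * (\<integral>\<^sup>+S. decay e S * h (e, e, grow e S) \<partial>H_law 0)) \<in> borel_measurable lborel"
      by measurable
    have "(\<lambda>z. indicator {e. 0 \<le> e \<and> e \<le> b - fst (fst z) \<and> e \<le> snd (fst z)} (snd z) *
        (?half * attach_weight (snd (fst z)) (\<lambda>T. decay (fst (fst z)) T * h (fst (fst z), snd z + fst (fst z), grow (fst (fst z)) T)))) \<in> borel_measurable ((borel \<Otimes>\<^sub>M borel) \<Otimes>\<^sub>M lborel)"
      unfolding indicator_def by measurable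
    then have [measurable]: "(\<lambda>(z, e). indicator {0..min (b - fst z) (snd z)} e *
        (?half * attach_weight (snd z) (\<lambda>T. decay (fst z) T * h (fst z, e + fst z, grow (fst z) T)))) \<in> borel_measurable ((borel \<Otimes>\<^sub>M borel) \<Otimes>\<^sub>M lborel)"
      by (simp add: indicator_def case_prod_unfold)
    have "(\<lambda>z. \<integral>\<^sup>+e. indicator {0..min (b - fst z) (snd z)} e *
        (?half * attach_weight (snd z) (\<lambda>T. decay (fst z) T * h (fst z, e + fst z, grow (fst z) T))) \<partial>lborel) \<in> borel_measurable (borel \<Otimes>\<^sub>M borel)"
      by measurable
    then have [measurable]: "(\<lambda>(c, a). \<integral>\<^sup>+e. indicator {0..min (b - c) a} e * (?half * attach_weight a (\<lambda>T. decay c T * h (c, e + c, grow c T))) \<partial>lborel) \<in> borel_measurable (borel \<Otimes>\<^sub>M lborel)"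
      by (simp add: case_prod_unfold)
    show "(\<lambda>c. indicator {0..b} c * (\<integral>\<^sup>+a. indicator {0..} a * (\<integral>\<^sup>+e. indicator {0..min (b - c) a} e *
        (?half * attach_weight a (\<lambda>T. decay c T * h (c, e + c, grow c T))) \<partial>lborel) \<partial>lborel)) \<in> borel_measurable lborel"
      by measurable
  qed
  finally show ?thesis by (simp only: distrib_left)
qed

lemma attach_weight_0: "attach_weight b (\<lambda>T. 0) = 0"
  unfolding attach_weight_def attach_def tree_weight_def by simp

lemma nn_integral_offspring_scale_strict:
  assumes c: "0 \<le> c" "c \<le> b" and g[measurable]: "g \<in> borel_measurable edge_space"
  shows "(\<integral>\<^sup>+p. indicator {p. ereal c < edge_min p} p * g p \<partial>offspring b) =
    (\<integral>\<^sup>+p. decay c (snd p) * g (fst p + c, grow c (snd p)) \<partial>offspring (b - c))"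
proof -
  interpret N: finite_full_measure "offspring b" by (rule finite_offspring)
  have m: "{p. edge_min p = ereal c} \<in> sets (offspring b)"
  proof -
    have "{p \<in> space edge_space. edge_min p = ereal c} \<in> sets edge_space" by measurable
    then show ?thesis by (simp add: sets_offspring space_edge_space)
  qed
  have "AE p in offspring b. edge_min p \<noteq> ereal c"
    using offspring_edge_min_null[where c = "ereal c" and b = b] m
    by (intro AE_I[where N = "{p. edge_min p = ereal c}"]) (auto simp: nn_integral_indicator)
  then have "(\<integral>\<^sup>+p. indicator {p. ereal c < edge_min p} p * g p \<partial>offspring b) =
      (\<integral>\<^sup>+p. indicator {p. ereal c \<le> edge_min p} p * g p \<partial>offspring b)"
    by (intro nn_integral_cong_AE) (auto elim!: eventually_mono simp: indicator_def)
  also have "\<dots> = (\<integral>\<^sup>+p. decay c (snd p) * g (fst p + c, grow c (snd p)) \<partial>offspring (b - c))"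
    by (rule nn_integral_offspring_scale[where S = UNIV, OF c _ g]) (rule tree_weight_scale[OF c(1)], auto)
  finally show ?thesis .
qed

text \<open>
  The weight of trees of root age \<open>b\<close>, decomposed at the youngest edge: without edges there is
  only the root; otherwise let \<open>c\<close> be the least edge age. Lowering all ages by \<open>c\<close> costs
  \<open>exp (- c |T|)\<close> and leaves a tree of root age \<open>b - c\<close> with an edge of age \<open>0\<close>. Among the
  children of the root, the one whose branch contains the youngest edge is found with
  \<open>poisson_int_minimum\<close>; its branch is decomposed by \<open>nn_integral_offspring_by_min\<close>, using the
  claim for smaller trees, and \<open>attach_weight_fixed_point\<close> puts the parts together.
\<close>

lemma tree_weight_core_bounded:
  assumes "\<And>T. m < num_vertices T \<Longrightarrow> f T = 0" "f \<in> borel_measurable tree_space" "0 \<le> b"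
  shows "tree_weight b f = ennreal (exp (- b)) * f (Vertex b {#}) +
    (\<integral>\<^sup>+c. indicator {0..b} c * attach_weight (b - c) (\<lambda>T. decay c T * f (grow c T)) \<partial>lborel)"
  using assms
proof (induction m arbitrary: f b)
  case 0
  then have "f = (\<lambda>_. 0)" by auto
  then show ?case by (simp add: tree_weight_def attach_weight_0)
next
  case (Suc m f b)
  note f[measurable] = Suc.prems(2) and b = Suc.prems(3)
  let ?N = "offspring b" and ?half = "ennreal (1 / 2)"
  interpret N: finite_full_measure "offspring b" by (rule finite_offspring)
  define F where "F C = f (Vertex b C)" for C
  have F[measurable]: "F \<in> borel_measurable (multiset_space edge_space)"
    unfolding F_def by measurable
  \<comment> \<open>The contribution of the branch \<open>q\<close> of the root together with all branches whose edges are
    older than \<open>c\<close>.\<close>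
  define h where "h = (\<lambda>(c, q). poisson_int ?N (\<lambda>C. indicator {C. \<forall>p\<in>#C. ereal c < edge_min p} C * F (add_mset q C)))"
  have h_eq: "h (c, q) = poisson_int ?N (\<lambda>C. indicator {C. \<forall>p\<in>#C. ereal c < edge_min p} C * F (add_mset q C))" for c q
    by (simp only: h_def prod.case)
  have h[measurable]: "h \<in> borel_measurable (borel \<Otimes>\<^sub>M edge_space)"
    unfolding h_def case_prod_unfold
  proof (rule N.borel_measurable_poisson_int)
    have [measurable]: "Measurable.pred ((borel \<Otimes>\<^sub>M edge_space) \<Otimes>\<^sub>M multiset_space edge_space) (\<lambda>z. \<forall>p\<in>#snd z. ereal (fst (fst z)) < edge_min p)"
      by (rule measurable_all_mset[OF space_edge_space]) measurable
    have "(\<lambda>z. (if \<forall>p\<in>#snd z. ereal (fst (fst z)) < edge_min p then 1 else 0) * F (add_mset (snd (fst z)) (snd z)))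
        \<in> borel_measurable ((borel \<Otimes>\<^sub>M edge_space) \<Otimes>\<^sub>M multiset_space edge_space)"
      by measurable
    then show "(\<lambda>(x, C). indicator {C. \<forall>p\<in>#C. ereal (fst x) < edge_min p} C * F (add_mset (snd x) C))
        \<in> borel_measurable ((borel \<Otimes>\<^sub>M edge_space) \<Otimes>\<^sub>M multiset_space (offspring b))"
      by (simp add: indicator_def case_prod_unfold multiset_space_offspring cong: if_cong)
  qed
  have P: "poisson_int ?N F = F {#} + (\<integral>\<^sup>+p. h (real_of_ereal (edge_min p), p) \<partial>?N)"
  proof -
    have "poisson_int ?N F = F {#} + (\<integral>\<^sup>+q. poisson_int ?N (\<lambda>C. indicator {C. \<forall>p\<in>#C. edge_min q < edge_min p} C * F (add_mset q C)) \<partial>?N)"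
    proof (rule N.poisson_int_minimum)
      show "edge_min \<in> borel_measurable ?N" unfolding measurable_offspring by measurable
      show "F \<in> borel_measurable (multiset_space ?N)" unfolding multiset_space_offspring by measurable
    qed (rule edge_min_not_MInf, rule offspring_edge_min_null)
    also have "(\<lambda>q. poisson_int ?N (\<lambda>C. indicator {C. \<forall>p\<in>#C. edge_min q < edge_min p} C * F (add_mset q C))) =
       (\<lambda>q. h (real_of_ereal (edge_min q), q))"
    proof
      fix q
      have "ereal (real_of_ereal (edge_min q)) = edge_min q"
        using edge_min_not_MInf[of q] edge_min_not_PInf[of q] by (cases "edge_min q") auto
      then show "poisson_int ?N (\<lambda>C. indicator {C. \<forall>p\<in>#C. edge_min q < edge_min p} C * F (add_mset q C)) = h (real_of_ereal (edge_min q), q)"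
        unfolding h_eq by (simp only:)
    qed
    finally show ?thesis .
  qed
  have supp: "h (c, p) = 0" if "snd p \<notin> {T. num_vertices T \<le> m}" for c p
  proof -
    have "F (add_mset p C) = 0" for C
      unfolding F_def
    proof (rule Suc.prems(1))
      show "Suc m < num_vertices (Vertex b (add_mset p C))"
        unfolding num_vertices_add_child
      proof -
        have "m < num_vertices (snd p)" using that by simp
        then show "Suc m < num_vertices (snd p) + num_vertices (Vertex b C)"
          using num_vertices_pos[of "Vertex b C"] by linarith
      qed
    qed
    then show ?thesis unfolding h_eq poisson_int_def by simp
  qed
  have min: "(\<integral>\<^sup>+p. h (real_of_ereal (edge_min p), p) \<partial>?N) =
    (\<integral>\<^sup>+c. indicator {0..b} c * ((\<integral>\<^sup>+S. decay c S * h (c, c, grow c S) \<partial>H_law 0) +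
      (\<integral>\<^sup>+a. indicator {0..} a * (\<integral>\<^sup>+e. indicator {0..min (b - c) a} e *
        (?half * attach_weight a (\<lambda>T. decay c T * h (c, e + c, grow c T))) \<partial>lborel) \<partial>lborel)) \<partial>lborel)"
    (is "_ = (\<integral>\<^sup>+c. indicator {0..b} c * ?bracket c \<partial>lborel)")
  proof (rule nn_integral_offspring_by_min[where S = "{T. num_vertices T \<le> m}", OF h supp])
    fix a :: real and g :: "aged_tree \<Rightarrow> ennreal"
    assume "0 \<le> a" "g \<in> borel_measurable tree_space" "\<And>T. T \<notin> {T. num_vertices T \<le> m} \<Longrightarrow> g T = (0 :: ennreal)"
    then show "tree_weight a g = ennreal (exp (- a)) * g (Vertex a {#}) +
        (\<integral>\<^sup>+c. indicator {0..a} c * attach_weight (a - c) (\<lambda>T. decay c T * g (grow c T)) \<partial>lborel)"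
      by (intro Suc.IH) auto
  qed
  \<comment> \<open>Both sides describe a tree with a marked edge of age \<open>c\<close>, all other edges being older.\<close>
  have bracket: "attach_weight (b - c) (\<lambda>T. decay c T * f (grow c T)) = ennreal (exp (- (b - c))) * (ennreal (exp (- c)) * ?bracket c)"
    if c: "0 \<le> c" "c \<le> b" for c
  proof -
    let ?N' = "offspring (b - c)"
    interpret N': finite_full_measure "?N'" by (rule finite_offspring)
    let ?k = "\<lambda>T. decay c T * f (grow c T)"
    have k: "?k \<in> borel_measurable tree_space" by measurable
    have R: "poisson_int ?N' (\<lambda>C. ?k (Vertex (b - c) (add_mset q C))) = ennreal (exp (- c)) * (decay c (snd q) * h (c, (fst q + c, grow c (snd q))))" for q
    proof -
      let ?q = "(fst q + c, grow c (snd q))"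
      have Fq: "(\<lambda>C. F (add_mset ?q C)) \<in> borel_measurable (multiset_space edge_space)"
        by measurable
      have "?k (Vertex (b - c) (add_mset q C)) = (ennreal (exp (- c)) * decay c (snd q)) * (decay_points c C * F (add_mset ?q (shift_points c C)))" for C
      proof -
        have "decay c (Vertex (b - c) (add_mset q C)) = ennreal (exp (- c)) * decay c (snd q) * decay_points c C"
          unfolding decay_eq_points decay_points_simps by (simp only: mult_ac)
        moreover have "f (grow c (Vertex (b - c) (add_mset q C))) = F (add_mset ?q (shift_points c C))"
          unfolding grow_Vertex F_def diff_add_cancel by (simp add: shift_points_def)
        ultimately show ?thesis by (simp only: mult.assoc)
      qed
      then have "poisson_int ?N' (\<lambda>C. ?k (Vertex (b - c) (add_mset q C))) =
          poisson_int ?N' (\<lambda>C. (ennreal (exp (- c)) * decay c (snd q)) * (decay_points c C * F (add_mset ?q (shift_points c C))))"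
        by (simp only:)
      also have "\<dots> = (ennreal (exp (- c)) * decay c (snd q)) * poisson_int ?N' (\<lambda>C. decay_points c C * F (add_mset ?q (shift_points c C)))"
        by (rule N'.poisson_int_cmult) (unfold multiset_space_offspring, measurable)
      also have "poisson_int ?N' (\<lambda>C. decay_points c C * F (add_mset ?q (shift_points c C))) = h (c, ?q)"
        unfolding h_eq
      proof (rule poisson_int_offspring_scale[where S = UNIV and P = "\<lambda>p. ereal c < edge_min p", OF c, symmetric])
        show "Measurable.pred edge_space (\<lambda>p. ereal c < edge_min p)" by measurable
      qed (use Fq nn_integral_offspring_scale_strict[OF c] in auto)
      finally show ?thesis by (simp only: mult.assoc)
    qed
    have aw: "attach_weight a (\<lambda>T. ennreal (exp (- c)) * (decay c T * h (c, (e + c, grow c T)))) =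
       ennreal (exp (- c)) * attach_weight a (\<lambda>T. decay c T * h (c, (e + c, grow c T)))" for a e
      by (rule attach_weight_cmult) measurable
    have I1: "(\<integral>\<^sup>+S. ennreal (exp (- c)) * (decay c S * h (c, (0 + c, grow c S))) \<partial>H_law 0) =
        ennreal (exp (- c)) * (\<integral>\<^sup>+S. decay c S * h (c, c, grow c S) \<partial>H_law 0)"
      unfolding add_0_left by (rule nn_integral_cmult) (unfold measurable_cong_sets[OF sets_H_law refl], measurable)
    have [measurable]: "(\<lambda>(a, e). indicator {0..min (b - c) a} e * (?half * attach_weight a (\<lambda>T. decay c T * h (c, e + c, grow c T)))) \<in> borel_measurable (borel \<Otimes>\<^sub>M lborel)"
    proof -
      have "(\<lambda>(a, e). indicator {e. 0 \<le> e \<and> e \<le> b - c \<and> e \<le> a} e * (?half * attach_weight a (\<lambda>T. decay c T * h (c, e + c, grow c T)))) \<in> borel_measurable (borel \<Otimes>\<^sub>M lborel)"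
        unfolding indicator_def by measurable
      then show ?thesis by (simp add: indicator_def case_prod_unfold)
    qed
    have I2: "(\<integral>\<^sup>+a. indicator {0..} a * (\<integral>\<^sup>+e. indicator {0..min (b - c) a} e *
        (?half * (ennreal (exp (- c)) * attach_weight a (\<lambda>T. decay c T * h (c, e + c, grow c T)))) \<partial>lborel) \<partial>lborel) =
       ennreal (exp (- c)) * (\<integral>\<^sup>+a. indicator {0..} a * (\<integral>\<^sup>+e. indicator {0..min (b - c) a} e *
        (?half * attach_weight a (\<lambda>T. decay c T * h (c, e + c, grow c T))) \<partial>lborel) \<partial>lborel)"
    proof -
      have "(\<integral>\<^sup>+e. indicator {0..min (b - c) a} e * (?half * (ennreal (exp (- c)) * attach_weight a (\<lambda>T. decay c T * h (c, e + c, grow c T)))) \<partial>lborel) =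
         ennreal (exp (- c)) * (\<integral>\<^sup>+e. indicator {0..min (b - c) a} e * (?half * attach_weight a (\<lambda>T. decay c T * h (c, e + c, grow c T))) \<partial>lborel)" for a
        by (subst nn_integral_cmult[symmetric]) (measurable, simp only: mult.left_commute)
      then have "(\<integral>\<^sup>+a. indicator {0..} a * (\<integral>\<^sup>+e. indicator {0..min (b - c) a} e *
        (?half * (ennreal (exp (- c)) * attach_weight a (\<lambda>T. decay c T * h (c, e + c, grow c T)))) \<partial>lborel) \<partial>lborel) =
        (\<integral>\<^sup>+a. ennreal (exp (- c)) * (indicator {0..} a * (\<integral>\<^sup>+e. indicator {0..min (b - c) a} e * (?half * attach_weight a (\<lambda>T. decay c T * h (c, e + c, grow c T))) \<partial>lborel)) \<partial>lborel)"
        by (simp only: mult.left_commute)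
      also have "\<dots> = ennreal (exp (- c)) * (\<integral>\<^sup>+a. indicator {0..} a * (\<integral>\<^sup>+e. indicator {0..min (b - c) a} e *
        (?half * attach_weight a (\<lambda>T. decay c T * h (c, e + c, grow c T))) \<partial>lborel) \<partial>lborel)"
        by (rule nn_integral_cmult) measurable
      finally show ?thesis .
    qed
    have bc: "0 \<le> b - c" using c by simp
    show ?thesis
      unfolding attach_weight_fixed_point[OF bc k] R fst_conv snd_conv aw I1 I2 by (simp only: distrib_left)
  qed
  have bm: "?bracket \<in> borel_measurable borel"
  proof -
    have 1: "(\<lambda>c. \<integral>\<^sup>+S. decay c S * h (c, c, grow c S) \<partial>H_law 0) \<in> borel_measurable borel"
      by (rule borel_measurable_H_integral) measurable
    have "(\<lambda>z. indicator {e. 0 \<le> e \<and> e \<le> b - fst (fst z) \<and> e \<le> snd (fst z)} (snd z) *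
        (?half * attach_weight (snd (fst z)) (\<lambda>T. decay (fst (fst z)) T * h (fst (fst z), snd z + fst (fst z), grow (fst (fst z)) T)))) \<in> borel_measurable ((borel \<Otimes>\<^sub>M borel) \<Otimes>\<^sub>M lborel)"
      unfolding indicator_def by measurable
    then have [measurable]: "(\<lambda>(z, e). indicator {0..min (b - fst z) (snd z)} e *
        (?half * attach_weight (snd z) (\<lambda>T. decay (fst z) T * h (fst z, e + fst z, grow (fst z) T)))) \<in> borel_measurable ((borel \<Otimes>\<^sub>M borel) \<Otimes>\<^sub>M lborel)"
      by (simp add: indicator_def case_prod_unfold)
    have "(\<lambda>z. \<integral>\<^sup>+e. indicator {0..min (b - fst z) (snd z)} e *
        (?half * attach_weight (snd z) (\<lambda>T. decay (fst z) T * h (fst z, e + fst z, grow (fst z) T))) \<partial>lborel) \<in> borel_measurable (borel \<Otimes>\<^sub>M borel)"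
      by measurable
    then have [measurable]: "(\<lambda>(c, a). \<integral>\<^sup>+e. indicator {0..min (b - c) a} e * (?half * attach_weight a (\<lambda>T. decay c T * h (c, e + c, grow c T))) \<partial>lborel) \<in> borel_measurable (borel \<Otimes>\<^sub>M lborel)"
      by (simp add: case_prod_unfold)
    show ?thesis using 1 by measurable
  qed
  have "(\<lambda>c. indicator {0..b} c * ?bracket c) \<in> borel_measurable lborel"
    using bm by (intro borel_measurable_times_ennreal) simp_all
  then have pull: "(\<integral>\<^sup>+c. ennreal (exp (- b)) * (indicator {0..b} c * ?bracket c) \<partial>lborel) = ennreal (exp (- b)) * (\<integral>\<^sup>+c. indicator {0..b} c * ?bracket c \<partial>lborel)"
    by (rule nn_integral_cmult)
  have "tree_weight b f = ennreal (exp (- b)) * (F {#} + (\<integral>\<^sup>+c. indicator {0..b} c * ?bracket c \<partial>lborel))"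
    unfolding tree_weight_fixed_point[OF b f] F_def[symmetric] P min ..
  also have "\<dots> = ennreal (exp (- b)) * F {#} + (\<integral>\<^sup>+c. ennreal (exp (- b)) * (indicator {0..b} c * ?bracket c) \<partial>lborel)"
    unfolding pull by (rule distrib_left)
  also have "(\<integral>\<^sup>+c. ennreal (exp (- b)) * (indicator {0..b} c * ?bracket c) \<partial>lborel) =
     (\<integral>\<^sup>+c. indicator {0..b} c * attach_weight (b - c) (\<lambda>T. decay c T * f (grow c T)) \<partial>lborel)"
  proof (rule nn_integral_cong)
    fix c :: real
    show "ennreal (exp (- b)) * (indicator {0..b} c * ?bracket c) = indicator {0..b} c * attach_weight (b - c) (\<lambda>T. decay c T * f (grow c T))"
    proof (cases "0 \<le> c \<and> c \<le> b")
      case True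
      have "ennreal (exp (- b)) = ennreal (exp (- (b - c))) * ennreal (exp (- c))"
        by (simp add: ennreal_mult[symmetric] mult_exp_exp)
      then show ?thesis
        using bracket[of c] True by (simp only: mult.assoc mult.left_commute[of _ "indicator {0..b} c"])
    next
      case False
      then have "indicator {0..b} c = (0 :: ennreal)" by (simp add: indicator_def)
      then show ?thesis by (simp only: mult_zero_left mult_zero_right)
    qed
  qed
  finally show ?case by (simp only: F_def)
qed

section \<open>The transition kernel of the growth process\<close>

lemma sum_mset_count_ennreal:
  assumes "finite B" "set_mset A \<subseteq> B"
  shows "(\<Sum>x\<in>#A. f x) = (\<Sum>x\<in>B. of_nat (count A x) * f x :: ennreal)"
  using assms(2)
proof (induction A)
  case (add a A)
  have "(\<Sum>x\<in>B. of_nat (count (add_mset a A) x) * f x) = (\<Sum>x\<in>B. of_nat (count A x) * f x + (if x = a then f x else 0))"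
    by (intro sum.cong) (auto simp: distrib_right)
  also have "\<dots> = (\<Sum>x\<in>B. of_nat (count A x) * f x) + f a"
    using add.prems assms(1) by (simp add: sum.distrib sum.delta)
  also have "(\<Sum>x\<in>B. of_nat (count A x) * f x) = (\<Sum>x\<in>#A. f x)"
    using add by simp
  finally show ?case by (simp add: add.commute)
qed simp

lemma nn_integral_pmf_of_multiset:
  assumes "A \<noteq> {#}"
  shows "(\<integral>\<^sup>+x. f x \<partial>measure_pmf (pmf_of_multiset A)) = ennreal (1 / real (size A)) * (\<Sum>x\<in>#A. f x)"
proof -
  have "(\<integral>\<^sup>+x. f x \<partial>measure_pmf (pmf_of_multiset A)) = (\<Sum>x\<in>set_mset A. f x * ennreal (real (count A x) / real (size A)))"
    using assms by (subst nn_integral_measure_pmf_finite) simp_all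
  also have "\<dots> = (\<Sum>x\<in>set_mset A. ennreal (1 / real (size A)) * (of_nat (count A x) * f x))"
  proof (rule sum.cong[OF refl])
    fix x
    have "ennreal (real (count A x) / real (size A)) = ennreal (1 / real (size A)) * ennreal (real (count A x))"
      by (subst ennreal_mult[symmetric]) simp_all
    then show "f x * ennreal (real (count A x) / real (size A)) = ennreal (1 / real (size A)) * (of_nat (count A x) * f x)"
      by (simp only: ennreal_of_nat_eq_real_of_nat mult_ac)
  qed
  also have "\<dots> = ennreal (1 / real (size A)) * (\<Sum>x\<in>#A. f x)"
    by (simp only: sum_mset_count_ennreal[OF finite_set_mset subset_refl] sum_distrib_left)
  finally show ?thesis .
qed

lemma attachments_nonempty: "attachments S T \<noteq> {#}"
proof -
  have "size (attachments S T) \<noteq> 0"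
    unfolding size_attachments using num_vertices_pos[of T] by linarith
  then show ?thesis by auto
qed

lemma space_jump_space: "space jump_space = UNIV"
  by (rule space_edge_space)

text \<open>
  The last two steps of \<open>H1_jump\<close>, as a function of the grown tree and of the tree to be
  attached.
\<close>

definition attach_law :: "real \<Rightarrow> aged_tree \<Rightarrow> aged_tree \<Rightarrow> (real \<times> aged_tree) measure" where
  "attach_law \<tau> T S = measure_pmf (pmf_of_multiset (attachments S T)) \<bind> (\<lambda>T'. return jump_space (\<tau>, T'))"

lemma attach_law_kernel: "(\<lambda>T'. return jump_space (\<tau>, T')) \<in> measure_pmf p \<rightarrow>\<^sub>M subprob_algebra jump_space"
  by (auto simp: measurable_def space_subprob_algebra space_jump_space intro!: prob_space_imp_subprob_space prob_space_return)

lemma sets_attach_law: "sets (attach_law \<tau> T S) = sets jump_space"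
  unfolding attach_law_def by (rule sets_bind) auto

lemma nn_integral_attach_law:
  assumes f: "f \<in> borel_measurable jump_space"
  shows "(\<integral>\<^sup>+z. f z \<partial>attach_law \<tau> T S) = ennreal (1 / real (num_vertices T)) * (\<Sum>T'\<in>#attachments S T. f (\<tau>, T'))"
proof -
  have "(\<integral>\<^sup>+z. f z \<partial>attach_law \<tau> T S) = (\<integral>\<^sup>+T'. \<integral>\<^sup>+z. f z \<partial>return jump_space (\<tau>, T') \<partial>measure_pmf (pmf_of_multiset (attachments S T)))"
    unfolding attach_law_def by (rule nn_integral_bind[OF f attach_law_kernel])
  also have "\<dots> = (\<integral>\<^sup>+T'. f (\<tau>, T') \<partial>measure_pmf (pmf_of_multiset (attachments S T)))"
    by (intro nn_integral_cong nn_integral_return f) (simp add: space_jump_space)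
  finally show ?thesis
    by (simp only: nn_integral_pmf_of_multiset[OF attachments_nonempty] size_attachments)
qed

lemma measurable_attach_law:
  "(\<lambda>w. attach_law (fst (fst w)) (snd (fst w)) (snd w)) \<in> jump_space \<Otimes>\<^sub>M tree_space \<rightarrow>\<^sub>M subprob_algebra jump_space"
proof (rule measurable_subprob_algebra)
  fix w
  have "emeasure (attach_law \<tau> T S) UNIV = (\<integral>\<^sup>+z. 1 \<partial>attach_law \<tau> T S)" for \<tau> T S
    using sets_eq_imp_space_eq[OF sets_attach_law[of \<tau> T S]] by (simp add: space_jump_space)
  also have "(\<integral>\<^sup>+z. 1 \<partial>attach_law \<tau> T S) = ennreal (1 / real (num_vertices T)) * of_nat (num_vertices T)" for \<tau> T S
    by (subst nn_integral_attach_law) (simp_all add: size_attachments)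
  also have "ennreal (1 / real (num_vertices T)) * of_nat (num_vertices T) = 1" for T
    using num_vertices_pos[of T] by (simp add: ennreal_of_nat_eq_real_of_nat ennreal_mult[symmetric] del: num_vertices_pos)
  finally show "subprob_space (attach_law (fst (fst w)) (snd (fst w)) (snd w))"
    using sets_eq_imp_space_eq[OF sets_attach_law[of "fst (fst w)" "snd (fst w)" "snd w"]]
    by (intro subprob_spaceI) (simp_all add: space_jump_space)
next
  fix A assume A[measurable]: "A \<in> sets jump_space"
  have "emeasure (attach_law \<tau> T S) A = ennreal (1 / real (num_vertices T)) * (\<Sum>T'\<in>#attachments S T. indicator A (\<tau>, T'))" for \<tau> T S
    using nn_integral_attach_law[of "indicator A" \<tau> T S] A by (simp add: sets_attach_law)
  moreover have "(\<lambda>w. ennreal (1 / real (num_vertices (snd (fst w)))) * (\<Sum>T'\<in>#attachments (snd w) (snd (fst w)). indicator A (fst (fst w), T')))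
      \<in> borel_measurable (jump_space \<Otimes>\<^sub>M tree_space)"
    by measurable
  ultimately show "(\<lambda>w. emeasure (attach_law (fst (fst w)) (snd (fst w)) (snd w)) A) \<in> borel_measurable (jump_space \<Otimes>\<^sub>M tree_space)"
    by (simp only:)
qed (rule sets_attach_law)

lemma H1_jump_eq:
  "H1_jump z = density lborel (exponential_density (real (num_vertices (snd z)))) \<bind>
     (\<lambda>d. H_law 0 \<bind> (\<lambda>S. attach_law (fst z + d) (grow d (snd z)) S))"
  by (simp add: H1_jump_def attach_law_def)

lemma H_law_in_subprob: "H_law 0 \<in> space (subprob_algebra tree_space)"
  using subprob_H_law by (simp add: space_subprob_algebra sets_H_law)

lemma measurable_attach_step:
  "(\<lambda>w. H_law 0 \<bind> (\<lambda>S. attach_law (fst (fst w) + snd w) (grow (snd w) (snd (fst w))) S)) \<in> jump_space \<Otimes>\<^sub>M borel \<rightarrow>\<^sub>M subprob_algebra jump_space"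
proof (rule measurable_bind[where N = tree_space])
  show "(\<lambda>w. H_law 0) \<in> jump_space \<Otimes>\<^sub>M borel \<rightarrow>\<^sub>M subprob_algebra tree_space"
    by (rule measurable_const[OF H_law_in_subprob])
  have "(\<lambda>u. ((fst (fst (fst u)) + snd (fst u), grow (snd (fst u)) (snd (fst (fst u)))), snd u)) \<in> (jump_space \<Otimes>\<^sub>M borel) \<Otimes>\<^sub>M tree_space \<rightarrow>\<^sub>M jump_space \<Otimes>\<^sub>M tree_space"
    by measurable
  from measurable_compose[OF this measurable_attach_law]
  show "(\<lambda>x. attach_law (fst (fst (fst x)) + snd (fst x)) (grow (snd (fst x)) (snd (fst (fst x)))) (snd x)) \<in> (jump_space \<Otimes>\<^sub>M borel) \<Otimes>\<^sub>M tree_space \<rightarrow>\<^sub>M subprob_algebra jump_space"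
    by simp
qed

lemma measurable_exponential_kernel:
  "(\<lambda>z. density lborel (exponential_density (real (num_vertices (snd z))))) \<in> jump_space \<rightarrow>\<^sub>M subprob_algebra borel"
proof (rule measurable_subprob_algebra)
  fix z :: "real \<times> aged_tree"
  have "prob_space (density lborel (exponential_density (real (num_vertices (snd z)))))"
    by (rule prob_space_exponential_density) (simp del: num_vertices.simps)
  then show "subprob_space (density lborel (exponential_density (real (num_vertices (snd z)))))"
    by (rule prob_space_imp_subprob_space)
next
  fix A :: "real set" assume [measurable]: "A \<in> sets borel"
  have "emeasure (density lborel (exponential_density l)) A = (\<integral>\<^sup>+d. ennreal (exponential_density l d) * indicator A d \<partial>lborel)" for l
    by (rule emeasure_density) simp_all
  moreover have "(\<lambda>z. \<integral>\<^sup>+d. ennreal (exponential_density (real (num_vertices (snd z))) d) * indicator A d \<partial>lborel) \<in> borel_measurable jump_space"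
    unfolding exponential_density_def by measurable
  ultimately show "(\<lambda>z. emeasure (density lborel (exponential_density (real (num_vertices (snd z))))) A) \<in> borel_measurable jump_space"
    by (simp only:)
qed simp

lemma measurable_H1_jump [measurable]: "H1_jump \<in> jump_space \<rightarrow>\<^sub>M subprob_algebra jump_space"
proof -
  have "(\<lambda>z. density lborel (exponential_density (real (num_vertices (snd z)))) \<bind>
     (\<lambda>d. H_law 0 \<bind> (\<lambda>S. attach_law (fst z + d) (grow d (snd z)) S))) \<in> jump_space \<rightarrow>\<^sub>M subprob_algebra jump_space"
    by (rule measurable_bind[OF measurable_exponential_kernel measurable_attach_step])
  then show ?thesis by (simp only: H1_jump_eq[abs_def])
qed

text \<open>
  The rate \<open>num_vertices T\<close> of the exponential density cancels against the uniform choice of the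
  vertex, so that \<open>attach\<close> appears with its natural mass.
\<close>

lemma nn_integral_H1_jump:
  assumes f[measurable]: "f \<in> borel_measurable jump_space"
  shows "(\<integral>\<^sup>+z. f z \<partial>H1_jump (\<tau>, T)) = (\<integral>\<^sup>+d. indicator {0..} d * (decay d T * attach (\<lambda>T'. f (\<tau> + d, T')) (grow d T)) \<partial>lborel)"
proof -
  let ?n = "real (num_vertices T)"
  have n: "0 < ?n" by (simp del: num_vertices.simps)
  have k2: "(\<lambda>d. H_law 0 \<bind> (\<lambda>S. attach_law (\<tau> + d) (grow d T) S)) \<in> borel \<rightarrow>\<^sub>M subprob_algebra jump_space"
  proof -
    have "(\<lambda>d. ((\<tau>, T), d)) \<in> borel \<rightarrow>\<^sub>M jump_space \<Otimes>\<^sub>M borel" by measurable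
    from measurable_compose[OF this measurable_attach_step] show ?thesis by simp
  qed
  then have k2': "(\<lambda>d. H_law 0 \<bind> (\<lambda>S. attach_law (\<tau> + d) (grow d T) S)) \<in> density lborel (exponential_density ?n) \<rightarrow>\<^sub>M subprob_algebra jump_space"
    by (simp cong: measurable_cong_sets)
  have k3: "(\<lambda>S. attach_law \<tau>' T' S) \<in> H_law 0 \<rightarrow>\<^sub>M subprob_algebra jump_space" for \<tau>' T'
  proof -
    have "(\<lambda>S. ((\<tau>', T'), S)) \<in> tree_space \<rightarrow>\<^sub>M jump_space \<Otimes>\<^sub>M tree_space" by measurable
    from measurable_compose[OF this measurable_attach_law] show ?thesis
      by (simp add: measurable_cong_sets[OF sets_H_law refl])
  qed
  have fm: "(\<lambda>T'. f (\<tau>', T')) \<in> borel_measurable tree_space" for \<tau>' by measurable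
  have inner: "(\<integral>\<^sup>+z. f z \<partial>(H_law 0 \<bind> (\<lambda>S. attach_law (\<tau> + d) (grow d T) S))) = ennreal (1 / ?n) * attach (\<lambda>T'. f (\<tau> + d, T')) (grow d T)" for d
    unfolding nn_integral_bind[OF f k3] nn_integral_attach_law[OF f] attach_def num_vertices_grow
    by (rule nn_integral_cmult[OF measurable_attachments_sum1[OF fm]])
  have am: "(\<lambda>d. attach (\<lambda>T'. f (\<tau> + d, T')) (grow d T)) \<in> borel_measurable borel"
    by (rule borel_measurable_attach) measurable
  have "(\<integral>\<^sup>+z. f z \<partial>H1_jump (\<tau>, T)) = (\<integral>\<^sup>+d. ennreal (1 / ?n) * attach (\<lambda>T'. f (\<tau> + d, T')) (grow d T) \<partial>density lborel (exponential_density ?n))"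
    unfolding H1_jump_eq fst_conv snd_conv nn_integral_bind[OF f k2'] inner ..
  also have "\<dots> = (\<integral>\<^sup>+d. ennreal (exponential_density ?n d) * (ennreal (1 / ?n) * attach (\<lambda>T'. f (\<tau> + d, T')) (grow d T)) \<partial>lborel)"
    by (rule nn_integral_density) (use am in simp_all)
  also have "\<dots> = (\<integral>\<^sup>+d. indicator {0..} d * (decay d T * attach (\<lambda>T'. f (\<tau> + d, T')) (grow d T)) \<partial>lborel)"
  proof (rule nn_integral_cong)
    fix d :: real
    have "ennreal (exponential_density ?n d) * ennreal (1 / ?n) = indicator {0..} d * decay d T"
      using n by (simp add: exponential_density_def indicator_def ennreal_mult[symmetric] mult.commute del: num_vertices.simps)
    then show "ennreal (exponential_density ?n d) * (ennreal (1 / ?n) * attach (\<lambda>T'. f (\<tau> + d, T')) (grow d T)) =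
      indicator {0..} d * (decay d T * attach (\<lambda>T'. f (\<tau> + d, T')) (grow d T))"
      by (simp only: mult.assoc[symmetric])
  qed
  finally show ?thesis .
qed

lemma H1_process_Markov:
  fixes F :: "(nat \<Rightarrow> real \<times> aged_tree) \<Rightarrow> ennreal"
  assumes Z: "H1_process M Z"
    and F: "F \<in> borel_measurable (PiM {..n} (\<lambda>_. jump_space))"
    and h: "h \<in> borel_measurable jump_space"
  shows "(\<integral>\<^sup>+\<omega>. F (\<lambda>i\<in>{..n}. Z i \<omega>) * h (Z (Suc n) \<omega>) \<partial>M) =
    (\<integral>\<^sup>+\<omega>. F (\<lambda>i\<in>{..n}. Z i \<omega>) * (\<integral>\<^sup>+z. h z \<partial>H1_jump (Z n \<omega>)) \<partial>M)"
proof -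
  note F[measurable] h[measurable]
  have Zm[measurable]: "Z i \<in> M \<rightarrow>\<^sub>M jump_space" for i
    using Z by (simp add: H1_process_def)
  have law: "distr M (PiM {..Suc n} (\<lambda>_. jump_space)) (\<lambda>\<omega>. \<lambda>i\<in>{..Suc n}. Z i \<omega>) =
      distr M (PiM {..n} (\<lambda>_. jump_space)) (\<lambda>\<omega>. \<lambda>i\<in>{..n}. Z i \<omega>) \<bind>
      (\<lambda>h. H1_jump (h n) \<bind> (\<lambda>z. return (PiM {..Suc n} (\<lambda>_. jump_space)) (h(Suc n := z))))"
    using Z by (simp add: H1_process_def)
  let ?P = "PiM {..n} (\<lambda>_. jump_space)" and ?P' = "PiM {..Suc n} (\<lambda>_. jump_space)"
  have Zn: "(\<lambda>\<omega>. \<lambda>i\<in>{..n}. Z i \<omega>) \<in> M \<rightarrow>\<^sub>M ?P" "(\<lambda>\<omega>. \<lambda>i\<in>{..Suc n}. Z i \<omega>) \<in> M \<rightarrow>\<^sub>M ?P'"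
    by (rule measurable_restrict, measurable)+
  define G where "G g = F (restrict g {..n}) * h (g (Suc n))" for g
  have G[measurable]: "G \<in> borel_measurable ?P'"
  proof -
    have "(\<lambda>g. restrict g {..n}) \<in> ?P' \<rightarrow>\<^sub>M ?P"
      by (rule measurable_restrict_subset) auto
    moreover have "(\<lambda>g. g (Suc n)) \<in> ?P' \<rightarrow>\<^sub>M jump_space"
      by (rule measurable_component_singleton) simp
    ultimately show ?thesis unfolding G_def by measurable
  qed
  have comp: "(\<lambda>g. g n) \<in> ?P \<rightarrow>\<^sub>M jump_space"
    by (rule measurable_component_singleton) simp
  have upd: "(\<lambda>x. (fst x)(Suc n := snd x)) \<in> ?P \<Otimes>\<^sub>M jump_space \<rightarrow>\<^sub>M ?P'"
    by (rule measurable_fun_upd[where J = "{..n}"]) (auto simp: atMost_Suc)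
  have K: "(\<lambda>g. H1_jump (g n) \<bind> (\<lambda>z. return ?P' (g(Suc n := z)))) \<in> ?P \<rightarrow>\<^sub>M subprob_algebra ?P'"
    by (rule measurable_bind[OF measurable_compose[OF comp measurable_H1_jump]])
       (rule measurable_compose[OF upd return_measurable])
  have K1: "(\<lambda>z. return ?P' (g(Suc n := z))) \<in> H1_jump z0 \<rightarrow>\<^sub>M subprob_algebra ?P'" if "g \<in> space ?P" for g z0
  proof -
    have "(\<lambda>z. (g, z)) \<in> jump_space \<rightarrow>\<^sub>M ?P \<Otimes>\<^sub>M jump_space" using that by measurable
    from measurable_compose[OF measurable_compose[OF this upd] return_measurable]
    show ?thesis by (simp add: measurable_cong_sets[OF sets_kernel[OF measurable_H1_jump] refl] space_jump_space)
  qed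
  have step: "(\<integral>\<^sup>+g'. G g' \<partial>(H1_jump (g n) \<bind> (\<lambda>z. return ?P' (g(Suc n := z))))) = F g * (\<integral>\<^sup>+z. h z \<partial>H1_jump (g n))"
    if g: "g \<in> space ?P" for g
  proof -
    have "restrict g {..n} = g"
      using g by (simp add: space_PiM PiE_restrict)
    then have Gz: "G (g(Suc n := z)) = F g * h z" for z
      unfolding G_def by (simp add: restrict_upd)
    have sp: "g(Suc n := z) \<in> space ?P'" for z
      using g by (auto simp: space_PiM PiE_iff extensional_def space_jump_space)
    have "(\<integral>\<^sup>+g'. G g' \<partial>(H1_jump (g n) \<bind> (\<lambda>z. return ?P' (g(Suc n := z))))) = (\<integral>\<^sup>+z. F g * h z \<partial>H1_jump (g n))"
      unfolding nn_integral_bind[OF G K1[OF g]]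
      by (intro nn_integral_cong) (simp add: nn_integral_return[OF sp G] Gz)
    also have "\<dots> = F g * (\<integral>\<^sup>+z. h z \<partial>H1_jump (g n))"
      by (rule nn_integral_cmult) (simp add: measurable_cong_sets[OF sets_kernel[OF measurable_H1_jump] refl] space_jump_space h)
    finally show ?thesis .
  qed
  have meas: "(\<lambda>g. F g * (\<integral>\<^sup>+z. h z \<partial>H1_jump (g n))) \<in> borel_measurable ?P"
    using measurable_compose[OF measurable_compose[OF comp measurable_H1_jump] nn_integral_measurable_subprob_algebra[OF h]] F
    by (intro borel_measurable_times_ennreal) simp_all
  have "(\<integral>\<^sup>+\<omega>. F (\<lambda>i\<in>{..n}. Z i \<omega>) * h (Z (Suc n) \<omega>) \<partial>M) = (\<integral>\<^sup>+\<omega>. G (\<lambda>i\<in>{..Suc n}. Z i \<omega>) \<partial>M)"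
    unfolding G_def by (intro nn_integral_cong) (simp add: Int_absorb1 inf.absorb2 min_def restrict_restrict)
  also have "\<dots> = (\<integral>\<^sup>+g. G g \<partial>distr M ?P' (\<lambda>\<omega>. \<lambda>i\<in>{..Suc n}. Z i \<omega>))"
    by (subst nn_integral_distr[OF Zn(2)]) (simp_all add: G)
  also have "\<dots> = (\<integral>\<^sup>+g. \<integral>\<^sup>+g'. G g' \<partial>(H1_jump (g n) \<bind> (\<lambda>z. return ?P' (g(Suc n := z)))) \<partial>distr M ?P (\<lambda>\<omega>. \<lambda>i\<in>{..n}. Z i \<omega>))"
    unfolding law by (rule nn_integral_bind[OF G]) (use K in simp)
  also have "\<dots> = (\<integral>\<^sup>+g. F g * (\<integral>\<^sup>+z. h z \<partial>H1_jump (g n)) \<partial>distr M ?P (\<lambda>\<omega>. \<lambda>i\<in>{..n}. Z i \<omega>))"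
    by (intro nn_integral_cong step) simp
  also have "\<dots> = (\<integral>\<^sup>+\<omega>. F (\<lambda>i\<in>{..n}. Z i \<omega>) * (\<integral>\<^sup>+z. h z \<partial>H1_jump (Z n \<omega>)) \<partial>M)"
    by (subst nn_integral_distr[OF Zn(1)]) (simp_all add: meas)
  finally show ?thesis .
qed

section \<open>Sojourn and survival\<close>

lemma num_vertices_attachment:
  "T' \<in># attachments S T \<Longrightarrow> num_vertices T' = num_vertices S + num_vertices T"
proof (induction T arbitrary: T' rule: tree_height_induct)
  case (less T T')
  have T: "num_vertices (Vertex b (children T)) = num_vertices T" for b
    by (simp only: num_vertices_eq[of T] num_vertices_eq[of "Vertex b (children T)"] aged_tree.sel)
  from less.prems(1) consider "T' = Vertex (root_age T) (add_mset (0, S) (children T))"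
    | p T'' where "p \<in># children T" "T'' \<in># attachments S (snd p)"
        "T' = Vertex (root_age T) (add_mset (fst p, T'') (children T - {#p#}))"
    by (subst (asm) attachments_eq) auto
  then show ?case
  proof cases
    case 1
    show ?thesis unfolding 1 num_vertices_add_child T by simp
  next
    case 2
    have "num_vertices T'' = num_vertices S + num_vertices (snd p)"
      using less.IH[of "fst p" "snd p" T''] 2 by simp
    moreover have "num_vertices T = num_vertices (snd p) + num_vertices (Vertex (root_age T) (children T - {#p#}))"
      using T[of "root_age T"] num_vertices_add_child[of "root_age T" p "children T - {#p#}"] insert_DiffM[OF 2(1)] by simp
    ultimately show ?thesis unfolding 2(3) num_vertices_add_child snd_conv by linarith
  qed
qed

lemma attach_larger_eq_0:
  assumes "\<And>T'. num_vertices T < num_vertices T' \<Longrightarrow> k T' = 0"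
  shows "attach k T = 0"
proof -
  have "(\<Sum>T'\<in>#attachments S T. k T') = 0" for S
  proof -
    have "k T' = 0" if "T' \<in># attachments S T" for T'
      using num_vertices_attachment[OF that] num_vertices_pos[of S] by (intro assms) linarith
    then show ?thesis by (simp add: sum_mset.neutral)
  qed
  then have "attach k T = (\<integral>\<^sup>+S. 0 \<partial>H_law 0)" by (simp only: attach_def)
  then show ?thesis by simp
qed

text \<open>
  The probability that the process started from \<open>T\<close> does not explode within time \<open>y\<close>: the
  vertices and what is attached below them evolve independently, and each contributes a factor
  \<open>sech (y/2)\<^sup>2\<close>.
\<close>

abbreviation sech_power :: "real \<Rightarrow> aged_tree \<Rightarrow> ennreal" where
  "sech_power y T \<equiv> ennreal ((sech (y / 2) ^ 2) ^ num_vertices T)"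

lemma measurable_sech_power [measurable (raw)]:
  assumes [measurable]: "g \<in> borel_measurable N" "h \<in> N \<rightarrow>\<^sub>M tree_space"
  shows "(\<lambda>x. sech_power (g x) (h x)) \<in> borel_measurable N"
  by measurable

lemma tree_weight_sech_power:
  assumes "0 \<le> y" "0 \<le> b"
  shows "tree_weight b (sech_power y) = ennreal (sech ((b + y) / 2) ^ 2)"
  using tree_weight_power[of y b] tree_weight_1[of b] assms by (cases "y = 0") (simp_all add: sech_def)

lemma nn_integral_H_sech_power:
  assumes "0 \<le> y"
  shows "(\<integral>\<^sup>+S. sech_power y S \<partial>H_law 0) = ennreal (1 - tanh (y / 2))"
proof -
  have "(\<integral>\<^sup>+S. sech_power y S \<partial>H_law 0) = (\<integral>\<^sup>+a. indicator {0..} a * (ennreal (1 / 2) * tree_weight a (sech_power y)) \<partial>lborel)"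
    by (rule nn_integral_H_law) measurable
  also have "\<dots> = (\<integral>\<^sup>+a. ennreal (child_density y a) * indicator {0..} a \<partial>lborel)"
  proof (rule nn_integral_cong)
    fix a :: real
    have "ennreal (1 / 2) * ennreal (sech ((a + y) / 2) ^ 2) = ennreal (child_density y a)"
      unfolding child_density_def by (rule ennreal_mult[symmetric]) simp_all
    then show "indicator {0..} a * (ennreal (1 / 2) * tree_weight a (sech_power y)) = ennreal (child_density y a) * indicator {0..} a"
      using tree_weight_sech_power[OF assms, of a] by (cases "0 \<le> a") (simp_all del: ennreal_half)
  qed
  finally show ?thesis by (simp add: nn_integral_child_density)
qed

lemma attach_sech_power:
  assumes "0 \<le> y"
  shows "attach (sech_power y) T = ennreal (real (num_vertices T) * (sech (y / 2) ^ 2) ^ num_vertices T * (1 - tanh (y / 2)))"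
proof -
  let ?n = "num_vertices T"
  have "(\<Sum>T'\<in>#attachments S T. sech_power y T') = ennreal (real ?n * (sech (y / 2) ^ 2) ^ ?n) * sech_power y S" for S
  proof -
    have "(\<Sum>T'\<in>#attachments S T. sech_power y T') = (\<Sum>T'\<in>#attachments S T. ennreal ((sech (y / 2) ^ 2) ^ (num_vertices S + ?n)))"
      by (rule arg_cong[where f = sum_mset], rule image_mset_cong, simp only: num_vertices_attachment)
    also have "\<dots> = of_nat ?n * ennreal ((sech (y / 2) ^ 2) ^ (num_vertices S + ?n))"
      by (simp only: sum_mset_constant size_attachments)
    also have "\<dots> = ennreal (real ?n * (sech (y / 2) ^ 2) ^ ?n) * sech_power y S"
      by (simp add: ennreal_of_nat_eq_real_of_nat ennreal_mult[symmetric] power_add mult_ac)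
    finally show ?thesis .
  qed
  then have "attach (sech_power y) T = (\<integral>\<^sup>+S. ennreal (real ?n * (sech (y / 2) ^ 2) ^ ?n) * sech_power y S \<partial>H_law 0)"
    by (simp only: attach_def)
  also have "\<dots> = ennreal (real ?n * (sech (y / 2) ^ 2) ^ ?n) * ennreal (1 - tanh (y / 2))"
    unfolding nn_integral_H_sech_power[OF assms, symmetric]
    by (rule nn_integral_cmult) (simp add: measurable_cong_sets[OF sets_H_law refl])
  also have "\<dots> = ennreal (real ?n * (sech (y / 2) ^ 2) ^ ?n * (1 - tanh (y / 2)))"
    using tanh_real_lt_1[of "y / 2"] by (intro ennreal_mult[symmetric]) simp_all
  finally show ?thesis .
qed

text \<open>
  For a state \<open>z = (\<tau>, T)\<close> just after a jump: \<open>f\<close> evaluated at the state at time \<open>s\<close>, on the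
  event that no further jump happens until \<open>s\<close>, averaged over the time of that jump.
\<close>

definition sojourn :: "real \<Rightarrow> (aged_tree \<Rightarrow> ennreal) \<Rightarrow> real \<times> aged_tree \<Rightarrow> ennreal" where
  "sojourn s f z = indicator {..s} (fst z) * (decay (s - fst z) (snd z) * f (grow (s - fst z) (snd z)))"

lemma borel_measurable_sojourn [measurable (raw)]:
  assumes [measurable]: "s \<in> borel_measurable N" "z \<in> N \<rightarrow>\<^sub>M jump_space"
    and k: "(\<lambda>(x, T). k x T :: ennreal) \<in> borel_measurable (N \<Otimes>\<^sub>M tree_space)"
  shows "(\<lambda>x. sojourn (s x) (k x) (z x)) \<in> borel_measurable N"
proof -
  have "(\<lambda>x. (x, grow (s x - fst (z x)) (snd (z x)))) \<in> N \<rightarrow>\<^sub>M N \<Otimes>\<^sub>M tree_space" by measurable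
  from measurable_compose[OF this k] have [measurable]: "(\<lambda>x. k x (grow (s x - fst (z x)) (snd (z x)))) \<in> borel_measurable N"
    by simp
  show ?thesis unfolding sojourn_def indicator_def atMost_iff by measurable
qed

text \<open>
  The value of \<open>f\<close> at a time \<open>c\<close> later, on the event that there is no jump in between.
\<close>

abbreviation delayed :: "(aged_tree \<Rightarrow> ennreal) \<Rightarrow> real \<Rightarrow> aged_tree \<Rightarrow> ennreal" where
  "delayed f c \<equiv> (\<lambda>T. decay c T * f (grow c T))"

lemma measurable_attach_delayed:
  assumes [measurable]: "f \<in> borel_measurable tree_space" "g \<in> borel_measurable N"
  shows "(\<lambda>(x, T). attach (delayed f (g x)) T) \<in> borel_measurable (N \<Otimes>\<^sub>M tree_space)"
  unfolding case_prod_unfold by (rule borel_measurable_attach) measurable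

text \<open>
  Substitution of the time \<open>c\<close> elapsed since the jump for its date, \<open>s - c\<close>.
\<close>

lemma nn_integral_sojourn_H1_jump:
  assumes f[measurable]: "f \<in> borel_measurable tree_space"
  shows "(\<integral>\<^sup>+z. sojourn s f z \<partial>H1_jump z0) =
    (\<integral>\<^sup>+c. indicator {0..} c * sojourn (s - c) (attach (delayed f c)) z0 \<partial>lborel)"
proof -
  obtain \<tau> T where z0: "z0 = (\<tau>, T)" by (cases z0)
  have sm: "sojourn s f \<in> borel_measurable jump_space"
    by (rule borel_measurable_sojourn) measurable
  define G where "G d = indicator {0..} d * (decay d T * attach (\<lambda>T'. sojourn s f (\<tau> + d, T')) (grow d T))" for d :: real
  have Gm: "G \<in> borel_measurable borel"
  proof -
    have "(\<lambda>d. attach (\<lambda>T'. sojourn s f (\<tau> + d, T')) (grow d T)) \<in> borel_measurable borel"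
    proof (rule borel_measurable_attach)
      have "(\<lambda>w. (\<tau> + fst w, snd w)) \<in> borel \<Otimes>\<^sub>M tree_space \<rightarrow>\<^sub>M jump_space" by measurable
      from measurable_compose[OF this sm] show "(\<lambda>(d, T'). sojourn s f (\<tau> + d, T')) \<in> borel_measurable (borel \<Otimes>\<^sub>M tree_space)"
        by (simp add: case_prod_unfold)
    qed measurable
    then show ?thesis unfolding G_def by measurable
  qed
  have "(\<integral>\<^sup>+z. sojourn s f z \<partial>H1_jump z0) = (\<integral>\<^sup>+d. G d \<partial>lborel)"
    unfolding z0 nn_integral_H1_jump[OF sm] G_def ..
  also have "\<dots> = (\<integral>\<^sup>+c. G (s - \<tau> + - 1 * c) \<partial>lborel)"
    by (subst nn_integral_real_affine[OF Gm, of "- 1" "s - \<tau>"]) simp_all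
  also have "\<dots> = (\<integral>\<^sup>+c. indicator {0..} c * sojourn (s - c) (attach (delayed f c)) z0 \<partial>lborel)"
  proof (rule nn_integral_cong)
    fix c :: real
    have soj: "sojourn s f (\<tau> + (s - \<tau> + - 1 * c), T') = indicator {0..} c * delayed f c T'" for T'
      by (simp add: sojourn_def indicator_def)
    have dm: "delayed f c \<in> borel_measurable tree_space" by measurable
    have e: "s - \<tau> + - 1 * c = s - c - \<tau>" by simp
    show "G (s - \<tau> + - 1 * c) = indicator {0..} c * sojourn (s - c) (attach (delayed f c)) z0"
      unfolding G_def soj attach_cmult[OF dm] unfolding sojourn_def z0 fst_conv snd_conv e
      by (simp add: indicator_def)
  qed
  finally show ?thesis .
qed

text \<open>
  The probability of explosion after \<open>r\<close>, from the state \<open>T\<close> just after a jump at time \<open>\<tau>\<close>.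
  Beyond \<open>r\<close> it is \<open>1\<close>.
\<close>

definition survival :: "real \<Rightarrow> real \<times> aged_tree \<Rightarrow> ennreal" where
  "survival r z = sech_power (max 0 (r - fst z)) (snd z)"

lemma measurable_survival [measurable]: "survival r \<in> borel_measurable jump_space"
  unfolding survival_def by measurable

lemma survival_le_1: "survival r z \<le> 1"
  unfolding survival_def by (simp add: power_le_one sech_le_1)

lemma survival_after: "r \<le> fst z \<Longrightarrow> survival r z = 1"
  by (simp add: survival_def sech_def)

lemma AE_H1_jump_time_neq: "AE z in H1_jump z0. fst z \<noteq> s"
proof -
  obtain \<tau> T where z0: "z0 = (\<tau>, T)" by (cases z0)
  have m: "(\<lambda>z. indicator {s} (fst z) :: ennreal) \<in> borel_measurable jump_space" by measurable
  have "(\<integral>\<^sup>+z. indicator {s} (fst z) \<partial>H1_jump z0) = (\<integral>\<^sup>+d. 0 \<partial>(lborel :: real measure))"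
    unfolding z0 nn_integral_H1_jump[OF m]
  proof (rule nn_integral_cong_AE)
    show "AE d in lborel. indicator {0..} d * (decay d T * attach (\<lambda>T'. indicator {s} (fst (\<tau> + d, T'))) (grow d T)) = 0"
      using AE_lborel_singleton[of "s - \<tau>"]
    proof eventually_elim
      case (elim d)
      then have "\<tau> + d \<noteq> s" by auto
      then show ?case by (simp add: attach_def)
    qed
  qed
  then have "(\<integral>\<^sup>+z. indicator {s} (fst z) \<partial>H1_jump z0) = 0" by simp
  moreover have "(\<lambda>z. indicator {s} (fst z) :: ennreal) \<in> borel_measurable (H1_jump z0)"
    using m by (simp add: measurable_cong_sets[OF sets_kernel[OF measurable_H1_jump] refl] space_jump_space)
  ultimately have "AE z in H1_jump z0. (indicator {s} (fst z) :: ennreal) = 0"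
    by (simp add: nn_integral_0_iff_AE)
  then show ?thesis by eventually_elim (auto simp: indicator_def split: if_splits)
qed

text \<open>
  On \<open>[u, R]\<close> the integrand is the derivative of \<open>- exp (- n d) sech ((R - d)/2)\<^sup>2 ^ n\<close>; beyond
  \<open>R\<close> it is the exponential density.
\<close>

lemma nn_integral_survival_density:
  fixes u R :: real
  assumes uR: "u \<le> R" and n: "0 < n"
  shows "(\<integral>\<^sup>+d. ennreal (exp (- d * real n) * (real n * (sech (max 0 (R - d) / 2) ^ 2) ^ n * (1 - tanh (max 0 (R - d) / 2)))) * indicator {u..} d \<partial>lborel) =
    ennreal (exp (- u * real n) * (sech ((R - u) / 2) ^ 2) ^ n)"
proof -
  obtain m where m: "n = Suc m" using n by (cases n) auto
  define g where "g d = exp (- d * real n) * (real n * (1 - tanh ((R - d) / 2) ^ 2) ^ n * (1 - tanh ((R - d) / 2)))" for d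
  have gm[measurable]: "g \<in> borel_measurable borel"
    unfolding g_def sech_squared[symmetric] by (intro borel_measurable_continuous_onI continuous_intros) (auto simp: sech_def intro!: continuous_intros)
  have g0: "0 \<le> g d" for d
    unfolding g_def sech_squared[symmetric] using tanh_real_lt_1[of "(R - d) / 2"] by simp
  have D: "((\<lambda>d. - (exp (- d * real n) * (1 - tanh ((R - d) / 2) ^ 2) ^ n)) has_real_derivative g d) (at d)" for d
  proof -
    let ?t = "tanh ((R - d) / 2)"
    have "((\<lambda>d. 1 - tanh ((R - d) / 2) ^ 2) has_real_derivative ?t * (1 - ?t ^ 2)) (at d)"
      by (auto intro!: derivative_eq_intros)
    from DERIV_power[OF this, of n]
    have P: "((\<lambda>d. (1 - tanh ((R - d) / 2) ^ 2) ^ n) has_real_derivative real n * (1 - ?t ^ 2) ^ n * ?t) (at d)"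
      by (simp add: m mult_ac)
    have E: "((\<lambda>d. exp (- d * real n)) has_real_derivative - real n * exp (- d * real n)) (at d)"
      by (auto intro!: derivative_eq_intros)
    show ?thesis
      by (rule DERIV_cong[OF DERIV_minus[OF DERIV_mult[OF E P]]]) (simp add: g_def algebra_simps)
  qed
  have I1: "(\<integral>\<^sup>+d. ennreal (g d) * indicator {u..R} d \<partial>lborel) =
      - (exp (- R * real n) * (1 - tanh ((R - R) / 2) ^ 2) ^ n) - - (exp (- u * real n) * (1 - tanh ((R - u) / 2) ^ 2) ^ n)"
    by (rule nn_integral_FTC_Icc[OF gm _ g0 uR]) (rule D)
  have I2: "(\<integral>\<^sup>+d. ennreal (real n * exp (- d * real n)) * indicator {R..} d \<partial>lborel) = 0 - - exp (- R * real n)"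
  proof (rule nn_integral_FTC_atLeast)
    show "((\<lambda>d. - exp (- d * real n)) has_real_derivative real n * exp (- d * real n)) (at d)" for d
      by (auto intro!: derivative_eq_intros)
    have "filterlim (\<lambda>d::real. - d * real n) at_bot at_top"
      using n by (simp add: filterlim_uminus_at_bot filterlim_at_top_mult_tendsto_pos[OF tendsto_const _ filterlim_ident])
    then have "((\<lambda>d. exp (- d * real n)) \<longlongrightarrow> 0) at_top"
      by (rule filterlim_compose[OF exp_at_bot])
    from tendsto_minus[OF this] show "((\<lambda>d. - exp (- d * real n)) \<longlongrightarrow> 0) at_top" by simp
  qed simp_all
  have "(\<integral>\<^sup>+d. ennreal (exp (- d * real n) * (real n * (sech (max 0 (R - d) / 2) ^ 2) ^ n * (1 - tanh (max 0 (R - d) / 2)))) * indicator {u..} d \<partial>lborel)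
     = (\<integral>\<^sup>+d. ennreal (g d) * indicator {u..R} d + ennreal (real n * exp (- d * real n)) * indicator {R..} d \<partial>lborel)"
  proof (rule nn_integral_cong_AE)
    show "AE d in lborel. ennreal (exp (- d * real n) * (real n * (sech (max 0 (R - d) / 2) ^ 2) ^ n * (1 - tanh (max 0 (R - d) / 2)))) * indicator {u..} d
       = ennreal (g d) * indicator {u..R} d + ennreal (real n * exp (- d * real n)) * indicator {R..} d"
      using AE_lborel_singleton[of R]
    proof eventually_elim
      case (elim d)
      then show ?case using uR
        by (cases "d < R") (auto simp: g_def sech_squared max_def mult_ac indicator_def)
    qed
  qed
  also have "\<dots> = (\<integral>\<^sup>+d. ennreal (g d) * indicator {u..R} d \<partial>lborel) + (\<integral>\<^sup>+d. ennreal (real n * exp (- d * real n)) * indicator {R..} d \<partial>lborel)"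
    by (rule nn_integral_add) measurable
  also have "\<dots> = ennreal (exp (- u * real n) * (sech ((R - u) / 2) ^ 2) ^ n)"
  proof -
    have "0 \<le> (\<integral>d. g d * indicator {u..R} d \<partial>lborel)" by (simp add: g0)
    also have "\<dots> = - (exp (- R * real n) * (1 - tanh ((R - R) / 2) ^ 2) ^ n) - - (exp (- u * real n) * (1 - tanh ((R - u) / 2) ^ 2) ^ n)"
      by (rule integral_FTC_Icc_nonneg[OF gm _ g0 uR]) (rule D)
    finally show ?thesis
      unfolding I1 I2 by (subst ennreal_plus[symmetric]) (simp_all add: sech_squared)
  qed
  finally show ?thesis .
qed

text \<open>
  The martingale property of \<open>survival\<close>, also when the next jump is required to happen after
  \<open>s\<close>. With \<open>r = s\<close> this is the exponential law of the waiting time.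
\<close>

lemma survival_jump_after:
  assumes "\<tau> \<le> s" "s \<le> r"
  shows "(\<integral>\<^sup>+z. indicator {s<..} (fst z) * survival r z \<partial>H1_jump (\<tau>, T)) = decay (s - \<tau>) T * sech_power (r - s) T"
proof -
  let ?n = "num_vertices T"
  have m: "(\<lambda>z. indicator {s..} (fst z) * survival r z) \<in> borel_measurable jump_space" by measurable
  have "(\<integral>\<^sup>+z. indicator {s<..} (fst z) * survival r z \<partial>H1_jump (\<tau>, T)) = (\<integral>\<^sup>+z. indicator {s..} (fst z) * survival r z \<partial>H1_jump (\<tau>, T))"
    by (rule nn_integral_cong_AE, use AE_H1_jump_time_neq[where ?z0.0 = "(\<tau>, T)" and s = s] in eventually_elim) (auto simp: indicator_def)
  also have "\<dots> = (\<integral>\<^sup>+d. ennreal (exp (- d * real ?n) * (real ?n * (sech (max 0 (r - \<tau> - d) / 2) ^ 2) ^ ?n * (1 - tanh (max 0 (r - \<tau> - d) / 2)))) * indicator {s - \<tau>..} d \<partial>lborel)"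
    unfolding nn_integral_H1_jump[OF m]
  proof (rule nn_integral_cong)
    fix d :: real
    have sm: "sech_power (max 0 (r - \<tau> - d)) \<in> borel_measurable tree_space" by measurable
    have "attach (\<lambda>T'. indicator {s..} (fst (\<tau> + d, T')) * survival r (\<tau> + d, T')) (grow d T) = indicator {s..} (\<tau> + d) * attach (sech_power (max 0 (r - \<tau> - d))) (grow d T)"
      unfolding survival_def fst_conv snd_conv diff_diff_eq[symmetric] by (rule attach_cmult[OF sm])
    also have "attach (sech_power (max 0 (r - \<tau> - d))) (grow d T) = ennreal (real ?n * (sech (max 0 (r - \<tau> - d) / 2) ^ 2) ^ ?n * (1 - tanh (max 0 (r - \<tau> - d) / 2)))"
      by (subst attach_sech_power) (simp_all only: max.cobounded1 num_vertices_grow)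
    finally have A: "attach (\<lambda>T'. indicator {s..} (fst (\<tau> + d, T')) * survival r (\<tau> + d, T')) (grow d T) = indicator {s..} (\<tau> + d) * \<dots>" .
    have I: "indicator {0..} d * (indicator {s..} (\<tau> + d) :: ennreal) = indicator {s - \<tau>..} d"
      using assms by (auto simp: indicator_def)
    have E: "decay d T * ennreal x = ennreal (exp (- d * real ?n) * x)" for x
      by (rule ennreal_mult'[symmetric]) simp
    have C: "i * (a * (j * b)) = (a * b) * (i * j)" for i a j b :: ennreal
      by (simp only: mult_ac)
    show "indicator {0..} d * (decay d T * attach (\<lambda>T'. indicator {s..} (fst (\<tau> + d, T')) * survival r (\<tau> + d, T')) (grow d T)) =
      ennreal (exp (- d * real ?n) * (real ?n * (sech (max 0 (r - \<tau> - d) / 2) ^ 2) ^ ?n * (1 - tanh (max 0 (r - \<tau> - d) / 2)))) * indicator {s - \<tau>..} d"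
      unfolding A C I E ..
  qed
  also have "\<dots> = ennreal (exp (- (s - \<tau>) * real ?n) * (sech ((r - \<tau> - (s - \<tau>)) / 2) ^ 2) ^ ?n)"
    using assms by (intro nn_integral_survival_density) (simp_all del: num_vertices.simps)
  also have "r - \<tau> - (s - \<tau>) = r - s" by simp
  also have "ennreal (exp (- (s - \<tau>) * real ?n) * (sech ((r - s) / 2) ^ 2) ^ ?n) = decay (s - \<tau>) T * sech_power (r - s) T"
    by (rule ennreal_mult) simp_all
  finally show ?thesis .
qed

lemma no_jump_until:
  assumes "\<tau> \<le> s"
  shows "(\<integral>\<^sup>+z. indicator {s<..} (fst z) \<partial>H1_jump (\<tau>, T)) = decay (s - \<tau>) T"
proof -
  have "(\<integral>\<^sup>+z. indicator {s<..} (fst z) \<partial>H1_jump (\<tau>, T)) = (\<integral>\<^sup>+z. indicator {s<..} (fst z) * survival s z \<partial>H1_jump (\<tau>, T))"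
    by (rule nn_integral_cong) (auto simp: indicator_def survival_after)
  also have "\<dots> = decay (s - \<tau>) T * sech_power (s - s) T"
    by (rule survival_jump_after[OF assms order_refl])
  finally show ?thesis by (simp add: sech_def)
qed

lemma jump_not_before:
  assumes "q \<le> fst z0"
  shows "(\<integral>\<^sup>+z. indicator {..<q} (fst z) \<partial>H1_jump z0) = 0"
proof -
  obtain \<tau> T where z0: "z0 = (\<tau>, T)" by (cases z0)
  have m: "(\<lambda>z. indicator {..<q} (fst z) :: ennreal) \<in> borel_measurable jump_space" by measurable
  have "(\<integral>\<^sup>+z. indicator {..<q} (fst z) \<partial>H1_jump z0) = (\<integral>\<^sup>+d. 0 \<partial>(lborel :: real measure))"
    unfolding z0 nn_integral_H1_jump[OF m]
    by (rule nn_integral_cong) (use assms z0 in \<open>auto simp: indicator_def attach_def\<close>)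
  then show ?thesis by simp
qed

lemma survival_supermartingale: "(\<integral>\<^sup>+z. survival r z \<partial>H1_jump z0) \<le> survival r z0"
proof -
  obtain \<tau> T where z0: "z0 = (\<tau>, T)" by (cases z0)
  show ?thesis
  proof (cases "\<tau> \<le> r")
    case True
    have m: "(\<lambda>z. indicator {..<\<tau>} (fst z) :: ennreal) \<in> borel_measurable (H1_jump z0)"
      by (simp add: measurable_cong_sets[OF sets_kernel[OF measurable_H1_jump] refl] space_jump_space)
    have "AE z in H1_jump z0. (indicator {..<\<tau>} (fst z) :: ennreal) = 0"
      using jump_not_before[of \<tau> z0] nn_integral_0_iff_AE[OF m] by (simp add: z0)
    then have "AE z in H1_jump z0. survival r z = indicator {\<tau><..} (fst z) * survival r z"
      using AE_H1_jump_time_neq[where ?z0.0 = z0 and s = \<tau>] by eventually_elim (auto simp: indicator_def split: if_splits)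
    then have "(\<integral>\<^sup>+z. survival r z \<partial>H1_jump z0) = (\<integral>\<^sup>+z. indicator {\<tau><..} (fst z) * survival r z \<partial>H1_jump (\<tau>, T))"
      unfolding z0 by (rule nn_integral_cong_AE)
    also have "\<dots> = decay (\<tau> - \<tau>) T * sech_power (r - \<tau>) T"
      by (rule survival_jump_after[OF order_refl True])
    finally show ?thesis using True by (simp add: survival_def z0 max_def)
  next
    case False
    interpret J: subprob_space "H1_jump z0"
      by (rule subprob_space_kernel[OF measurable_H1_jump]) (simp add: space_jump_space)
    have "(\<integral>\<^sup>+z. survival r z \<partial>H1_jump z0) \<le> (\<integral>\<^sup>+z. 1 \<partial>H1_jump z0)"
      by (intro nn_integral_mono survival_le_1)
    also have "\<dots> \<le> 1" using J.subprob_emeasure_le_1 by simp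
    finally show ?thesis using False by (simp add: survival_after z0)
  qed
qed

section \<open>The state before explosion\<close>

locale growth_process =
  fixes M :: "'w measure" and Z :: "nat \<Rightarrow> 'w \<Rightarrow> real \<times> aged_tree"
  assumes process: "H1_process M Z"
begin

sublocale prob_space M
  using process by (simp add: H1_process_def)

lemma Z_measurable [measurable]: "Z n \<in> M \<rightarrow>\<^sub>M jump_space"
  using process by (simp add: H1_process_def)

lemma AE_Z_0: "AE \<omega> in M. Z 0 \<omega> = (0, Vertex 0 {#})"
  using process by (simp add: H1_process_def)

lemma Markov_state:
  assumes [measurable]: "f \<in> borel_measurable jump_space" "h \<in> borel_measurable jump_space"
  shows "(\<integral>\<^sup>+\<omega>. f (Z n \<omega>) * h (Z (Suc n) \<omega>) \<partial>M) = (\<integral>\<^sup>+\<omega>. f (Z n \<omega>) * (\<integral>\<^sup>+z. h z \<partial>H1_jump (Z n \<omega>)) \<partial>M)"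
proof -
  have "(\<lambda>g. f (g n)) \<in> borel_measurable (PiM {..n} (\<lambda>_. jump_space))" by measurable
  from H1_process_Markov[OF process this assms(2)] show ?thesis by simp
qed

text \<open>
  Compare with all rational numbers, since the Markov property gives the joint law through
  products only.
\<close>

lemma AE_times: "AE \<omega> in M. fst (Z 0 \<omega>) = 0 \<and> incseq (\<lambda>n. fst (Z n \<omega>))"
proof -
  have "AE \<omega> in M. \<not> (real_of_rat q \<le> fst (Z n \<omega>) \<and> fst (Z (Suc n) \<omega>) < real_of_rat q)" for q n
  proof -
    let ?f = "\<lambda>\<omega>. indicator {real_of_rat q..} (fst (Z n \<omega>)) * indicator {..<real_of_rat q} (fst (Z (Suc n) \<omega>)) :: ennreal"
    have "(\<integral>\<^sup>+\<omega>. ?f \<omega> \<partial>M) = (\<integral>\<^sup>+\<omega>. indicator {real_of_rat q..} (fst (Z n \<omega>)) * (\<integral>\<^sup>+z. indicator {..<real_of_rat q} (fst z) \<partial>H1_jump (Z n \<omega>)) \<partial>M)"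
      by (rule Markov_state) measurable
    also have "\<dots> = (\<integral>\<^sup>+\<omega>. 0 \<partial>M)"
    proof (rule nn_integral_cong)
      fix \<omega>
      show "indicator {real_of_rat q..} (fst (Z n \<omega>)) * (\<integral>\<^sup>+z. indicator {..<real_of_rat q} (fst z) \<partial>H1_jump (Z n \<omega>)) = 0"
        using jump_not_before[of "real_of_rat q" "Z n \<omega>"] by (cases "real_of_rat q \<le> fst (Z n \<omega>)") simp_all
    qed
    finally have "(\<integral>\<^sup>+\<omega>. ?f \<omega> \<partial>M) = 0" by simp
    moreover have "?f \<in> borel_measurable M" by measurable
    ultimately have "AE \<omega> in M. ?f \<omega> = 0" by (simp only: nn_integral_0_iff_AE)
    then show ?thesis by eventually_elim (auto simp: indicator_def split: if_splits)
  qed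
  then have "AE \<omega> in M. \<forall>q n. \<not> (real_of_rat q \<le> fst (Z n \<omega>) \<and> fst (Z (Suc n) \<omega>) < real_of_rat q)"
    by (simp only: AE_all_countable) simp
  then show ?thesis
    using AE_Z_0
  proof eventually_elim
    case (elim \<omega>)
    have "fst (Z n \<omega>) \<le> fst (Z (Suc n) \<omega>)" for n
    proof (rule ccontr)
      assume "\<not> ?thesis"
      then obtain q where "fst (Z (Suc n) \<omega>) < real_of_rat q" "real_of_rat q < fst (Z n \<omega>)"
        using of_rat_dense[of "fst (Z (Suc n) \<omega>)" "fst (Z n \<omega>)"] by auto
      with elim(1) show False by (meson less_imp_le)
    qed
    then show ?case using elim(2) by (auto intro: incseq_SucI)
  qed
qed

lemma AE_time_nonneg: "AE \<omega> in M. 0 \<le> fst (Z n \<omega>)"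
  using AE_times
proof eventually_elim
  case (elim \<omega>)
  then show ?case by (metis incseqD le0)
qed

text \<open>
  The law of the state at time \<open>s\<close> on the event of exactly \<open>n\<close> jumps until \<open>s\<close>.
\<close>

definition occupation :: "nat \<Rightarrow> real \<Rightarrow> (aged_tree \<Rightarrow> ennreal) \<Rightarrow> ennreal" where
  "occupation n s f = (\<integral>\<^sup>+\<omega>. sojourn s f (Z n \<omega>) \<partial>M)"

lemma occupation_0:
  assumes "0 \<le> s"
  shows "occupation 0 s f = ennreal (exp (- s)) * f (Vertex s {#})"
proof -
  have "occupation 0 s f = (\<integral>\<^sup>+\<omega>. ennreal (exp (- s)) * f (Vertex s {#}) \<partial>M)"
    unfolding occupation_def
  proof (rule nn_integral_cong_AE)
    show "AE \<omega> in M. sojourn s f (Z 0 \<omega>) = ennreal (exp (- s)) * f (Vertex s {#})"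
      using AE_Z_0
    proof eventually_elim
      case (elim \<omega>)
      show ?case unfolding elim sojourn_def fst_conv snd_conv diff_zero decay_single using assms by simp
    qed
  qed
  then show ?thesis by (simp add: emeasure_space_1)
qed

lemma occupation_neg: "s < 0 \<Longrightarrow> occupation n s f = 0"
proof -
  assume s: "s < 0"
  have "occupation n s f = (\<integral>\<^sup>+\<omega>. 0 \<partial>M)"
    unfolding occupation_def
  proof (rule nn_integral_cong_AE)
    show "AE \<omega> in M. sojourn s f (Z n \<omega>) = 0"
      using AE_time_nonneg[of n] by eventually_elim (use s in \<open>simp add: sojourn_def\<close>)
  qed
  then show ?thesis by simp
qed

lemma measurable_occupation_delayed:
  assumes [measurable]: "f \<in> borel_measurable tree_space"
  shows "(\<lambda>(\<omega>, c). sojourn (s - c) (attach (delayed f c)) (Z n \<omega>)) \<in> borel_measurable (M \<Otimes>\<^sub>M borel)"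
    and "(\<lambda>c. occupation n (s - c) (attach (delayed f c))) \<in> borel_measurable borel"
proof -
  have A: "(\<lambda>w. sojourn (s - snd w) (attach (delayed f (snd w))) (Z n (fst w))) \<in> borel_measurable (M \<Otimes>\<^sub>M borel)"
    by (rule borel_measurable_sojourn[OF _ _ measurable_attach_delayed]) measurable
  then show "(\<lambda>(\<omega>, c). sojourn (s - c) (attach (delayed f c)) (Z n \<omega>)) \<in> borel_measurable (M \<Otimes>\<^sub>M borel)"
    by (simp add: case_prod_unfold)
  have "(\<lambda>w. sojourn (s - fst w) (attach (delayed f (fst w))) (Z n (snd w))) \<in> borel_measurable (borel \<Otimes>\<^sub>M M)"
    by (rule borel_measurable_sojourn[OF _ _ measurable_attach_delayed]) measurable
  then show "(\<lambda>c. occupation n (s - c) (attach (delayed f c))) \<in> borel_measurable borel"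
    unfolding occupation_def by (intro borel_measurable_nn_integral) (simp add: case_prod_unfold)
qed

text \<open>
  Conditioning on the time \<open>s - c\<close> of the last jump: at this time the process is in the state
  after \<open>n\<close> jumps.
\<close>

lemma occupation_Suc:
  assumes f[measurable]: "f \<in> borel_measurable tree_space"
  shows "occupation (Suc n) s f = (\<integral>\<^sup>+c. indicator {0..s} c * occupation n (s - c) (attach (delayed f c)) \<partial>lborel)"
proof -
  interpret P: pair_sigma_finite M lborel by unfold_locales
  have sm: "sojourn s f \<in> borel_measurable jump_space"
    by (rule borel_measurable_sojourn) measurable
  note m[measurable] = measurable_occupation_delayed(1)[OF f, of s n]
  have "occupation (Suc n) s f = (\<integral>\<^sup>+\<omega>. (\<integral>\<^sup>+c. indicator {0..} c * sojourn (s - c) (attach (delayed f c)) (Z n \<omega>) \<partial>lborel) \<partial>M)"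
    using Markov_state[OF _ sm, of "\<lambda>_. 1" n] unfolding occupation_def by (simp add: nn_integral_sojourn_H1_jump[OF f])
  also have "\<dots> = (\<integral>\<^sup>+c. (\<integral>\<^sup>+\<omega>. indicator {0..} c * sojourn (s - c) (attach (delayed f c)) (Z n \<omega>) \<partial>M) \<partial>lborel)"
  proof (rule P.Fubini'[symmetric])
    have "(\<lambda>w. indicator {0..} (snd w) * (case w of (\<omega>, c) \<Rightarrow> sojourn (s - c) (attach (delayed f c)) (Z n \<omega>))) \<in> borel_measurable (M \<Otimes>\<^sub>M lborel)"
      by measurable
    then show "(\<lambda>(\<omega>, c). indicator {0..} c * sojourn (s - c) (attach (delayed f c)) (Z n \<omega>)) \<in> borel_measurable (M \<Otimes>\<^sub>M lborel)"
      by (simp add: case_prod_unfold)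
  qed
  also have "\<dots> = (\<integral>\<^sup>+c. indicator {0..s} c * occupation n (s - c) (attach (delayed f c)) \<partial>lborel)"
  proof (rule nn_integral_cong)
    fix c :: real
    have "attach (delayed f c) \<in> borel_measurable tree_space"
      by (rule borel_measurable_attach_const) measurable
    then have "sojourn (s - c) (attach (delayed f c)) \<in> borel_measurable jump_space"
      by (intro borel_measurable_sojourn) measurable
    from measurable_compose[OF Z_measurable[of n] this]
    have "(\<integral>\<^sup>+\<omega>. indicator {0..} c * sojourn (s - c) (attach (delayed f c)) (Z n \<omega>) \<partial>M) = indicator {0..} c * occupation n (s - c) (attach (delayed f c))"
      unfolding occupation_def by (rule nn_integral_cmult)
    then show "(\<integral>\<^sup>+\<omega>. indicator {0..} c * sojourn (s - c) (attach (delayed f c)) (Z n \<omega>) \<partial>M) = indicator {0..s} c * occupation n (s - c) (attach (delayed f c))"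
      using occupation_neg[of "s - c" n] by (cases "c \<le> s") (simp_all add: indicator_def)
  qed
  finally show ?thesis .
qed

text \<open>
  The decomposition at the youngest edge and the decomposition at the last jump are the same
  recursion.
\<close>

lemma tree_weight_occupation_bounded:
  assumes "\<And>T. m < num_vertices T \<Longrightarrow> f T = 0" "f \<in> borel_measurable tree_space" "0 \<le> s"
  shows "tree_weight s f = (\<Sum>n. occupation n s f)"
  using assms
proof (induction m arbitrary: f s)
  case 0
  then have "f = (\<lambda>_. 0)" by auto
  then show ?case by (simp add: tree_weight_def occupation_def sojourn_def)
next
  case (Suc m)
  note f[measurable] = Suc.prems(2)
  have "tree_weight s f = ennreal (exp (- s)) * f (Vertex s {#}) + (\<integral>\<^sup>+c. indicator {0..s} c * attach_weight (s - c) (delayed f c) \<partial>lborel)"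
    using Suc.prems by (rule tree_weight_core_bounded)
  also have "(\<integral>\<^sup>+c. indicator {0..s} c * attach_weight (s - c) (delayed f c) \<partial>lborel) =
     (\<integral>\<^sup>+c. (\<Sum>n. indicator {0..s} c * occupation n (s - c) (attach (delayed f c))) \<partial>lborel)"
  proof (rule nn_integral_cong)
    fix c :: real
    have "attach_weight (s - c) (delayed f c) = (\<Sum>n. occupation n (s - c) (attach (delayed f c)))" if "c \<le> s"
      unfolding attach_weight_def
    proof (rule Suc.IH)
      show "attach (delayed f c) T = 0" if "m < num_vertices T" for T
      proof (rule attach_larger_eq_0)
        fix T' assume "num_vertices T < num_vertices T'"
        then have "Suc m < num_vertices (grow c T')" unfolding num_vertices_grow using that by linarith
        then show "delayed f c T' = 0" using Suc.prems(1) by simp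
      qed
      show "attach (delayed f c) \<in> borel_measurable tree_space"
        by (rule borel_measurable_attach_const) measurable
    qed (use that in simp)
    then show "indicator {0..s} c * attach_weight (s - c) (delayed f c) = (\<Sum>n. indicator {0..s} c * occupation n (s - c) (attach (delayed f c)))"
      by (cases "c \<le> s") simp_all
  qed
  also have "\<dots> = (\<Sum>n. occupation (Suc n) s f)"
    unfolding occupation_Suc[OF f]
    by (rule nn_integral_suminf) (use measurable_occupation_delayed(2)[OF f] in measurable)
  finally show ?case
    using suminf_split_head_ennreal[of "\<lambda>n. occupation n s f"] occupation_0[OF Suc.prems(3)] by simp
qed

lemma sojourn_mono: "(\<And>T. f T \<le> g T) \<Longrightarrow> sojourn s f z \<le> sojourn s g z"
  unfolding sojourn_def by (intro mult_left_mono) auto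

text \<open>
  The weight \<open>w\<^sub>s\<close> is the law of the state at time \<open>s\<close>, restricted to the event that finitely
  many jumps happen until \<open>s\<close>.
\<close>

theorem tree_weight_occupation:
  assumes f[measurable]: "f \<in> borel_measurable tree_space" and s: "0 \<le> s"
  shows "tree_weight s f = (\<Sum>n. occupation n s f)"
proof -
  let ?f = "\<lambda>m T. f T * indicator {T. num_vertices T \<le> m} T"
  have fm: "?f m \<in> borel_measurable tree_space" for m by (rule measurable_size_truncation) fact
  have inc: "?f m T \<le> ?f m' T" if "m \<le> m'" for m m' T
    using incseq_size_truncation[of f] that by (auto simp: incseq_def le_fun_def)
  have "tree_weight s f = tree_weight s (\<lambda>T. SUP m. ?f m T)"
    by (simp only: SUP_size_truncation)
  also have "\<dots> = (SUP m. tree_weight s (?f m))"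
    by (rule tree_weight_SUP[OF fm incseq_size_truncation])
  also have "\<dots> = (SUP m. \<Sum>n. occupation n s (?f m))"
  proof (rule SUP_cong[OF refl])
    fix m
    show "tree_weight s (?f m) = (\<Sum>n. occupation n s (?f m))"
      by (rule tree_weight_occupation_bounded[of m, OF _ fm s]) (simp add: indicator_def)
  qed
  also have "\<dots> = (\<Sum>n. SUP m. occupation n s (?f m))"
    unfolding occupation_def
    by (rule ennreal_suminf_SUP_eq[symmetric]) (auto simp: incseq_def intro!: nn_integral_mono sojourn_mono inc)
  also have "\<dots> = (\<Sum>n. occupation n s f)"
  proof (rule arg_cong[where f = suminf], rule ext)
    fix n
    have "(SUP m. occupation n s (?f m)) = (\<integral>\<^sup>+\<omega>. (SUP m. sojourn s (?f m) (Z n \<omega>)) \<partial>M)"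
      unfolding occupation_def
    proof (rule nn_integral_monotone_convergence_SUP[symmetric])
      show "incseq (\<lambda>m \<omega>. sojourn s (?f m) (Z n \<omega>))"
        unfolding incseq_def le_fun_def by (auto intro!: sojourn_mono inc)
      show "(\<lambda>\<omega>. sojourn s (?f m) (Z n \<omega>)) \<in> borel_measurable M" for m
        by (rule borel_measurable_sojourn) (use measurable_compose[OF measurable_snd fm] in \<open>simp_all add: case_prod_unfold\<close>)
    qed
    also have "\<dots> = occupation n s f"
      unfolding occupation_def sojourn_def
      by (simp only: SUP_mult_left_ennreal[symmetric] SUP_size_truncation[unfolded SUP_mult_left_ennreal[symmetric]])
    finally show "(SUP m. occupation n s (?f m)) = occupation n s f" .
  qed
  finally show ?thesis .
qed

end

section \<open>Power series in the size\<close>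

lemma tree_weight_suminf:
  assumes "\<And>n. f n \<in> borel_measurable tree_space"
  shows "tree_weight b (\<lambda>T. \<Sum>n. f n T) = (\<Sum>n. tree_weight b (f n))"
  unfolding tree_weight_def
  by (subst nn_integral_suminf) (simp_all add: measurable_cong_sets[OF sets_gw_law refl] assms)

text \<open>
  The coefficients of the power series \<open>z \<mapsto> w\<^sub>b (1\<^sub>A z ^ |T|)\<close>.
\<close>

definition size_weight :: "real \<Rightarrow> aged_tree set \<Rightarrow> nat \<Rightarrow> real" where
  "size_weight b A n = enn2real (tree_weight b (\<lambda>T. indicator A T * indicator {T. num_vertices T = n} T))"

lemma size_weight_nonneg: "0 \<le> size_weight b A n"
  by (simp add: size_weight_def)

lemma tree_weight_by_size:
  assumes A[measurable]: "A \<in> sets tree_space" and b: "0 \<le> b"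
  shows "tree_weight b (\<lambda>T. indicator A T * ennreal (\<phi> (num_vertices T))) = (\<Sum>n. ennreal (\<phi> n) * ennreal (size_weight b A n))"
proof -
  have I[measurable]: "{T. num_vertices T = n} \<in> sets tree_space" for n
  proof -
    have "{T \<in> space tree_space. num_vertices T = n} \<in> sets tree_space" by measurable
    then show ?thesis by simp
  qed
  let ?f = "\<lambda>n T. indicator A T * indicator {T. num_vertices T = n} T :: ennreal"
  have "?f n T \<le> 1" for n T by (simp add: indicator_def)
  then have "tree_weight b (?f n) \<le> tree_weight b (\<lambda>_. 1)" for n by (rule tree_weight_mono)
  then have "tree_weight b (?f n) < \<top>" for n
    unfolding tree_weight_1[OF b] by (rule le_less_trans) simp
  then have c: "tree_weight b (?f n) = ennreal (size_weight b A n)" for n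
    by (simp add: size_weight_def)
  have "(\<Sum>n. ennreal (\<phi> n) * ?f n T) = indicator A T * ennreal (\<phi> (num_vertices T))" for T
  proof -
    have "(\<lambda>n. if n = num_vertices T then ennreal (\<phi> n) * indicator A T else 0) sums (ennreal (\<phi> (num_vertices T)) * indicator A T)"
      by (rule sums_single)
    moreover have "(\<lambda>n. if n = num_vertices T then ennreal (\<phi> n) * indicator A T else 0) = (\<lambda>n. ennreal (\<phi> n) * ?f n T)"
      by (auto simp: indicator_def)
    ultimately show ?thesis by (simp add: sums_iff mult.commute)
  qed
  then have "tree_weight b (\<lambda>T. indicator A T * ennreal (\<phi> (num_vertices T))) = tree_weight b (\<lambda>T. \<Sum>n. ennreal (\<phi> n) * ?f n T)"
    by (simp only:)
  also have "\<dots> = (\<Sum>n. tree_weight b (\<lambda>T. ennreal (\<phi> n) * ?f n T))"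
    by (rule tree_weight_suminf) measurable
  also have "\<dots> = (\<Sum>n. ennreal (\<phi> n) * ennreal (size_weight b A n))"
    unfolding c[symmetric] by (intro arg_cong[where f = suminf] ext tree_weight_cmult) measurable
  finally show ?thesis .
qed

lemma summable_size_weight:
  assumes A: "A \<in> sets tree_space" and b: "0 \<le> b"
  shows "summable (size_weight b A)"
proof (rule summable_suminf_not_top[OF size_weight_nonneg])
  have "(\<Sum>n. ennreal (size_weight b A n)) = tree_weight b (indicator A)"
    using tree_weight_by_size[OF A b, of "\<lambda>_. 1"] by simp
  also have "\<dots> \<le> tree_weight b (\<lambda>_. 1)"
    by (rule tree_weight_mono) (simp add: indicator_def)
  also have "\<dots> < \<top>" unfolding tree_weight_1[OF b] by simp
  finally show "(\<Sum>n. ennreal (size_weight b A n)) \<noteq> \<top>" by simp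
qed

lemma summable_size_weight_power:
  assumes "A \<in> sets tree_space" "0 \<le> b" "\<bar>z\<bar> \<le> 1"
  shows "summable (\<lambda>n. size_weight b A n * z ^ n)"
proof (rule summable_comparison_test'[OF summable_size_weight[OF assms(1,2)], of 0])
  fix n
  show "norm (size_weight b A n * z ^ n) \<le> size_weight b A n"
    using power_le_one[of "\<bar>z\<bar>" n] assms(3) by (simp add: abs_mult size_weight_nonneg power_abs mult_left_le)
qed

lemma tree_weight_indicator_sech_power:
  assumes "A \<in> sets tree_space" "0 \<le> b"
  shows "tree_weight b (\<lambda>T. indicator A T * sech_power y T) = ennreal (\<Sum>n. size_weight b A n * (sech (y / 2) ^ 2) ^ n)"
proof -
  have "tree_weight b (\<lambda>T. indicator A T * sech_power y T) = (\<Sum>n. ennreal ((sech (y / 2) ^ 2) ^ n) * ennreal (size_weight b A n))"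
    using tree_weight_by_size[OF assms, of "\<lambda>n. (sech (y / 2) ^ 2) ^ n"] .
  also have "\<dots> = (\<Sum>n. ennreal (size_weight b A n * (sech (y / 2) ^ 2) ^ n))"
    by (simp add: ennreal_mult[symmetric] size_weight_nonneg mult.commute)
  also have "\<dots> = ennreal (\<Sum>n. size_weight b A n * (sech (y / 2) ^ 2) ^ n)"
    by (intro suminf_ennreal2 summable_size_weight_power assms) (simp_all add: size_weight_nonneg sech_le_1)
  finally show ?thesis .
qed

text \<open>
  Since \<open>z = sech (x/2)\<^sup>2\<close> has derivative \<open>- tanh (x/2) z\<close>, differentiating \<open>z ^ n\<close> brings down
  \<open>- tanh (x/2) n z ^ n\<close>. For \<open>x > 0\<close> the argument is inside the disc of convergence.
\<close>

lemma size_weight_derivative: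
  assumes A: "A \<in> sets tree_space" and b: "0 \<le> b" and x: "0 < x"
  obtains N where "0 \<le> N"
    "tree_weight b (\<lambda>T. indicator A T * ennreal (real (num_vertices T) * (sech (x / 2) ^ 2) ^ num_vertices T)) = ennreal N"
    "((\<lambda>x. \<Sum>n. size_weight b A n * (sech (x / 2) ^ 2) ^ n) has_real_derivative - (tanh (x / 2) * N)) (at x)"
proof -
  let ?c = "size_weight b A"
  define z where "z = sech (x / 2) ^ 2"
  have z: "0 \<le> z" by (simp add: z_def)
  have z1: "z < 1" using x by (simp add: z_def sech_squared)
  have conv: "summable (\<lambda>n. diffs ?c n * z ^ n)"
    by (rule termdiff_converges[where K = 1]) (use z z1 in \<open>auto intro!: summable_size_weight_power A b\<close>)
  have shift: "real (Suc n) * ?c (Suc n) * z ^ Suc n = z * (diffs ?c n * z ^ n)" for n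
    by (simp add: diffs_def mult_ac)
  have sm: "summable (\<lambda>n. real n * ?c n * z ^ n)"
    by (subst summable_Suc_iff[symmetric]) (use summable_mult[OF conv, of z] in \<open>simp only: shift\<close>)
  define N where "N = (\<Sum>n. real n * ?c n * z ^ n)"
  have N: "N = z * (\<Sum>n. diffs ?c n * z ^ n)"
  proof -
    have "N = (\<Sum>n. real (Suc n) * ?c (Suc n) * z ^ Suc n)"
      unfolding N_def using suminf_split_head[OF sm] by simp
    also have "\<dots> = z * (\<Sum>n. diffs ?c n * z ^ n)"
      unfolding shift by (rule suminf_mult[OF conv])
    finally show ?thesis .
  qed
  show thesis
  proof (rule that[of N])
    show "0 \<le> N"
      unfolding N_def by (rule suminf_nonneg[OF sm]) (simp add: z size_weight_nonneg)
    have "tree_weight b (\<lambda>T. indicator A T * ennreal (real (num_vertices T) * z ^ num_vertices T)) =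
      (\<Sum>n. ennreal (real n * z ^ n) * ennreal (?c n))"
      by (rule tree_weight_by_size[OF A b])
    also have "\<dots> = (\<Sum>n. ennreal (real n * ?c n * z ^ n))"
      by (simp add: ennreal_mult[symmetric] size_weight_nonneg z mult_ac)
    also have "\<dots> = ennreal N"
      unfolding N_def by (rule suminf_ennreal2[OF _ sm]) (simp add: z size_weight_nonneg)
    finally show "tree_weight b (\<lambda>T. indicator A T * ennreal (real (num_vertices T) * (sech (x / 2) ^ 2) ^ num_vertices T)) = ennreal N"
      by (simp only: z_def)
    have "((\<lambda>z. \<Sum>n. ?c n * z ^ n) has_real_derivative (\<Sum>n. diffs ?c n * z ^ n)) (at z)"
      by (rule termdiffs_strong[where K = 1]) (use z z1 in \<open>auto intro!: summable_size_weight A b\<close>)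
    moreover have "((\<lambda>x. sech (x / 2) ^ 2) has_real_derivative - (tanh (x / 2) * z)) (at x)"
      unfolding z_def sech_squared by (auto intro!: derivative_eq_intros)
    ultimately show "((\<lambda>x. \<Sum>n. ?c n * (sech (x / 2) ^ 2) ^ n) has_real_derivative - (tanh (x / 2) * N)) (at x)"
      unfolding z_def using DERIV_chain2[of "\<lambda>z. \<Sum>n. ?c n * z ^ n" "\<Sum>n. diffs ?c n * (sech (x / 2) ^ 2) ^ n" "\<lambda>x. sech (x / 2) ^ 2" x "- (tanh (x / 2) * sech (x / 2) ^ 2)" UNIV]
      by (simp add: N z_def mult_ac)
  qed
qed

section \<open>The joint law of the state and the explosion time\<close>

lemma ennreal_term_le_suminf: "f k \<le> (\<Sum>k. f k :: ennreal)"
  using sum_le_suminf[OF summableI, of "{k}" f] by simp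

lemma crossing_exists:
  fixes f :: "nat \<Rightarrow> real"
  assumes "f 0 \<le> s" "s < f m"
  shows "\<exists>n. f n \<le> s \<and> s < f (Suc n)"
  using assms(2)
proof (induction m)
  case 0
  then show ?case using assms(1) by simp
next
  case (Suc m)
  then show ?case by (cases "s < f m") (auto simp: not_less)
qed

lemma crossing_unique:
  fixes f :: "nat \<Rightarrow> real"
  assumes "incseq f" "f i \<le> s" "s < f (Suc i)" "s < f (Suc j)"
  shows "i \<le> j"
proof (rule ccontr)
  assume "\<not> i \<le> j"
  then have "f (Suc j) \<le> f i" by (intro incseqD[OF assms(1)]) simp
  then show False using assms by simp
qed

lemma H1_at_eq:
  assumes "incseq (\<lambda>n. fst (Z n \<omega>))" "fst (Z n \<omega>) \<le> s" "s < fst (Z (Suc n) \<omega>)"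
  shows "H1_at Z s \<omega> = grow (s - fst (Z n \<omega>)) (snd (Z n \<omega>))"
proof -
  have "jumps_until Z s \<omega> = n"
    unfolding jumps_until_def
    by (rule Least_equality) (use crossing_unique[OF assms] assms in auto)
  then show ?thesis by (simp add: H1_at_def case_prod_unfold Let_def)
qed

lemma less_explosion_time_iff:
  assumes "incseq (\<lambda>n. fst (Z n \<omega>))"
  shows "ereal r < explosion_time Z \<omega> \<longleftrightarrow> (\<exists>n. r < fst (Z n \<omega>))"
proof -
  have "incseq (\<lambda>n. ereal (fst (Z n \<omega>)))"
    using assms by (simp add: incseq_def)
  then have "explosion_time Z \<omega> = (SUP n. ereal (fst (Z n \<omega>)))"
    unfolding explosion_time_def by (intro limI LIMSEQ_SUP)
  then show ?thesis by (simp add: less_SUP_iff)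
qed

context growth_process
begin

lemma measurable_jumps_until [measurable]: "jumps_until Z s \<in> M \<rightarrow>\<^sub>M count_space UNIV"
  unfolding jumps_until_def by measurable

lemma measurable_H1_at [measurable]: "H1_at Z s \<in> M \<rightarrow>\<^sub>M tree_space"
proof -
  have [measurable]: "(\<lambda>\<omega>. Z (jumps_until Z s \<omega>) \<omega>) \<in> M \<rightarrow>\<^sub>M jump_space"
    by (rule measurable_compose_countable[OF Z_measurable measurable_jumps_until])
  show ?thesis unfolding H1_at_def[abs_def] Let_def case_prod_unfold by measurable
qed

lemma measurable_explosion_time [measurable]: "explosion_time Z \<in> borel_measurable M"
  unfolding explosion_time_def[abs_def] by measurable

text \<open>
  The function \<open>survival\<close> is a supermartingale along the chain, also on events that depend on an
  earlier state and its successor.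
\<close>

lemma survival_decreasing:
  assumes K: "(\<lambda>(x, y). K x y) \<in> borel_measurable (jump_space \<Otimes>\<^sub>M jump_space)" and "Suc k \<le> n"
  shows "(\<integral>\<^sup>+\<omega>. K (Z k \<omega>) (Z (Suc k) \<omega>) * survival r (Z n \<omega>) \<partial>M) \<le> (\<integral>\<^sup>+\<omega>. K (Z k \<omega>) (Z (Suc k) \<omega>) * survival r (Z (Suc k) \<omega>) \<partial>M)"
  using assms(2)
proof (induction n rule: dec_induct)
  case (step n)
  let ?F = "\<lambda>g. K (g k) (g (Suc k))"
  have "(\<lambda>g. (g k, g (Suc k))) \<in> PiM {..n} (\<lambda>_. jump_space) \<rightarrow>\<^sub>M jump_space \<Otimes>\<^sub>M jump_space"
    using step.hyps by (intro measurable_Pair measurable_component_singleton) auto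
  from measurable_compose[OF this K] have F: "?F \<in> borel_measurable (PiM {..n} (\<lambda>_. jump_space))" by simp
  have "(\<integral>\<^sup>+\<omega>. K (Z k \<omega>) (Z (Suc k) \<omega>) * survival r (Z (Suc n) \<omega>) \<partial>M) = (\<integral>\<^sup>+\<omega>. K (Z k \<omega>) (Z (Suc k) \<omega>) * (\<integral>\<^sup>+z. survival r z \<partial>H1_jump (Z n \<omega>)) \<partial>M)"
    using H1_process_Markov[OF process F measurable_survival, of r] step.hyps by simp
  also have "\<dots> \<le> (\<integral>\<^sup>+\<omega>. K (Z k \<omega>) (Z (Suc k) \<omega>) * survival r (Z n \<omega>) \<partial>M)"
    by (intro nn_integral_mono mult_left_mono survival_supermartingale) simp
  finally show ?case using step.IH by (rule order_trans)
qed simp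

definition visit :: "real \<Rightarrow> aged_tree set \<Rightarrow> nat \<Rightarrow> 'w \<Rightarrow> ennreal" where
  "visit s A k \<omega> = indicator {..s} (fst (Z k \<omega>)) * indicator A (grow (s - fst (Z k \<omega>)) (snd (Z k \<omega>))) * indicator {s<..} (fst (Z (Suc k) \<omega>))"

lemma measurable_visit [measurable]:
  assumes [measurable]: "A \<in> sets tree_space"
  shows "visit s A k \<in> borel_measurable M"
  unfolding visit_def[abs_def] by measurable

lemma nn_integral_visit:
  assumes A[measurable]: "A \<in> sets tree_space" and h: "h \<in> borel_measurable jump_space"
    and eq: "\<And>\<tau> T. \<tau> \<le> s \<Longrightarrow> (\<integral>\<^sup>+z. indicator {s<..} (fst z) * h z \<partial>H1_jump (\<tau>, T)) = decay (s - \<tau>) T * k (num_vertices T)"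
  shows "(\<integral>\<^sup>+\<omega>. visit s A n \<omega> * h (Z (Suc n) \<omega>) \<partial>M) = occupation n s (\<lambda>T. indicator A T * k (num_vertices T))"
proof -
  note h[measurable]
  let ?f = "\<lambda>z. indicator {..s} (fst z) * indicator A (grow (s - fst z) (snd z)) :: ennreal"
  have "(\<integral>\<^sup>+\<omega>. visit s A n \<omega> * h (Z (Suc n) \<omega>) \<partial>M) = (\<integral>\<^sup>+\<omega>. ?f (Z n \<omega>) * (indicator {s<..} (fst (Z (Suc n) \<omega>)) * h (Z (Suc n) \<omega>)) \<partial>M)"
    by (simp only: visit_def mult.assoc)
  also have "\<dots> = (\<integral>\<^sup>+\<omega>. ?f (Z n \<omega>) * (\<integral>\<^sup>+z. indicator {s<..} (fst z) * h z \<partial>H1_jump (Z n \<omega>)) \<partial>M)"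
    by (rule Markov_state[where f = ?f and h = "\<lambda>z. indicator {s<..} (fst z) * h z"]) measurable
  also have "\<dots> = (\<integral>\<^sup>+\<omega>. sojourn s (\<lambda>T. indicator A T * k (num_vertices T)) (Z n \<omega>) \<partial>M)"
  proof (rule nn_integral_cong)
    fix \<omega>
    obtain \<tau> T where z: "Z n \<omega> = (\<tau>, T)" by (cases "Z n \<omega>")
    show "?f (Z n \<omega>) * (\<integral>\<^sup>+z. indicator {s<..} (fst z) * h z \<partial>H1_jump (Z n \<omega>)) = sojourn s (\<lambda>T. indicator A T * k (num_vertices T)) (Z n \<omega>)"
      unfolding z sojourn_def fst_conv snd_conv num_vertices_grow[of "s - \<tau>" T]
    proof (cases "\<tau> \<le> s")
      case True
      show "indicator {..s} \<tau> * indicator A (grow (s - \<tau>) T) * (\<integral>\<^sup>+z. indicator {s<..} (fst z) * h z \<partial>H1_jump (\<tau>, T)) =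
        indicator {..s} \<tau> * (decay (s - \<tau>) T * (indicator A (grow (s - \<tau>) T) * k (num_vertices T)))"
        unfolding eq[OF True] by (simp only: mult_ac)
    qed simp
  qed
  finally show ?thesis by (simp only: occupation_def)
qed

text \<open>
  If the explosion is after \<open>r\<close>, then eventually the jump times exceed \<open>r\<close> and \<open>survival r\<close> is
  \<open>1\<close>. So the probability is at most a limit of expectations of \<open>survival r\<close>, which decrease.
\<close>

lemma visit_explosion_le:
  assumes A[measurable]: "A \<in> sets tree_space" and sr: "s \<le> r"
  shows "(\<integral>\<^sup>+\<omega>. visit s A k \<omega> * indicator {\<omega>. ereal r < explosion_time Z \<omega>} \<omega> \<partial>M) \<le> occupation k s (\<lambda>T. indicator A T * sech_power (r - s) T)"
proof -
  let ?f = "\<lambda>m \<omega>. visit s A k \<omega> * indicator {r<..} (fst (Z (Suc k + m) \<omega>))"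
  have "(\<integral>\<^sup>+\<omega>. visit s A k \<omega> * indicator {\<omega>. ereal r < explosion_time Z \<omega>} \<omega> \<partial>M) \<le> (\<integral>\<^sup>+\<omega>. (SUP m. ?f m \<omega>) \<partial>M)"
  proof (rule nn_integral_mono_AE)
    show "AE \<omega> in M. visit s A k \<omega> * indicator {\<omega>. ereal r < explosion_time Z \<omega>} \<omega> \<le> (SUP m. ?f m \<omega>)"
      using AE_times
    proof eventually_elim
      case (elim \<omega>)
      show ?case
      proof (cases "ereal r < explosion_time Z \<omega>")
        case True
        then have "\<exists>n. r < fst (Z n \<omega>)"
          by (simp only: less_explosion_time_iff[where Z = Z and \<omega> = \<omega>, OF conjunct2[OF elim]])
        then obtain n where n: "r < fst (Z n \<omega>)" ..
        also have "fst (Z n \<omega>) \<le> fst (Z (Suc k + n) \<omega>)"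
          by (rule incseqD[OF conjunct2[OF elim]]) simp
        finally have "?f n \<omega> = visit s A k \<omega>" by simp
        then show ?thesis using True by (intro SUP_upper2[of n]) simp_all
      qed simp
    qed
  qed
  also have "\<dots> = (SUP m. \<integral>\<^sup>+\<omega>. ?f m \<omega> \<partial>M)"
  proof (rule nn_integral_monotone_convergence_SUP_AE)
    fix m
    show "AE \<omega> in M. ?f m \<omega> \<le> ?f (Suc m) \<omega>"
      using AE_times
    proof eventually_elim
      case (elim \<omega>)
      have "fst (Z (Suc k + m) \<omega>) \<le> fst (Z (Suc k + Suc m) \<omega>)"
        by (rule incseqD[OF conjunct2[OF elim]]) simp
      then show ?case by (intro mult_left_mono) (auto simp: indicator_def)
    qed
  qed measurable
  also have "\<dots> \<le> (\<integral>\<^sup>+\<omega>. visit s A k \<omega> * survival r (Z (Suc k) \<omega>) \<partial>M)"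
  proof (rule SUP_least)
    fix m
    have "(\<integral>\<^sup>+\<omega>. ?f m \<omega> \<partial>M) \<le> (\<integral>\<^sup>+\<omega>. visit s A k \<omega> * survival r (Z (Suc k + m) \<omega>) \<partial>M)"
      by (intro nn_integral_mono mult_left_mono) (auto simp: indicator_def survival_after)
    also have "\<dots> \<le> (\<integral>\<^sup>+\<omega>. visit s A k \<omega> * survival r (Z (Suc k) \<omega>) \<partial>M)"
      unfolding visit_def
      by (rule survival_decreasing[where K = "\<lambda>x y. indicator {..s} (fst x) * indicator A (grow (s - fst x) (snd x)) * indicator {s<..} (fst y)"])
         (unfold case_prod_unfold, measurable)
    finally show "(\<integral>\<^sup>+\<omega>. ?f m \<omega> \<partial>M) \<le> (\<integral>\<^sup>+\<omega>. visit s A k \<omega> * survival r (Z (Suc k) \<omega>) \<partial>M)" .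
  qed
  also have "\<dots> = occupation k s (\<lambda>T. indicator A T * sech_power (r - s) T)"
    by (rule nn_integral_visit[where k = "\<lambda>n. ennreal ((sech ((r - s) / 2) ^ 2) ^ n)", OF A measurable_survival survival_jump_after[OF _ sr]])
  finally show ?thesis .
qed

lemma measurable_before_explosion [measurable]: "{\<omega> \<in> space M. ereal r < explosion_time Z \<omega>} \<in> sets M"
  by measurable

definition joint :: "real \<Rightarrow> aged_tree set \<Rightarrow> real \<Rightarrow> real" where
  "joint s A r = measure M {\<omega> \<in> space M. H1_at Z s \<omega> \<in> A \<and> ereal r < explosion_time Z \<omega>}"

lemma joint_sets [measurable]:
  assumes [measurable]: "A \<in> sets tree_space"
  shows "{\<omega> \<in> space M. H1_at Z s \<omega> \<in> A \<and> ereal r < explosion_time Z \<omega>} \<in> sets M"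
  by measurable

lemma joint_le:
  assumes A[measurable]: "A \<in> sets tree_space" and s: "0 \<le> s" and sr: "s \<le> r"
  shows "ennreal (joint s A r) \<le> tree_weight s (\<lambda>T. indicator A T * sech_power (r - s) T)"
proof -
  let ?E = "{\<omega>. ereal r < explosion_time Z \<omega>}"
  have "ennreal (joint s A r) = (\<integral>\<^sup>+\<omega>. indicator {\<omega> \<in> space M. H1_at Z s \<omega> \<in> A \<and> ereal r < explosion_time Z \<omega>} \<omega> \<partial>M)"
    unfolding joint_def by (subst nn_integral_indicator) (simp_all add: emeasure_eq_measure)
  also have "\<dots> \<le> (\<integral>\<^sup>+\<omega>. (\<Sum>k. visit s A k \<omega> * indicator ?E \<omega>) \<partial>M)"
  proof (rule nn_integral_mono_AE)
    show "AE \<omega> in M. indicator {\<omega> \<in> space M. H1_at Z s \<omega> \<in> A \<and> ereal r < explosion_time Z \<omega>} \<omega> \<le> (\<Sum>k. visit s A k \<omega> * indicator ?E \<omega>)"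
      using AE_times
    proof eventually_elim
      case (elim \<omega>)
      show ?case
      proof (cases "H1_at Z s \<omega> \<in> A \<and> ereal r < explosion_time Z \<omega>")
        case True
        then have "\<exists>m. r < fst (Z m \<omega>)"
          by (simp only: less_explosion_time_iff[where Z = Z and \<omega> = \<omega>, OF conjunct2[OF elim]])
        then obtain m where "r < fst (Z m \<omega>)" ..
        then obtain k where k: "fst (Z k \<omega>) \<le> s" "s < fst (Z (Suc k) \<omega>)"
          using crossing_exists[of "\<lambda>n. fst (Z n \<omega>)" s m] elim s sr by auto
        have "visit s A k \<omega> * indicator ?E \<omega> = 1"
          using True k H1_at_eq[where Z = Z and \<omega> = \<omega>, OF conjunct2[OF elim] k] by (simp add: visit_def)
        moreover have "visit s A k \<omega> * indicator ?E \<omega> \<le> (\<Sum>k. visit s A k \<omega> * indicator ?E \<omega>)"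
          by (rule ennreal_term_le_suminf)
        ultimately have "1 \<le> (\<Sum>k. visit s A k \<omega> * indicator ?E \<omega>)" by (simp only:)
        then show ?thesis by (rule order_trans[rotated]) (simp add: indicator_def)
      qed (auto simp: indicator_def)
    qed
  qed
  also have "\<dots> = (\<Sum>k. \<integral>\<^sup>+\<omega>. visit s A k \<omega> * indicator ?E \<omega> \<partial>M)"
  proof (rule nn_integral_suminf)
    have "(\<lambda>\<omega>. indicator ?E \<omega> :: ennreal) \<in> borel_measurable M"
      unfolding indicator_def mem_Collect_eq by measurable
    then show "(\<lambda>\<omega>. visit s A k \<omega> * indicator ?E \<omega>) \<in> borel_measurable M" for k
      by measurable
  qed
  also have "\<dots> \<le> (\<Sum>k. occupation k s (\<lambda>T. indicator A T * sech_power (r - s) T))"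
    by (intro suminf_le visit_explosion_le A sr summableI)
  also have "\<dots> = tree_weight s (\<lambda>T. indicator A T * sech_power (r - s) T)"
    by (rule tree_weight_occupation[symmetric, OF _ s]) measurable
  finally show ?thesis .
qed

lemma explosion_after_ge:
  assumes r: "0 \<le> r"
  shows "sech (r / 2) ^ 2 \<le> measure M {\<omega> \<in> space M. ereal r < explosion_time Z \<omega>}"
proof -
  have "ennreal (sech (r / 2) ^ 2) = tree_weight r (\<lambda>T. indicator UNIV T * 1)"
    using tree_weight_1[OF r] by simp
  also have "\<dots> = (\<Sum>k. occupation k r (\<lambda>T. indicator UNIV T * 1))"
    by (rule tree_weight_occupation[OF _ r]) simp
  also have "\<dots> = (\<Sum>k. \<integral>\<^sup>+\<omega>. visit r UNIV k \<omega> * 1 \<partial>M)"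
    by (rule arg_cong[where f = suminf], rule ext, rule nn_integral_visit[symmetric, where k = "\<lambda>_. 1"])
       (use no_jump_until sets.top[of tree_space] in simp_all)
  also have "\<dots> = (\<integral>\<^sup>+\<omega>. (\<Sum>k. visit r UNIV k \<omega>) \<partial>M)"
    using sets.top[of tree_space] by (subst nn_integral_suminf) simp_all
  also have "\<dots> \<le> (\<integral>\<^sup>+\<omega>. indicator {\<omega> \<in> space M. ereal r < explosion_time Z \<omega>} \<omega> \<partial>M)"
  proof (rule nn_integral_mono_AE)
    show "AE \<omega> in M. (\<Sum>k. visit r UNIV k \<omega>) \<le> indicator {\<omega> \<in> space M. ereal r < explosion_time Z \<omega>} \<omega>"
      using AE_times AE_space
    proof eventually_elim
      case (elim \<omega>)
      note inc = conjunct2[OF elim(1)]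
      show ?case
      proof (cases "\<exists>k. fst (Z k \<omega>) \<le> r \<and> r < fst (Z (Suc k) \<omega>)")
        case True
        then obtain k where k: "fst (Z k \<omega>) \<le> r" "r < fst (Z (Suc k) \<omega>)" by blast
        have "visit r UNIV j \<omega> = (if j = k then 1 else 0)" for j
        proof (cases "fst (Z j \<omega>) \<le> r \<and> r < fst (Z (Suc j) \<omega>)")
          case True
          then have "j = k"
            using crossing_unique[OF inc, of j r k] crossing_unique[OF inc, of k r j] k by auto
          then show ?thesis using k by (simp add: visit_def)
        next
          case False
          then show ?thesis using k by (auto simp: visit_def indicator_def)
        qed
        then have "(\<Sum>k. visit r UNIV k \<omega>) = 1"
          using sums_unique[OF sums_single[of k "\<lambda>_. 1 :: ennreal"]] by simp
        then show ?thesis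
          using k elim(2) less_explosion_time_iff[where Z = Z and \<omega> = \<omega>, OF inc] by (auto simp: indicator_def)
      next
        case False
        then have "visit r UNIV k \<omega> = 0" for k by (auto simp: visit_def indicator_def)
        then show ?thesis by simp
      qed
    qed
  qed
  also have "\<dots> = ennreal (measure M {\<omega> \<in> space M. ereal r < explosion_time Z \<omega>})"
    by (subst nn_integral_indicator) (simp_all add: emeasure_eq_measure)
  finally show ?thesis by simp
qed

text \<open>
  The upper bounds \<open>joint_le\<close> for \<open>A\<close> and for its complement add up to \<open>sech (r/2)\<^sup>2\<close>, by the
  generating function of the size. This is at most the probability of explosion after \<open>r\<close>, by
  \<open>explosion_after_ge\<close>, so neither bound can be strict.
\<close>

theorem joint_eq:
  assumes A[measurable]: "A \<in> sets tree_space" and s: "0 \<le> s" and sr: "s \<le> r"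
  shows "joint s A r = (\<Sum>n. size_weight s A n * (sech ((r - s) / 2) ^ 2) ^ n)" (is "_ = ?W A")
    and "measure M {\<omega> \<in> space M. ereal r < explosion_time Z \<omega>} = sech (r / 2) ^ 2"
proof -
  let ?P = "measure M {\<omega> \<in> space M. ereal r < explosion_time Z \<omega>}"
  have W0: "0 \<le> ?W B" if "B \<in> sets tree_space" for B
    by (intro suminf_nonneg summable_size_weight_power that s) (simp_all add: sech_le_1 size_weight_nonneg)
  have le: "joint s B r \<le> ?W B" if "B \<in> sets tree_space" for B
    using joint_le[OF that s sr] W0[OF that] unfolding tree_weight_indicator_sech_power[OF that s] by simp
  have nA[measurable]: "- A \<in> sets tree_space"
    using sets.compl_sets[OF A] by (simp add: Compl_eq_Diff_UNIV)
  have "?P = joint s A r + joint s (- A) r"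
    unfolding joint_def
    by (subst finite_measure_Union[symmetric]) (auto intro!: arg_cong[where f = "measure M"])
  moreover have "?W A + ?W (- A) = sech (r / 2) ^ 2"
  proof -
    have "ennreal (?W A + ?W (- A)) = tree_weight s (\<lambda>T. indicator A T * sech_power (r - s) T) + tree_weight s (\<lambda>T. indicator (- A) T * sech_power (r - s) T)"
      unfolding tree_weight_indicator_sech_power[OF A s] tree_weight_indicator_sech_power[OF nA s]
      by (rule ennreal_plus[OF W0[OF A] W0[OF nA]])
    also have "\<dots> = tree_weight s (\<lambda>T. indicator A T * sech_power (r - s) T + indicator (- A) T * sech_power (r - s) T)"
      by (rule tree_weight_add[symmetric]) measurable
    also have "\<dots> = tree_weight s (sech_power (r - s))"
      by (rule arg_cong[where f = "tree_weight s"]) (auto simp: indicator_def)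
    also have "\<dots> = ennreal (sech (r / 2) ^ 2)"
      using s sr by (subst tree_weight_sech_power) simp_all
    finally show ?thesis using W0[OF A] W0[OF nA] by (simp del: ennreal_plus)
  qed
  moreover have "sech (r / 2) ^ 2 \<le> ?P"
    using s sr by (intro explosion_after_ge) simp
  ultimately show "joint s A r = ?W A" "?P = sech (r / 2) ^ 2"
    using le[OF A] le[OF nA] by linarith+
qed

text \<open>
  The law of the explosion time has no atom at \<open>t\<close>, as \<open>joint\<close> is continuous there.
\<close>

lemma joint_at_least:
  assumes A[measurable]: "A \<in> sets tree_space" and s: "0 \<le> s" and st: "s < t"
  shows "measure M {\<omega> \<in> space M. H1_at Z s \<omega> \<in> A \<and> ereal t \<le> explosion_time Z \<omega>} = joint s A t"
proof (rule antisym)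
  let ?X = "{\<omega> \<in> space M. H1_at Z s \<omega> \<in> A \<and> ereal t \<le> explosion_time Z \<omega>}"
  let ?g = "\<lambda>x. \<Sum>n. size_weight s A n * (sech (x / 2) ^ 2) ^ n"
  show "joint s A t \<le> measure M ?X"
    unfolding joint_def by (intro finite_measure_mono) auto
  have "isCont ?g (t - s)"
  proof (rule size_weight_derivative[OF A s])
    show "0 < t - s" using st by simp
    fix N assume "(?g has_real_derivative - (tanh ((t - s) / 2) * N)) (at (t - s))"
    then show "isCont ?g (t - s)" by (rule DERIV_isCont)
  qed
  moreover have "((\<lambda>r. r - s) \<longlongrightarrow> t - s) (at_left t)" by (intro tendsto_intros)
  ultimately have "((\<lambda>r. ?g (r - s)) \<longlongrightarrow> ?g (t - s)) (at_left t)"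
    by (rule isCont_tendsto_compose)
  then have lim: "((\<lambda>r. ?g (r - s)) \<longlongrightarrow> joint s A t) (at_left t)"
    using joint_eq(1)[OF A s] st by simp
  show "measure M ?X \<le> joint s A t"
  proof (rule tendsto_lowerbound[OF lim])
    show "eventually (\<lambda>r. measure M ?X \<le> ?g (r - s)) (at_left t)"
      using eventually_at_left_real[OF st]
    proof eventually_elim
      case (elim r)
      have "measure M ?X \<le> joint s A r"
        unfolding joint_def using elim
        by (intro finite_measure_mono) (auto intro: less_le_trans[of "ereal r" "ereal t"])
      then show ?case using joint_eq(1)[OF A s] elim by simp
    qed
  qed simp
qed

lemma joint_window:
  assumes A[measurable]: "A \<in> sets tree_space" and s: "0 \<le> s" and st: "s < t" and e: "0 < e"
  shows "measure M {\<omega> \<in> space M. H1_at Z s \<omega> \<in> A \<and> ereal t \<le> explosion_time Z \<omega> \<and> explosion_time Z \<omega> < ereal (t + e)} = joint s A t - joint s A (t + e)"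
proof -
  let ?X = "\<lambda>t. {\<omega> \<in> space M. H1_at Z s \<omega> \<in> A \<and> ereal t \<le> explosion_time Z \<omega>}"
  have "{\<omega> \<in> space M. H1_at Z s \<omega> \<in> A \<and> ereal t \<le> explosion_time Z \<omega> \<and> explosion_time Z \<omega> < ereal (t + e)} = ?X t - ?X (t + e)"
    by (auto simp: not_le)
  moreover have "?X (t + e) \<subseteq> ?X t"
    using e by (auto intro: order_trans[of "ereal t" "ereal (t + e)"])
  ultimately have "measure M {\<omega> \<in> space M. H1_at Z s \<omega> \<in> A \<and> ereal t \<le> explosion_time Z \<omega> \<and> explosion_time Z \<omega> < ereal (t + e)} = measure M (?X t) - measure M (?X (t + e))"
    by (simp add: finite_measure_Diff)
  then show ?thesis using joint_at_least[OF A s] st e by simp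
qed

lemma joint_UNIV:
  assumes "0 \<le> s" "s \<le> r"
  shows "joint s UNIV r = sech (r / 2) ^ 2"
  using joint_eq(2)[OF sets.top assms] by (simp add: joint_def)

end

section \<open>Conditioning on the explosion time\<close>

context growth_process
begin

text \<open>
  The tilting identity turns the derivative of the power series into an integral against the law
  of the tree with parameter \<open>t - s\<close>.
\<close>

lemma joint_rate:
  assumes A[measurable]: "A \<in> sets tree_space" and s: "0 \<le> s" and st: "s < t"
  obtains N where "0 \<le> N"
    "(\<integral>\<^sup>+T. of_nat (num_vertices T) * indicator A T \<partial>gw_law (t - s) s) = ennreal (N / sech (t / 2) ^ 2)"
    "((\<lambda>\<epsilon>. (joint s A t - joint s A (t + \<epsilon>)) / \<epsilon>) \<longlongrightarrow> tanh ((t - s) / 2) * N) (at_right 0)"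
proof (rule size_weight_derivative[OF A s])
  show "0 < t - s" using st by simp
  let ?g = "\<lambda>x. \<Sum>n. size_weight s A n * (sech (x / 2) ^ 2) ^ n"
  let ?v = "sech ((t - s) / 2) ^ 2"
  fix N assume N: "0 \<le> N"
    and w: "tree_weight s (\<lambda>T. indicator A T * ennreal (real (num_vertices T) * ?v ^ num_vertices T)) = ennreal N"
    and D: "(?g has_real_derivative - (tanh ((t - s) / 2) * N)) (at (t - s))"
  show thesis
  proof (rule that[OF N])
    have q: "0 < sech (t / 2) ^ 2" by (rule zero_less_power[OF sech_pos])
    let ?I = "\<integral>\<^sup>+T. of_nat (num_vertices T) * indicator A T \<partial>gw_law (t - s) s"
    have "ennreal (sech ((s + (t - s)) / 2) ^ 2) * ?I = tree_weight s (\<lambda>T. ennreal (?v ^ num_vertices T) * (of_nat (num_vertices T) * indicator A T))"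
      by (rule gw_law_tilt[OF _ s]) measurable
    also have "(\<lambda>T. ennreal (?v ^ num_vertices T) * (of_nat (num_vertices T) * indicator A T)) = (\<lambda>T. indicator A T * ennreal (real (num_vertices T) * ?v ^ num_vertices T))"
      by (rule ext) (simp add: ennreal_of_nat_eq_real_of_nat ennreal_mult mult_ac)
    finally have "ennreal (sech (t / 2) ^ 2) * ?I = ennreal N" by (simp add: w)
    then have "?I = ennreal N / ennreal (sech (t / 2) ^ 2)"
      using q by (metis ennreal_eq_0_iff ennreal_mult_divide_eq ennreal_neq_top mult.commute not_le)
    then show "?I = ennreal (N / sech (t / 2) ^ 2)"
      using divide_ennreal[OF N q] by simp
    have "((\<lambda>h. (?g (t - s + h) - ?g (t - s)) / h) \<longlongrightarrow> - (tanh ((t - s) / 2) * N)) (at_right 0)"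
      using D unfolding DERIV_def by (rule tendsto_mono[rotated]) (simp add: at_le)
    from tendsto_minus[OF this]
    have lim: "((\<lambda>h. - ((?g (t - s + h) - ?g (t - s)) / h)) \<longlongrightarrow> tanh ((t - s) / 2) * N) (at_right 0)"
      by simp
    have ev: "eventually (\<lambda>h. - ((?g (t - s + h) - ?g (t - s)) / h) = (joint s A t - joint s A (t + h)) / h) (at_right 0)"
      using eventually_at_right_less[of "0 :: real"]
    proof eventually_elim
      case (elim h)
      have "joint s A (t + h) = ?g (t - s + h)" "joint s A t = ?g (t - s)"
        using elim st joint_eq(1)[OF A s, of "t + h"] joint_eq(1)[OF A s, of t] by (simp_all add: add_diff_eq diff_add_eq)
      then show ?case by (simp only: minus_divide_left minus_diff_eq)
    qed
    show "((\<lambda>\<epsilon>. (joint s A t - joint s A (t + \<epsilon>)) / \<epsilon>) \<longlongrightarrow> tanh ((t - s) / 2) * N) (at_right 0)"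
      using lim by (rule Lim_transform_eventually[OF _ ev])
  qed
qed

lemma total_rate:
  assumes s: "0 \<le> s" and st: "s < t"
  shows "((\<lambda>\<epsilon>. (joint s UNIV t - joint s UNIV (t + \<epsilon>)) / \<epsilon>) \<longlongrightarrow> tanh (t / 2) * sech (t / 2) ^ 2) (at_right 0)"
proof -
  have "((\<lambda>r. sech (r / 2) ^ 2) has_real_derivative - (tanh (t / 2) * sech (t / 2) ^ 2)) (at t)"
    unfolding sech_squared by (auto intro!: derivative_eq_intros)
  then have "((\<lambda>h. (sech ((t + h) / 2) ^ 2 - sech (t / 2) ^ 2) / h) \<longlongrightarrow> - (tanh (t / 2) * sech (t / 2) ^ 2)) (at_right 0)"
    unfolding DERIV_def by (rule tendsto_mono[rotated]) (simp add: at_le)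
  from tendsto_minus[OF this]
  have lim: "((\<lambda>h. - ((sech ((t + h) / 2) ^ 2 - sech (t / 2) ^ 2) / h)) \<longlongrightarrow> tanh (t / 2) * sech (t / 2) ^ 2) (at_right 0)"
    by simp
  have ev: "eventually (\<lambda>h. - ((sech ((t + h) / 2) ^ 2 - sech (t / 2) ^ 2) / h) = (joint s UNIV t - joint s UNIV (t + h)) / h) (at_right 0)"
    using eventually_at_right_less[of "0 :: real"]
  proof eventually_elim
    case (elim h)
    then show ?case using s st by (simp only: joint_UNIV minus_divide_left minus_diff_eq)
  qed
  show ?thesis using lim by (rule Lim_transform_eventually[OF _ ev])
qed

text \<open>
  For \<open>A = UNIV\<close> the rate of \<open>joint_rate\<close> is minus the derivative of \<open>sech (r/2)\<^sup>2\<close> at \<open>t\<close>.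
\<close>

lemma mean_num_vertices:
  assumes s: "0 \<le> s" and st: "s < t"
  shows "(\<integral>\<^sup>+T. of_nat (num_vertices T) \<partial>gw_law (t - s) s) = ennreal (tanh (t / 2) / tanh ((t - s) / 2))"
proof (rule joint_rate[OF sets.top[of tree_space] s st])
  fix N
  assume I: "(\<integral>\<^sup>+T. of_nat (num_vertices T) * indicator (space tree_space) T \<partial>gw_law (t - s) s) = ennreal (N / sech (t / 2) ^ 2)"
    and lim: "((\<lambda>\<epsilon>. (joint s (space tree_space) t - joint s (space tree_space) (t + \<epsilon>)) / \<epsilon>) \<longlongrightarrow> tanh ((t - s) / 2) * N) (at_right 0)"
  have "tanh ((t - s) / 2) * N = tanh (t / 2) * sech (t / 2) ^ 2"
    by (rule tendsto_unique[OF _ _ total_rate[OF s st]]) (use lim in simp_all)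
  then have "N / sech (t / 2) ^ 2 = tanh (t / 2) / tanh ((t - s) / 2)"
    using st less_imp_neq[OF sech_pos[of "t / 2"]] by (simp add: field_simps)
  then show ?thesis using I by simp
qed

end

theorem lemma31:
  fixes M :: "'w measure" and Z :: "nat \<Rightarrow> 'w \<Rightarrow> real \<times> aged_tree" and s t :: real
  assumes "H1_process M Z" and "0 \<le> s" and "s < t"
  shows "prob_space (gw_law (t - s) s) \<and>
    (\<integral>\<^sup>+T. of_nat (num_vertices T) \<partial>gw_law (t - s) s) = ennreal (tanh (t / 2) / tanh ((t - s) / 2)) \<and>
    (\<forall>\<A>\<in>sets tree_space.
      ((\<lambda>\<epsilon>. \<P>(\<omega> in M. H1_at Z s \<omega> \<in> \<A> \<bar>
               ereal t \<le> explosion_time Z \<omega> \<and> explosion_time Z \<omega> < ereal (t + \<epsilon>)))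
         \<longlongrightarrow> measure (size_biased (gw_law (t - s) s)) \<A>) (at_right 0))"
proof (intro conjI ballI)
  interpret growth_process M Z by unfold_locales (rule assms(1))
  let ?G = "gw_law (t - s) s" and ?\<mu> = "tanh (t / 2) / tanh ((t - s) / 2)"
  show "prob_space ?G" using assms by (intro prob_space_gw_law) simp_all
  show mean: "(\<integral>\<^sup>+T. of_nat (num_vertices T) \<partial>?G) = ennreal ?\<mu>"
    by (rule mean_num_vertices[OF assms(2,3)])
  have pos: "0 < tanh (t / 2)" "0 < tanh ((t - s) / 2)" "0 < sech (t / 2)"
    using assms by (simp_all add: sech_pos)
  fix A assume A[measurable]: "A \<in> sets tree_space"
  show "((\<lambda>\<epsilon>. \<P>(\<omega> in M. H1_at Z s \<omega> \<in> A \<bar> ereal t \<le> explosion_time Z \<omega> \<and> explosion_time Z \<omega> < ereal (t + \<epsilon>)))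
         \<longlongrightarrow> measure (size_biased ?G) A) (at_right 0)"
  proof (rule joint_rate[OF A assms(2,3)])
    fix N
    assume N: "0 \<le> N"
      and I: "(\<integral>\<^sup>+T. of_nat (num_vertices T) * indicator A T \<partial>?G) = ennreal (N / sech (t / 2) ^ 2)"
      and lim: "((\<lambda>\<epsilon>. (joint s A t - joint s A (t + \<epsilon>)) / \<epsilon>) \<longlongrightarrow> tanh ((t - s) / 2) * N) (at_right 0)"
    have "(\<lambda>T. of_nat (num_vertices T) / c :: ennreal) \<in> borel_measurable tree_space"
      "(\<lambda>T. of_nat (num_vertices T) * indicator A T :: ennreal) \<in> borel_measurable tree_space" for c
      by measurable measurable
    then have m: "(\<lambda>T. of_nat (num_vertices T) / c :: ennreal) \<in> borel_measurable ?G"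
      "(\<lambda>T. of_nat (num_vertices T) * indicator A T :: ennreal) \<in> borel_measurable ?G" for c
      by (simp_all only: measurable_cong_sets[OF sets_gw_law refl])
    have "emeasure (size_biased ?G) A = (\<integral>\<^sup>+T. of_nat (num_vertices T) / ennreal ?\<mu> * indicator A T \<partial>?G)"
      unfolding size_biased_def mean using A by (subst emeasure_density[OF m(1)]) (simp_all add: sets_gw_law)
    also have "\<dots> = (\<integral>\<^sup>+T. of_nat (num_vertices T) * indicator A T / ennreal ?\<mu> \<partial>?G)"
      by (rule nn_integral_cong) (simp only: divide_ennreal_def mult_ac)
    also have "\<dots> = ennreal (N / sech (t / 2) ^ 2) / ennreal ?\<mu>"
      unfolding nn_integral_divide[OF m(2)] I ..
    also have "\<dots> = ennreal (N / sech (t / 2) ^ 2 / ?\<mu>)"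
      using N pos by (intro divide_ennreal) simp_all
    finally have biased: "measure (size_biased ?G) A = N / sech (t / 2) ^ 2 / ?\<mu>"
      using N pos by (simp add: measure_def)
    have "((\<lambda>\<epsilon>. (joint s A t - joint s A (t + \<epsilon>)) / \<epsilon> / ((joint s UNIV t - joint s UNIV (t + \<epsilon>)) / \<epsilon>)) \<longlongrightarrow>
        tanh ((t - s) / 2) * N / (tanh (t / 2) * sech (t / 2) ^ 2)) (at_right 0)"
      using pos(1) less_imp_neq[OF sech_pos[of "t / 2"], THEN not_sym]
      by (intro tendsto_divide lim total_rate assms) simp
    also have "tanh ((t - s) / 2) * N / (tanh (t / 2) * sech (t / 2) ^ 2) = measure (size_biased ?G) A"
    proof -
      have "sech (t / 2) \<noteq> 0" using pos(3) by linarith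
      then show ?thesis unfolding biased using pos(1,2) by (simp add: field_simps)
    qed
    finally have lim': "((\<lambda>\<epsilon>. (joint s A t - joint s A (t + \<epsilon>)) / \<epsilon> / ((joint s UNIV t - joint s UNIV (t + \<epsilon>)) / \<epsilon>)) \<longlongrightarrow> measure (size_biased ?G) A) (at_right 0)" .
    have ev: "eventually (\<lambda>\<epsilon>. (joint s A t - joint s A (t + \<epsilon>)) / \<epsilon> / ((joint s UNIV t - joint s UNIV (t + \<epsilon>)) / \<epsilon>) =
        \<P>(\<omega> in M. H1_at Z s \<omega> \<in> A \<bar> ereal t \<le> explosion_time Z \<omega> \<and> explosion_time Z \<omega> < ereal (t + \<epsilon>))) (at_right 0)"
      using eventually_at_right_less[of "0 :: real"]
    proof eventually_elim
      case (elim \<epsilon>)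
      have U: "UNIV \<in> sets tree_space" using sets.top[of tree_space] by simp
      show ?case
        unfolding cond_prob_def joint_window[OF A assms(2,3) elim]
        using joint_window[OF U assms(2,3) elim] elim by simp
    qed
    show ?thesis using lim' by (rule Lim_transform_eventually[OF _ ev])
  qed
qed

end
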